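(* Let $\mathcal{G}$ be a connected noncompact metric graph with finitely many edges and with non-empty compact core $\mathcal{K}$, let $\kappa$ be the characteristic function of $\mathcal{K}$, and let $p>6$. Then, for every $\mu>0$, there exist $u\in H^1(\mathcal{G})$ and $\lambda>0$ such that $u>0$ on $\mathcal{G}$, $\int_{\mathcal{G}}|u|^2\,dx=\mu$, and $$\begin{cases} -u''+\lambda u=\kappa(x)|u|^{p-2}u & \text{on every edge } \mathrm{e} \text{ of } \mathcal{G},\\ \sum_{\mathrm{e}\succ \mathrm{v}}u_{\mathrm{e}}'(\mathrm{v})=0 & \text{at every vertex } \mathrm{v}\in\mathcal{K}.\end{cases}$$ Moreover, $u$ is a critical point of the functional $$E(u,\mathcal{G})=\frac12\int_{\mathcal{G}}|u'|^2\,dx-\frac1p\int_{\mathcal{K}}|u|^p\,dx$$ constrained to $H^1_\mu(\mathcal{G})=\{w\in H^1(\mathcal{G}):\int_{\mathcal{G}}|w|^2\,dx=\mu\}$, and $E(u,\mathcal{G})>0$.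
   Context: A metric graph $\mathcal{G}$ consists of edges and vertices; each bounded edge $\mathrm{e}$ is identified with an interval $I_{\mathrm{e}}=[0,\ell_{\mathrm{e}}]$ ($\ell_{\mathrm{e}}$ being its length) and each unbounded edge with a half-line $I_{\mathrm{e}}=[0,+\infty)$. Here the graph is connected, has finitely many edges (and vertices) and is noncompact, i.e. it has at least one half-line. The compact core $\mathcal{K}$ is the metric subgraph consisting of all bounded edges of $\mathcal{G}$. A function $u:\mathcal{G}\to\mathbb{R}$ is identified with a family $\{u_{\mathrm{e}}\}$ of functions on the intervals $I_{\mathrm{e}}$; each edge carries Lebesgue measure, and $\|u\|_{L^p(\mathcal{G})}^p=\sum_{\mathrm{e}}\|u_{\mathrm{e}}\|_{L^p(I_{\mathrm{e}})}^p$. The space $H^1(\mathcal{G})$ is the set of continuous $u:\mathcal{G}\to\mathbb{R}$ with $u_{\mathrm{e}}\in H^1(I_{\mathrm{e}})$ for every edge, with norm $\|u\|_{H^1(\mathcal{G})}^2=\sum_{\mathrm{e}}(\|u_{\mathrm{e}}'\|_{L^2}^2+\|u_{\mathrm{e}}\|_{L^2}^2)$. The notation $\mathrm{e}\succ\mathrm{v}$ means that $\mathrm{e}$ is incident at $\mathrm{v}$, and $u_{\mathrm{e}}'(\mathrm{v})$ denotes $u_{\mathrm{e}}'(0)$ or $-u_{\mathrm{e}}'(\ell_{\mathrm{e}})$ according to whether $\mathrm{v}$ is identified with $0$ or $\ell_{\mathrm{e}}$ (outer derivative at $\mathrm{v}$). *)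

theory Defs
  imports "HOL-Analysis.Analysis"
begin

section \<open>Metric graphs\<close>

text \<open>
  Loops and multiple edges are allowed. An edge of length \<open>\<infinity>\<close> is a half-line;
  it is attached to the graph only at the vertex \<open>src e\<close>, identified with \<open>0\<close>, and
  the value \<open>tgt e\<close> is then irrelevant. For a bounded edge, \<open>tgt e\<close> is
  identified with the end point \<open>len e\<close>.
\<close>

record ('v, 'e) mgraph =
  verts :: "'v set"
  edges :: "'e set"
  len :: "'e \<Rightarrow> ereal"
  src :: "'e \<Rightarrow> 'v"
  tgt :: "'e \<Rightarrow> 'v"

definition bounded_edges :: "('v, 'e) mgraph \<Rightarrow> 'e set" where
  "bounded_edges G = {e \<in> edges G. len G e < \<infinity>}"

definition half_lines :: "('v, 'e) mgraph \<Rightarrow> 'e set" where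
  "half_lines G = {e \<in> edges G. len G e = \<infinity>}"

definition finite_metric_graph :: "('v, 'e) mgraph \<Rightarrow> bool" where
  "finite_metric_graph G \<longleftrightarrow>
     finite (verts G) \<and> finite (edges G) \<and>
     (\<forall>e\<in>edges G. 0 < len G e) \<and>
     src G ` edges G \<subseteq> verts G \<and> tgt G ` bounded_edges G \<subseteq> verts G"

text \<open>A half-line has only one vertex, so only bounded edges can join two vertices.\<close>

definition connected_metric_graph :: "('v, 'e) mgraph \<Rightarrow> bool" where
  "connected_metric_graph G \<longleftrightarrow>
     (\<forall>v\<in>verts G. \<forall>w\<in>verts G.
        (v, w) \<in> {(a, b). \<exists>e\<in>bounded_edges G. {a, b} = {src G e, tgt G e}}\<^sup>*)"

definition noncompact_metric_graph :: "('v, 'e) mgraph \<Rightarrow> bool" where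
  "noncompact_metric_graph G \<longleftrightarrow> half_lines G \<noteq> {}"

definition edge_interval :: "('v, 'e) mgraph \<Rightarrow> 'e \<Rightarrow> real set" where
  "edge_interval G e = {x. 0 \<le> x \<and> ereal x \<le> len G e}"

definition core_verts :: "('v, 'e) mgraph \<Rightarrow> 'v set" where
  "core_verts G = src G ` bounded_edges G \<union> tgt G ` bounded_edges G"

text \<open>
  Points of the graph are addressed by pairs of an edge and a coordinate. The origin of a
  half-line belongs to the compact core whenever its vertex does.
\<close>

definition compact_core :: "('v, 'e) mgraph \<Rightarrow> ('e \<times> real) set" where
  "compact_core G =
     {(e, x). e \<in> bounded_edges G \<and> x \<in> edge_interval G e} \<union>
     {(e, x). e \<in> half_lines G \<and> x = 0 \<and> src G e \<in> core_verts G}"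

definition core_indicator :: "('v, 'e) mgraph \<Rightarrow> 'e \<Rightarrow> real \<Rightarrow> real" where
  "core_indicator G e x = indicator (compact_core G) (e, x)"

section \<open>Sobolev spaces on intervals\<close>

definition L2_on :: "real set \<Rightarrow> (real \<Rightarrow> real) set" where
  "L2_on I = {f. f \<in> borel_measurable (lebesgue_on I) \<and>
                 integrable (lebesgue_on I) (\<lambda>x. (f x)\<^sup>2)}"

text \<open>The space \<open>C\<^sub>c\<^sup>1\<close> of the interior of \<open>I\<close>, its elements being extended by zero.\<close>

definition test_functions :: "real set \<Rightarrow> (real \<Rightarrow> real) set" where
  "test_functions I = {\<phi>. \<phi> C1_differentiable_on UNIV \<and>
     compact (closure {x. \<phi> x \<noteq> 0}) \<and> closure {x. \<phi> x \<noteq> 0} \<subseteq> interior I}"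

definition has_weak_deriv :: "real set \<Rightarrow> (real \<Rightarrow> real) \<Rightarrow> (real \<Rightarrow> real) \<Rightarrow> bool" where
  "has_weak_deriv I f g \<longleftrightarrow>
     (\<forall>\<phi>\<in>test_functions I.
        (LINT x|lebesgue_on I. f x * deriv \<phi> x) = - (LINT x|lebesgue_on I. g x * \<phi> x))"

definition H1_on :: "real set \<Rightarrow> (real \<Rightarrow> real) set" where
  "H1_on I = {f \<in> L2_on I. \<exists>g\<in>L2_on I. has_weak_deriv I f g}"

text \<open>The weak derivative is unique up to null sets; any representative will do.\<close>

definition weak_deriv :: "real set \<Rightarrow> (real \<Rightarrow> real) \<Rightarrow> real \<Rightarrow> real" where
  "weak_deriv I f = (SOME g. g \<in> L2_on I \<and> has_weak_deriv I f g)"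

section \<open>Function spaces and functionals on metric graphs\<close>

text \<open>
  A function on the graph is a family of functions on the edges; only the values on the
  intervals \<open>edge_interval G e\<close> for \<open>e \<in> edges G\<close> matter. Continuity means continuity on
  every edge and agreement of the values at common vertices; \<open>c v\<close> is the value at \<open>v\<close>.
\<close>

type_synonym 'e gfun = "'e \<Rightarrow> real \<Rightarrow> real"

definition graph_continuous :: "('v, 'e) mgraph \<Rightarrow> 'e gfun \<Rightarrow> bool" where
  "graph_continuous G u \<longleftrightarrow>
     (\<forall>e\<in>edges G. continuous_on (edge_interval G e) (u e)) \<and>
     (\<exists>c. (\<forall>e\<in>edges G. u e 0 = c (src G e)) \<and>
          (\<forall>e\<in>bounded_edges G. u e (real_of_ereal (len G e)) = c (tgt G e)))"

definition H1 :: "('v, 'e) mgraph \<Rightarrow> 'e gfun set" where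
  "H1 G = {u. graph_continuous G u \<and> (\<forall>e\<in>edges G. u e \<in> H1_on (edge_interval G e))}"

definition mass :: "('v, 'e) mgraph \<Rightarrow> 'e gfun \<Rightarrow> real" where
  "mass G u = (\<Sum>e\<in>edges G. LINT x|lebesgue_on (edge_interval G e). \<bar>u e x\<bar>\<^sup>2)"

definition kinetic :: "('v, 'e) mgraph \<Rightarrow> 'e gfun \<Rightarrow> real" where
  "kinetic G u = (\<Sum>e\<in>edges G. LINT x|lebesgue_on (edge_interval G e).
                    \<bar>weak_deriv (edge_interval G e) (u e) x\<bar>\<^sup>2)"

definition H1_norm :: "('v, 'e) mgraph \<Rightarrow> 'e gfun \<Rightarrow> real" where
  "H1_norm G u = sqrt (kinetic G u + mass G u)"

definition H1_mass :: "('v, 'e) mgraph \<Rightarrow> real \<Rightarrow> 'e gfun set" where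
  "H1_mass G \<mu> = {w \<in> H1 G. mass G w = \<mu>}"

definition energy :: "('v, 'e) mgraph \<Rightarrow> real \<Rightarrow> 'e gfun \<Rightarrow> real" where
  "energy G p u = 1 / 2 * kinetic G u -
     1 / p * (\<Sum>e\<in>bounded_edges G. LINT x|lebesgue_on (edge_interval G e). \<bar>u e x\<bar> powr p)"

section \<open>Constrained critical points\<close>

definition H1_frechet_deriv ::
  "('v, 'e) mgraph \<Rightarrow> ('e gfun \<Rightarrow> real) \<Rightarrow> 'e gfun \<Rightarrow> ('e gfun \<Rightarrow> real) \<Rightarrow> bool" where
  "H1_frechet_deriv G F u L \<longleftrightarrow>
     (\<forall>v\<in>H1 G. \<forall>w\<in>H1 G. L (\<lambda>e x. v e x + w e x) = L v + L w) \<and>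
     (\<forall>c. \<forall>v\<in>H1 G. L (\<lambda>e x. c * v e x) = c * L v) \<and>
     (\<exists>K. \<forall>v\<in>H1 G. \<bar>L v\<bar> \<le> K * H1_norm G v) \<and>
     (\<forall>\<epsilon>>0. \<exists>\<delta>>0. \<forall>v\<in>H1 G. H1_norm G v < \<delta> \<longrightarrow>
        \<bar>F (\<lambda>e x. u e x + v e x) - F u - L v\<bar> \<le> \<epsilon> * H1_norm G v)"

text \<open>
  The differential of \<open>F\<close> at \<open>u\<close> vanishes on the tangent space at \<open>u\<close> of \<open>H1_mass G \<mu>\<close>,
  which is the kernel of the (nonzero) differential of the mass.
\<close>

definition constrained_critical_point ::
  "('v, 'e) mgraph \<Rightarrow> ('e gfun \<Rightarrow> real) \<Rightarrow> real \<Rightarrow> 'e gfun \<Rightarrow> bool" where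
  "constrained_critical_point G F \<mu> u \<longleftrightarrow>
     u \<in> H1_mass G \<mu> \<and>
     (\<exists>L M. H1_frechet_deriv G F u L \<and> H1_frechet_deriv G (mass G) u M \<and>
            (\<exists>v\<in>H1 G. M v \<noteq> 0) \<and> (\<forall>v\<in>H1 G. M v = 0 \<longrightarrow> L v = 0))"

section \<open>The differential equation and the vertex conditions\<close>

text \<open>Classical derivative on an edge, one-sided at its end points.\<close>

definition edge_deriv :: "('v, 'e) mgraph \<Rightarrow> 'e gfun \<Rightarrow> 'e gfun" where
  "edge_deriv G u e x = vector_derivative (u e) (at x within edge_interval G e)"

text \<open>
  The equation is imposed in the interior of the edge (at a vertex the indicator of the core
  is not the limit along the incident half-lines), while the function is continuously
  differentiable up to the end points, so that the vertex conditions make sense.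
\<close>

definition solves_on_edge ::
  "('v, 'e) mgraph \<Rightarrow> real \<Rightarrow> real \<Rightarrow> 'e gfun \<Rightarrow> 'e \<Rightarrow> bool" where
  "solves_on_edge G p lam u e \<longleftrightarrow>
     u e differentiable_on edge_interval G e \<and>
     continuous_on (edge_interval G e) (edge_deriv G u e) \<and>
     (\<forall>x\<in>interior (edge_interval G e).
        edge_deriv G u e differentiable (at x) \<and>
        - deriv (edge_deriv G u e) x + lam * u e x =
          core_indicator G e x * \<bar>u e x\<bar> powr (p - 2) * u e x)"

text \<open>The sum of the outer derivatives at \<open>v\<close>; a loop at \<open>v\<close> contributes at both its ends.\<close>

definition kirchhoff_sum :: "('v, 'e) mgraph \<Rightarrow> 'e gfun \<Rightarrow> 'v \<Rightarrow> real" where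
  "kirchhoff_sum G u v =
     (\<Sum>e\<in>{e \<in> edges G. src G e = v}. edge_deriv G u e 0) +
     (\<Sum>e\<in>{e \<in> bounded_edges G. tgt G e = v}. - edge_deriv G u e (real_of_ereal (len G e)))"

end

theory Submission
  imports Defs "HOL-Complex_Analysis.Great_Picard" "HOL-Real_Asymp.Real_Asymp"
begin

text \<open>
  On a half-line the equation forces \<open>u(x) = c exp(-a x)\<close> with \<open>a\<^sup>2 = \<lambda>\<close>, so the problem
  lives on the compact core: \<open>u'' = a\<^sup>2 u - u\<^bsup>p-1\<^esup>\<close> on each bounded edge, the Robin condition
  \<open>\<Sum> u' = a N(v) c(v)\<close> at each vertex \<open>v\<close>, with \<open>N(v)\<close> half-lines, and
  \<open>2 a (\<mu> - M) = S\<close>, where \<open>M\<close> is the mass on the core and \<open>S = \<Sum> N(v) c(v)\<^sup>2\<close>. These are the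
  critical points, under the open constraint \<open>M < \<mu>\<close>, of the energy minimised over the
  exponential tails, \<open>1/2 \<integral> u'\<^sup>2 + S\<^sup>2 / (8 (\<mu> - M)) - 1/p \<integral> u\<^sub>+\<^bsup>p\<^esup>\<close>.

  On a uniform mesh this functional is a function of finitely many variables with a mountain-pass
  geometry that is uniform in the mesh. Multiplying the power term by a parameter \<open>\<rho> \<le> 1\<close>, the
  monotonicity trick of Struwe and Jeanjean gives critical points with all terms of the energy bounded, for some
  \<open>\<rho>\<close> arbitrarily close to 1. Refining the mesh yields solutions for such \<open>\<rho>\<close>. To let \<open>\<rho>\<close> tend
  to 1, the parameter \<open>a\<close> must be bounded by the energy: the Pohozaev identity
  expresses the energy through \<open>a\<^sup>2 \<mu>\<close> and the Hamiltonians of the edges, and for \<open>p > 6\<close> the former dominates,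
  since integrating \<open>(u'/u)'\<close> bounds a negative Hamiltonian by a lower power of \<open>a\<close>.
\<close>

section \<open>Mountain passes and the monotonicity trick in finite dimension\<close>

text \<open>For \<open>p > 6\<close> the energy is unbounded below under the mass constraint and no
  direct bound on almost critical sequences is at hand; hence the detour through
  \<open>\<rho>\<close>. The other obstacle is mass escaping along half-lines, and eliminating them
  removes it: tails of rate \<open>a\<close> carry mass \<open>S / (2 a)\<close> and energy
  \<open>a S / 4\<close>, so the mass \<open>\<mu> - M\<close> fixes \<open>a\<close> and leaves
  \<open>S\<^sup>2 / (8 (\<mu> - M))\<close>, whose derivative contains both the Robin term and the
  multiplier \<open>a\<^sup>2\<close>. The mesh turns min-max theory in a Sobolev space into
  calculus in finitely many variables; the price is that the geometric constants must be independent
  of the mesh. Truncation to \<open>u\<^sub>+\<close> yields nonnegative critical points, and the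
  positive lower bound of the level survives all limits, which excludes the zero function and
  \<open>a = 0\<close>. The exponent 6 enters twice: a tent of width w at fixed mass has kinetic
  energy of order w^(-2) and power term of order w^(1 - p/2), and the Pohozaev identity leaves a
  multiple of \<open>p - 6\<close> in front of \<open>a\<^sup>2 \<mu>\<close>.\<close>

definition conv_on :: "'i set \<Rightarrow> (nat \<Rightarrow> 'i \<Rightarrow> real) \<Rightarrow> ('i \<Rightarrow> real) \<Rightarrow> bool" where
  "conv_on I X x \<longleftrightarrow> (\<forall>i\<in>I. (\<lambda>n. X n i) \<longlonglongrightarrow> x i)"

lemma conv_on_subseq: "conv_on I X x \<Longrightarrow> strict_mono r \<Longrightarrow> conv_on I (X \<circ> r) x"
  unfolding conv_on_def using LIMSEQ_subseq_LIMSEQ[of "\<lambda>n. X n i" "x i" r for i] by (simp add: o_def)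

lemma bounded_real_convergent_subseq:
  fixes f :: "nat \<Rightarrow> real"
  assumes "\<And>n. \<bar>f n\<bar> \<le> b"
  obtains l r where "strict_mono r" "(\<lambda>n. f (r n)) \<longlonglongrightarrow> l" "\<bar>l\<bar> \<le> b"
proof -
  have "bounded (range f)" using assms by (auto simp: bounded_iff)
  then obtain l r where r: "strict_mono r" "(f \<circ> r) \<longlonglongrightarrow> l"
    using bounded_imp_convergent_subsequence by blast
  have "\<bar>l\<bar> \<le> b"
    by (rule LIMSEQ_le_const2[OF tendsto_rabs[OF r(2)]]) (use assms in auto)
  with r that show thesis by (auto simp: o_def)
qed

lemma finite_bolzano:
  fixes X :: "nat \<Rightarrow> 'i \<Rightarrow> real"
  assumes "finite I" "\<And>i. i \<in> I \<Longrightarrow> \<exists>b. \<forall>n. \<bar>X n i\<bar> \<le> b"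
  shows "\<exists>r x. strict_mono r \<and> conv_on I (X \<circ> r) x"
  using assms
proof (induction I)
  case empty
  show ?case by (rule exI[of _ id]) (auto simp: conv_on_def strict_mono_def)
next
  case (insert j I)
  then obtain r x where r: "strict_mono r" "conv_on I (X \<circ> r) x" by blast
  obtain b where b: "\<And>n. \<bar>X n j\<bar> \<le> b" using insert.prems by blast
  obtain l q where q: "strict_mono q" "(\<lambda>n. X (r (q n)) j) \<longlonglongrightarrow> l"
    using bounded_real_convergent_subseq[of "\<lambda>n. X (r n) j" b] b by metis
  have "conv_on (insert j I) (X \<circ> (r \<circ> q)) (x(j := l))"
    using conv_on_subseq[OF r(2) q(1)] q(2) insert.hyps by (auto simp: conv_on_def o_def)
  then show ?case using strict_mono_o[OF r(1) q(1)] by blast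
qed

text \<open>The mean rate of decrease over an interval is the average of the rates over its halves,
  so one half inherits the bound \<open>S\<close>. Bisection gives arbitrarily short intervals of
  controlled slope; this takes the place of almost everywhere differentiability of a monotone
  function in the monotonicity trick.\<close>

lemma dyadic_small_slope:
  fixes f :: "real \<Rightarrow> real"
  assumes "p < q" "f p - f q \<le> S * (q - p)"
  shows "\<exists>a b. p \<le> a \<and> a < b \<and> b \<le> q \<and> b - a = (q - p) / 2 ^ k \<and> f a - f b \<le> S * (b - a)"
proof (induction k)
  case 0
  show ?case using assms by (intro exI[of _ p] exI[of _ q]) auto
next
  case (Suc k)
  then obtain a b where ab: "p \<le> a" "a < b" "b \<le> q" "b - a = (q - p) / 2 ^ k"
    "f a - f b \<le> S * (b - a)" by blast
  define m where "m = (a + b) / 2"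
  have m: "a < m" "m < b" "m - a = (q - p) / 2 ^ Suc k" "b - m = (q - p) / 2 ^ Suc k"
    using ab by (auto simp: m_def field_simps)
  have "S * (b - a) = S * (m - a) + S * (b - m)" by (simp add: algebra_simps)
  then have "f a - f m \<le> S * (m - a) \<or> f m - f b \<le> S * (b - m)" using ab(5) by linarith
  then show ?case
  proof
    assume "f a - f m \<le> S * (m - a)"
    moreover have "m \<le> q" using ab m by linarith
    ultimately show ?thesis using ab m by blast
  next
    assume "f m - f b \<le> S * (b - m)"
    moreover have "p \<le> m" using ab m by linarith
    ultimately show ?thesis using ab m by blast
  qed
qed

text \<open>
  Points are functions of which only the values on the finite set \<open>I\<close> matter; hence continuity
  and compactness are expressed by sequences converging on \<open>I\<close>.
\<close>

locale mountain_pass =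
  fixes I :: "'i set" and D :: "('i \<Rightarrow> real) set"
    and A B :: "('i \<Rightarrow> real) \<Rightarrow> real" and gA gB :: "('i \<Rightarrow> real) \<Rightarrow> 'i \<Rightarrow> real"
    and z0 z1 :: "'i \<Rightarrow> real" and \<gamma>0 :: "real \<Rightarrow> 'i \<Rightarrow> real" and \<alpha> C \<rho>0 :: real
  assumes fin: "finite I"
    and D_open: "x \<in> D \<Longrightarrow> conv_on I X x \<Longrightarrow> \<forall>\<^sub>F n in sequentially. X n \<in> D"
    and D_segment: "x \<in> D \<Longrightarrow> (\<lambda>i. x i + s * y i) \<in> D \<Longrightarrow> 0 \<le> \<tau> \<Longrightarrow> \<tau> \<le> s \<Longrightarrow> (\<lambda>i. x i + \<tau> * y i) \<in> D"
    and A_cont: "x \<in> D \<Longrightarrow> (\<And>n. X n \<in> D) \<Longrightarrow> conv_on I X x \<Longrightarrow> (\<lambda>n. A (X n)) \<longlonglongrightarrow> A x"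
    and B_cont: "x \<in> D \<Longrightarrow> (\<And>n. X n \<in> D) \<Longrightarrow> conv_on I X x \<Longrightarrow> (\<lambda>n. B (X n)) \<longlonglongrightarrow> B x"
    and gA_cont: "x \<in> D \<Longrightarrow> (\<And>n. X n \<in> D) \<Longrightarrow> conv_on I X x \<Longrightarrow> i \<in> I \<Longrightarrow> (\<lambda>n. gA (X n) i) \<longlonglongrightarrow> gA x i"
    and gB_cont: "x \<in> D \<Longrightarrow> (\<And>n. X n \<in> D) \<Longrightarrow> conv_on I X x \<Longrightarrow> i \<in> I \<Longrightarrow> (\<lambda>n. gB (X n) i) \<longlonglongrightarrow> gB x i"
    and A_deriv: "(\<lambda>i. x i + \<tau> * y i) \<in> D \<Longrightarrow>
      ((\<lambda>t. A (\<lambda>i. x i + t * y i)) has_real_derivative (\<Sum>i\<in>I. gA (\<lambda>i. x i + \<tau> * y i) i * y i)) (at \<tau>)"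
    and B_deriv: "(\<lambda>i. x i + \<tau> * y i) \<in> D \<Longrightarrow>
      ((\<lambda>t. B (\<lambda>i. x i + t * y i)) has_real_derivative (\<Sum>i\<in>I. gB (\<lambda>i. x i + \<tau> * y i) i * y i)) (at \<tau>)"
    and A_compact: "(\<And>n. X n \<in> D) \<Longrightarrow> (\<And>n. A (X n) \<le> c) \<Longrightarrow> \<exists>x\<in>D. \<exists>r. strict_mono r \<and> conv_on I (X \<circ> r) x"
    and B_nonneg: "x \<in> D \<Longrightarrow> 0 \<le> B x"
    and \<rho>0: "0 \<le> \<rho>0" "\<rho>0 < 1"
    and \<gamma>0: "\<And>t. t \<in> {0..1} \<Longrightarrow> \<gamma>0 t \<in> D" "\<And>i. i \<in> I \<Longrightarrow> continuous_on {0..1} (\<lambda>t. \<gamma>0 t i)"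
       "\<gamma>0 0 = z0" "\<gamma>0 1 = z1" "\<And>t. t \<in> {0..1} \<Longrightarrow> A (\<gamma>0 t) \<le> C"
    and lower: "(\<And>t::real. t \<in> {0..1} \<Longrightarrow> \<gamma> t \<in> D) \<Longrightarrow> (\<And>i. i \<in> I \<Longrightarrow> continuous_on {0..1} (\<lambda>t. \<gamma> t i)) \<Longrightarrow>
       \<gamma> 0 = z0 \<Longrightarrow> \<gamma> 1 = z1 \<Longrightarrow> \<exists>t\<in>{0..1}. \<alpha> \<le> A (\<gamma> t) - B (\<gamma> t)"
    and ends: "A z0 - \<rho>0 * B z0 < \<alpha>" "A z1 - \<rho>0 * B z1 < \<alpha>"
begin

definition J where "J \<rho> x = A x - \<rho> * B x"
definition gJ where "gJ \<rho> x i = gA x i - \<rho> * gB x i"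
definition paths where
  "paths = {\<gamma>. (\<forall>t\<in>{0..1::real}. \<gamma> t \<in> D) \<and> (\<forall>i\<in>I. continuous_on {0..1} (\<lambda>t. \<gamma> t i)) \<and> \<gamma> 0 = z0 \<and> \<gamma> 1 = z1}"
text \<open>The mountain-pass value, taken as an infimum of upper bounds along paths, so that no
  maximum along a path has to be exhibited.\<close>

definition level where
  "level \<rho> = Inf {m. \<exists>\<gamma>\<in>paths. \<forall>t\<in>{0..1}. J \<rho> (\<gamma> t) \<le> m}"

lemma J_mono: "x \<in> D \<Longrightarrow> a \<le> b \<Longrightarrow> J b x \<le> J a x"
  unfolding J_def using mult_right_mono[OF _ B_nonneg, of a b x] by auto

lemma J_deriv:
  assumes "(\<lambda>i. x i + \<tau> * y i) \<in> D"
  shows "((\<lambda>t. J \<rho> (\<lambda>i. x i + t * y i)) has_real_derivative (\<Sum>i\<in>I. gJ \<rho> (\<lambda>i. x i + \<tau> * y i) i * y i)) (at \<tau>)"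
proof -
  have "(\<Sum>i\<in>I. gJ \<rho> (\<lambda>i. x i + \<tau> * y i) i * y i)
     = (\<Sum>i\<in>I. gA (\<lambda>i. x i + \<tau> * y i) i * y i) - \<rho> * (\<Sum>i\<in>I. gB (\<lambda>i. x i + \<tau> * y i) i * y i)"
    by (simp add: gJ_def left_diff_distrib sum_subtractf sum_distrib_left mult.assoc)
  then show ?thesis unfolding J_def
    by (auto intro!: derivative_eq_intros A_deriv[OF assms] B_deriv[OF assms])
qed

lemma gJ_cont:
  assumes "x \<in> D" "\<And>n. X n \<in> D" "conv_on I X x" "i \<in> I" "R \<longlonglongrightarrow> \<rho>"
  shows "(\<lambda>n. gJ (R n) (X n) i) \<longlonglongrightarrow> gJ \<rho> x i"
  unfolding gJ_def by (intro tendsto_intros gA_cont gB_cont assms)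

lemma J_cont:
  assumes "x \<in> D" "\<And>n. X n \<in> D" "conv_on I X x" "R \<longlonglongrightarrow> \<rho>"
  shows "(\<lambda>n. J (R n) (X n)) \<longlonglongrightarrow> J \<rho> x"
  unfolding J_def by (intro tendsto_intros A_cont B_cont assms)

text \<open>The step length has to be uniform in \<open>x\<close> and \<open>\<rho>\<close>, while
  the gradients are only continuous. Failures with lengths tending to 0 would accumulate, by
  \<open>A_compact\<close>, at some point of \<open>D\<close>; the mean value theorem then gives in
  the limit \<open>|g|^2 <= |g|^2 / 2\<close> there, against \<open>|g|^2 >= \<eta>\<close>.\<close>

lemma gradient_step:
  assumes \<eta>: "\<eta> > 0"
  shows "\<exists>s0>0. \<forall>\<rho>\<in>{0..1}. \<forall>x\<in>D. A x \<le> c \<longrightarrow> \<eta> \<le> (\<Sum>i\<in>I. (gJ \<rho> x i)\<^sup>2) \<longrightarrow>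
    (\<forall>s\<in>{0..s0}. (\<lambda>i. x i - s * gJ \<rho> x i) \<in> D \<and>
       J \<rho> (\<lambda>i. x i - s * gJ \<rho> x i) \<le> J \<rho> x - s / 2 * (\<Sum>i\<in>I. (gJ \<rho> x i)\<^sup>2))"
proof (rule ccontr)
  define Q where "Q = (\<lambda>s \<rho> x. 0 \<le> \<rho> \<and> \<rho> \<le> 1 \<and> x \<in> D \<and> A x \<le> c \<and> \<eta> \<le> (\<Sum>i\<in>I. (gJ \<rho> x i)\<^sup>2) \<and>
     \<not> ((\<lambda>i. x i - s * gJ \<rho> x i) \<in> D \<and>
       J \<rho> (\<lambda>i. x i - s * gJ \<rho> x i) \<le> J \<rho> x - s / 2 * (\<Sum>i\<in>I. (gJ \<rho> x i)\<^sup>2)))"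
  assume neg: "\<not> ?thesis"
  have "\<exists>s \<rho> x. 0 \<le> s \<and> s \<le> 1 / Suc n \<and> Q s \<rho> x" for n
  proof -
    have pos: "1 / real (Suc n) > 0" by simp
    show ?thesis
    proof (rule ccontr)
      assume H: "\<not> ?thesis"
      have "\<forall>\<rho>\<in>{0..1}. \<forall>x\<in>D. A x \<le> c \<longrightarrow> \<eta> \<le> (\<Sum>i\<in>I. (gJ \<rho> x i)\<^sup>2) \<longrightarrow>
        (\<forall>s\<in>{0..1 / real (Suc n)}. (\<lambda>i. x i - s * gJ \<rho> x i) \<in> D \<and>
         J \<rho> (\<lambda>i. x i - s * gJ \<rho> x i) \<le> J \<rho> x - s / 2 * (\<Sum>i\<in>I. (gJ \<rho> x i)\<^sup>2))"
        using H unfolding Q_def by (meson atLeastAtMost_iff)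
      then show False using neg pos by blast
    qed
  qed
  then obtain s R X where sQ: "\<And>n. 0 \<le> s n" "\<And>n. s n \<le> 1 / Suc n" "\<And>n. Q (s n) (R n) (X n)"
    by metis
  have XD: "X n \<in> D" and AX: "A (X n) \<le> c" and R01: "\<bar>R n\<bar> \<le> 1" for n
    using sQ(3)[of n] by (auto simp: Q_def)
  obtain x r where x: "x \<in> D" "strict_mono r" "conv_on I (X \<circ> r) x" 
    using A_compact[of X c] XD AX by auto
  obtain \<rho> q where q: "strict_mono q" "(\<lambda>n. R (r (q n))) \<longlonglongrightarrow> \<rho>"
    using bounded_real_convergent_subseq[of "\<lambda>n. R (r n)" 1] R01 by metis
  define k where "k = r \<circ> q"
  have k: "strict_mono k" unfolding k_def by (rule strict_mono_o[OF x(2) q(1)])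
  define Y where "Y = (\<lambda>n. X (k n))"
  define P where "P = (\<lambda>n. R (k n))"
  define \<sigma> where "\<sigma> = (\<lambda>n. s (k n))"
  define G where "G = (\<lambda>n i. - gJ (P n) (Y n) i)"
  have s0: "s \<longlonglongrightarrow> 0"
    by (rule tendsto_sandwich[OF _ _ tendsto_const LIMSEQ_inverse_real_of_nat])
       (use sQ in \<open>auto simp: inverse_eq_divide\<close>)
  have \<sigma>0: "\<sigma> \<longlonglongrightarrow> 0" using LIMSEQ_subseq_LIMSEQ[OF s0 k] by (simp add: \<sigma>_def o_def)
  have Y: "\<And>n. Y n \<in> D" "conv_on I Y x"
    using XD conv_on_subseq[OF x(3) q(1)] by (auto simp: Y_def k_def o_def)
  have P: "P \<longlonglongrightarrow> \<rho>" using q(2) by (simp add: P_def k_def)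
  have G: "(\<lambda>n. G n i) \<longlonglongrightarrow> - gJ \<rho> x i" if "i \<in> I" for i
    unfolding G_def by (intro tendsto_minus gJ_cont x Y P that)
  \<comment> \<open>Any choice of points on the failing segments converges to \<open>x\<close>; this
    is used for the far end points and for the mean value points.\<close>
  have mid: "conv_on I (\<lambda>n i. Y n i + \<theta> n * G n i) x" if \<theta>: "\<And>n. 0 \<le> \<theta> n" "\<And>n. \<theta> n \<le> \<sigma> n" for \<theta>
  proof -
    have "\<theta> \<longlonglongrightarrow> 0" by (rule tendsto_sandwich[OF _ _ tendsto_const \<sigma>0]) (use \<theta> in auto)
    then have "(\<lambda>n. Y n i + \<theta> n * G n i) \<longlonglongrightarrow> x i + 0 * - gJ \<rho> x i" if "i \<in> I" for i
      using Y(2) that by (intro tendsto_intros G) (auto simp: conv_on_def)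
    then show ?thesis by (auto simp: conv_on_def)
  qed
  have "\<forall>\<^sub>F n in sequentially. (\<lambda>i. Y n i + \<sigma> n * G n i) \<in> D"
    by (rule D_open[OF x(1) mid]) (use sQ in \<open>auto simp: \<sigma>_def\<close>)
  then obtain N where N: "\<And>n. n \<ge> N \<Longrightarrow> (\<lambda>i. Y n i + \<sigma> n * G n i) \<in> D"
    by (auto simp: eventually_sequentially)
  define W where "W = (\<lambda>n \<theta>. 0 \<le> \<theta> \<and> \<theta> \<le> \<sigma> n \<and> (\<lambda>i. Y n i + \<theta> * G n i) \<in> D \<and>
     (\<Sum>i\<in>I. gJ (P n) (\<lambda>i. Y n i + \<theta> * G n i) i * gJ (P n) (Y n) i) \<le> 1/2 * (\<Sum>i\<in>I. (gJ (P n) (Y n) i)\<^sup>2))"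
  have W: "\<exists>\<theta>. W n \<theta>" if n: "n \<ge> N" for n
  proof -
    have v: "J (P n) (\<lambda>i. Y n i + \<sigma> n * G n i) > J (P n) (Y n) - \<sigma> n / 2 * (\<Sum>i\<in>I. (gJ (P n) (Y n) i)\<^sup>2)"
      using sQ(3)[of "k n"] N[OF n] unfolding Q_def Y_def P_def \<sigma>_def G_def by auto
    have \<sigma>ge: "\<sigma> n \<ge> 0" using sQ by (auto simp: \<sigma>_def)
    have \<sigma>pos: "\<sigma> n > 0"
    proof (rule ccontr)
      assume "\<not> \<sigma> n > 0" then have "\<sigma> n = 0" using \<sigma>ge by auto
      then show False using v by simp
    qed
    have seg: "(\<lambda>i. Y n i + \<tau> * G n i) \<in> D" if "0 \<le> \<tau>" "\<tau> \<le> \<sigma> n" for \<tau>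
      using D_segment[OF Y(1) N[OF n]] that by auto
    have "\<exists>z>0. z < \<sigma> n \<and> J (P n) (\<lambda>i. Y n i + \<sigma> n * G n i) - J (P n) (\<lambda>i. Y n i + 0 * G n i)
       = (\<sigma> n - 0) * (\<Sum>i\<in>I. gJ (P n) (\<lambda>i. Y n i + z * G n i) i * G n i)"
      by (rule MVT2[OF \<sigma>pos]) (rule J_deriv, rule seg, auto)
    then obtain z where z: "0 < z" "z < \<sigma> n"
      "J (P n) (\<lambda>i. Y n i + \<sigma> n * G n i) - J (P n) (Y n)
        = \<sigma> n * (\<Sum>i\<in>I. gJ (P n) (\<lambda>i. Y n i + z * G n i) i * G n i)" by auto
    have "\<sigma> n * (\<Sum>i\<in>I. gJ (P n) (\<lambda>i. Y n i + z * G n i) i * gJ (P n) (Y n) i)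
       < \<sigma> n * (1 / 2 * (\<Sum>i\<in>I. (gJ (P n) (Y n) i)\<^sup>2))"
      using v z(3) by (simp add: G_def sum_negf)
    then have "(\<Sum>i\<in>I. gJ (P n) (\<lambda>i. Y n i + z * G n i) i * gJ (P n) (Y n) i) \<le> 1/2 * (\<Sum>i\<in>I. (gJ (P n) (Y n) i)\<^sup>2)"
      using \<sigma>pos by (simp add: mult_less_cancel_left)
    then show ?thesis using z seg[of z] unfolding W_def by (intro exI[of _ z]) auto
  qed
  then obtain \<theta>' where "\<And>n. n \<ge> N \<Longrightarrow> W n (\<theta>' n)" by metis
  note \<theta>' = this[unfolded W_def]
  \<comment> \<open>For \<open>n < N\<close> the value 0 gives \<open>Z n = Y n\<close>, so that
    \<open>Z\<close> stays in \<open>D\<close> at every index, as \<open>gJ_cont\<close>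
    demands.\<close>
  define \<theta> where "\<theta> = (\<lambda>n. if n \<ge> N then \<theta>' n else 0)"
  define Z where "Z = (\<lambda>n i. Y n i + \<theta> n * G n i)"
  have ZD: "Z n \<in> D" for n using \<theta>'[of n] Y(1)[of n] by (auto simp: Z_def \<theta>_def)
  have Zx: "conv_on I Z x" unfolding Z_def
    by (rule mid) (use \<theta>' sQ in \<open>auto simp: \<theta>_def \<sigma>_def\<close>)
  have l1: "(\<lambda>n. \<Sum>i\<in>I. gJ (P n) (Z n) i * gJ (P n) (Y n) i) \<longlonglongrightarrow> (\<Sum>i\<in>I. gJ \<rho> x i * gJ \<rho> x i)"
    by (intro tendsto_sum tendsto_mult gJ_cont x ZD Zx Y P)
  have l2: "(\<lambda>n. 1/2 * (\<Sum>i\<in>I. (gJ (P n) (Y n) i)\<^sup>2)) \<longlonglongrightarrow> 1/2 * (\<Sum>i\<in>I. (gJ \<rho> x i)\<^sup>2)"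
    by (intro tendsto_intros gJ_cont x Y P)
  have l3: "(\<lambda>n. (\<Sum>i\<in>I. (gJ (P n) (Y n) i)\<^sup>2)) \<longlonglongrightarrow> (\<Sum>i\<in>I. (gJ \<rho> x i)\<^sup>2)"
    by (intro tendsto_intros gJ_cont x Y P)
  have "(\<Sum>i\<in>I. gJ \<rho> x i * gJ \<rho> x i) \<le> 1/2 * (\<Sum>i\<in>I. (gJ \<rho> x i)\<^sup>2)"
    by (rule LIMSEQ_le[OF l1 l2], rule exI[of _ N]) (use \<theta>' in \<open>auto simp: Z_def \<theta>_def\<close>)
  moreover have "\<eta> \<le> (\<Sum>i\<in>I. (gJ \<rho> x i)\<^sup>2)"
    by (rule LIMSEQ_le_const[OF l3]) (use sQ(3) in \<open>auto simp: Q_def Y_def P_def\<close>)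
  ultimately show False using \<eta> by (simp add: power2_eq_square)
qed

lemma continuous_on_path:
  assumes \<gamma>: "\<gamma> \<in> paths"
    and f: "\<And>x X. x \<in> D \<Longrightarrow> (\<And>n. X n \<in> D) \<Longrightarrow> conv_on I X x \<Longrightarrow> (\<lambda>n. f (X n)) \<longlonglongrightarrow> (f x :: real)"
  shows "continuous_on {0..1} (\<lambda>t. f (\<gamma> t))"
  unfolding continuous_on_sequentially o_def
proof (intro allI ballI impI, elim conjE)
  fix X :: "nat \<Rightarrow> real" and a
  assume X: "a \<in> {0..1}" "\<forall>n. X n \<in> {0..1}" "X \<longlonglongrightarrow> a"
  have "conv_on I (\<lambda>n. \<gamma> (X n)) (\<gamma> a)"
    unfolding conv_on_def
  proof
    fix i assume "i \<in> I"
    then have "continuous_on {0..1} (\<lambda>t. \<gamma> t i)" using \<gamma> by (auto simp: paths_def)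
    then show "(\<lambda>n. \<gamma> (X n) i) \<longlonglongrightarrow> \<gamma> a i"
      using X unfolding continuous_on_sequentially o_def by blast
  qed
  then show "(\<lambda>n. f (\<gamma> (X n))) \<longlonglongrightarrow> f (\<gamma> a)"
    using f X \<gamma> by (auto simp: paths_def)
qed

text \<open>The separation is assumed for the functional with parameter 1; it carries over to
  smaller parameters because \<open>B\<close> is nonnegative.\<close>

lemma path_lower: 
  assumes "\<rho> \<le> 1" "\<gamma> \<in> paths" "\<And>t. t \<in> {0..1} \<Longrightarrow> J \<rho> (\<gamma> t) \<le> m"
  shows "\<alpha> \<le> m"
proof -
  obtain t where t: "t \<in> {0..1}" "\<alpha> \<le> A (\<gamma> t) - B (\<gamma> t)"
    using lower[of \<gamma>] assms(2) by (auto simp: paths_def)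
  have "\<gamma> t \<in> D" using assms(2) t by (auto simp: paths_def)
  from J_mono[OF this assms(1)] assms(3)[OF t(1)] t(2) show ?thesis by (simp add: J_def)
qed

lemma level_le: 
  assumes "\<rho> \<le> 1" "\<gamma> \<in> paths" "\<And>t. t \<in> {0..1} \<Longrightarrow> J \<rho> (\<gamma> t) \<le> m"
  shows "level \<rho> \<le> m"
  unfolding level_def
  by (rule cInf_lower; (rule bdd_belowI[of _ \<alpha>])?) (use assms path_lower in blast)+

lemma \<gamma>0_paths: "\<gamma>0 \<in> paths"
  using \<gamma>0 by (auto simp: paths_def)

lemma \<gamma>0_bound: "0 \<le> \<rho> \<Longrightarrow> t \<in> {0..1} \<Longrightarrow> J \<rho> (\<gamma>0 t) \<le> C"
  using \<gamma>0(5)[of t] B_nonneg[OF \<gamma>0(1)[of t]] by (auto simp: J_def intro: order_trans[rotated])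

lemma level_bounds: "0 \<le> \<rho> \<Longrightarrow> \<rho> \<le> 1 \<Longrightarrow> \<alpha> \<le> level \<rho>" "0 \<le> \<rho> \<Longrightarrow> \<rho> \<le> 1 \<Longrightarrow> level \<rho> \<le> C"
proof -
  assume \<rho>: "0 \<le> \<rho>" "\<rho> \<le> 1"
  show "level \<rho> \<le> C" by (rule level_le[OF \<rho>(2) \<gamma>0_paths]) (use \<gamma>0_bound \<rho> in auto)
  show "\<alpha> \<le> level \<rho>" unfolding level_def
    by (rule cInf_greatest) (use \<gamma>0_bound[OF \<rho>(1)] \<gamma>0_paths path_lower[OF \<rho>(2)] in blast)+
qed

lemma level_path:
  assumes "0 \<le> \<rho>" "\<rho> \<le> 1" "level \<rho> < m"
  obtains \<gamma> where "\<gamma> \<in> paths" "\<And>t. t \<in> {0..1} \<Longrightarrow> J \<rho> (\<gamma> t) \<le> m"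
proof -
  have "{m. \<exists>\<gamma>\<in>paths. \<forall>t\<in>{0..1}. J \<rho> (\<gamma> t) \<le> m} \<noteq> {}"
    using \<gamma>0_bound[OF assms(1)] \<gamma>0_paths by blast
  from cInf_lessD[OF this assms(3)[unfolded level_def]] that show thesis by force
qed

text \<open>
  Since \<open>B = (J a - J b) / (b - a)\<close>, the slope of \<open>level\<close> bounds \<open>B\<close> at the points of a nearly
  optimal path for \<open>a\<close> where \<open>J b\<close> is almost \<open>level b\<close>; were the gradient large at all these
  points, a gradient step would push the whole path below \<open>level b\<close>.
\<close>

lemma almost_critical:
  assumes \<eta>: "\<eta> > 0" and S: "S \<ge> 0"
  shows "\<exists>\<tau>0>0. \<forall>a b. \<rho>0 \<le> a \<longrightarrow> a < b \<longrightarrow> b \<le> 1 \<longrightarrow> b - a \<le> \<tau>0 \<longrightarrow> level a - level b \<le> S * (b - a) \<longrightarrow>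
    (\<exists>x\<in>D. (\<Sum>i\<in>I. (gJ b x i)\<^sup>2) < \<eta> \<and> \<alpha> - (b - a) \<le> J b x \<and> J b x \<le> C + (S + 1) * (b - a) \<and> B x \<le> S + 2)"
proof -
  \<comment> \<open>Bounds \<open>A = J b + b * B\<close> on the part of the path that is moved:
    there \<open>J b\<close> is at most \<open>C + (S + 1) * \<tau>\<close> with
    \<open>\<tau> <= 1\<close>, and \<open>b * B\<close> at most \<open>S + 2\<close>.\<close>
  define cA where "cA = C + (S + 1) + (S + 2)"
  obtain s0 where s0: "s0 > 0" and step: "\<And>\<rho> x s. 0 \<le> \<rho> \<Longrightarrow> \<rho> \<le> 1 \<Longrightarrow> x \<in> D \<Longrightarrow> A x \<le> cA \<Longrightarrow>
     \<eta> \<le> (\<Sum>i\<in>I. (gJ \<rho> x i)\<^sup>2) \<Longrightarrow> 0 \<le> s \<Longrightarrow> s \<le> s0 \<Longrightarrow> (\<lambda>i. x i - s * gJ \<rho> x i) \<in> D \<and>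
       J \<rho> (\<lambda>i. x i - s * gJ \<rho> x i) \<le> J \<rho> x - s / 2 * (\<Sum>i\<in>I. (gJ \<rho> x i)\<^sup>2)"
  proof -
    obtain s0 where s0: "s0 > 0" and *: "\<forall>\<rho>\<in>{0..1}. \<forall>x\<in>D. A x \<le> cA \<longrightarrow> \<eta> \<le> (\<Sum>i\<in>I. (gJ \<rho> x i)\<^sup>2) \<longrightarrow>
      (\<forall>s\<in>{0..s0}. (\<lambda>i. x i - s * gJ \<rho> x i) \<in> D \<and>
       J \<rho> (\<lambda>i. x i - s * gJ \<rho> x i) \<le> J \<rho> x - s / 2 * (\<Sum>i\<in>I. (gJ \<rho> x i)\<^sup>2))"
      using gradient_step[OF \<eta>, of cA] by blast
    show thesis
      by (rule that[OF s0], goal_cases) (rule *[rule_format]; simp)+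
  qed
  define gap where "gap = min (\<alpha> - J \<rho>0 z0) (\<alpha> - J \<rho>0 z1)"
  have gap: "gap > 0" using ends by (simp add: gap_def J_def)
  \<comment> \<open>The second entry makes the gain \<open>s0 * \<eta> / 2\<close> of a full step at
    least the height \<open>(S + 2) * \<tau>\<close> of the window to be crossed; the third leaves
    the ends of the path at least \<open>\<tau>\<close> below \<open>\<alpha>\<close>.\<close>
  define \<tau>0 where "\<tau>0 = Min {1, s0 * \<eta> / (2 * (S + 2)), gap}"
  have \<tau>0: "\<tau>0 > 0" "\<tau>0 \<le> 1" "\<tau>0 \<le> s0 * \<eta> / (2 * (S + 2))" "\<tau>0 \<le> gap"
    using s0 \<eta> S gap by (auto simp: \<tau>0_def)
  have z: "z0 \<in> D" "z1 \<in> D" using \<gamma>0(1)[of 0] \<gamma>0(1)[of 1] \<gamma>0(3,4) by auto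
  show ?thesis
  proof (intro exI[of _ \<tau>0] conjI allI impI \<tau>0(1))
    fix a b assume ab: "\<rho>0 \<le> a" "a < b" "b \<le> 1" "b - a \<le> \<tau>0" "level a - level b \<le> S * (b - a)"
    define \<tau> where "\<tau> = b - a"
    have \<tau>: "\<tau> > 0" "\<tau> \<le> \<tau>0" using ab by (auto simp: \<tau>_def)
    have r: "0 \<le> a" "a \<le> 1" "0 \<le> b" using ab \<rho>0 by auto
    have big: "(S + 2) * \<tau> \<le> s0 * \<eta> / 2"
    proof -
      have "\<tau> \<le> s0 * \<eta> / (2 * (S + 2))" using \<tau> \<tau>0 by linarith
      then show ?thesis using S by (simp add: field_simps)
    qed
    define L where "L = level b"
    have L: "\<alpha> \<le> L" "L \<le> C" using level_bounds r ab by (auto simp: L_def)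
    show "\<exists>x\<in>D. (\<Sum>i\<in>I. (gJ b x i)\<^sup>2) < \<eta> \<and> \<alpha> - (b - a) \<le> J b x \<and> J b x \<le> C + (S + 1) * (b - a) \<and> B x \<le> S + 2"
      unfolding \<tau>_def[symmetric]
    proof (rule ccontr)
      assume "\<not> (\<exists>x\<in>D. (\<Sum>i\<in>I. (gJ b x i)\<^sup>2) < \<eta> \<and> \<alpha> - \<tau> \<le> J b x \<and> J b x \<le> C + (S + 1) * \<tau> \<and> B x \<le> S + 2)"
      note neg = this
      have no: "\<And>x. x \<in> D \<Longrightarrow> \<alpha> - \<tau> \<le> J b x \<Longrightarrow> J b x \<le> C + (S + 1) * \<tau> \<Longrightarrow> B x \<le> S + 2 \<Longrightarrow> \<eta> \<le> (\<Sum>i\<in>I. (gJ b x i)\<^sup>2)"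
        using neg by (meson not_le)
      obtain \<gamma> where \<gamma>: "\<gamma> \<in> paths" "\<And>t. t \<in> {0..1} \<Longrightarrow> J a (\<gamma> t) \<le> level a + \<tau>"
        using level_path[of a "level a + \<tau>"] r \<tau> by auto
      have \<gamma>D: "\<gamma> t \<in> D" if "t \<in> {0..1}" for t using \<gamma>(1) that by (auto simp: paths_def)
      have Ja: "J a (\<gamma> t) \<le> L + (S + 1) * \<tau>" if "t \<in> {0..1}" for t
        using \<gamma>(2)[OF that] ab(5) by (simp add: L_def \<tau>_def algebra_simps)
      have Jb: "J b (\<gamma> t) \<le> L + (S + 1) * \<tau>" if "t \<in> {0..1}" for t
        using Ja[OF that] J_mono[OF \<gamma>D[OF that], of a b] ab by linarith
      \<comment> \<open>Continuous cut-off: 0 where \<open>J b <= L - \<tau>\<close>, in particular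
        at the end points, and 1 where \<open>J b >= L - \<tau> / 2\<close>. In between the partial
        step does not raise \<open>J b\<close>, so every point ends at or below
        \<open>L - \<tau> / 2\<close>.\<close>
      define \<zeta> where "\<zeta> = (\<lambda>t. min 1 (max 0 ((J b (\<gamma> t) - (L - \<tau>)) * 2 / \<tau>)))"
      define \<gamma>' where "\<gamma>' = (\<lambda>t i. \<gamma> t i - s0 * \<zeta> t * gJ b (\<gamma> t) i)"
      have \<zeta>01: "0 \<le> \<zeta> t" "\<zeta> t \<le> 1" for t by (auto simp: \<zeta>_def)
      have act: "\<gamma>' t \<in> D \<and> J b (\<gamma>' t) \<le> L - \<tau> / 2" if t: "t \<in> {0..1}" for t
      proof (cases "J b (\<gamma> t) \<le> L - \<tau>")
        case True
        then have "\<zeta> t = 0" using \<tau> by (auto simp: \<zeta>_def field_simps min_def max_def)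
        then have "\<gamma>' t = \<gamma> t" by (simp add: \<gamma>'_def)
        then show ?thesis using True \<gamma>D[OF t] \<tau> by auto
      next
        case False
        have eq: "\<tau> * B (\<gamma> t) = J a (\<gamma> t) - J b (\<gamma> t)" by (simp add: J_def \<tau>_def algebra_simps)
        have "\<tau> * B (\<gamma> t) \<le> \<tau> * (S + 2)"
          using eq Ja[OF t] False by (simp add: algebra_simps)
        then have Bb: "B (\<gamma> t) \<le> S + 2" using \<tau> by simp
        have Jle: "J b (\<gamma> t) \<le> C + (S + 1) * \<tau>" using Jb[OF t] L by linarith
        have grad: "\<eta> \<le> (\<Sum>i\<in>I. (gJ b (\<gamma> t) i)\<^sup>2)"
          by (rule no[OF \<gamma>D[OF t] _ Jle Bb]) (use False L in linarith)
        have "(S + 1) * \<tau> \<le> S + 1" using \<tau> \<tau>0 S by (simp add: mult_left_le)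
        moreover have "b * B (\<gamma> t) \<le> S + 2"
          using mult_mono[OF ab(3) Bb] r B_nonneg[OF \<gamma>D[OF t]] by simp
        ultimately have "A (\<gamma> t) \<le> cA" using Jle by (simp add: J_def cA_def)
        note st = step[OF r(3) ab(3) \<gamma>D[OF t] this grad, of "s0 * \<zeta> t"]
        have st': "\<gamma>' t \<in> D" "J b (\<gamma>' t) \<le> J b (\<gamma> t) - s0 * \<zeta> t / 2 * (\<Sum>i\<in>I. (gJ b (\<gamma> t) i)\<^sup>2)"
          using st \<zeta>01[of t] s0 by (auto simp: \<gamma>'_def mult_left_le)
        have dec: "s0 * \<zeta> t / 2 * \<eta> \<le> s0 * \<zeta> t / 2 * (\<Sum>i\<in>I. (gJ b (\<gamma> t) i)\<^sup>2)"
          using grad \<zeta>01[of t] s0 by (intro mult_left_mono) auto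
        have dec0: "0 \<le> s0 * \<zeta> t / 2 * \<eta>" using \<zeta>01[of t] s0 \<eta> by auto
        show ?thesis
        proof (cases "J b (\<gamma> t) \<le> L - \<tau> / 2")
          case True
          then show ?thesis using st' dec dec0 by auto
        next
          case False
          then have "\<zeta> t = 1" using \<tau> by (auto simp: \<zeta>_def field_simps min_def max_def)
          then have "J b (\<gamma>' t) \<le> L + (S + 1) * \<tau> - (S + 2) * \<tau>"
            using st'(2) dec big Jb[OF t] by simp
          then show ?thesis using st'(1) \<tau> by (simp add: algebra_simps)
        qed
      qed
      have ends': "J b z \<le> \<alpha> - \<tau>" if "z \<in> {z0, z1}" for z
      proof -
        have "J b z \<le> J \<rho>0 z" using that z ab by (intro J_mono) auto
        moreover have "gap \<le> \<alpha> - J \<rho>0 z" using that by (auto simp: gap_def)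
        moreover have "\<tau> \<le> gap" using \<tau> \<tau>0 by linarith
        ultimately show ?thesis using \<tau>(1) by linarith
      qed
      have \<gamma>ends: "\<gamma> 0 = z0" "\<gamma> 1 = z1" using \<gamma>(1) by (auto simp: paths_def)
      have "\<zeta> 0 = 0" "\<zeta> 1 = 0"
        using ends'[of z0] ends'[of z1] L \<tau> by (auto simp: \<zeta>_def \<gamma>ends field_simps min_def max_def)
      then have "\<gamma>' 0 = z0" "\<gamma>' 1 = z1" by (auto simp: \<gamma>'_def \<gamma>ends)
      moreover have "continuous_on {0..1} (\<lambda>t. \<gamma>' t i)" if "i \<in> I" for i
      proof -
        have c1: "continuous_on {0..1} (\<lambda>t. J b (\<gamma> t))"
          by (rule continuous_on_path[OF \<gamma>(1)]) (rule J_cont, auto)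
        have c2: "continuous_on {0..1} (\<lambda>t. gJ b (\<gamma> t) i)"
          by (rule continuous_on_path[OF \<gamma>(1)]) (rule gJ_cont, auto simp: that)
        have c3: "continuous_on {0..1} (\<lambda>t. \<gamma> t i)" using \<gamma>(1) that by (auto simp: paths_def)
        show ?thesis unfolding \<gamma>'_def \<zeta>_def
          by (intro continuous_intros c1 c2 c3) (use \<tau> in auto)
      qed
      ultimately have "\<gamma>' \<in> paths" using act by (auto simp: paths_def)
      from level_le[OF ab(3) this] act have "L \<le> L - \<tau> / 2" by (auto simp: L_def)
      then show False using \<tau> by simp
    qed
  qed
qed

text \<open>Bisection of \<open>[\<rho>0, 1]\<close>, where the mean slope of \<open>level\<close>
  is at most \<open>(C - \<alpha>) / (1 - \<rho>0)\<close>, supplies arbitrarily short intervals for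
  \<open>almost_critical\<close>. The bounds on \<open>J\<close> and \<open>B\<close> together bound
  \<open>A\<close>, so the almost critical points accumulate, and the limit is critical for the
  limiting parameter.\<close>

theorem critical_point:
  shows "\<exists>\<rho>\<in>{\<rho>0..1}. \<exists>x\<in>D. (\<forall>i\<in>I. gA x i = \<rho> * gB x i) \<and> \<alpha> \<le> A x - \<rho> * B x \<and> A x - \<rho> * B x \<le> C
    \<and> B x \<le> (C - \<alpha>) / (1 - \<rho>0) + 2"
proof -
  define S where "S = (C - \<alpha>) / (1 - \<rho>0)"
  have lb: "\<alpha> \<le> level \<rho>0" "level \<rho>0 \<le> C" "\<alpha> \<le> level 1" "level 1 \<le> C" using level_bounds \<rho>0 by auto
  have S: "S \<ge> 0" using lb \<rho>0 by (auto simp: S_def)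
  have slope: "level \<rho>0 - level 1 \<le> S * (1 - \<rho>0)" using lb \<rho>0 by (simp add: S_def)
  have "\<exists>a b x. \<rho>0 \<le> a \<and> a < b \<and> b \<le> 1 \<and> b - a \<le> 1 / Suc n \<and> x \<in> D \<and> (\<Sum>i\<in>I. (gJ b x i)\<^sup>2) < 1 / Suc n
    \<and> \<alpha> - (b - a) \<le> J b x \<and> J b x \<le> C + (S + 1) * (b - a) \<and> B x \<le> S + 2" for n
  proof -
    obtain \<tau>0 where \<tau>0: "\<tau>0 > 0" and ac: "\<And>a b. \<rho>0 \<le> a \<Longrightarrow> a < b \<Longrightarrow> b \<le> 1 \<Longrightarrow> b - a \<le> \<tau>0 \<Longrightarrow> level a - level b \<le> S * (b - a) \<Longrightarrow>
    (\<exists>x\<in>D. (\<Sum>i\<in>I. (gJ b x i)\<^sup>2) < 1 / Suc n \<and> \<alpha> - (b - a) \<le> J b x \<and> J b x \<le> C + (S + 1) * (b - a) \<and> B x \<le> S + 2)"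
      using almost_critical[of "1 / Suc n" S] S by auto
    define m where "m = min \<tau>0 (1 / Suc n)"
    have "m > 0" using \<tau>0 by (simp add: m_def)
    obtain k where k: "(1/2::real) ^ k < m" using real_arch_pow_inv[of m "1/2"] \<open>m > 0\<close> by auto
    obtain a b where ab: "\<rho>0 \<le> a" "a < b" "b \<le> 1" "b - a = (1 - \<rho>0) / 2 ^ k" "level a - level b \<le> S * (b - a)"
      using dyadic_small_slope[OF \<rho>0(2) slope, of k] by blast
    have "(1 - \<rho>0) / 2 ^ k \<le> 1 / 2 ^ k" using \<rho>0 by (intro divide_right_mono) auto
    then have "b - a \<le> m" using k ab by (simp add: power_one_over)
    then show ?thesis using ac[of a b] ab unfolding m_def by (metis min.boundedE)
  qed
  then obtain a b X where ab: "\<And>n. \<rho>0 \<le> a n" "\<And>n. a n < b n" "\<And>n. b n \<le> 1" "\<And>n. b n - a n \<le> 1 / Suc n"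
    and XD: "\<And>n. X n \<in> D" and g: "\<And>n. (\<Sum>i\<in>I. (gJ (b n) (X n) i)\<^sup>2) < 1 / Suc n"
    and J: "\<And>n. \<alpha> - (b n - a n) \<le> J (b n) (X n)" "\<And>n. J (b n) (X n) \<le> C + (S + 1) * (b n - a n)"
    and B: "\<And>n. B (X n) \<le> S + 2" by metis
  have b01: "0 \<le> b n" "b n - a n \<le> 1" for n
  proof -
    show "0 \<le> b n" using ab(1)[of n] ab(2)[of n] \<rho>0 by linarith
    have "1 / real (Suc n) \<le> 1" by simp
    then show "b n - a n \<le> 1" using ab(4)[of n] by linarith
  qed
  have "A (X n) \<le> C + (S + 1) + (S + 2)" for n
  proof -
    have "(S + 1) * (b n - a n) \<le> S + 1" using b01[of n] S by (simp add: mult_left_le)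
    moreover have "b n * B (X n) \<le> S + 2"
      using mult_mono[OF ab(3)[of n] B[of n]] b01[of n] B_nonneg[OF XD[of n]] by simp
    ultimately show ?thesis using J(2)[of n] by (simp add: J_def)
  qed
  from A_compact[of X, OF XD this] obtain x r where x: "x \<in> D" "strict_mono r" "conv_on I (X \<circ> r) x" by auto
  have "\<bar>b (r n)\<bar> \<le> 1" for n using b01 ab(3) by (simp add: abs_le_iff)
  then obtain \<rho> q where q: "strict_mono q" "(\<lambda>n. b (r (q n))) \<longlonglongrightarrow> \<rho>"
    using bounded_real_convergent_subseq[of "\<lambda>n. b (r n)" 1] by metis
  define k where "k = r \<circ> q"
  have k: "strict_mono k" unfolding k_def by (rule strict_mono_o[OF x(2) q(1)])
  have inv0: "(\<lambda>n. 1 / real (Suc (k n))) \<longlonglongrightarrow> 0"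
    using LIMSEQ_subseq_LIMSEQ[OF LIMSEQ_inverse_real_of_nat k] by (simp add: o_def inverse_eq_divide)
  have c: "conv_on I (\<lambda>n. X (k n)) x" using conv_on_subseq[OF x(3) q(1)] by (simp add: k_def o_def)
  have R: "(\<lambda>n. b (k n)) \<longlonglongrightarrow> \<rho>" using q(2) by (simp add: k_def)
  have d0: "(\<lambda>n. b (k n) - a (k n)) \<longlonglongrightarrow> 0"
    by (rule tendsto_sandwich[OF _ _ tendsto_const inv0]) (use ab in \<open>auto intro!: always_eventually less_imp_le\<close>)
  have Jl: "(\<lambda>n. J (b (k n)) (X (k n))) \<longlonglongrightarrow> J \<rho> x" by (rule J_cont[OF x(1) XD c R])
  have gl: "(\<lambda>n. \<Sum>i\<in>I. (gJ (b (k n)) (X (k n)) i)\<^sup>2) \<longlonglongrightarrow> (\<Sum>i\<in>I. (gJ \<rho> x i)\<^sup>2)"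
    by (intro tendsto_intros gJ_cont[OF x(1) XD c _ R])
  have "(\<Sum>i\<in>I. (gJ \<rho> x i)\<^sup>2) \<le> 0"
    by (rule LIMSEQ_le[OF gl inv0]) (use g in \<open>auto intro: less_imp_le\<close>)
  then have "\<forall>i\<in>I. gJ \<rho> x i = 0"
    using sum_nonneg_eq_0_iff[OF fin, of "\<lambda>i. (gJ \<rho> x i)\<^sup>2"] sum_nonneg[of I "\<lambda>i. (gJ \<rho> x i)\<^sup>2"] by simp
  moreover have "\<alpha> - 0 \<le> J \<rho> x"
    by (rule LIMSEQ_le[OF tendsto_diff[OF tendsto_const d0] Jl]) (use J in auto)
  moreover have "J \<rho> x \<le> C + (S + 1) * 0"
    by (rule LIMSEQ_le[OF Jl tendsto_add[OF tendsto_const tendsto_mult[OF tendsto_const d0]]]) (use J in auto)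
  moreover have "B x \<le> S + 2" 
    by (rule LIMSEQ_le_const2[OF B_cont[OF x(1) XD c]]) (use B in auto)
  moreover have "\<rho>0 \<le> b n" for n using ab(1)[of n] ab(2)[of n] by linarith
  then have "\<rho>0 \<le> \<rho>" by (intro LIMSEQ_le_const[OF R]) auto
  moreover have "\<rho> \<le> 1" by (rule LIMSEQ_le_const2[OF R]) (use ab in auto)
  ultimately show ?thesis using x(1) by (intro bexI[of _ \<rho>] bexI[of _ x]) (auto simp: gJ_def J_def S_def)
qed

end

section \<open>The discretised problem on the core\<close>

text \<open>\<open>E\<close> holds the bounded edges; the half-lines survive only through the
  weights \<open>N\<close>, and \<open>N_pos\<close> says that there is at least one. By
  \<open>V_ends\<close> every vertex value is also a value on some edge.\<close>

locale core_graph =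
  fixes V :: "'v set" and E :: "'e set" and el :: "'e \<Rightarrow> real" and s t :: "'e \<Rightarrow> 'v"
    and N :: "'v \<Rightarrow> real" and p \<mu> :: real
  assumes finV: "finite V" and finE: "finite E" and E_ne: "E \<noteq> {}"
    and el_pos: "e \<in> E \<Longrightarrow> 0 < el e"
    and s_in: "e \<in> E \<Longrightarrow> s e \<in> V" and t_in: "e \<in> E \<Longrightarrow> t e \<in> V"
    and V_ends: "V \<subseteq> s ` E \<union> t ` E"
    and connected: "v \<in> V \<Longrightarrow> w \<in> V \<Longrightarrow> (v, w) \<in> {(a, b). \<exists>e\<in>E. {a, b} = {s e, t e}}\<^sup>*"
    and N_nonneg: "v \<in> V \<Longrightarrow> 0 \<le> N v" and N_pos: "\<exists>v\<in>V. 0 < N v"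
    and p6: "6 < p" and \<mu>_pos: "0 < \<mu>"

section \<open>Truncated powers and linear forms in finitely many coordinates\<close>

lemma pos_part_powr_deriv:
  fixes q :: real assumes q: "q > 1"
  shows "((\<lambda>x. (max 0 x) powr q) has_real_derivative q * (max 0 x) powr (q - 1)) (at x)"
proof -
  consider "x > 0" | "x < 0" | "x = 0" by linarith
  then show ?thesis
  proof cases
    case 1
    have "((\<lambda>x. x powr q) has_real_derivative q * x powr (q - 1)) (at x)"
      using 1 by (auto intro!: derivative_eq_intros)
    then have "((\<lambda>x. (max 0 x) powr q) has_real_derivative q * x powr (q - 1)) (at x)"
      by (rule has_field_derivative_transform_within_open[where S = "{0<..}"]) (use 1 in auto)
    then show ?thesis using 1 by simp
  next
    case 2
    have "((\<lambda>x. 0::real) has_real_derivative 0) (at x)" by simp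
    then have "((\<lambda>x. (max 0 x) powr q) has_real_derivative 0) (at x)"
      by (rule has_field_derivative_transform_within_open[where S = "{..<0}"]) (use 2 in auto)
    then show ?thesis using 2 by simp
  next
    case 3
    have "((\<lambda>h::real. (\<bar>h\<bar>) powr (q - 1)) \<longlongrightarrow> 0) (at 0)"
    proof (rule tendsto_eq_rhs)
      show "((\<lambda>h::real. (\<bar>h\<bar>) powr (q - 1)) \<longlongrightarrow> \<bar>0\<bar> powr (q - 1)) (at 0)"
        by (rule tendsto_powr'[OF tendsto_rabs[OF tendsto_ident_at] tendsto_const]) (use q in auto)
    qed (use q in auto)
    moreover have "norm ((max 0 (0 + h)) powr q / h) \<le> (\<bar>h\<bar>) powr (q - 1)" for h :: real
    proof (cases "h > 0")
      case True then show ?thesis by (simp add: powr_diff)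
    qed (auto simp: max_def)
    ultimately have "((\<lambda>h. (max 0 (0 + h)) powr q / h) \<longlongrightarrow> 0) (at (0::real))"
      by (intro Lim_null_comparison[OF _ \<open>((\<lambda>h::real. (\<bar>h\<bar>) powr (q - 1)) \<longlongrightarrow> 0) (at 0)\<close>]) auto
    then show ?thesis using 3 q by (simp add: DERIV_def)
  qed
qed

lemma tendsto_pos_part_powr:
  fixes q :: real assumes "q > 1" "(f \<longlongrightarrow> l) F"
  shows "((\<lambda>x. (max 0 (f x)) powr q) \<longlongrightarrow> (max 0 l) powr q) F"
  using isCont_tendsto_compose[OF DERIV_isCont[OF pos_part_powr_deriv[OF assms(1)]] assms(2)] .

text \<open>A linear form that sees only the coordinates in \<open>I\<close>, expressed by its
  expansion in unit vectors. It turns the directional derivatives \<open>dA\<close> and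
  \<open>dB\<close> into the coordinate gradients with which the abstract mountain pass
  works.\<close>

definition linear_in :: "'i set \<Rightarrow> (('i \<Rightarrow> real) \<Rightarrow> real) \<Rightarrow> bool" where
  "linear_in I F \<longleftrightarrow> (\<forall>y. F y = (\<Sum>i\<in>I. F (\<lambda>k. if k = i then 1 else 0) * y i))"

lemma linear_in_coord: "finite I \<Longrightarrow> k \<in> I \<Longrightarrow> linear_in I (\<lambda>y. y k)"
  unfolding linear_in_def
proof
  fix y :: "'a \<Rightarrow> real" assume I: "finite I" "k \<in> I"
  have "(\<Sum>i\<in>I. (if k = i then 1 else 0) * y i) = (\<Sum>i\<in>I. if i = k then y i else 0)"
    by (rule sum.cong) auto
  then show "y k = (\<Sum>i\<in>I. (if k = i then 1 else 0) * y i)" using I by simp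
qed

lemma linear_in_add:
  assumes "linear_in I F" "linear_in I G" shows "linear_in I (\<lambda>y. F y + G y)"
  unfolding linear_in_def
proof
  fix y
  have "F y + G y = (\<Sum>i\<in>I. F (\<lambda>k. if k = i then 1 else 0) * y i) + (\<Sum>i\<in>I. G (\<lambda>k. if k = i then 1 else 0) * y i)"
    by (rule arg_cong2[where f = "(+)", OF assms[unfolded linear_in_def, rule_format]])
  then show "F y + G y = (\<Sum>i\<in>I. (F (\<lambda>k. if k = i then 1 else 0) + G (\<lambda>k. if k = i then 1 else 0)) * y i)"
    by (simp only: distrib_right sum.distrib)
qed

lemma linear_in_diff:
  assumes "linear_in I F" "linear_in I G" shows "linear_in I (\<lambda>y. F y - G y)"
  unfolding linear_in_def
proof
  fix y
  have "F y - G y = (\<Sum>i\<in>I. F (\<lambda>k. if k = i then 1 else 0) * y i) - (\<Sum>i\<in>I. G (\<lambda>k. if k = i then 1 else 0) * y i)"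
    by (rule arg_cong2[where f = "(-)", OF assms[unfolded linear_in_def, rule_format]])
  then show "F y - G y = (\<Sum>i\<in>I. (F (\<lambda>k. if k = i then 1 else 0) - G (\<lambda>k. if k = i then 1 else 0)) * y i)"
    by (simp only: left_diff_distrib sum_subtractf)
qed

lemma linear_in_cmult: "linear_in I F \<Longrightarrow> linear_in I (\<lambda>y. c * F y)"
  unfolding linear_in_def
proof
  fix y assume H: "\<forall>y. F y = (\<Sum>i\<in>I. F (\<lambda>k. if k = i then 1 else 0) * y i)"
  show "c * F y = (\<Sum>i\<in>I. c * F (\<lambda>k. if k = i then 1 else 0) * y i)"
    by (subst H[rule_format, of y]) (simp add: sum_distrib_left mult.assoc)
qed

lemma linear_in_sum: 
  assumes "\<And>q. q \<in> Q \<Longrightarrow> linear_in I (F q)" shows "linear_in I (\<lambda>y. \<Sum>q\<in>Q. F q y)"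
  unfolding linear_in_def
proof
  fix y
  have "(\<Sum>q\<in>Q. F q y) = (\<Sum>q\<in>Q. \<Sum>i\<in>I. F q (\<lambda>k. if k = i then 1 else 0) * y i)"
    using assms unfolding linear_in_def by (intro sum.cong) blast+
  also have "\<dots> = (\<Sum>i\<in>I. (\<Sum>q\<in>Q. F q (\<lambda>k. if k = i then 1 else 0)) * y i)"
    by (subst sum.swap) (simp add: sum_distrib_right)
  finally show "(\<Sum>q\<in>Q. F q y) = (\<Sum>i\<in>I. (\<Sum>q\<in>Q. F q (\<lambda>k. if k = i then 1 else 0)) * y i)" .
qed

section \<open>The mesh, its quadratic forms and the reduced energy\<close>

context core_graph
begin

text \<open>
  Each edge is cut into \<open>n\<close> equal parts; the value of \<open>x\<close> at the \<open>j\<close>-th node of \<open>e\<close> is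
  \<open>x (nd n e j)\<close>, nodes at the same vertex being shared. The last term of \<open>AA\<close> is the kinetic
  energy of exponential tails of rate \<open>aa\<close> attached to the vertices, which carry the remaining
  mass; \<open>\<epsilon> > 0\<close> keeps sequences with bounded \<open>AA\<close> away from \<open>MQ = \<mu>\<close>.
\<close>

definition nd :: "nat \<Rightarrow> 'e \<Rightarrow> nat \<Rightarrow> 'v + 'e \<times> nat" where
  "nd n e j = (if j = 0 then Inl (s e) else if j \<ge> n then Inl (t e) else Inr (e, j))"
definition I :: "nat \<Rightarrow> ('v + 'e \<times> nat) set" where "I n = Inl ` V \<union> Inr ` (E \<times> {1..<n})"
definition h where "h n e = el e / real n"
definition KQ where
  "KQ n x y = (\<Sum>e\<in>E. \<Sum>j<n. 1 / h n e * ((x (nd n e (Suc j)) - x (nd n e j)) * (y (nd n e (Suc j)) - y (nd n e j))))"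
definition MQ where "MQ n x y = (\<Sum>e\<in>E. \<Sum>j\<le>n. h n e * (x (nd n e j) * y (nd n e j)))"
definition SQ :: "('v + 'e \<times> nat \<Rightarrow> real) \<Rightarrow> ('v + 'e \<times> nat \<Rightarrow> real) \<Rightarrow> real" where
  "SQ x y = (\<Sum>v\<in>V. N v * (x (Inl v) * y (Inl v)))"
definition aa where "aa n \<epsilon> x = (SQ x x + \<epsilon>) / (2 * (\<mu> - MQ n x x))"
definition AA where "AA n \<epsilon> x = KQ n x x / 2 + (SQ x x + \<epsilon>)\<^sup>2 / (8 * (\<mu> - MQ n x x))"
definition BB where "BB n x = (\<Sum>e\<in>E. \<Sum>j\<le>n. h n e * ((max 0 (x (nd n e j))) powr p / p))"
text \<open>The directional derivative of \<open>AA\<close>. Differentiating the quotient in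
  \<open>AA\<close> gives exactly the last two terms, so the tail rate \<open>aa\<close> is the
  Robin coefficient and its square the multiplier of the mass.\<close>

definition dA where "dA n \<epsilon> x y = KQ n x y + aa n \<epsilon> x * SQ x y + (aa n \<epsilon> x)\<^sup>2 * MQ n x y"
definition dB where "dB n x y = (\<Sum>e\<in>E. \<Sum>j\<le>n. h n e * ((max 0 (x (nd n e j))) powr (p - 1) * y (nd n e j)))"
definition DD where "DD n = {x. MQ n x x < \<mu>}"

lemma finI: "finite (I n)" unfolding I_def by (intro finite_UnI finite_imageI finite_cartesian_product finV finE finite_atLeastLessThan)

lemma nd_in: "e \<in> E \<Longrightarrow> nd n e j \<in> I n"
  by (auto simp: nd_def I_def s_in t_in)

lemma h_pos: "n > 0 \<Longrightarrow> e \<in> E \<Longrightarrow> h n e > 0" by (simp add: h_def el_pos)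

lemma SQ_nonneg: "0 \<le> SQ x x" unfolding SQ_def by (intro sum_nonneg) (simp add: N_nonneg)
lemma KQ_nonneg: "0 \<le> KQ n x x" unfolding KQ_def
  by (intro sum_nonneg) (auto simp: h_def less_imp_le[OF el_pos])
lemma MQ_nonneg: "0 \<le> MQ n x x" unfolding MQ_def
  by (intro sum_nonneg) (auto simp: h_def less_imp_le[OF el_pos])
lemma BB_nonneg: "0 \<le> BB n x" unfolding BB_def
  by (intro sum_nonneg) (use p6 in \<open>auto simp: h_def less_imp_le[OF el_pos]\<close>)

lemma linear_dA: "linear_in (I n) (dA n \<epsilon> x)"
proof -
  have "linear_in (I n) (\<lambda>y. KQ n x y + aa n \<epsilon> x * SQ x y + (aa n \<epsilon> x)\<^sup>2 * MQ n x y)"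
    unfolding KQ_def SQ_def MQ_def
    by (intro linear_in_add linear_in_sum linear_in_cmult linear_in_diff linear_in_coord finI nd_in)
       (auto simp: I_def)
  then show ?thesis by (simp add: dA_def[abs_def])
qed

lemma linear_dB: "linear_in (I n) (dB n x)"
  unfolding dB_def[abs_def]
  by (intro linear_in_sum linear_in_cmult linear_in_coord finI nd_in) auto

lemma Q_deriv:
  fixes x y :: "'v + 'e \<times> nat \<Rightarrow> real"
  defines "z \<equiv> \<lambda>\<tau> i. x i + \<tau> * y i"
  shows "((\<lambda>\<tau>. KQ n (z \<tau>) (z \<tau>)) has_real_derivative 2 * KQ n (z \<tau>) y) (at \<tau>)"
    "((\<lambda>\<tau>. MQ n (z \<tau>) (z \<tau>)) has_real_derivative 2 * MQ n (z \<tau>) y) (at \<tau>)"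
    "((\<lambda>\<tau>. SQ (z \<tau>) (z \<tau>)) has_real_derivative 2 * SQ (z \<tau>) y) (at \<tau>)"
    "((\<lambda>\<tau>. BB n (z \<tau>)) has_real_derivative dB n (z \<tau>) y) (at \<tau>)"
proof -
  have sq: "((\<lambda>\<tau>. c * ((a + \<tau> * b) * (a + \<tau> * b))) has_real_derivative 2 * (c * ((a + \<tau> * b) * b))) (at \<tau>)"
    for a b c :: real by (auto intro!: derivative_eq_intros)
  show "((\<lambda>\<tau>. MQ n (z \<tau>) (z \<tau>)) has_real_derivative 2 * MQ n (z \<tau>) y) (at \<tau>)"
    unfolding MQ_def z_def sum_distrib_left by (intro DERIV_sum sq)
  show "((\<lambda>\<tau>. SQ (z \<tau>) (z \<tau>)) has_real_derivative 2 * SQ (z \<tau>) y) (at \<tau>)"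
    unfolding SQ_def z_def sum_distrib_left by (intro DERIV_sum sq)
  have r: "x (nd n e (Suc j)) + \<tau> * y (nd n e (Suc j)) - (x (nd n e j) + \<tau> * y (nd n e j)) = 
     (x (nd n e (Suc j)) - x (nd n e j)) + \<tau> * (y (nd n e (Suc j)) - y (nd n e j))" for \<tau> e j
    by (simp add: algebra_simps)
  show "((\<lambda>\<tau>. KQ n (z \<tau>) (z \<tau>)) has_real_derivative 2 * KQ n (z \<tau>) y) (at \<tau>)"
    unfolding KQ_def z_def sum_distrib_left r by (intro DERIV_sum sq)
  have "((\<lambda>\<tau>. (max 0 (a + \<tau> * b)) powr p) has_real_derivative p * (max 0 (a + \<tau> * b)) powr (p - 1) * b) (at \<tau>)"
    for a b :: real
    by (rule DERIV_chain2[OF pos_part_powr_deriv]) (use p6 in \<open>auto intro!: derivative_eq_intros\<close>)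
  then have "((\<lambda>\<tau>. c * ((max 0 (a + \<tau> * b)) powr p / p)) has_real_derivative c * (p * (max 0 (a + \<tau> * b)) powr (p - 1) * b / p)) (at \<tau>)"
    for a b c :: real by (intro DERIV_cmult DERIV_cdivide)
  then have pw: "((\<lambda>\<tau>. c * ((max 0 (a + \<tau> * b)) powr p / p)) has_real_derivative c * ((max 0 (a + \<tau> * b)) powr (p - 1) * b)) (at \<tau>)"
    for a b c :: real using p6 by (simp add: mult.assoc)
  show "((\<lambda>\<tau>. BB n (z \<tau>)) has_real_derivative dB n (z \<tau>) y) (at \<tau>)"
    unfolding BB_def dB_def z_def by (intro DERIV_sum pw)
qed

lemma AA_deriv:
  fixes x y :: "'v + 'e \<times> nat \<Rightarrow> real"
  defines "z \<equiv> \<lambda>\<tau> i. x i + \<tau> * y i"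
  assumes "z \<tau> \<in> DD n"
  shows "((\<lambda>\<tau>. AA n \<epsilon> (z \<tau>)) has_real_derivative dA n \<epsilon> (z \<tau>) y) (at \<tau>)"
proof -
  define P where "P = \<mu> - MQ n (z \<tau>) (z \<tau>)"
  define Q where "Q = SQ (z \<tau>) (z \<tau>) + \<epsilon>"
  have P: "P > 0" using assms(2) by (simp add: DD_def P_def)
  have d: "((\<lambda>\<tau>. KQ n (z \<tau>) (z \<tau>)) has_real_derivative 2 * KQ n (z \<tau>) y) (at \<tau>)"
    "((\<lambda>\<tau>. MQ n (z \<tau>) (z \<tau>)) has_real_derivative 2 * MQ n (z \<tau>) y) (at \<tau>)"
    "((\<lambda>\<tau>. SQ (z \<tau>) (z \<tau>)) has_real_derivative 2 * SQ (z \<tau>) y) (at \<tau>)" for \<tau>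
    unfolding z_def by (rule Q_deriv)+
  have num: "((\<lambda>\<tau>. (SQ (z \<tau>) (z \<tau>) + \<epsilon>)\<^sup>2) has_real_derivative 2 * Q * (2 * SQ (z \<tau>) y)) (at \<tau>)"
    by (auto intro!: derivative_eq_intros d(3) simp: Q_def)
  have den: "((\<lambda>\<tau>. 8 * (\<mu> - MQ n (z \<tau>) (z \<tau>))) has_real_derivative 8 * (- (2 * MQ n (z \<tau>) y))) (at \<tau>)"
    by (auto intro!: derivative_eq_intros d(2))
  have "((\<lambda>\<tau>. AA n \<epsilon> (z \<tau>)) has_real_derivative
     (2 * KQ n (z \<tau>) y / 2 + (2 * Q * (2 * SQ (z \<tau>) y) * (8 * P) - Q\<^sup>2 * (8 * (- (2 * MQ n (z \<tau>) y)))) / (8 * P)\<^sup>2)) (at \<tau>)"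
    unfolding AA_def P_def Q_def power2_eq_square[of "8 * (\<mu> - MQ n (z \<tau>) (z \<tau>))"]
    by (rule DERIV_add[OF DERIV_cdivide[OF d(1)] DERIV_divide[OF num[unfolded Q_def] den]]) (use P in \<open>auto simp: P_def\<close>)
  moreover have "2 * KQ n (z \<tau>) y / 2 + (2 * Q * (2 * SQ (z \<tau>) y) * (8 * P) - Q\<^sup>2 * (8 * (- (2 * MQ n (z \<tau>) y)))) / (8 * P)\<^sup>2
     = dA n \<epsilon> (z \<tau>) y"
    using P unfolding dA_def aa_def P_def[symmetric] Q_def[symmetric] by (simp add: field_simps power2_eq_square)
  ultimately show ?thesis by simp
qed

definition bas :: "'i \<Rightarrow> 'i \<Rightarrow> real" where "bas i = (\<lambda>k. if k = i then 1 else 0)"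

lemma Q_cont:
  assumes "conv_on (I n) X x"
  shows "(\<lambda>k. KQ n (X k) (X k)) \<longlonglongrightarrow> KQ n x x" "(\<lambda>k. KQ n (X k) y) \<longlonglongrightarrow> KQ n x y"
   "(\<lambda>k. MQ n (X k) (X k)) \<longlonglongrightarrow> MQ n x x" "(\<lambda>k. MQ n (X k) y) \<longlonglongrightarrow> MQ n x y"
   "(\<lambda>k. SQ (X k) (X k)) \<longlonglongrightarrow> SQ x x" "(\<lambda>k. SQ (X k) y) \<longlonglongrightarrow> SQ x y"
   "(\<lambda>k. BB n (X k)) \<longlonglongrightarrow> BB n x" "(\<lambda>k. dB n (X k) y) \<longlonglongrightarrow> dB n x y"
proof -
  have c: "(\<lambda>k. X k (nd n e j)) \<longlonglongrightarrow> x (nd n e j)" if "e \<in> E" for e j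
    using assms nd_in[OF that] by (auto simp: conv_on_def)
  have v: "(\<lambda>k. X k (Inl v)) \<longlonglongrightarrow> x (Inl v)" if "v \<in> V" for v
    using assms that by (auto simp: conv_on_def I_def)
  note i = tendsto_sum tendsto_mult tendsto_diff tendsto_const c v tendsto_pos_part_powr
  show "(\<lambda>k. KQ n (X k) (X k)) \<longlonglongrightarrow> KQ n x x" "(\<lambda>k. KQ n (X k) y) \<longlonglongrightarrow> KQ n x y"
   "(\<lambda>k. MQ n (X k) (X k)) \<longlonglongrightarrow> MQ n x x" "(\<lambda>k. MQ n (X k) y) \<longlonglongrightarrow> MQ n x y"
   "(\<lambda>k. SQ (X k) (X k)) \<longlonglongrightarrow> SQ x x" "(\<lambda>k. SQ (X k) y) \<longlonglongrightarrow> SQ x y"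
    unfolding KQ_def MQ_def SQ_def by (intro i; assumption)+
  show "(\<lambda>k. dB n (X k) y) \<longlonglongrightarrow> dB n x y" unfolding dB_def by (intro i) (use p6 in auto)
  show "(\<lambda>k. BB n (X k)) \<longlonglongrightarrow> BB n x" unfolding BB_def 
    by (intro i tendsto_divide) (use p6 in auto)
qed

text \<open>The domain is convex because the mass is a convex function; this supplies
  \<open>D_segment\<close>.\<close>

lemma MQ_convex:
  assumes "MQ n x x < \<mu>" "MQ n (\<lambda>i. x i + q * y i) (\<lambda>i. x i + q * y i) < \<mu>" "0 \<le> \<tau>" "\<tau> \<le> q"
  shows "MQ n (\<lambda>i. x i + \<tau> * y i) (\<lambda>i. x i + \<tau> * y i) < \<mu>"
proof (cases "q = 0")
  case True then show ?thesis using assms by simp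
next
  case False
  define \<theta> where "\<theta> = \<tau> / q"
  have \<theta>: "0 \<le> \<theta>" "\<theta> \<le> 1" "\<tau> = \<theta> * q" using assms False by (auto simp: \<theta>_def)
  have pt: "(a + \<tau> * b) * (a + \<tau> * b) \<le> (1 - \<theta>) * (a * a) + \<theta> * ((a + q * b) * (a + q * b))" for a b :: real
  proof -
    have "(1 - \<theta>) * (a * a) + \<theta> * ((a + q * b) * (a + q * b)) - (a + \<tau> * b) * (a + \<tau> * b) = \<theta> * (1 - \<theta>) * (q * b)\<^sup>2"
      unfolding \<theta>(3) by (simp add: algebra_simps power2_eq_square)
    moreover have "\<theta> * (1 - \<theta>) * (q * b)\<^sup>2 \<ge> 0" using \<theta> by simp
    ultimately show ?thesis by linarith
  qed
  have "MQ n (\<lambda>i. x i + \<tau> * y i) (\<lambda>i. x i + \<tau> * y i) \<le> 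
     (\<Sum>e\<in>E. \<Sum>j\<le>n. h n e * ((1 - \<theta>) * (x (nd n e j) * x (nd n e j)) + \<theta> * ((x (nd n e j) + q * y (nd n e j)) * (x (nd n e j) + q * y (nd n e j)))))"
    unfolding MQ_def by (intro sum_mono mult_left_mono pt) (auto simp: h_def less_imp_le[OF el_pos])
  also have "\<dots> = (1 - \<theta>) * MQ n x x + \<theta> * MQ n (\<lambda>i. x i + q * y i) (\<lambda>i. x i + q * y i)"
    unfolding MQ_def sum_distrib_left sum.distrib[symmetric] by (intro sum.cong refl) (simp add: algebra_simps)
  also have "\<dots> < \<mu>"
  proof (cases "\<theta> = 0")
    case False
    have "(1 - \<theta>) * MQ n x x \<le> (1 - \<theta>) * \<mu>" using assms \<theta> by (intro mult_left_mono) auto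
    moreover have "\<theta> * MQ n (\<lambda>i. x i + q * y i) (\<lambda>i. x i + q * y i) < \<theta> * \<mu>"
      using assms \<theta> False by (intro mult_strict_left_mono) auto
    ultimately show ?thesis by (simp add: algebra_simps)
  qed (use assms in auto)
  finally show ?thesis .
qed

text \<open>Every node, and by \<open>V_ends\<close> every vertex, carries a positive mesh weight on
  some edge, so the mass alone bounds all coordinates.\<close>

lemma MQ_coord:
  assumes "n > 0" "i \<in> I n"
  shows "\<exists>c>0. \<forall>x. c * (x i)\<^sup>2 \<le> MQ n x x"
proof -
  have "\<exists>e\<in>E. \<exists>j\<le>n. i = nd n e j"
  proof (cases i)
    case (Inl v)
    then have "v \<in> V" using assms by (auto simp: I_def)
    then consider e where "e \<in> E" "v = s e" | e where "e \<in> E" "v = t e" using V_ends by blast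
    then show ?thesis
    proof cases
      case 1 then show ?thesis using Inl by (intro bexI[of _ e] exI[of _ 0]) (auto simp: nd_def)
    next
      case 2 then show ?thesis using Inl assms by (intro bexI[of _ e] exI[of _ n]) (auto simp: nd_def)
    qed
  next
    case (Inr q)
    then obtain e j where "q = (e, j)" "e \<in> E" "1 \<le> j" "j < n" using assms by (auto simp: I_def)
    then show ?thesis using Inr by (intro bexI[of _ e] exI[of _ j]) (auto simp: nd_def)
  qed
  then obtain e j where e: "e \<in> E" "j \<le> n" "i = nd n e j" by blast
  have "h n e * (x i)\<^sup>2 \<le> MQ n x x" for x
  proof -
    have "h n e * (x (nd n e j) * x (nd n e j)) \<le> (\<Sum>j\<le>n. h n e * (x (nd n e j) * x (nd n e j)))"
      by (rule member_le_sum) (use e in \<open>auto simp: h_def less_imp_le[OF el_pos]\<close>)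
    also have "\<dots> \<le> MQ n x x" unfolding MQ_def
      by (rule member_le_sum[where f = "\<lambda>e. \<Sum>j\<le>n. h n e * (x (nd n e j) * x (nd n e j))"])
         (use e finE in \<open>auto simp: h_def less_imp_le[OF el_pos] intro!: sum_nonneg\<close>)
    finally show ?thesis by (simp add: e power2_eq_square)
  qed
  then show ?thesis using h_pos[OF assms(1) e(1)] by blast
qed

text \<open>Coordinates are bounded through the mass; the danger is a limit on the boundary
  \<open>MQ n x x = \<mu>\<close>. Bounded \<open>AA\<close> gives
  \<open>\<epsilon>\<^sup>2 <= 8 * c * (\<mu> - MQ n x x)\<close> along the sequence, and this
  survives the limit.\<close>

lemma AA_compact:
  fixes X :: "nat \<Rightarrow> 'v + 'e \<times> nat \<Rightarrow> real"
  assumes n: "n > 0" and \<epsilon>: "\<epsilon> > 0" and X: "\<And>k. X k \<in> DD n" and A: "\<And>k. AA n \<epsilon> (X k) \<le> c"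
  shows "\<exists>x\<in>DD n. \<exists>r. strict_mono r \<and> conv_on (I n) (X \<circ> r) x"
proof -
  have "\<exists>b. \<forall>k. \<bar>X k i\<bar> \<le> b" if i: "i \<in> I n" for i
  proof -
    obtain c where c: "c > 0" "\<And>x. c * (x i)\<^sup>2 \<le> MQ n x x" using MQ_coord[OF n i] by blast
    have "\<bar>X k i\<bar> \<le> sqrt (\<mu> / c)" for k
    proof -
      have "c * (X k i)\<^sup>2 \<le> \<mu>" using c(2)[of "X k"] X[of k] by (auto simp: DD_def)
      then have "(X k i)\<^sup>2 \<le> \<mu> / c" using c(1) by (simp add: field_simps)
      then show ?thesis using real_le_rsqrt[of "\<bar>X k i\<bar>" "\<mu> / c"] by simp
    qed
    then show ?thesis by blast
  qed
  from finite_bolzano[of "I n" X, OF finI this] obtain r x where r: "strict_mono r" "conv_on (I n) (X \<circ> r) x" by auto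
  have "\<epsilon>\<^sup>2 \<le> 8 * c * (\<mu> - MQ n (X k) (X k))" for k
  proof -
    have P: "\<mu> - MQ n (X k) (X k) > 0" using X[of k] by (simp add: DD_def)
    have "\<epsilon>\<^sup>2 \<le> (SQ (X k) (X k) + \<epsilon>)\<^sup>2" using SQ_nonneg \<epsilon> by (intro power_mono) auto
    moreover have "(SQ (X k) (X k) + \<epsilon>)\<^sup>2 / (8 * (\<mu> - MQ n (X k) (X k))) \<le> c"
      using A[of k] KQ_nonneg[of n "X k"] unfolding AA_def by linarith
    ultimately show ?thesis using P by (simp add: field_simps)
  qed
  moreover have "(\<lambda>k. 8 * c * (\<mu> - MQ n (X (r k)) (X (r k)))) \<longlonglongrightarrow> 8 * c * (\<mu> - MQ n x x)"
    using Q_cont(3)[OF r(2)] by (intro tendsto_intros) (auto simp: o_def)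
  ultimately have le: "\<epsilon>\<^sup>2 \<le> 8 * c * (\<mu> - MQ n x x)" by (intro LIMSEQ_le_const) auto
  have "MQ n x x \<le> \<mu>" 
    by (rule LIMSEQ_le_const2[OF Q_cont(3)[OF r(2)]]) (use X in \<open>auto simp: DD_def intro: less_imp_le\<close>)
  moreover have "MQ n x x \<noteq> \<mu>" using le \<epsilon> by auto
  ultimately show ?thesis using r by (intro bexI[of _ x]) (auto simp: DD_def)
qed

lemma mountain_pass_discrete:
  fixes \<gamma>0 :: "real \<Rightarrow> 'v + 'e \<times> nat \<Rightarrow> real"
  assumes n: "n > 0" and \<epsilon>: "\<epsilon> > 0" and \<rho>0: "0 \<le> \<rho>0" "\<rho>0 < 1"
    and \<gamma>0: "\<And>\<tau>. \<tau> \<in> {0..1} \<Longrightarrow> \<gamma>0 \<tau> \<in> DD n" "\<And>i. i \<in> I n \<Longrightarrow> continuous_on {0..1} (\<lambda>\<tau>. \<gamma>0 \<tau> i)"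
       "\<gamma>0 0 = z0" "\<gamma>0 1 = z1" "\<And>\<tau>. \<tau> \<in> {0..1} \<Longrightarrow> AA n \<epsilon> (\<gamma>0 \<tau>) \<le> C"
    and lower: "\<And>\<gamma>. (\<And>\<tau>::real. \<tau> \<in> {0..1} \<Longrightarrow> \<gamma> \<tau> \<in> DD n) \<Longrightarrow> (\<And>i. i \<in> I n \<Longrightarrow> continuous_on {0..1} (\<lambda>\<tau>. \<gamma> \<tau> i)) \<Longrightarrow>
       \<gamma> 0 = z0 \<Longrightarrow> \<gamma> 1 = z1 \<Longrightarrow> \<exists>\<tau>\<in>{0..1}. \<alpha> \<le> AA n \<epsilon> (\<gamma> \<tau>) - BB n (\<gamma> \<tau>)"
    and ends: "AA n \<epsilon> z0 - \<rho>0 * BB n z0 < \<alpha>" "AA n \<epsilon> z1 - \<rho>0 * BB n z1 < \<alpha>"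
  shows "\<exists>\<rho>\<in>{\<rho>0..1}. \<exists>x\<in>DD n. (\<forall>y. dA n \<epsilon> x y = \<rho> * dB n x y) \<and> \<alpha> \<le> AA n \<epsilon> x - \<rho> * BB n x \<and>
     AA n \<epsilon> x - \<rho> * BB n x \<le> C \<and> BB n x \<le> (C - \<alpha>) / (1 - \<rho>0) + 2"
proof -
  have lin: "dA n \<epsilon> x y = (\<Sum>i\<in>I n. dA n \<epsilon> x (bas i) * y i)" "dB n x y = (\<Sum>i\<in>I n. dB n x (bas i) * y i)" for x y
    using linear_dA linear_dB unfolding linear_in_def bas_def by blast+
  interpret mountain_pass "I n" "DD n" "AA n \<epsilon>" "BB n" "\<lambda>x i. dA n \<epsilon> x (bas i)" "\<lambda>x i. dB n x (bas i)" z0 z1 \<gamma>0 \<alpha> C \<rho>0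
  proof (unfold_locales, goal_cases)
    case 1 show ?case by (rule finI)
  next
    case (2 x X)
    then show ?case using order_tendstoD(2)[OF Q_cont(3)] by (auto simp: DD_def)
  next
    case (3 x s y \<tau>) then show ?case using MQ_convex by (auto simp: DD_def)
  next
    case (4 x X)
    then show ?case unfolding AA_def by (intro tendsto_intros Q_cont) (auto simp: DD_def)
  next
    case (5 x X) then show ?case by (intro Q_cont)
  next
    case (6 x X i)
    then show ?case unfolding dA_def aa_def by (intro tendsto_intros Q_cont) (auto simp: DD_def)
  next
    case (7 x X i) then show ?case by (intro Q_cont)
  next
    case (8 x \<tau> y) then show ?case using AA_deriv[where x = x and y = y] by (simp add: lin(1)[symmetric])
  next
    case (9 x \<tau> y) then show ?case using Q_deriv(4)[where x = x and y = y] by (simp add: lin(2)[symmetric])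
  next
    case (10 X c) then show ?case using AA_compact[OF n \<epsilon>] by blast
  next
    case (11 x) show ?case by (rule BB_nonneg)
  next
    case 12 show ?case by (rule \<rho>0)
  next
    case 13 show ?case by (rule \<rho>0)
  next
    case (14 t) then show ?case by (rule \<gamma>0)
  next
    case (15 i) then show ?case by (rule \<gamma>0)
  next
    case 16 show ?case by (rule \<gamma>0)
  next
    case 17 show ?case by (rule \<gamma>0)
  next
    case (18 t) then show ?case by (rule \<gamma>0)
  next
    case (19 \<gamma>) then show ?case by (rule lower)
  next
    case 20 show ?case by (rule ends)
  next
    case 21 show ?case by (rule ends)
  qed
  obtain \<rho> x where rx: "\<rho> \<in> {\<rho>0..1}" "x \<in> DD n" "\<forall>i\<in>I n. dA n \<epsilon> x (bas i) = \<rho> * dB n x (bas i)"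
     "\<alpha> \<le> AA n \<epsilon> x - \<rho> * BB n x" "AA n \<epsilon> x - \<rho> * BB n x \<le> C" "BB n x \<le> (C - \<alpha>) / (1 - \<rho>0) + 2"
    using critical_point by blast
  have "dA n \<epsilon> x y = \<rho> * dB n x y" for y
    unfolding lin[of x y] using rx(3) by (simp add: sum_distrib_left mult.assoc)
  then show ?thesis using rx by blast
qed

end

section \<open>Mountain-pass geometry uniform in the mesh\<close>

lemma continuous_on_Max_image:
  fixes f :: "'i \<Rightarrow> real \<Rightarrow> real"
  assumes "finite I" "I \<noteq> {}" "\<And>i. i \<in> I \<Longrightarrow> continuous_on S (f i)"
  shows "continuous_on S (\<lambda>t. Max ((\<lambda>i. f i t) ` I))"
  using assms
proof (induction I rule: finite_ne_induct)
  case (singleton i) then show ?case by simp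
next
  case (insert i I)
  then show ?case by (simp add: continuous_on_max)
qed

context core_graph
begin

definition LL where "LL = sum el E"

lemma LL_pos: "LL > 0" unfolding LL_def using finE E_ne el_pos by (intro sum_pos) auto

text \<open>A crude upper bound for all inverse edge lengths at once; it is unrelated to the
  characteristic function of the core.\<close>

definition \<kappa> where "\<kappa> = (\<Sum>e\<in>E. 1 / el e)"

lemma \<kappa>_ge: "e \<in> E \<Longrightarrow> 1 / el e \<le> \<kappa>"
  unfolding \<kappa>_def by (rule member_le_sum) (use finE in \<open>auto simp: less_imp_le[OF el_pos]\<close>)

lemma \<kappa>_nonneg: "0 \<le> \<kappa>"
  unfolding \<kappa>_def by (intro sum_nonneg) (simp add: less_imp_le[OF el_pos])

lemma LL_ge: "e \<in> E \<Longrightarrow> el e \<le> LL"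
  unfolding LL_def by (rule member_le_sum) (use finE in \<open>auto simp: less_imp_le[OF el_pos]\<close>)

text \<open>Cauchy-Schwarz on the increments. The factor \<open>n\<close> from the number of
  increments is absorbed by the weights \<open>1 / h n e\<close>, so the bound does not see the
  mesh.\<close>

lemma edge_variation:
  assumes "n > 0" "e \<in> E" "j \<le> k" "k \<le> n"
  shows "\<bar>x (nd n e k) - x (nd n e j)\<bar> \<le> sqrt (LL * KQ n x x)"
proof -
  define d where "d = (\<lambda>i. x (nd n e (Suc i)) - x (nd n e i))"
  have hp: "h n e > 0" using h_pos assms by auto
  have "x (nd n e k) - x (nd n e j) = (\<Sum>i\<in>{j..<k}. d i)"
    unfolding d_def using assms(3) by (simp add: sum_Suc_diff'[where f = "\<lambda>i. x (nd n e i)"])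
  then have "(x (nd n e k) - x (nd n e j))\<^sup>2 \<le> (\<Sum>i\<in>{j..<k}. (d i)\<^sup>2) * card {j..<k}"
    using sum_squared_le_sum_of_squares[of d "{j..<k}"] by simp
  also have "\<dots> \<le> (\<Sum>i<n. (d i)\<^sup>2) * n"
    using assms by (intro mult_mono sum_mono2) (auto intro!: sum_nonneg)
  also have "\<dots> = el e * (\<Sum>i<n. 1 / h n e * (d i * d i))"
    using assms hp by (subst sum_distrib_left[symmetric]) (use el_pos[OF assms(2)] in \<open>simp add: h_def power2_eq_square\<close>)
  also have "\<dots> \<le> LL * KQ n x x"
  proof (rule mult_mono)
    show "el e \<le> LL" unfolding LL_def
      by (rule member_le_sum) (use assms finE in \<open>auto simp: less_imp_le[OF el_pos]\<close>)
    have "(\<Sum>i<n. 1 / h n e * (d i * d i)) = (\<lambda>e. \<Sum>i<n. 1 / h n e * ((x (nd n e (Suc i)) - x (nd n e i)) * (x (nd n e (Suc i)) - x (nd n e i)))) e"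
      by (simp add: d_def)
    also have "\<dots> \<le> KQ n x x" unfolding KQ_def
      by (rule member_le_sum) (use assms finE in \<open>auto simp: h_def less_imp_le[OF el_pos] intro!: sum_nonneg\<close>)
    finally show "(\<Sum>i<n. 1 / h n e * (d i * d i)) \<le> KQ n x x" .
    show "0 \<le> LL" using LL_pos by simp
    show "0 \<le> (\<Sum>i<n. 1 / h n e * (d i * d i))" using hp by (intro sum_nonneg) auto
  qed
  finally show ?thesis using real_le_rsqrt[of "\<bar>x (nd n e k) - x (nd n e j)\<bar>"] by simp
qed

text \<open>Induction along a chain of bounded edges; \<open>m\<close> is the number of edges in the
  chain and is therefore fixed before the mesh.\<close>

lemma vertex_variation:
  assumes "(v, w) \<in> {(a, b). \<exists>e\<in>E. {a, b} = {s e, t e}}\<^sup>*"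
  shows "\<exists>m::real. \<forall>n>0. \<forall>x. \<bar>x (Inl v) - x (Inl w)\<bar> \<le> m * sqrt (LL * KQ n x x)"
  using assms
proof (induction rule: rtrancl_induct)
  case base show ?case by (rule exI[of _ 0]) auto
next
  case (step a b)
  then obtain m where m: "\<And>n x. n > 0 \<Longrightarrow> \<bar>x (Inl v) - x (Inl a)\<bar> \<le> m * sqrt (LL * KQ n x x)" by blast
  obtain e where e: "e \<in> E" "{a, b} = {s e, t e}" using step by auto
  have "\<bar>x (Inl a) - x (Inl b)\<bar> \<le> sqrt (LL * KQ n x x)" if n: "n > 0" for n :: nat and x
  proof -
    have "\<bar>x (Inl (t e)) - x (Inl (s e))\<bar> \<le> sqrt (LL * KQ n x x)"
      using edge_variation[OF n e(1), of 0 n x] n by (simp add: nd_def)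
    then show ?thesis using e(2) by (auto simp: doubleton_eq_iff abs_minus_commute)
  qed
  then have "\<bar>x (Inl v) - x (Inl b)\<bar> \<le> (m + 1) * sqrt (LL * KQ n x x)" if n: "n > 0" for n x
    using m[OF n, of x] \<open>\<And>n x. n > 0 \<Longrightarrow> \<bar>x (Inl a) - x (Inl b)\<bar> \<le> sqrt (LL * KQ n x x)\<close>[OF n, of x]
    unfolding distrib_right mult_1 by linarith
  then show ?case by blast
qed

text \<open>A Poincare-type bound on the oscillation over the whole core: pass from \<open>w\<close>
  to the start of an edge through vertices, then move along the edge. The constant is the same for
  all meshes.\<close>

lemma node_variation:
  assumes "w \<in> V"
  shows "\<exists>\<kappa>>0. \<forall>n>0. \<forall>x. \<forall>i\<in>I n. \<bar>x i - x (Inl w)\<bar> \<le> \<kappa> * sqrt (KQ n x x)"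
proof -
  have "\<forall>v\<in>V. \<exists>m::real. \<forall>n>0. \<forall>x. \<bar>x (Inl v) - x (Inl w)\<bar> \<le> m * sqrt (LL * KQ n x x)"
    using vertex_variation[OF connected[OF _ assms]] by blast
  then obtain m where m: "\<And>v n x. v \<in> V \<Longrightarrow> n > 0 \<Longrightarrow> \<bar>x (Inl v) - x (Inl w)\<bar> \<le> m v * sqrt (LL * KQ n x x)"
    unfolding bchoice_iff by blast
  define M where "M = (\<Sum>v\<in>V. \<bar>m v\<bar>)"
  have mM: "m v \<le> M" if "v \<in> V" for v
  proof -
    have "\<bar>m v\<bar> \<le> M" unfolding M_def by (rule member_le_sum) (use that finV in auto)
    then show ?thesis by simp
  qed
  have M0: "M \<ge> 0" by (simp add: M_def sum_nonneg)
  have vb: "\<bar>x (Inl v) - x (Inl w)\<bar> \<le> M * sqrt (LL * KQ n x x)" if "v \<in> V" "n > 0" for v n x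
    by (rule order_trans[OF m[OF that] mult_right_mono[OF mM[OF that(1)]]]) (use KQ_nonneg[of n x] LL_pos in simp)
  have bd: "\<bar>x i - x (Inl w)\<bar> \<le> ((M + 1) * sqrt LL) * sqrt (KQ n x x)" if n: "n > 0" and i: "i \<in> I n" for n x i
  proof -
    have q: "0 \<le> sqrt (LL * KQ n x x)" using KQ_nonneg[of n x] LL_pos by simp
    have "\<bar>x i - x (Inl w)\<bar> \<le> (M + 1) * sqrt (LL * KQ n x x)"
    proof (cases i)
      case (Inl v)
      then have "v \<in> V" using i by (auto simp: I_def)
      then show ?thesis using vb[OF _ n, of v x] q unfolding Inl distrib_right mult_1 by linarith
    next
      case (Inr ej)
      then obtain e j where ej: "e \<in> E" "1 \<le> j" "j < n" "i = nd n e j" using i by (auto simp: I_def nd_def)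
      have "\<bar>x (nd n e j) - x (nd n e 0)\<bar> \<le> sqrt (LL * KQ n x x)"
        by (rule edge_variation) (use ej n in auto)
      moreover have "\<bar>x (Inl (s e)) - x (Inl w)\<bar> \<le> M * sqrt (LL * KQ n x x)" by (rule vb[OF s_in[OF ej(1)] n])
      moreover have "nd n e 0 = Inl (s e)" by (simp add: nd_def)
      ultimately show ?thesis unfolding ej(4) distrib_right mult_1 by simp
    qed
    then show ?thesis unfolding real_sqrt_mult mult.assoc .
  qed
  show ?thesis
  proof (rule exI[of _ "(M + 1) * sqrt LL"], rule conjI)
    show "(M + 1) * sqrt LL > 0" using M0 LL_pos by (intro mult_pos_pos) auto
    show "\<forall>n>0. \<forall>x. \<forall>i\<in>I n. \<bar>x i - x (Inl w)\<bar> \<le> (M + 1) * sqrt LL * sqrt (KQ n x x)"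
      by (intro allI impI ballI) (rule bd)
  qed
qed

text \<open>The \<open>n + 1\<close> nodes of an edge have weight \<open>el e / n\<close> each, in
  total at most twice the length; hence the factor 2.\<close>

lemma BB_bound:
  assumes n: "n > 0" and r: "\<And>i. i \<in> I n \<Longrightarrow> \<bar>x i\<bar> \<le> r"
  shows "BB n x \<le> 2 * LL * (r powr p)"
proof -
  have "BB n x \<le> (\<Sum>e\<in>E. \<Sum>j\<le>n. h n e * (r powr p))"
    unfolding BB_def
  proof (intro sum_mono mult_left_mono)
    fix e j assume e: "e \<in> E" "j \<in> {..n}"
    have "\<bar>x (nd n e j)\<bar> \<le> r" by (rule r[OF nd_in[OF e(1)]])
    then have "(max 0 (x (nd n e j))) powr p \<le> r powr p" using p6 by (intro powr_mono2) auto
    moreover have "(max 0 (x (nd n e j))) powr p / p \<le> (max 0 (x (nd n e j))) powr p" 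
      using p6 divide_left_mono[of 1 p "(max 0 (x (nd n e j))) powr p"] by simp
    ultimately show "(max 0 (x (nd n e j))) powr p / p \<le> r powr p" by linarith
    show "0 \<le> h n e" using h_pos[OF n e(1)] by simp
  qed
  also have "\<dots> = (\<Sum>e\<in>E. el e * (real (n + 1) / n)) * r powr p"
    by (simp add: h_def sum_distrib_right mult.assoc) (simp add: algebra_simps)
  also have "\<dots> \<le> (\<Sum>e\<in>E. el e * 2) * r powr p"
    using n by (intro mult_right_mono sum_mono mult_left_mono) (auto simp: field_simps less_imp_le[OF el_pos])
  also have "\<dots> = 2 * LL * r powr p" by (simp add: LL_def sum_distrib_right mult.commute)
  finally show ?thesis .
qed

text \<open>Two cases on a small sphere of the sup norm. If the value at a vertex bearing a
  half-line is at least \<open>r / 2\<close> in modulus, the tail term is at least of order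
  \<open>r ^ 4\<close>; otherwise the function varies by \<open>r / 2\<close> and the kinetic term
  is at least of order \<open>r\<^sup>2\<close>. For small \<open>r\<close> both beat the power
  term, which is of order \<open>r powr p\<close>.\<close>

lemma energy_on_sphere_lower:
  shows "\<exists>r>0. \<exists>\<alpha>>0. \<forall>n>0. \<forall>\<epsilon>>0. \<forall>x\<in>DD n. (\<forall>i\<in>I n. \<bar>x i\<bar> \<le> r) \<longrightarrow> (\<exists>i\<in>I n. \<bar>x i\<bar> = r) \<longrightarrow> \<alpha> \<le> AA n \<epsilon> x - BB n x"
proof -
  obtain v0 where v0: "v0 \<in> V" "N v0 > 0" using N_pos by blast
  obtain \<kappa> where \<kappa>: "\<kappa> > 0" "\<And>n x i. n > 0 \<Longrightarrow> i \<in> I n \<Longrightarrow> \<bar>x i - x (Inl v0)\<bar> \<le> \<kappa> * sqrt (KQ n x x)"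
    using node_variation[OF v0(1)] by blast
  \<comment> \<open>One entry for each of the two cases; \<open>r <= 1\<close> weakens the quadratic
    bound of the second case to \<open>r ^ 4\<close>.\<close>
  define c0 where "c0 = min ((N v0)\<^sup>2 / (128 * \<mu>)) (1 / (8 * \<kappa>\<^sup>2))"
  have c0: "c0 > 0" using v0 \<kappa> \<mu>_pos by (simp add: c0_def)
  \<comment> \<open>Small enough that the power term, at most \<open>2 * LL * r powr p\<close>,
    takes away at most half of \<open>c0 * r ^ 4\<close>.\<close>
  define r where "r = min 1 ((c0 / (4 * LL)) powr (1 / (p - 4)))"
  have r: "0 < r" "r \<le> 1" using c0 LL_pos by (auto simp: r_def)
  have "r powr (p - 4) \<le> ((c0 / (4 * LL)) powr (1 / (p - 4))) powr (p - 4)"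
    using r p6 by (intro powr_mono2) (auto simp: r_def)
  then have rp: "r powr (p - 4) \<le> c0 / (4 * LL)" using p6 c0 LL_pos by (simp add: powr_powr)
  have "2 * LL * r powr p \<le> c0 / 2 * r ^ 4"
  proof -
    have "r powr p = r powr (p - 4) * r ^ 4"
      using r powr_add[of r "p - 4" 4] by (simp add: powr_numeral)
    also have "\<dots> \<le> c0 / (4 * LL) * r ^ 4" using rp r by (intro mult_right_mono) auto
    finally show ?thesis using LL_pos by (simp add: field_simps)
  qed
  note Bsmall = this
  have "c0 / 2 * r ^ 4 \<le> AA n \<epsilon> x - BB n x" if n: "n > 0" and \<epsilon>: "\<epsilon> > 0" and x: "x \<in> DD n" "\<And>i. i \<in> I n \<Longrightarrow> \<bar>x i\<bar> \<le> r"
    and i: "i \<in> I n" "\<bar>x i\<bar> = r" for n \<epsilon> x i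
  proof -
    have P: "\<mu> - MQ n x x > 0" "\<mu> - MQ n x x \<le> \<mu>" using x MQ_nonneg[of n x] by (auto simp: DD_def)
    have "c0 * r ^ 4 \<le> AA n \<epsilon> x"
    proof (cases "\<bar>x (Inl v0)\<bar> \<ge> r / 2")
      case True
      have "(r / 2)\<^sup>2 \<le> (x (Inl v0))\<^sup>2" using power_mono[OF True, of 2] r by simp
      then have "N v0 * (r\<^sup>2 / 4) \<le> N v0 * (x (Inl v0) * x (Inl v0))"
        using v0 by (intro mult_left_mono) (auto simp: power2_eq_square)
      also have "\<dots> \<le> SQ x x" unfolding SQ_def
        by (rule member_le_sum) (use v0 finV N_nonneg in auto)
      finally have "(N v0 * (r\<^sup>2 / 4))\<^sup>2 \<le> (SQ x x + \<epsilon>)\<^sup>2"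
        using v0 \<epsilon> by (intro power_mono) auto
      then have "(N v0 * (r\<^sup>2 / 4))\<^sup>2 / (8 * \<mu>) \<le> (SQ x x + \<epsilon>)\<^sup>2 / (8 * (\<mu> - MQ n x x))"
        using P by (intro frac_le) auto
      moreover have "c0 * r ^ 4 \<le> ((N v0)\<^sup>2 / (128 * \<mu>)) * r ^ 4"
        using r by (intro mult_right_mono) (auto simp: c0_def)
      moreover have "((N v0)\<^sup>2 / (128 * \<mu>)) * r ^ 4 = (N v0 * (r\<^sup>2 / 4))\<^sup>2 / (8 * \<mu>)"
        by (simp add: power_mult_distrib power_divide power_mult[symmetric])
      ultimately show ?thesis using KQ_nonneg[of n x] unfolding AA_def by linarith
    next
      case False
      have "r / 2 \<le> \<bar>x i - x (Inl v0)\<bar>" using False i by linarith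
      also have "\<dots> \<le> \<kappa> * sqrt (KQ n x x)" by (rule \<kappa>(2)[OF n i(1)])
      finally have "(r / 2)\<^sup>2 \<le> (\<kappa> * sqrt (KQ n x x))\<^sup>2" using r by (intro power_mono) auto
      then have "r\<^sup>2 / 4 \<le> \<kappa>\<^sup>2 * KQ n x x" using KQ_nonneg[of n x] by (simp add: power_mult_distrib power_divide)
      then have "1 / (8 * \<kappa>\<^sup>2) * r\<^sup>2 \<le> KQ n x x / 2" using \<kappa>(1) by (simp add: field_simps)
      moreover have "c0 * r ^ 4 \<le> 1 / (8 * \<kappa>\<^sup>2) * r ^ 4"
        using r by (intro mult_right_mono) (auto simp: c0_def)
      moreover have "1 / (8 * \<kappa>\<^sup>2) * r ^ 4 \<le> 1 / (8 * \<kappa>\<^sup>2) * r ^ 2"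
        using r power_decreasing[of 2 4 r] by (intro mult_left_mono) auto
      moreover have "0 \<le> (SQ x x + \<epsilon>)\<^sup>2 / (8 * (\<mu> - MQ n x x))" using P by simp
      ultimately show ?thesis unfolding AA_def by linarith
    qed
    moreover have "BB n x \<le> c0 / 2 * r ^ 4" using BB_bound[of n x r, OF n x(2)] Bsmall by linarith
    ultimately show ?thesis by simp
  qed
  note bd = this
  show ?thesis
  proof (rule exI[of _ r], rule conjI[OF r(1)], rule exI[of _ "c0 / 2 * r ^ 4"], rule conjI)
    show "c0 / 2 * r ^ 4 > 0" using c0 r by simp
    show "\<forall>n>0. \<forall>\<epsilon>>0. \<forall>x\<in>DD n. (\<forall>i\<in>I n. \<bar>x i\<bar> \<le> r) \<longrightarrow> (\<exists>i\<in>I n. \<bar>x i\<bar> = r) \<longrightarrow> c0 / 2 * r ^ 4 \<le> AA n \<epsilon> x - BB n x"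
    proof (intro allI impI ballI, elim bexE)
      fix n :: nat and \<epsilon> :: real and x i
      assume "0 < n" "0 < \<epsilon>" "x \<in> DD n" and le: "\<forall>i\<in>I n. \<bar>x i\<bar> \<le> r" and "i \<in> I n" "\<bar>x i\<bar> = r"
      then show "c0 / 2 * r ^ 4 \<le> AA n \<epsilon> x - BB n x" by (intro bd[of n \<epsilon> x i] bspec[OF le])
    qed
  qed
qed

text \<open>The maximum of the moduli over the finitely many nodes is continuous along the path, so
  the intermediate value theorem applies to it.\<close>

lemma path_crosses:
  assumes n: "n > 0" and c: "\<And>i. i \<in> I n \<Longrightarrow> continuous_on {0..1::real} (\<lambda>\<tau>. \<gamma> \<tau> i)"
    and 0: "\<And>i. i \<in> I n \<Longrightarrow> \<gamma> 0 i = 0" and 1: "i1 \<in> I n" "\<bar>\<gamma> 1 i1\<bar> \<ge> r" and r: "r > (0::real)"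
  shows "\<exists>\<tau>\<in>{0..1}. (\<forall>i\<in>I n. \<bar>\<gamma> \<tau> i\<bar> \<le> r) \<and> (\<exists>i\<in>I n. \<bar>\<gamma> \<tau> i\<bar> = r)"
proof -
  define m where "m = (\<lambda>\<tau>. Max ((\<lambda>i. \<bar>\<gamma> \<tau> i\<bar>) ` I n))"
  have ne: "I n \<noteq> {}" using 1 by auto
  have "continuous_on {0..1} m" unfolding m_def
    by (rule continuous_on_Max_image[OF finI ne]) (intro continuous_intros c)
  moreover have "m 0 \<le> r" using 0 r ne finI by (simp add: m_def)
  moreover have "r \<le> m 1"
    unfolding m_def by (rule order_trans[OF 1(2) Max_ge]) (use 1 finI in auto)
  ultimately have "\<exists>\<tau>\<ge>0. \<tau> \<le> 1 \<and> m \<tau> = r" by (intro IVT') auto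
  then obtain \<tau> where \<tau>: "0 \<le> \<tau>" "\<tau> \<le> 1" "m \<tau> = r" by blast
  have "r \<in> (\<lambda>i. \<bar>\<gamma> \<tau> i\<bar>) ` I n" 
    unfolding \<tau>(3)[symmetric] m_def by (rule Max_in) (use finI ne in auto)
  moreover have "\<bar>\<gamma> \<tau> i\<bar> \<le> r" if "i \<in> I n" for i
    unfolding \<tau>(3)[symmetric] m_def by (rule Max_ge) (use that finI in auto)
  ultimately show ?thesis using \<tau> by (intro bexI[of _ \<tau>]) auto
qed

end

text \<open>Applied with \<open>q = p / 2 - 1\<close> and \<open>x\<close> the inverse width of a
  tent: at fixed mass its kinetic energy grows like \<open>x\<^sup>2\<close> and its power term like
  \<open>x powr q\<close>, and \<open>q > 2\<close> means \<open>p > 6\<close>.\<close>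

lemma powr_dominates_square:
  fixes a b c q :: real
  assumes "a \<ge> 0" "b \<ge> 0" "c > 0" "q > 2"
  shows "\<exists>X\<ge>1. \<forall>x\<ge>X. a * x\<^sup>2 + b \<le> c * x powr q"
proof -
  define X where "X = max 1 (((a + b) / c) powr (1 / (q - 2)))"
  have "a * x\<^sup>2 + b \<le> c * x powr q" if x: "x \<ge> X" for x
  proof -
    have x1: "x \<ge> 1" using x by (simp add: X_def)
    have "(a + b) / c \<le> x powr (q - 2)"
    proof (cases "a + b = 0")
      case False
      then have pos: "(a + b) / c > 0" using assms by auto
      have "(a + b) / c = (((a + b) / c) powr (1 / (q - 2))) powr (q - 2)"
        using assms pos by (simp add: powr_powr)
      also have "\<dots> \<le> x powr (q - 2)" using x assms by (intro powr_mono2) (auto simp: X_def)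
      finally show ?thesis .
    qed simp
    then have "a + b \<le> c * x powr (q - 2)" using assms by (simp add: field_simps)
    from mult_right_mono[OF this, of "x\<^sup>2"]
    have "(a + b) * x\<^sup>2 \<le> c * (x powr (q - 2) * x\<^sup>2)" by (simp add: mult.assoc)
    also have "x powr (q - 2) * x\<^sup>2 = x powr q"
      using x1 powr_add[of x "q - 2" 2] by (simp add: powr_numeral)
    finally have "(a + b) * x\<^sup>2 \<le> c * x powr q" .
    moreover have "b * 1 \<le> b * x\<^sup>2" using x1 assms by (intro mult_left_mono) auto
    ultimately show ?thesis by (simp add: distrib_right)
  qed
  then show ?thesis by (intro exI[of _ X]) (auto simp: X_def)
qed

context core_graph
begin

text \<open>
  A tent vanishing at all vertices, of fixed height and width on a mesh with \<open>2 m k\<close> cells; as \<open>m\<close> and \<open>T\<close> are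
  independent of \<open>k\<close>, it serves as end point of the paths for all these meshes.
\<close>

lemma tent_function:
  fixes m k :: nat
  assumes e0: "e0 \<in> E" and m: "m \<ge> 4" and k: "k > 0" and T: "T > 0"
  defines "n \<equiv> 2 * m * k :: nat" and "w \<equiv> el e0 / real m"
  shows "\<exists>z. (\<forall>v. z (Inl v) = 0) \<and> KQ n z z \<le> 2 * T\<^sup>2 / w \<and> MQ n z z \<le> 5 / 2 * w * T\<^sup>2 \<and>
      w * (T / 2) powr p / p \<le> BB n z \<and> (\<exists>i\<in>I n. z i = T)"
proof -
  \<comment> \<open>Peak at node \<open>4 * k\<close>, half-width \<open>2 * k\<close> nodes, that
    is \<open>w\<close> in length. Since \<open>8 * k <= n\<close>, the support stays inside the
    edge and the tent vanishes at both ends.\<close>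
  define \<phi> where "\<phi> = (\<lambda>j::nat. T * max 0 (1 - \<bar>real j - 4 * real k\<bar> / (2 * real k)))"
  define z :: "'v + 'e \<times> nat \<Rightarrow> real" where "z = (\<lambda>i. case i of Inl v \<Rightarrow> 0 | Inr (e, j) \<Rightarrow> if e = e0 then \<phi> j else 0)"
  define g where "g = h n e0"
  have n0: "n > 0" using m k by (simp add: n_def)
  have n8: "8 * k \<le> n" using m by (simp add: n_def)
  have g0: "g > 0" using h_pos[OF n0 e0] by (simp add: g_def)
  have gw: "2 * real k * g = w" using m k by (simp add: g_def h_def n_def w_def)
  have w0: "w > 0" using el_pos[OF e0] m by (simp add: w_def)
  have \<phi>0: "\<phi> j = 0" if "j \<le> 2 * k \<or> j \<ge> 6 * k" for j
  proof -
    have "2 * real k \<le> \<bar>real j - 4 * real k\<bar>" using that by linarith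
    then show ?thesis using k by (simp add: \<phi>_def field_simps)
  qed
  have \<phi>T: "0 \<le> \<phi> j" "\<phi> j \<le> T" for j
    using T k by (auto simp: \<phi>_def intro!: mult_left_le)
  have z: "z (nd n e j) = (if e = e0 then \<phi> j else 0)" if "j \<le> n" for e j
    using \<phi>0[of 0] \<phi>0[of n] n8 k that by (auto simp: z_def nd_def)
  have K: "KQ n z z \<le> 2 * T\<^sup>2 / w"
  proof -
    have d: "1 / g * ((\<phi> (Suc j) - \<phi> j) * (\<phi> (Suc j) - \<phi> j)) \<le> (if j \<in> {2*k..<6*k} then 1 / g * (T / (2 * k))\<^sup>2 else 0)" for j
    proof (cases "j \<in> {2*k..<6*k}")
      case True
      have "\<bar>max 0 (1 - \<bar>real (Suc j) - 4 * real k\<bar> / (2 * real k)) - max 0 (1 - \<bar>real j - 4 * real k\<bar> / (2 * real k))\<bar>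
         \<le> \<bar>(1 - \<bar>real (Suc j) - 4 * real k\<bar> / (2 * real k)) - (1 - \<bar>real j - 4 * real k\<bar> / (2 * real k))\<bar>"
        by linarith
      also have "\<dots> = \<bar>\<bar>real j - 4 * real k\<bar> - \<bar>real (Suc j) - 4 * real k\<bar>\<bar> / (2 * real k)"
        using k by (simp add: diff_divide_distrib[symmetric])
      also have "\<dots> \<le> 1 / (2 * real k)" by (intro divide_right_mono) auto
      finally have "\<bar>\<phi> (Suc j) - \<phi> j\<bar> \<le> T * (1 / (2 * real k))"
        unfolding \<phi>_def right_diff_distrib[symmetric] abs_mult using T by (intro mult_mono) auto
      then have "(\<phi> (Suc j) - \<phi> j)\<^sup>2 \<le> (T / (2 * k))\<^sup>2"
        using power_mono[of "\<bar>\<phi> (Suc j) - \<phi> j\<bar>" "T / (2 * k)" 2] by simp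
      from mult_left_mono[OF this, of "1 / g"] show ?thesis using True g0 by (simp add: power2_eq_square)
    next
      case False
      then have "\<phi> (Suc j) = 0" "\<phi> j = 0" by (auto intro!: \<phi>0)
      then show ?thesis using False by auto
    qed
    have "KQ n z z = (\<Sum>e\<in>E. if e = e0 then \<Sum>j<n. 1 / g * ((\<phi> (Suc j) - \<phi> j) * (\<phi> (Suc j) - \<phi> j)) else 0)"
      unfolding KQ_def by (rule sum.cong) (auto simp: z g_def)
    also have "\<dots> = (\<Sum>j<n. 1 / g * ((\<phi> (Suc j) - \<phi> j) * (\<phi> (Suc j) - \<phi> j)))"
      using e0 finE by (simp add: sum.delta)
    also have "\<dots> \<le> (\<Sum>j<n. (if j \<in> {2*k..<6*k} then 1 / g * (T / (2 * k))\<^sup>2 else 0))"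
      by (rule sum_mono) (rule d)
    also have "\<dots> = (\<Sum>j\<in>{..<n} \<inter> {2*k..<6*k}. 1 / g * (T / (2 * k))\<^sup>2)"
      by (rule sum.inter_restrict[symmetric]) simp
    also have "{..<n} \<inter> {2*k..<6*k} = {2*k..<6*k}" using n8 by auto
    also have "(\<Sum>j\<in>{2*k..<6*k}. 1 / g * (T / (2 * k))\<^sup>2) = 4 * real k * (1 / g * (T / (2 * k))\<^sup>2)" by simp
    also have "\<dots> = 2 * T\<^sup>2 / w" using k g0 by (simp add: gw[symmetric] field_simps power2_eq_square)
    finally show ?thesis .
  qed
  have M: "MQ n z z \<le> 5 / 2 * w * T\<^sup>2"
  proof -
    have d: "g * (\<phi> j * \<phi> j) \<le> (if j \<in> {2*k..6*k} then g * T\<^sup>2 else 0)" for j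
    proof (cases "j \<in> {2*k..6*k}")
      case True
      then show ?thesis using \<phi>T[of j] g0 T by (auto simp: power2_eq_square intro!: mult_mono)
    next
      case False
      then have "\<phi> j = 0" by (intro \<phi>0) auto
      then show ?thesis using False by auto
    qed
    have "MQ n z z = (\<Sum>e\<in>E. if e = e0 then \<Sum>j\<le>n. g * (\<phi> j * \<phi> j) else 0)"
      unfolding MQ_def by (rule sum.cong) (auto simp: z g_def)
    also have "\<dots> = (\<Sum>j\<le>n. g * (\<phi> j * \<phi> j))"
      using e0 finE by (simp add: sum.delta)
    also have "\<dots> \<le> (\<Sum>j\<le>n. (if j \<in> {2*k..6*k} then g * T\<^sup>2 else 0))"
      by (rule sum_mono) (rule d)
    also have "\<dots> = (\<Sum>j\<in>{..n} \<inter> {2*k..6*k}. g * T\<^sup>2)"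
      by (rule sum.inter_restrict[symmetric]) simp
    also have "{..n} \<inter> {2*k..6*k} = {2*k..6*k}" using n8 by auto
    also have "(\<Sum>j\<in>{2*k..6*k}. g * T\<^sup>2) = real (4 * k + 1) * (g * T\<^sup>2)" by simp
    \<comment> \<open>The closed range has \<open>4 * k + 1\<close> nodes; replacing this by
      \<open>5 * k\<close> is the origin of the constant \<open>5 / 2\<close>.\<close>
    also have "\<dots> \<le> (5 * real k) * (g * T\<^sup>2)" using k g0 by (intro mult_right_mono) auto
    also have "\<dots> = 5 / 2 * w * T\<^sup>2" by (simp add: gw[symmetric])
    finally show ?thesis .
  qed
  have B: "w * (T / 2) powr p / p \<le> BB n z"
  proof -
    \<comment> \<open>On the middle half of the support, which has length \<open>w\<close>, the tent
      is at least \<open>T / 2\<close>.\<close>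
    have d: "g * ((T / 2) powr p / p) \<le> g * ((max 0 (\<phi> j)) powr p / p)" if "j \<in> {3*k..<5*k}" for j
    proof -
      have "\<bar>real j - 4 * real k\<bar> \<le> real k" using that by auto
      then have "\<bar>real j - 4 * real k\<bar> / (2 * real k) \<le> 1 / 2" using k by (simp add: field_simps)
      then have "T * (1/2) \<le> \<phi> j" unfolding \<phi>_def using T by (intro mult_left_mono) auto
      then show ?thesis using T g0 p6 by (intro mult_left_mono divide_right_mono powr_mono2) auto
    qed
    have "w * (T / 2) powr p / p = (\<Sum>j\<in>{3*k..<5*k}. g * ((T / 2) powr p / p))" by (simp add: gw[symmetric])
    also have "\<dots> \<le> (\<Sum>j\<in>{3*k..<5*k}. g * ((max 0 (\<phi> j)) powr p / p))" by (rule sum_mono) (rule d)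
    also have "\<dots> \<le> (\<Sum>j\<le>n. g * ((max 0 (\<phi> j)) powr p / p))"
      using n8 g0 p6 by (intro sum_mono2) auto
    also have "\<dots> = (\<Sum>e\<in>E. if e = e0 then \<Sum>j\<le>n. g * ((max 0 (\<phi> j)) powr p / p) else 0)"
      using e0 finE by (simp add: sum.delta)
    also have "\<dots> = BB n z"
      unfolding BB_def using p6 by (intro sum.cong) (auto simp: z g_def)
    finally show ?thesis .
  qed
  have "z (nd n e0 (4 * k)) = T" using z[of "4*k" e0] n8 T by (simp add: \<phi>_def)
  then have "\<exists>i\<in>I n. z i = T" using nd_in[OF e0] by blast
  moreover have "\<forall>v. z (Inl v) = 0" by (simp add: z_def)
  ultimately show ?thesis using K M B by blast
qed

lemma Q_scale:
  "KQ n (\<lambda>i. \<tau> * z i) (\<lambda>i. \<tau> * z i) = \<tau>\<^sup>2 * KQ n z z"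
  "MQ n (\<lambda>i. \<tau> * z i) (\<lambda>i. \<tau> * z i) = \<tau>\<^sup>2 * MQ n z z"
  unfolding KQ_def MQ_def sum_distrib_left
  by (intro sum.cong refl; simp add: power2_eq_square algebra_simps)+

text \<open>The order of quantifiers is the point: \<open>\<alpha>\<close>, \<open>C\<close>,
  \<open>m\<close> (hence the tent) and \<open>\<epsilon>0\<close> are fixed before the refinement
  \<open>k\<close>, and only the bound on \<open>BB\<close> depends on \<open>\<delta>\<close>. The
  path scales the tent from 0 to full height; since the tent vanishes at the vertices,
  \<open>SQ\<close> is 0 along it and the tail term is due to \<open>\<epsilon>\<close>
  alone.\<close>

theorem discrete_critical:
  shows "\<exists>\<alpha>>0. \<exists>C. \<exists>m>0. \<exists>\<epsilon>0>0. \<forall>\<delta> k \<epsilon>. 0 < \<delta> \<longrightarrow> \<delta> \<le> 1/2 \<longrightarrow> k > 0 \<longrightarrow> 0 < \<epsilon> \<longrightarrow> \<epsilon> < \<epsilon>0 \<longrightarrow>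
    (\<exists>\<rho>\<in>{1-\<delta>..1}. \<exists>x\<in>DD (2*m*k). (\<forall>y. dA (2*m*k) \<epsilon> x y = \<rho> * dB (2*m*k) x y) \<and>
       \<alpha> \<le> AA (2*m*k) \<epsilon> x - \<rho> * BB (2*m*k) x \<and> AA (2*m*k) \<epsilon> x - \<rho> * BB (2*m*k) x \<le> C \<and>
       BB (2*m*k) x \<le> (C - \<alpha>) / \<delta> + 2)"
proof -
  obtain r \<alpha> where r: "r > 0" and \<alpha>: "\<alpha> > 0" and mtn: "\<And>n \<epsilon> x. n > 0 \<Longrightarrow> \<epsilon> > 0 \<Longrightarrow> x \<in> DD n \<Longrightarrow>
     \<forall>i\<in>I n. \<bar>x i\<bar> \<le> r \<Longrightarrow> \<exists>i\<in>I n. \<bar>x i\<bar> = r \<Longrightarrow> \<alpha> \<le> AA n \<epsilon> x - BB n x"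
    using energy_on_sphere_lower by metis
  obtain e0 where e0: "e0 \<in> E" using E_ne by blast
  obtain X where X: "X \<ge> 1" "\<And>x. x \<ge> X \<Longrightarrow> \<mu> / 5 * x\<^sup>2 + 1 / (4 * \<mu>) \<le> (1 / (2 * p) * (\<mu> / 20) powr (p / 2)) * x powr (p / 2 - 1)"
    using powr_dominates_square[of "\<mu> / 5" "1 / (4 * \<mu>)" "1 / (2 * p) * (\<mu> / 20) powr (p / 2)" "p / 2 - 1"] \<mu>_pos p6 by auto
  \<comment> \<open>A narrow tent: \<open>1 / w >= X\<close> for the energy estimate, and
    \<open>1 / w >= 5 * r\<^sup>2 / \<mu>\<close> so that its height \<open>T\<close> reaches the
    sphere of radius \<open>r\<close>; the 4 is what \<open>tent_function\<close> asks for.\<close>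
  obtain m :: nat where m: "real m \<ge> max 4 (max (X * el e0) (5 * r\<^sup>2 / \<mu> * el e0))"
    using real_arch_simple by blast
  define w where "w = el e0 / m"
  have m4: "m \<ge> 4" using m by simp
  have el0: "el e0 > 0" by (rule el_pos[OF e0])
  have w0: "w > 0" using el0 m4 by (simp add: w_def)
  have wX: "1 / w \<ge> X" using m el0 m4 by (simp add: w_def field_simps)
  have wr: "1 / w \<ge> 5 * r\<^sup>2 / \<mu>" using m el0 m4 by (simp add: w_def field_simps)
  \<comment> \<open>Makes the mass bound \<open>5 / 2 * w * T\<^sup>2\<close> equal to
    \<open>\<mu> / 2\<close>, so that the whole path stays in \<open>DD n\<close>.\<close>
  define T where "T = sqrt (\<mu> / (5 * w))"
  have T0: "T > 0" using w0 \<mu>_pos by (simp add: T_def)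
  have T2: "T\<^sup>2 = \<mu> / (5 * w)" using w0 \<mu>_pos by (simp add: T_def)
  have Tr: "r \<le> T" unfolding T_def
    by (rule real_le_rsqrt) (use wr w0 \<mu>_pos in \<open>simp add: field_simps\<close>)
  \<comment> \<open>Half the kinetic form of the full tent is at most \<open>T\<^sup>2 / w\<close>,
    which is the first summand; the tail term is at most
    \<open>1 / (8 * (\<mu> / 2))\<close>.\<close>
  define C where "C = \<mu> / 5 * (1 / w)\<^sup>2 + 1 / (4 * \<mu>)"
  \<comment> \<open>The factor 1/2 is the least value of \<open>1 - \<delta>\<close>, so the far end
    of the path lies below \<open>\<alpha>\<close> for every admissible
    \<open>\<delta>\<close>.\<close>
  have Bbig: "C \<le> 1 / 2 * (w * (T / 2) powr p / p)"
  proof -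
    have "(T / 2) powr p = ((T / 2)\<^sup>2) powr (p / 2)"
      using T0 powr_powr[of "T / 2" 2 "p / 2"] by (simp add: powr_numeral)
    also have "(T / 2)\<^sup>2 = \<mu> / 20 * (1 / w)" by (simp add: power_divide T2)
    also have "\<dots> powr (p / 2) = (\<mu> / 20) powr (p / 2) * (1 / w) powr (p / 2)"
      using \<mu>_pos w0 by (intro powr_mult)
    also have "(1 / w) powr (p / 2) = (1 / w) powr (p / 2 - 1) * (1 / w)"
      using w0 powr_add[of "1 / w" "p / 2 - 1" 1] by simp
    finally have "1 / 2 * (w * (T / 2) powr p / p) = (1 / (2 * p) * (\<mu> / 20) powr (p / 2)) * (1 / w) powr (p / 2 - 1)"
      using w0 p6 by (simp add: field_simps)
    then show ?thesis using X(2)[OF wX] unfolding C_def by linarith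
  qed
  \<comment> \<open>At the zero function \<open>AA\<close> equals
    \<open>\<epsilon>\<^sup>2 / (8 * \<mu>)\<close>; this choice keeps that value below
    \<open>\<alpha>\<close>.\<close>
  define \<epsilon>0 where "\<epsilon>0 = min 1 (sqrt (8 * \<mu> * \<alpha>))"
  have \<epsilon>0: "\<epsilon>0 > 0" using \<mu>_pos \<alpha> by (simp add: \<epsilon>0_def)
  have main: "\<exists>\<rho>\<in>{1-\<delta>..1}. \<exists>x\<in>DD (2*m*k). (\<forall>y. dA (2*m*k) \<epsilon> x y = \<rho> * dB (2*m*k) x y) \<and>
       \<alpha> \<le> AA (2*m*k) \<epsilon> x - \<rho> * BB (2*m*k) x \<and> AA (2*m*k) \<epsilon> x - \<rho> * BB (2*m*k) x \<le> C \<and>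
       BB (2*m*k) x \<le> (C - \<alpha>) / \<delta> + 2"
    if \<delta>: "0 < \<delta>" "\<delta> \<le> 1/2" and k: "k > 0" and \<epsilon>: "0 < \<epsilon>" "\<epsilon> < \<epsilon>0" for \<delta> \<epsilon> :: real and k :: nat
  proof -
    define n where "n = 2 * m * k"
    have n0: "n > 0" using m4 k by (simp add: n_def)
    obtain z where z: "\<And>v. z (Inl v) = 0" "KQ n z z \<le> 2 * T\<^sup>2 / w" "MQ n z z \<le> 5 / 2 * w * T\<^sup>2"
      "w * (T / 2) powr p / p \<le> BB n z" "\<exists>i\<in>I n. z i = T"
      using tent_function[OF e0 m4 k T0] unfolding w_def n_def by blast
    have K: "KQ n z z / 2 \<le> \<mu> / 5 * (1 / w)\<^sup>2"
      using z(2) w0 unfolding T2 by (simp add: field_simps power2_eq_square)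
    have M: "MQ n z z \<le> \<mu> / 2" using z(3) w0 unfolding T2 by simp
    have e1: "\<epsilon>\<^sup>2 \<le> 1" using \<epsilon> by (auto simp: \<epsilon>0_def power_le_one)
    have e2: "\<epsilon>\<^sup>2 < 8 * \<mu> * \<alpha>"
    proof -
      have "\<epsilon> < sqrt (8 * \<mu> * \<alpha>)" using \<epsilon> by (simp add: \<epsilon>0_def)
      from power_strict_mono[OF this, of 2] \<epsilon> show ?thesis using \<mu>_pos \<alpha> by simp
    qed
    define \<gamma>0 where "\<gamma>0 = (\<lambda>\<tau> i. \<tau> * z i)"
    have t: "\<tau>\<^sup>2 \<le> 1" if "\<tau> \<in> {0..1}" for \<tau> :: real using that by (simp add: power_le_one)
    have Mt: "MQ n (\<gamma>0 \<tau>) (\<gamma>0 \<tau>) \<le> \<mu> / 2" if "\<tau> \<in> {0..1}" for \<tau>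
      using mult_mono[OF t[OF that] M] MQ_nonneg[of n z] by (simp add: \<gamma>0_def Q_scale)
    have AAt: "AA n \<epsilon> (\<gamma>0 \<tau>) \<le> C" if "\<tau> \<in> {0..1}" for \<tau>
    proof -
      have "SQ (\<gamma>0 \<tau>) (\<gamma>0 \<tau>) = 0" unfolding SQ_def \<gamma>0_def by (simp add: z(1))
      moreover have "\<epsilon>\<^sup>2 / (8 * (\<mu> - MQ n (\<gamma>0 \<tau>) (\<gamma>0 \<tau>))) \<le> 1 / (8 * (\<mu> / 2))"
        using e1 Mt[OF that] \<mu>_pos by (intro frac_le) auto
      moreover have "KQ n (\<gamma>0 \<tau>) (\<gamma>0 \<tau>) / 2 \<le> KQ n z z / 2"
        using mult_right_mono[OF t[OF that] KQ_nonneg[of n z]] by (simp add: \<gamma>0_def Q_scale)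
      ultimately show ?thesis using K by (simp add: AA_def C_def)
    qed
    have A0: "AA n \<epsilon> (\<gamma>0 0) < \<alpha>"
      using e2 \<mu>_pos by (simp add: AA_def \<gamma>0_def KQ_def MQ_def SQ_def field_simps)
    have "\<exists>\<rho>\<in>{1-\<delta>..1}. \<exists>x\<in>DD n. (\<forall>y. dA n \<epsilon> x y = \<rho> * dB n x y) \<and> \<alpha> \<le> AA n \<epsilon> x - \<rho> * BB n x \<and>
     AA n \<epsilon> x - \<rho> * BB n x \<le> C \<and> BB n x \<le> (C - \<alpha>) / (1 - (1 - \<delta>)) + 2"
    proof (rule mountain_pass_discrete[OF n0 \<epsilon>(1)])
      show "0 \<le> 1 - \<delta>" "1 - \<delta> < 1" using \<delta> by auto
      show "\<gamma>0 \<tau> \<in> DD n" if "\<tau> \<in> {0..1}" for \<tau> using Mt[OF that] \<mu>_pos by (simp add: DD_def)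
      show "continuous_on {0..1} (\<lambda>\<tau>. \<gamma>0 \<tau> i)" for i unfolding \<gamma>0_def by (intro continuous_intros)
      show "\<gamma>0 0 = \<gamma>0 0" "\<gamma>0 1 = \<gamma>0 1" by auto
      show "AA n \<epsilon> (\<gamma>0 \<tau>) \<le> C" if "\<tau> \<in> {0..1}" for \<tau> by (rule AAt[OF that])
      show "AA n \<epsilon> (\<gamma>0 0) - (1 - \<delta>) * BB n (\<gamma>0 0) < \<alpha>"
        using A0 mult_nonneg_nonneg[OF _ BB_nonneg[of n "\<gamma>0 0"], of "1 - \<delta>"] \<delta> by linarith
      have z1: "\<gamma>0 1 = z" by (simp add: \<gamma>0_def)
      have a1: "AA n \<epsilon> z \<le> C" using AAt[of 1] z1 by simp
      have "1 / 2 * BB n z \<le> (1 - \<delta>) * BB n z" using \<delta> BB_nonneg[of n z] by (intro mult_right_mono) auto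
      then have "C \<le> (1 - \<delta>) * BB n z"
        using order_trans[OF Bbig mult_left_mono[OF z(4), of "1 / 2"]] by simp
      then show "AA n \<epsilon> (\<gamma>0 1) - (1 - \<delta>) * BB n (\<gamma>0 1) < \<alpha>"
        using a1 \<alpha> unfolding z1 by linarith
      fix \<gamma> :: "real \<Rightarrow> 'v + 'e \<times> nat \<Rightarrow> real"
      assume \<gamma>: "\<And>\<tau>. \<tau> \<in> {0..1} \<Longrightarrow> \<gamma> \<tau> \<in> DD n" "\<And>i. i \<in> I n \<Longrightarrow> continuous_on {0..1} (\<lambda>\<tau>. \<gamma> \<tau> i)"
        "\<gamma> 0 = \<gamma>0 0" "\<gamma> 1 = \<gamma>0 1"
      obtain i1 where i1: "i1 \<in> I n" "z i1 = T" using z(5) by blast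
      have "\<exists>\<tau>\<in>{0..1}. (\<forall>i\<in>I n. \<bar>\<gamma> \<tau> i\<bar> \<le> r) \<and> (\<exists>i\<in>I n. \<bar>\<gamma> \<tau> i\<bar> = r)"
        by (rule path_crosses[OF n0 \<gamma>(2) _ i1(1) _ r]) (use \<gamma>(3,4) i1(2) Tr in \<open>auto simp: \<gamma>0_def\<close>)
      then obtain \<tau> where \<tau>: "\<tau> \<in> {0..1}" "\<forall>i\<in>I n. \<bar>\<gamma> \<tau> i\<bar> \<le> r" "\<exists>i\<in>I n. \<bar>\<gamma> \<tau> i\<bar> = r" by blast
      show "\<exists>\<tau>\<in>{0..1}. \<alpha> \<le> AA n \<epsilon> (\<gamma> \<tau>) - BB n (\<gamma> \<tau>)"
        by (rule bexI[OF _ \<tau>(1)]) (rule mtn[OF n0 \<epsilon>(1) \<gamma>(1)[OF \<tau>(1)] \<tau>(2,3)])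
    qed
    then show ?thesis by (simp add: n_def)
  qed
  have "m > 0" using m4 by simp
  show ?thesis
    by (rule exI[of _ \<alpha>], rule conjI[OF \<alpha>], rule exI[of _ C], rule exI[of _ m], rule conjI[OF \<open>m > 0\<close>],
        rule exI[of _ \<epsilon>0], rule conjI[OF \<epsilon>0]) (intro allI impI, rule main)
qed

end

section \<open>Approximate solutions and their limits\<close>

lemma family_convergent_subseq:
  fixes W :: "nat \<Rightarrow> 'e \<Rightarrow> real \<Rightarrow> real"
  assumes "finite F"
    and "\<And>k e x. e \<in> F \<Longrightarrow> x \<in> {0..L e} \<Longrightarrow> \<bar>W k e x\<bar> \<le> B"
    and "\<And>k e x y. e \<in> F \<Longrightarrow> x \<in> {0..L e} \<Longrightarrow> y \<in> {0..L e} \<Longrightarrow> \<bar>W k e x - W k e y\<bar> \<le> \<Lambda> * \<bar>x - y\<bar>"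
  shows "\<exists>r w. strict_mono r \<and> (\<forall>e\<in>F. continuous_on {0..L e} (w e) \<and> (\<forall>x\<in>{0..L e}. (\<lambda>k. W (r k) e x) \<longlonglongrightarrow> w e x))"
  using assms
proof (induction F)
  case empty
  have "strict_mono (id :: nat \<Rightarrow> nat)" by (simp add: strict_mono_def)
  then show ?case by blast
next
  case (insert e F)
  obtain r w where r: "strict_mono r"
    and w: "\<And>e. e \<in> F \<Longrightarrow> continuous_on {0..L e} (w e) \<and> (\<forall>x\<in>{0..L e}. (\<lambda>k. W (r k) e x) \<longlonglongrightarrow> w e x)"
    using insert.IH insert.prems by (metis insertCI)
  have B: "norm (W (r n) e x) \<le> B" if "x \<in> {0..L e}" for n x using insert.prems(1) that by auto
  have eq: "\<exists>d>0. \<forall>n y. y \<in> {0..L e} \<and> norm (x - y) < d \<longrightarrow> norm (W (r n) e x - W (r n) e y) < \<epsilon>"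
    if x: "x \<in> {0..L e}" "0 < \<epsilon>" for x \<epsilon>
  proof (intro exI[of _ "\<epsilon> / (\<bar>\<Lambda>\<bar> + 1)"] conjI allI impI)
    show "0 < \<epsilon> / (\<bar>\<Lambda>\<bar> + 1)" using x by simp
    fix n y assume y: "y \<in> {0..L e} \<and> norm (x - y) < \<epsilon> / (\<bar>\<Lambda>\<bar> + 1)"
    have "\<bar>W (r n) e x - W (r n) e y\<bar> \<le> \<Lambda> * \<bar>x - y\<bar>" using insert.prems(2) x y by auto
    also have "\<dots> \<le> (\<bar>\<Lambda>\<bar> + 1) * \<bar>x - y\<bar>" by (intro mult_right_mono) auto
    also have "\<dots> < \<epsilon>" using y by (simp add: field_simps)
    finally show "norm (W (r n) e x - W (r n) e y) < \<epsilon>" by simp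
  qed
  obtain g and q :: "nat \<Rightarrow> nat" where g: "continuous_on {0..L e} g" "strict_mono q"
    and conv: "\<And>\<epsilon>. 0 < \<epsilon> \<Longrightarrow> \<exists>N. \<forall>n x. n \<ge> N \<and> x \<in> {0..L e} \<longrightarrow> norm (W (r (q n)) e x - g x) < \<epsilon>"
    by (rule Arzela_Ascoli[of "{0..L e}" "\<lambda>n x. W (r n) e x" B, OF compact_Icc B eq]) (assumption | rule that)+
  have pt: "(\<lambda>k. W (r (q k)) e x) \<longlonglongrightarrow> g x" if "x \<in> {0..L e}" for x
    using conv that by (fastforce simp: LIMSEQ_iff)
  have old: "(\<lambda>k. W (r (q k)) f x) \<longlonglongrightarrow> w f x" if "f \<in> F" "x \<in> {0..L f}" for f x
    using LIMSEQ_subseq_LIMSEQ[OF _ g(2), of "\<lambda>k. W (r k) f x"] w[OF that(1)] that(2) by (auto simp: o_def)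
  show ?case
  proof (rule exI[of _ "r \<circ> q"], rule exI[of _ "w(e := g)"], intro conjI ballI)
    show "strict_mono (r \<circ> q)" by (rule strict_mono_o[OF r g(2)])
    fix f assume f: "f \<in> insert e F"
    show "continuous_on {0..L f} ((w(e := g)) f)" using f w g(1) by (cases "f = e") auto
    fix x assume x: "x \<in> {0..L f}"
    show "(\<lambda>k. W ((r \<circ> q) k) f x) \<longlonglongrightarrow> (w(e := g)) f x"
    proof (cases "f = e")
      case True
      then show ?thesis using pt[of x] x by simp
    next
      case False
      then have "f \<in> F" using f by simp
      then show ?thesis using old[of f x] x False by simp
    qed
  qed
qed

lemma bounded_convergence_interval:
  fixes f :: "nat \<Rightarrow> real \<Rightarrow> real"
  assumes "\<And>k. continuous_on {a..b} (f k)" "\<And>k x. x \<in> {a..b} \<Longrightarrow> \<bar>f k x\<bar> \<le> B"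
    "\<And>x. x \<in> {a..b} \<Longrightarrow> (\<lambda>k. f k x) \<longlonglongrightarrow> g x"
  shows "(\<lambda>k. integral {a..b} (f k)) \<longlonglongrightarrow> integral {a..b} g"
  by (rule dominated_convergence(2)[where h = "\<lambda>_. B"])
     (use assms in \<open>auto intro!: integrable_continuous_interval\<close>)

context core_graph
begin

definition gg :: "real \<Rightarrow> real \<Rightarrow> real \<Rightarrow> real" where "gg a \<rho> u = a\<^sup>2 * u - \<rho> * u powr (p - 1)"
definition Gi :: "real \<Rightarrow> real \<Rightarrow> ('e \<Rightarrow> real \<Rightarrow> real) \<Rightarrow> 'e \<Rightarrow> real \<Rightarrow> real" where
  "Gi a \<rho> u e x = integral {0..x} (\<lambda>y. gg a \<rho> (u e y))"
definition Mass :: "('e \<Rightarrow> real \<Rightarrow> real) \<Rightarrow> real" where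
  "Mass u = (\<Sum>e\<in>E. integral {0..el e} (\<lambda>x. (u e x)\<^sup>2))"
definition Pow :: "('e \<Rightarrow> real \<Rightarrow> real) \<Rightarrow> real" where
  "Pow u = (\<Sum>e\<in>E. integral {0..el e} (\<lambda>x. (u e x) powr p))"
definition Sc :: "('v \<Rightarrow> real) \<Rightarrow> real" where "Sc c = (\<Sum>v\<in>V. N v * (c v)\<^sup>2)"
text \<open>The energy of core and tails after the kinetic part has been eliminated by testing the
  equation with \<open>u\<close>. No derivative of \<open>u\<close> occurs, so pointwise convergence
  of bounded functions suffices to pass to the limit.\<close>

definition En :: "real \<Rightarrow> real \<Rightarrow> ('e \<Rightarrow> real \<Rightarrow> real) \<Rightarrow> ('v \<Rightarrow> real) \<Rightarrow> real" where
  "En a \<rho> u c = (1/2 - 1/p) * (\<rho> * Pow u) - a * Sc c / 4 - a\<^sup>2 * Mass u / 2"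

text \<open>
  The equation with defect \<open>\<eta>\<close>, integrated twice on every edge; \<open>d e\<close> is the slope at the start of \<open>e\<close>.
  For \<open>\<eta> = 0\<close> this is an exact solution.
\<close>

definition approx :: "real \<Rightarrow> real \<Rightarrow> real \<Rightarrow> ('e \<Rightarrow> real \<Rightarrow> real) \<Rightarrow> ('v \<Rightarrow> real) \<Rightarrow> ('e \<Rightarrow> real) \<Rightarrow> bool" where
  "approx \<eta> a \<rho> u c d \<longleftrightarrow>
    (\<forall>e\<in>E. continuous_on {0..el e} (u e) \<and> (\<forall>x\<in>{0..el e}. 0 \<le> u e x) \<and> u e 0 = c (s e) \<and> u e (el e) = c (t e) \<and>
      (\<forall>x\<in>{0..el e}. \<bar>u e x - (c (s e) + d e * x + integral {0..x} (Gi a \<rho> u e))\<bar> \<le> \<eta>)) \<and>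
    (\<forall>v\<in>V. \<bar>(\<Sum>e\<in>{e\<in>E. s e = v}. d e) - (\<Sum>e\<in>{e\<in>E. t e = v}. d e + Gi a \<rho> u e (el e)) - a * N v * c v\<bar> \<le> \<eta>) \<and>
    \<bar>2 * a * (\<mu> - Mass u) - Sc c\<bar> \<le> \<eta>"

lemma continuous_on_powr_nonneg:
  fixes f :: "real \<Rightarrow> real"
  assumes "continuous_on S f" "\<And>x. x \<in> S \<Longrightarrow> 0 \<le> f x" "q > 0"
  shows "continuous_on S (\<lambda>x. f x powr q)"
  by (rule continuous_on_powr') (use assms in auto)

lemma gg_cont:
  fixes f :: "real \<Rightarrow> real"
  assumes "continuous_on S f" "\<And>x. x \<in> S \<Longrightarrow> 0 \<le> f x"
  shows "continuous_on S (\<lambda>x. gg a \<rho> (f x))"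
proof -
  have "continuous_on S (\<lambda>x. f x powr (p - 1))"
    by (rule continuous_on_powr_nonneg[OF assms]) (use p6 in auto)
  then show ?thesis unfolding gg_def
    by (intro continuous_on_diff continuous_on_mult continuous_on_const assms(1))
qed

lemma gg_bound:
  assumes "0 \<le> x" "x \<le> B" "0 \<le> a" "a \<le> A" "0 \<le> \<rho>" "\<rho> \<le> 1"
  shows "\<bar>gg a \<rho> x\<bar> \<le> A\<^sup>2 * B + B powr (p - 1)"
proof -
  have "a\<^sup>2 * x \<le> A\<^sup>2 * B" using assms by (intro mult_mono power_mono) auto
  moreover have "0 \<le> a\<^sup>2 * x" using assms by simp
  moreover have "\<rho> * x powr (p - 1) \<le> 1 * B powr (p - 1)"
    using assms p6 by (intro mult_mono powr_mono2) auto
  moreover have "0 \<le> \<rho> * x powr (p - 1)" using assms by simp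
  ultimately show ?thesis unfolding gg_def by linarith
qed

lemma Gi_cont:
  assumes "continuous_on {0..L} (u e)" "\<And>x. x \<in> {0..L} \<Longrightarrow> 0 \<le> u e x"
  shows "continuous_on {0..L} (Gi a \<rho> u e)"
  unfolding Gi_def[abs_def]
  by (intro indefinite_integral_continuous_1 integrable_continuous_interval gg_cont assms)

lemma Gi_bound:
  assumes "continuous_on {0..L} (u e)" "\<And>x. x \<in> {0..L} \<Longrightarrow> 0 \<le> u e x \<and> u e x \<le> B"
    "0 \<le> a" "a \<le> A" "0 \<le> \<rho>" "\<rho> \<le> 1" "x \<in> {0..L}"
  shows "\<bar>Gi a \<rho> u e x\<bar> \<le> (A\<^sup>2 * B + B powr (p - 1)) * L"
proof -
  have "norm (integral {0..x} (\<lambda>y. gg a \<rho> (u e y))) \<le> (A\<^sup>2 * B + B powr (p - 1)) * (x - 0)"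
  proof (rule integral_bound)
    show "continuous_on {0..x} (\<lambda>y. gg a \<rho> (u e y))"
      by (rule gg_cont) (use assms in \<open>auto intro: continuous_on_subset\<close>)
    show "norm (gg a \<rho> (u e y)) \<le> A\<^sup>2 * B + B powr (p - 1)" if "y \<in> {0..x}" for y
      using gg_bound[of "u e y" B a A \<rho>] assms(2)[of y] that assms by auto
  qed (use assms in auto)
  also have "\<dots> \<le> (A\<^sup>2 * B + B powr (p - 1)) * L"
    using assms(2)[OF assms(7)] assms(7)
    by (intro mult_left_mono add_nonneg_nonneg mult_nonneg_nonneg) auto
  finally show ?thesis by (simp add: Gi_def)
qed

lemma sum_over_vertices:
  fixes f :: "'e \<Rightarrow> real"
  shows "(\<Sum>v\<in>V. \<Sum>e\<in>{e\<in>E. s e = v}. f e) = sum f E" "(\<Sum>v\<in>V. \<Sum>e\<in>{e\<in>E. t e = v}. f e) = sum f E"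
  using s_in t_in finV finE by (auto intro!: sum.group)

text \<open>Serves both limits, that of the mesh and that of \<open>\<rho>\<close>. Bounds on
  \<open>a\<close> and \<open>u\<close> bound the reaction term, hence the slopes, and give
  equicontinuity; the doubly integrated form of the equation then needs only pointwise bounded
  convergence.\<close>

lemma limit_of_approx:
  fixes \<eta> a \<rho> :: "nat \<Rightarrow> real" and u :: "nat \<Rightarrow> 'e \<Rightarrow> real \<Rightarrow> real"
  assumes ap: "\<And>k. approx (\<eta> k) (a k) (\<rho> k) (u k) (c k) (d k)"
    and \<eta>: "\<eta> \<longlonglongrightarrow> 0" "\<And>k. \<eta> k \<le> 1"
    and a: "\<And>k. 0 \<le> a k" "\<And>k. a k \<le> A"
    and \<rho>: "\<And>k. 1/2 \<le> \<rho> k" "\<And>k. \<rho> k \<le> 1"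
    and u: "\<And>k e x. e \<in> E \<Longrightarrow> x \<in> {0..el e} \<Longrightarrow> u k e x \<le> B"
    and En: "\<And>k. \<alpha> - \<eta> k \<le> En (a k) (\<rho> k) (u k) (c k)" "\<And>k. En (a k) (\<rho> k) (u k) (c k) \<le> C + \<eta> k"
    and \<alpha>: "\<alpha> > 0"
  shows "\<exists>a' \<rho>' u' c' d' r. a' > 0 \<and> strict_mono r \<and> (\<lambda>k. \<rho> (r k)) \<longlonglongrightarrow> \<rho>' \<and> approx 0 a' \<rho>' u' c' d' \<and>
    \<alpha> \<le> En a' \<rho>' u' c' \<and> En a' \<rho>' u' c' \<le> C"
proof -
  define \<Gamma> where "\<Gamma> = A\<^sup>2 * B + B powr (p - 1)"
  have uc: "continuous_on {0..el e} (u k e)" and u0: "\<And>x. x \<in> {0..el e} \<Longrightarrow> 0 \<le> u k e x"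
    and us: "u k e 0 = c k (s e)" and ut: "u k e (el e) = c k (t e)"
    and form: "\<And>x. x \<in> {0..el e} \<Longrightarrow> \<bar>u k e x - (c k (s e) + d k e * x + integral {0..x} (Gi (a k) (\<rho> k) (u k) e))\<bar> \<le> \<eta> k"
    if "e \<in> E" for k e using ap[of k] that unfolding approx_def by blast+
  have B0: "B \<ge> 0"
  proof -
    obtain e where e: "e \<in> E" using E_ne by blast
    then have "0 \<in> {0..el e}" using el_pos by (simp add: less_imp_le)
    then show ?thesis using u0[OF e, of 0 0] u[OF e, of 0 0] by simp
  qed
  have \<rho>0: "0 \<le> \<rho> k" for k using \<rho>(1)[of k] by linarith
  have A0: "A \<ge> 0" using a[of 0] by linarith
  have \<Gamma>0: "\<Gamma> \<ge> 0" unfolding \<Gamma>_def using B0 by (intro add_nonneg_nonneg mult_nonneg_nonneg) auto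
  have ggb: "\<bar>gg (a k) (\<rho> k) (u k e x)\<bar> \<le> \<Gamma>" if "e \<in> E" "x \<in> {0..el e}" for k e x
    unfolding \<Gamma>_def by (rule gg_bound) (use u0 u that a \<rho> \<rho>0 in auto)
  have ggc: "continuous_on {0..el e} (\<lambda>x. gg (a k) (\<rho> k) (u k e x))" if "e \<in> E" for k e
    by (rule gg_cont[OF uc[OF that] u0[OF that]])
  have Gic: "continuous_on {0..el e} (Gi (a k) (\<rho> k) (u k) e)" if "e \<in> E" for k e
    by (rule Gi_cont[of "el e" "u k" e, OF uc[OF that] u0[OF that]])
  have Gib: "\<bar>Gi (a k) (\<rho> k) (u k) e x\<bar> \<le> \<Gamma> * el e" if "e \<in> E" "x \<in> {0..el e}" for k e x
    unfolding \<Gamma>_def by (rule Gi_bound) (use uc u0 u that a \<rho> \<rho>0 in auto)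
  define Y where "Y = (\<lambda>k e x. integral {0..x} (Gi (a k) (\<rho> k) (u k) e))"
  have Yl: "\<bar>Y k e x - Y k e y\<bar> \<le> \<Gamma> * el e * \<bar>x - y\<bar>" if e: "e \<in> E" and x: "x \<in> {0..el e}" and y: "y \<in> {0..el e}" for k e x y
  proof -
    have *: "\<bar>Y k e x - Y k e y\<bar> \<le> \<Gamma> * el e * \<bar>x - y\<bar>" if yx: "y \<le> x" and y: "y \<in> {0..el e}" and x: "x \<in> {0..el e}" for x y
    proof -
      have "Y k e x - Y k e y = integral {y..x} (Gi (a k) (\<rho> k) (u k) e)"
        using Henstock_Kurzweil_Integration.integral_combine[of 0 y x "Gi (a k) (\<rho> k) (u k) e"] x y yx
          integrable_continuous_interval[OF continuous_on_subset[OF Gic[OF e]], of 0 x]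
        by (auto simp: Y_def)
      moreover have "norm (integral {y..x} (Gi (a k) (\<rho> k) (u k) e)) \<le> (\<Gamma> * el e) * (x - y)"
        by (rule integral_bound) (use yx x y Gib[OF e] in \<open>auto intro!: continuous_on_subset[OF Gic[OF e]]\<close>)
      ultimately show ?thesis using yx by simp
    qed
    show ?thesis using *[of x y] *[of y x] x y by (cases "y \<le> x") (auto simp: abs_minus_commute)
  qed
  have Y0: "Y k e 0 = 0" for k e by (simp add: Y_def)
  have Yb: "\<bar>Y k e x\<bar> \<le> \<Gamma> * el e * el e" if e: "e \<in> E" and x: "x \<in> {0..el e}" for k e x
  proof -
    have "\<bar>Y k e x - Y k e 0\<bar> \<le> \<Gamma> * el e * \<bar>x - 0\<bar>" by (rule Yl[OF e x]) (use x in auto)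
    also have "\<dots> \<le> \<Gamma> * el e * el e" using x \<Gamma>0 el_pos[OF e] by (intro mult_left_mono) auto
    finally show ?thesis by (simp add: Y0)
  qed
  have cb: "\<bar>c k (s e)\<bar> \<le> B" "\<bar>c k (t e)\<bar> \<le> B" if e: "e \<in> E" for k e
    using u0[OF e, of 0 k] u[OF e, of 0 k] u0[OF e, of "el e" k] u[OF e, of "el e" k] us[OF e, of k] ut[OF e, of k] el_pos[OF e]
    by auto
  define LM where "LM = (\<Sum>e\<in>E. el e)"
  have elM: "el e \<le> LM" if "e \<in> E" for e
    unfolding LM_def by (rule member_le_sum) (use that finE in \<open>auto simp: less_imp_le[OF el_pos]\<close>)
  define DB where "DB = (\<Sum>e\<in>E. (2 * B + 1 + \<Gamma> * el e * el e) / el e)"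
  have db: "\<bar>d k e\<bar> \<le> DB" if e: "e \<in> E" for k e
  proof -
    have "\<bar>d k e * el e\<bar> \<le> 2 * B + 1 + \<Gamma> * el e * el e"
    proof -
      have m: "el e \<in> {0..el e}" using el_pos[OF e] by simp
      have "\<bar>c k (t e) - (c k (s e) + d k e * el e + Y k e (el e))\<bar> \<le> \<eta> k"
        using form[OF e m, of k] by (simp add: Y_def ut[OF e])
      then show ?thesis using cb[OF e, of k] Yb[OF e m, of k] \<eta>(2)[of k] by linarith
    qed
    then have "\<bar>d k e\<bar> \<le> (2 * B + 1 + \<Gamma> * el e * el e) / el e"
      using el_pos[OF e] by (simp add: field_simps abs_mult)
    also have "\<dots> \<le> DB" unfolding DB_def
      by (rule member_le_sum[where f = "\<lambda>e. (2 * B + 1 + \<Gamma> * el e * el e) / el e"])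
         (use e finE B0 \<Gamma>0 in \<open>auto simp: less_imp_le[OF el_pos] intro!: divide_nonneg_nonneg add_nonneg_nonneg mult_nonneg_nonneg\<close>)
    finally show ?thesis .
  qed
  \<comment> \<open>The right-hand side of the integrated equation is equi-Lipschitz, whereas
    \<open>u k\<close> itself is only known to lie within \<open>\<eta> k\<close> of it; compactness
    is therefore applied to \<open>W\<close>.\<close>
  define W where "W = (\<lambda>k e x. c k (s e) + d k e * x + Y k e x)"
  have uW: "\<bar>u k e x - W k e x\<bar> \<le> \<eta> k" if "e \<in> E" "x \<in> {0..el e}" for k e x
    using form[OF that] by (simp add: W_def Y_def)
  have Wb: "\<bar>W k e x\<bar> \<le> B + 1" if "e \<in> E" "x \<in> {0..el e}" for k e x
    using uW[OF that, of k] u0[OF that, of k] u[OF that, of k] \<eta>(2)[of k] by linarith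
  have Wl: "\<bar>W k e x - W k e y\<bar> \<le> (DB + \<Gamma> * LM) * \<bar>x - y\<bar>" if e: "e \<in> E" and xy: "x \<in> {0..el e}" "y \<in> {0..el e}" for k e x y
  proof -
    have "\<bar>d k e * x - d k e * y\<bar> \<le> DB * \<bar>x - y\<bar>"
      using mult_right_mono[OF db[OF e], of "\<bar>x - y\<bar>"] by (simp add: abs_mult[symmetric] right_diff_distrib)
    moreover have "\<Gamma> * el e * \<bar>x - y\<bar> \<le> \<Gamma> * LM * \<bar>x - y\<bar>"
      using elM[OF e] \<Gamma>0 by (intro mult_right_mono mult_left_mono) auto
    moreover note Yl[OF e xy, of k]
    ultimately show ?thesis unfolding W_def distrib_right by linarith
  qed
  obtain r1 w where r1: "strict_mono r1" and w: "\<And>e. e \<in> E \<Longrightarrow> continuous_on {0..el e} (w e)"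
      "\<And>e x. e \<in> E \<Longrightarrow> x \<in> {0..el e} \<Longrightarrow> (\<lambda>k. W (r1 k) e x) \<longlonglongrightarrow> w e x"
    using family_convergent_subseq[OF finE, of el W "B + 1" "DB + \<Gamma> * LM", OF Wb Wl] by blast
  obtain a' r2 where r2: "strict_mono r2" "(\<lambda>k. a (r1 (r2 k))) \<longlonglongrightarrow> a'"
  proof -
    have "\<bar>a (r1 k)\<bar> \<le> A" for k using a by simp
    then show thesis using bounded_real_convergent_subseq[of "\<lambda>k. a (r1 k)" A] that by metis
  qed
  obtain \<rho>' r3 where r3: "strict_mono r3" "(\<lambda>k. \<rho> (r1 (r2 (r3 k)))) \<longlonglongrightarrow> \<rho>'"
  proof -
    have "\<bar>\<rho> (r1 (r2 k))\<bar> \<le> 1" for k using \<rho> \<rho>0 by simp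
    then show thesis using bounded_real_convergent_subseq[of "\<lambda>k. \<rho> (r1 (r2 k))" 1] that by metis
  qed
  define r where "r = r1 \<circ> (r2 \<circ> r3)"
  have r: "strict_mono r" unfolding r_def by (intro strict_mono_o r1 r2 r3)
  have aL: "(\<lambda>k. a (r k)) \<longlonglongrightarrow> a'" using LIMSEQ_subseq_LIMSEQ[OF r2(2) r3(1)] by (simp add: r_def o_def)
  have \<rho>L: "(\<lambda>k. \<rho> (r k)) \<longlonglongrightarrow> \<rho>'" using r3(2) by (simp add: r_def)
  have \<eta>L: "(\<lambda>k. \<eta> (r k)) \<longlonglongrightarrow> 0" using LIMSEQ_subseq_LIMSEQ[OF \<eta>(1) r] by (simp add: o_def)
  have uL: "(\<lambda>k. u (r k) e x) \<longlonglongrightarrow> w e x" if "e \<in> E" "x \<in> {0..el e}" for e x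
  proof -
    have "(\<lambda>k. W (r k) e x) \<longlonglongrightarrow> w e x"
      using LIMSEQ_subseq_LIMSEQ[OF w(2)[OF that] strict_mono_o[OF r2(1) r3(1)]] by (simp add: r_def o_def)
    moreover have "(\<lambda>k. u (r k) e x - W (r k) e x) \<longlonglongrightarrow> 0"
      by (rule Lim_null_comparison[OF _ \<eta>L]) (use uW[OF that] in auto)
    ultimately show ?thesis using tendsto_add by fastforce
  qed
  have w0: "0 \<le> w e x" if "e \<in> E" "x \<in> {0..el e}" for e x
    by (rule LIMSEQ_le_const[OF uL[OF that]]) (use u0 that in auto)
  have pw: "(\<lambda>k. u (r k) e x powr q) \<longlonglongrightarrow> w e x powr q" if "e \<in> E" "x \<in> {0..el e}" "q > 0" for e x q
    by (rule tendsto_powr'[OF uL[OF that(1,2)] tendsto_const]) (use u0 that in auto)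
  have ggL: "(\<lambda>k. gg (a (r k)) (\<rho> (r k)) (u (r k) e x)) \<longlonglongrightarrow> gg a' \<rho>' (w e x)" if "e \<in> E" "x \<in> {0..el e}" for e x
    unfolding gg_def by (intro tendsto_intros aL \<rho>L uL pw that) (use p6 in auto)
  have GiL: "(\<lambda>k. Gi (a (r k)) (\<rho> (r k)) (u (r k)) e x) \<longlonglongrightarrow> Gi a' \<rho>' w e x" if e: "e \<in> E" and x: "x \<in> {0..el e}" for e x
    unfolding Gi_def
    by (rule bounded_convergence_interval[where B = \<Gamma>])
       (use x in \<open>auto intro!: continuous_on_subset[OF ggc[OF e]] ggb[OF e] ggL[OF e]\<close>)
  have YL: "(\<lambda>k. Y (r k) e x) \<longlonglongrightarrow> integral {0..x} (Gi a' \<rho>' w e)" if e: "e \<in> E" and x: "x \<in> {0..el e}" for e x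
    unfolding Y_def
    by (rule bounded_convergence_interval[where B = "\<Gamma> * el e"])
       (use x in \<open>auto intro!: continuous_on_subset[OF Gic[OF e]] Gib[OF e] GiL[OF e]\<close>)
  have MassL: "(\<lambda>k. Mass (u (r k))) \<longlonglongrightarrow> Mass w" unfolding Mass_def
  proof (intro tendsto_sum bounded_convergence_interval[where B = "B\<^sup>2"])
    fix k e x assume e: "e \<in> E" and x: "x \<in> {0..el e}"
    show "\<bar>(u (r k) e x)\<^sup>2\<bar> \<le> B\<^sup>2" using u0[OF e x, of "r k"] u[OF e x, of "r k"] by (simp add: power_mono)
  qed (auto intro!: continuous_intros uc tendsto_intros uL)
  have PowL: "(\<lambda>k. Pow (u (r k))) \<longlonglongrightarrow> Pow w" unfolding Pow_def
  proof (intro tendsto_sum bounded_convergence_interval[where B = "B powr p"])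
    fix k e x assume e: "e \<in> E" and x: "x \<in> {0..el e}"
    show "\<bar>u (r k) e x powr p\<bar> \<le> B powr p" using u0[OF e x, of "r k"] u[OF e x, of "r k"] p6 by (simp add: powr_mono2)
  qed (use p6 in \<open>auto intro!: continuous_on_powr_nonneg uc u0 pw\<close>)
  have "\<exists>cl. (\<lambda>k. c (r k) v) \<longlonglongrightarrow> cl" if v: "v \<in> V" for v
  proof -
    consider e where "e \<in> E" "v = s e" | e where "e \<in> E" "v = t e" using V_ends v by blast
    then show ?thesis
    proof cases
      case 1 then show ?thesis using uL[OF 1(1), of 0] us[OF 1(1)] el_pos[OF 1(1)] by auto
    next
      case 2 then show ?thesis using uL[OF 2(1), of "el e"] ut[OF 2(1)] el_pos[OF 2(1)] by auto
    qed
  qed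
  then obtain c' where cL: "\<And>v. v \<in> V \<Longrightarrow> (\<lambda>k. c (r k) v) \<longlonglongrightarrow> c' v" by metis
  have ScL: "(\<lambda>k. Sc (c (r k))) \<longlonglongrightarrow> Sc c'" unfolding Sc_def by (intro tendsto_intros cL)
  have ws: "w e 0 = c' (s e)" and wt: "w e (el e) = c' (t e)" if e: "e \<in> E" for e
    using LIMSEQ_unique[OF uL[OF e, of 0]] LIMSEQ_unique[OF uL[OF e, of "el e"]] cL[OF s_in[OF e]] cL[OF t_in[OF e]]
      us[OF e] ut[OF e] el_pos[OF e] by auto
  \<comment> \<open>Forced by the limit equation at \<open>x = el e\<close>, where the two end
    values determine the slope.\<close>
  define d' where "d' = (\<lambda>e. (c' (t e) - c' (s e) - integral {0..el e} (Gi a' \<rho>' w e)) / el e)"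
  have dL: "(\<lambda>k. d (r k) e) \<longlonglongrightarrow> d' e" if e: "e \<in> E" for e
  proof -
    have m: "el e \<in> {0..el e}" using el_pos[OF e] by simp
    have "(\<lambda>k. W (r k) e (el e) - u (r k) e (el e)) \<longlonglongrightarrow> 0"
      by (rule Lim_null_comparison[OF _ \<eta>L]) (use uW[OF e m] in \<open>auto simp: abs_minus_commute\<close>)
    then have "(\<lambda>k. (c (r k) (t e) - c (r k) (s e) - Y (r k) e (el e) + (W (r k) e (el e) - u (r k) e (el e))) / el e) \<longlonglongrightarrow> 
      (c' (t e) - c' (s e) - integral {0..el e} (Gi a' \<rho>' w e) + 0) / el e"
      using el_pos[OF e] by (intro tendsto_intros cL s_in[OF e] t_in[OF e] YL[OF e m]) auto
    moreover have "(c (r k) (t e) - c (r k) (s e) - Y (r k) e (el e) + (W (r k) e (el e) - u (r k) e (el e))) / el e = d (r k) e" for k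
      using el_pos[OF e] by (simp add: W_def ut[OF e])
    ultimately show ?thesis by (simp add: d'_def)
  qed
  have lim0: "\<bar>l\<bar> \<le> 0" if "f \<longlonglongrightarrow> l" "\<And>k. \<bar>f k\<bar> \<le> \<eta> (r k)" for f l
    by (rule LIMSEQ_le[OF tendsto_rabs[OF that(1)] \<eta>L]) (use that(2) in auto)
  have app: "approx 0 a' \<rho>' w c' d'"
    unfolding approx_def
  proof (intro conjI ballI)
    fix e assume e: "e \<in> E"
    show "continuous_on {0..el e} (w e)" by (rule w(1)[OF e])
    show "w e 0 = c' (s e)" "w e (el e) = c' (t e)" using ws[OF e] wt[OF e] by auto
    fix x assume x: "x \<in> {0..el e}"
    show "0 \<le> w e x" by (rule w0[OF e x])
    show "\<bar>w e x - (c' (s e) + d' e * x + integral {0..x} (Gi a' \<rho>' w e))\<bar> \<le> 0"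
      by (rule lim0[of "\<lambda>k. u (r k) e x - W (r k) e x"])
         (use uW[OF e x] in \<open>auto simp: W_def intro!: tendsto_intros uL[OF e x] cL s_in[OF e] dL[OF e] YL[OF e x]\<close>)
  next
    fix v assume v: "v \<in> V"
    have m: "el e \<in> {0..el e}" if "e \<in> E" for e using el_pos[OF that] by simp
    show "\<bar>(\<Sum>e | e \<in> E \<and> s e = v. d' e) - (\<Sum>e | e \<in> E \<and> t e = v. d' e + Gi a' \<rho>' w e (el e)) - a' * N v * c' v\<bar> \<le> 0"
    proof (rule lim0)
      show "(\<lambda>k. (\<Sum>e\<in>{e\<in>E. s e = v}. d (r k) e) - (\<Sum>e\<in>{e\<in>E. t e = v}. d (r k) e + Gi (a (r k)) (\<rho> (r k)) (u (r k)) e (el e)) - a (r k) * N v * c (r k) v)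
       \<longlonglongrightarrow> (\<Sum>e | e \<in> E \<and> s e = v. d' e) - (\<Sum>e | e \<in> E \<and> t e = v. d' e + Gi a' \<rho>' w e (el e)) - a' * N v * c' v"
        by (intro tendsto_intros dL GiL aL cL v m) auto
    qed (use ap v in \<open>auto simp: approx_def\<close>)
  next
    show "\<bar>2 * a' * (\<mu> - Mass w) - Sc c'\<bar> \<le> 0"
    proof (rule lim0)
      show "(\<lambda>k. 2 * a (r k) * (\<mu> - Mass (u (r k))) - Sc (c (r k))) \<longlonglongrightarrow> 2 * a' * (\<mu> - Mass w) - Sc c'"
        by (intro tendsto_intros aL MassL ScL)
    qed (use ap in \<open>auto simp: approx_def\<close>)
  qed
  have EnL: "(\<lambda>k. En (a (r k)) (\<rho> (r k)) (u (r k)) (c (r k))) \<longlonglongrightarrow> En a' \<rho>' w c'"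
    unfolding En_def by (intro tendsto_intros aL \<rho>L MassL ScL PowL) auto
  have E1: "\<alpha> - 0 \<le> En a' \<rho>' w c'"
    by (rule LIMSEQ_le[OF tendsto_diff[OF tendsto_const \<eta>L] EnL]) (use En in auto)
  have E2: "En a' \<rho>' w c' \<le> C + 0"
    by (rule LIMSEQ_le[OF EnL tendsto_add[OF tendsto_const \<eta>L]]) (use En in auto)
  have a'0: "0 \<le> a'" by (rule LIMSEQ_le_const[OF aL]) (use a in auto)
  have \<rho>'0: "1/2 \<le> \<rho>'" by (rule LIMSEQ_le_const[OF \<rho>L]) (use \<rho> in auto)
  \<comment> \<open>With \<open>a' = 0\<close> the vertex equations sum to a vanishing total
    integral of \<open>\<rho>' * w powr (p - 1)\<close>. Then \<open>w = 0\<close> and the energy is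
    0, against the lower bound \<open>\<alpha>\<close>.\<close>
  have "a' \<noteq> 0"
  proof
    assume a0: "a' = 0"
    have vz: "(\<Sum>e\<in>{e\<in>E. s e = v}. d' e) - (\<Sum>e\<in>{e\<in>E. t e = v}. d' e + Gi a' \<rho>' w e (el e)) = 0" if "v \<in> V" for v
      using app that a0 by (auto simp: approx_def)
    have "0 = (\<Sum>v\<in>V. (\<Sum>e\<in>{e\<in>E. s e = v}. d' e) - (\<Sum>e\<in>{e\<in>E. t e = v}. d' e + Gi a' \<rho>' w e (el e)))"
      by (rule sum.neutral[symmetric]) (use vz in blast)
    also have "\<dots> = - (\<Sum>e\<in>E. Gi a' \<rho>' w e (el e))"
      by (simp add: sum_subtractf sum_over_vertices sum.distrib)
    also have "\<dots> = (\<Sum>e\<in>E. \<rho>' * integral {0..el e} (\<lambda>x. w e x powr (p - 1)))"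
      by (simp add: Gi_def gg_def a0 sum_negf)
    finally have z: "(\<Sum>e\<in>E. \<rho>' * integral {0..el e} (\<lambda>x. w e x powr (p - 1))) = 0" by simp
    have cp: "continuous_on {0..el e} (\<lambda>x. w e x powr (p - 1))" if "e \<in> E" for e
      by (rule continuous_on_powr_nonneg[OF w(1)[OF that] w0[OF that]]) (use p6 in auto)
    have nn: "0 \<le> integral {0..el e} (\<lambda>x. w e x powr (p - 1))" if "e \<in> E" for e
      by (rule Henstock_Kurzweil_Integration.integral_nonneg) (auto intro!: integrable_continuous_interval cp that)
    have "\<rho>' * integral {0..el e} (\<lambda>x. w e x powr (p - 1)) = 0" if "e \<in> E" for e
      using z sum_nonneg_eq_0_iff[OF finE, of "\<lambda>e. \<rho>' * integral {0..el e} (\<lambda>x. w e x powr (p - 1))"] nn \<rho>'0 that by auto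
    then have i0: "integral {0..el e} (\<lambda>x. w e x powr (p - 1)) = 0" if "e \<in> E" for e using \<rho>'0 that by force
    have "w e x powr (p - 1) = 0" if "e \<in> E" "x \<in> {0..el e}" for e x
      using integral_eq_0_iff[OF cp[OF that(1)] el_pos[OF that(1)]] i0[OF that(1)] that(2) by auto
    then have wz: "w e x = 0" if "e \<in> E" "x \<in> {0..el e}" for e x using that by fastforce
    have "Pow w = 0" unfolding Pow_def
      by (rule sum.neutral) (use wz p6 in \<open>auto intro!: integral_unique has_integral_is_0\<close>)
    then show False using E1 \<alpha> by (simp add: En_def a0)
  qed
  then have "a' > 0" using a'0 by simp
  moreover have "\<alpha> \<le> En a' \<rho>' w c'" "En a' \<rho>' w c' \<le> C" using E1 E2 by auto
  ultimately show ?thesis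
    by (intro exI[of _ a'] exI[of _ \<rho>'] exI[of _ w] exI[of _ c'] exI[of _ d'] exI[of _ r] conjI r \<rho>L app) assumption+
qed

end

section \<open>From discrete critical points to approximate solutions\<close>

lemma riemann_sum_error:
  fixes f :: "real \<Rightarrow> real" and h \<omega> :: real
  assumes h: "h > 0" and c: "continuous_on {0..real n * h} f"
    and osc: "\<And>j y. j < n \<Longrightarrow> y \<in> {real j * h..real (Suc j) * h} \<Longrightarrow> \<bar>f y - f (real (Suc j) * h)\<bar> \<le> \<omega>"
    and i: "i \<le> n"
  shows "\<bar>(\<Sum>j<i. h * f (real (Suc j) * h)) - integral {0..real i * h} f\<bar> \<le> \<omega> * (real i * h)"
  using i
proof (induction i)
  case 0 show ?case by simp
next
  case (Suc i)
  have le: "real i * h \<le> real (Suc i) * h" "real (Suc i) * h \<le> real n * h"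
    using h Suc.prems by (auto intro!: mult_right_mono)
  have c1: "continuous_on {0..real (Suc i) * h} f" by (rule continuous_on_subset[OF c]) (use le in auto)
  have c2: "continuous_on {real i * h..real (Suc i) * h} f" by (rule continuous_on_subset[OF c]) (use le h in auto)
  have I: "integral {0..real (Suc i) * h} f = integral {0..real i * h} f + integral {real i * h..real (Suc i) * h} f"
    by (rule Henstock_Kurzweil_Integration.integral_combine[OF _ le(1) integrable_continuous_interval[OF c1], symmetric]) (use h in simp)
  have "norm (integral {real i * h..real (Suc i) * h} (\<lambda>y. f y - f (real (Suc i) * h))) \<le> \<omega> * (real (Suc i) * h - real i * h)"
    by (rule integral_bound[OF le(1) continuous_on_diff[OF c2 continuous_on_const]]) (use osc[of i] Suc.prems in auto)
  moreover have "integral {real i * h..real (Suc i) * h} (\<lambda>y. f y - f (real (Suc i) * h)) = integral {real i * h..real (Suc i) * h} f - h * f (real (Suc i) * h)"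
    unfolding Henstock_Kurzweil_Integration.integral_diff[OF integrable_continuous_interval[OF c2] integrable_continuous_interval[OF continuous_on_const]]
    using h by (simp add: algebra_simps)
  moreover have "\<bar>(\<Sum>j<i. h * f (real (Suc j) * h)) - integral {0..real i * h} f\<bar> \<le> \<omega> * (real i * h)"
    using Suc by simp
  moreover have "\<omega> * (real (Suc i) * h) = \<omega> * (real i * h) + \<omega> * (real (Suc i) * h - real i * h)"
    by (simp add: algebra_simps)
  ultimately show ?case unfolding I by simp
qed

lemma summation_by_parts:
  fixes U y :: "nat \<Rightarrow> real"
  shows "(\<Sum>j<Suc m. (U (Suc j) - U j) * (y (Suc j) - y j)) =
    (U (Suc m) - U m) * y (Suc m) - (U 1 - U 0) * y 0 - (\<Sum>j\<in>{1..<Suc m}. ((U (Suc j) - U j) - (U j - U (j - 1))) * y j)"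
proof (induction m)
  case 0 show ?case by (simp add: right_diff_distrib)
next
  case (Suc m)
  have "(\<Sum>j\<in>{1..<Suc (Suc m)}. ((U (Suc j) - U j) - (U j - U (j - 1))) * y j)
    = (\<Sum>j\<in>{1..<Suc m}. ((U (Suc j) - U j) - (U j - U (j - 1))) * y j) + ((U (Suc (Suc m)) - U (Suc m)) - (U (Suc m) - U m)) * y (Suc m)"
    by simp
  then show ?case unfolding sum.lessThan_Suc[of _ "Suc m"] Suc.IH by (simp only:) (simp add: algebra_simps)
qed

lemma powr_lipschitz:
  fixes x y q B :: real
  assumes "q > 1" "0 \<le> x" "x \<le> B" "0 \<le> y" "y \<le> B"
  shows "\<bar>x powr q - y powr q\<bar> \<le> q * B powr (q - 1) * \<bar>x - y\<bar>"
proof -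
  have "norm ((max 0 x) powr q - (max 0 y) powr q) \<le> (q * B powr (q - 1)) * norm (x - y)"
  proof (rule field_differentiable_bound[where S = "{0..B}"])
    fix z assume z: "z \<in> {0..B}"
    show "((\<lambda>x. (max 0 x) powr q) has_field_derivative q * (max 0 z) powr (q - 1)) (at z within {0..B})"
      by (rule has_field_derivative_at_within[OF pos_part_powr_deriv[OF assms(1)]])
    show "norm (q * (max 0 z) powr (q - 1)) \<le> q * B powr (q - 1)"
      using z assms by (auto intro!: mult_left_mono powr_mono2)
  qed (use assms in auto)
  then show ?thesis using assms by simp
qed

section \<open>Bounds and discrete equations at a critical point\<close>

context core_graph
begin

text \<open>Constants that do not involve the mesh, in terms of a common bound \<open>c\<close> for
  \<open>AA\<close> and \<open>BB\<close>: \<open>B0\<close> for the values, \<open>A0\<close> for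
  the rate \<open>a\<close>, \<open>G0\<close> for the reaction term, \<open>V0\<close> for the
  slopes, \<open>Lg\<close> and \<open>Lp\<close> for the Lipschitz constants of the reaction term
  and of the power \<open>p\<close>. In \<open>B0\<close> the first summand is a value attained at
  some node of each edge, the second the possible variation from there.\<close>

definition B0 where "B0 c = sqrt (\<mu> * \<kappa>) + sqrt (LL * (2 * c))"
definition A0 where "A0 c = max (sqrt (2 * p * c / \<mu>)) ((sum N V * (B0 c)\<^sup>2 + 1) / \<mu>)"
definition G0 where "G0 c = (A0 c)\<^sup>2 * B0 c + B0 c powr (p - 1)"
definition V0 where "V0 c = B0 c * \<kappa> + 2 * LL * G0 c"
definition Lg where "Lg c = (A0 c)\<^sup>2 + (p - 1) * B0 c powr (p - 2)"
definition Lp where "Lp c = p * B0 c powr (p - 1)"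

lemma const_nonneg: assumes "c \<ge> 0"
  shows "B0 c \<ge> 0" "A0 c \<ge> 0" "G0 c \<ge> 0" "V0 c \<ge> 0" "Lg c \<ge> 0" "Lp c \<ge> 0"
proof -
  show B: "B0 c \<ge> 0" unfolding B0_def using assms LL_pos \<mu>_pos \<kappa>_nonneg by simp
  show A: "A0 c \<ge> 0" unfolding A0_def using assms \<mu>_pos p6 by (simp add: le_max_iff_disj)
  show G: "G0 c \<ge> 0" unfolding G0_def using B by simp
  show "V0 c \<ge> 0" unfolding V0_def using B G LL_pos \<kappa>_nonneg by simp
  show "Lg c \<ge> 0" unfolding Lg_def using p6 by simp
  show "Lp c \<ge> 0" unfolding Lp_def using p6 by simp
qed

end

locale discrete_solution = core_graph V E el s t N p \<mu>
  for V :: "'v set" and E :: "'e set" and el s t N p \<mu> +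
  fixes n :: nat and \<epsilon> \<rho> c0 :: real and x :: "'v + 'e \<times> nat \<Rightarrow> real"
  assumes n: "n > 0" and \<epsilon>: "0 < \<epsilon>" "\<epsilon> \<le> 1" and \<rho>: "1/2 \<le> \<rho>" "\<rho> \<le> 1"
    and xD: "x \<in> DD n" and crit: "\<And>y. dA n \<epsilon> x y = \<rho> * dB n x y"
    and A_le: "AA n \<epsilon> x \<le> c0" and B_le: "BB n x \<le> c0"
begin

definition a where "a = aa n \<epsilon> x"
definition U where "U e j = x (nd n e j)"
definition VV where "VV e j = (U e (Suc j) - U e j) / h n e"

lemma hp: "e \<in> E \<Longrightarrow> h n e > 0" using h_pos n by auto
lemma nh: "real n * h n e = el e" using n by (simp add: h_def)
lemma P_pos: "\<mu> - MQ n x x > 0" using xD by (simp add: DD_def)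

lemma a_pos: "a > 0" unfolding a_def aa_def
  using P_pos SQ_nonneg[of x] \<epsilon> by (intro divide_pos_pos) auto

lemma c0: "c0 \<ge> 0" using B_le BB_nonneg[of n x] by linarith

text \<open>Test with the negative part of \<open>x\<close>. The truncated power term drops out,
  while the three quadratic terms are nonnegative, so each of them vanishes; the mass term then
  kills the negative part.\<close>

lemma U_nonneg: assumes e: "e \<in> E" and j: "j \<le> n" shows "U e j \<ge> 0"
proof -
  define y where "y = (\<lambda>i. min (x i) 0)"
  have 1: "KQ n x y \<ge> 0" unfolding KQ_def
  proof (intro sum_nonneg)
    fix e j assume "e \<in> E"
    have h0: "0 \<le> 1 / h n e" using hp[OF \<open>e \<in> E\<close>] by simp
    have "0 \<le> (a - b) * (min a 0 - min b 0)" for a b :: real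
      by (cases "a \<le> b") (auto simp: min_def mult_nonpos_nonpos mult_nonneg_nonneg intro: mult_nonpos_nonpos mult_nonneg_nonneg)
    then have "0 \<le> (x (nd n e (Suc j)) - x (nd n e j)) * (y (nd n e (Suc j)) - y (nd n e j))" by (simp add: y_def)
    with h0 show "0 \<le> 1 / h n e * ((x (nd n e (Suc j)) - x (nd n e j)) * (y (nd n e (Suc j)) - y (nd n e j)))"
      by (rule mult_nonneg_nonneg)
  qed
  have xy: "x i * y i \<ge> 0" "x i * y i = (y i)\<^sup>2" for i by (auto simp: y_def min_def power2_eq_square)
  have 2: "SQ x y \<ge> 0" unfolding SQ_def by (intro sum_nonneg mult_nonneg_nonneg xy N_nonneg)
  have 3: "dB n x y = 0" unfolding dB_def
    by (intro sum.neutral ballI) (use p6 in \<open>auto simp: y_def min_def max_def\<close>)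
  have 4: "0 \<le> aa n \<epsilon> x * SQ x y" using 2 a_pos by (simp add: a_def)
  have "(aa n \<epsilon> x)\<^sup>2 * MQ n x y \<le> 0" using crit[of y] 1 4 unfolding dA_def 3 by linarith
  then have M: "MQ n x y \<le> 0" using a_pos by (simp add: a_def mult_le_0_iff)
  have t0: "0 \<le> h n e * (x (nd n e j) * y (nd n e j))" if "e \<in> E" for e j
    using hp[OF that] xy by simp
  have "h n e * (x (nd n e j) * y (nd n e j)) \<le> (\<Sum>j\<le>n. h n e * (x (nd n e j) * y (nd n e j)))"
    by (rule member_le_sum) (use j t0 e in auto)
  also have "\<dots> \<le> MQ n x y" unfolding MQ_def
    by (rule member_le_sum[where f = "\<lambda>e. \<Sum>j\<le>n. h n e * (x (nd n e j) * y (nd n e j))"])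
       (use e finE t0 in \<open>auto intro!: sum_nonneg\<close>)
  finally have "h n e * (x (nd n e j) * y (nd n e j)) \<le> 0" using M by linarith
  then have "(y (nd n e j))\<^sup>2 \<le> 0" using hp[OF e] xy by (simp add: mult_le_0_iff)
  then have "y (nd n e j) = 0" by simp
  then show ?thesis by (auto simp: y_def U_def min_def split: if_splits)
qed

lemma KQ_bound: "KQ n x x \<le> 2 * c0"
proof -
  have "0 \<le> (SQ x x + \<epsilon>)\<^sup>2 / (8 * (\<mu> - MQ n x x))" using P_pos by simp
  then show ?thesis using A_le unfolding AA_def by linarith
qed

text \<open>On each edge some node has square at most \<open>\<mu> * \<kappa>\<close>, since
  otherwise that edge alone would carry mass at least \<open>\<mu>\<close>; the rest is
  \<open>edge_variation\<close>.\<close>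

lemma U_bound: assumes e: "e \<in> E" and k: "k \<le> n" shows "U e k \<le> B0 c0"
proof -
  have "\<exists>j\<le>n. (U e j)\<^sup>2 \<le> \<mu> * \<kappa>"
  proof (rule ccontr)
    assume "\<not> ?thesis"
    then have big: "\<mu> * \<kappa> < (U e j)\<^sup>2" if "j \<le> n" for j using that by force
    have "(\<Sum>j\<le>n. h n e * (\<mu> * \<kappa>)) \<le> (\<Sum>j\<le>n. h n e * (x (nd n e j) * x (nd n e j)))"
      using big hp[OF e] by (intro sum_mono mult_left_mono) (auto simp: U_def power2_eq_square intro: less_imp_le)
    also have "\<dots> \<le> MQ n x x" unfolding MQ_def
      by (rule member_le_sum[where f = "\<lambda>e. \<Sum>j\<le>n. h n e * (x (nd n e j) * x (nd n e j))"])
         (use e finE hp in \<open>auto intro!: sum_nonneg simp: less_imp_le\<close>)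
    also have "\<dots> < \<mu>" using P_pos by simp
    finally have "real (n + 1) * h n e * (\<mu> * \<kappa>) < \<mu>" by (simp add: algebra_simps)
    moreover have "real n * h n e * (\<mu> * \<kappa>) \<le> real (n + 1) * h n e * (\<mu> * \<kappa>)"
      using hp[OF e] \<mu>_pos \<kappa>_nonneg by (intro mult_right_mono) auto
    moreover have "el e * (\<mu> * (1 / el e)) \<le> el e * (\<mu> * \<kappa>)"
      using \<kappa>_ge[OF e] \<mu>_pos el_pos[OF e] by (intro mult_left_mono) auto
    ultimately show False using nh[of e] el_pos[OF e] by simp
  qed
  then obtain j where j: "j \<le> n" "(U e j)\<^sup>2 \<le> \<mu> * \<kappa>" by blast
  have "U e j \<le> sqrt (\<mu> * \<kappa>)" using j(2) by (rule real_le_rsqrt)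
  moreover have "\<bar>U e k - U e j\<bar> \<le> sqrt (LL * KQ n x x)"
    using edge_variation[OF n e, of j k x] edge_variation[OF n e, of k j x] j(1) k
    unfolding U_def by (cases "j \<le> k") (auto simp: abs_minus_commute)
  moreover have "sqrt (LL * KQ n x x) \<le> sqrt (LL * (2 * c0))"
    using KQ_bound LL_pos by (intro real_sqrt_le_mono mult_left_mono) auto
  ultimately show ?thesis unfolding B0_def by linarith
qed

lemma U_ends: "U e 0 = x (Inl (s e))" "U e n = x (Inl (t e))"
  using n by (auto simp: U_def nd_def)

lemma SQ_bound: "SQ x x \<le> sum N V * (B0 c0)\<^sup>2"
  unfolding SQ_def sum_distrib_right
proof (intro sum_mono mult_left_mono)
  fix v assume v: "v \<in> V"
  have "0 \<le> x (Inl v) \<and> x (Inl v) \<le> B0 c0"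
  proof -
    consider e where "e \<in> E" "v = s e" | e where "e \<in> E" "v = t e" using V_ends v by blast
    then show ?thesis
    proof cases
      case 1 then show ?thesis using U_nonneg[OF 1(1), of 0] U_bound[OF 1(1), of 0] by (simp add: U_ends)
    next
      case 2 then show ?thesis using U_nonneg[OF 2(1), of n] U_bound[OF 2(1), of n] by (simp add: U_ends)
    qed
  qed
  then show "x (Inl v) * x (Inl v) \<le> (B0 c0)\<^sup>2" by (auto simp: power2_eq_square intro!: mult_mono)
  show "0 \<le> N v" by (rule N_nonneg[OF v])
qed

lemma dB_self: "dB n x x = p * BB n x"
  unfolding dB_def BB_def sum_distrib_left
proof (intro sum.cong refl)
  fix e j assume e: "e \<in> E" and j: "j \<in> {..n}"
  have "x (nd n e j) \<ge> 0" using U_nonneg[OF e] j by (simp add: U_def)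
  then show "h n e * ((max 0 (x (nd n e j))) powr (p - 1) * x (nd n e j)) = p * (h n e * ((max 0 (x (nd n e j))) powr p / p))"
    using p6 powr_mult_base[of "x (nd n e j)" "p - 1"] by (simp add: mult.commute)
qed

lemma virial: "KQ n x x + a * SQ x x + a\<^sup>2 * MQ n x x = \<rho> * (p * BB n x)"
  using crit[of x] by (simp add: dA_def a_def dB_self)

text \<open>If the core carries at least half of the mass, the virial identity controls
  \<open>a\<^sup>2 * \<mu> / 2\<close>. Otherwise the denominator in \<open>aa\<close> is at least
  \<open>\<mu>\<close> and its numerator is bounded.\<close>

lemma a_bound: "a \<le> A0 c0"
proof (cases "MQ n x x \<ge> \<mu> / 2")
  case True
  have "0 \<le> a * SQ x x" using a_pos SQ_nonneg[of x] by simp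
  then have "a\<^sup>2 * MQ n x x \<le> \<rho> * (p * BB n x)" using virial KQ_nonneg[of n x] by linarith
  also have "\<dots> \<le> 1 * (p * c0)" using \<rho> p6 B_le BB_nonneg[of n x] by (intro mult_mono) auto
  finally have "a\<^sup>2 * (\<mu> / 2) \<le> p * c0" using mult_left_mono[OF True, of "a\<^sup>2"] by simp
  then have "a\<^sup>2 \<le> 2 * p * c0 / \<mu>" using \<mu>_pos by (simp add: field_simps)
  then have "a \<le> sqrt (2 * p * c0 / \<mu>)" by (rule real_le_rsqrt)
  then show ?thesis by (simp add: A0_def)
next
  case False
  have "a \<le> (sum N V * (B0 c0)\<^sup>2 + 1) / \<mu>" unfolding a_def aa_def
    using False SQ_bound \<epsilon> \<mu>_pos SQ_nonneg[of x] by (intro frac_le) auto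
  then show ?thesis by (simp add: A0_def)
qed

lemma U_range: "e \<in> E \<Longrightarrow> j \<le> n \<Longrightarrow> 0 \<le> U e j \<and> U e j \<le> B0 c0"
  using U_nonneg U_bound by blast

lemma g_bound: "0 \<le> z \<Longrightarrow> z \<le> B0 c0 \<Longrightarrow> \<bar>gg a \<rho> z\<bar> \<le> G0 c0"
  unfolding G0_def by (rule gg_bound) (use a_pos a_bound \<rho> in auto)

text \<open>Criticality after summation by parts. Unit vectors at interior nodes extract the
  difference equation from it, those at vertices the discrete Robin condition.\<close>

lemma weak_form:
  "(\<Sum>e\<in>E. VV e (n - 1) * y (nd n e n) - VV e 0 * y (nd n e 0) - (\<Sum>j\<in>{1..<n}. (VV e j - VV e (j - 1)) * y (nd n e j)))
    + a * SQ x y + (\<Sum>e\<in>E. \<Sum>j\<le>n. h n e * (gg a \<rho> (U e j) * y (nd n e j))) = 0"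
proof -
  obtain m where m: "n = Suc m" using n by (cases n) auto
  have n1: "n - 1 = m" "Suc m = n" using m by auto
  have "KQ n x y = (\<Sum>e\<in>E. VV e (n - 1) * y (nd n e n) - VV e 0 * y (nd n e 0) - (\<Sum>j\<in>{1..<n}. (VV e j - VV e (j - 1)) * y (nd n e j)))"
    unfolding KQ_def
  proof (rule sum.cong[OF refl])
    fix e assume e: "e \<in> E"
    have "(\<Sum>j<n. 1 / h n e * ((x (nd n e (Suc j)) - x (nd n e j)) * (y (nd n e (Suc j)) - y (nd n e j))))
      = 1 / h n e * (\<Sum>j<Suc m. (U e (Suc j) - U e j) * (y (nd n e (Suc j)) - y (nd n e j)))"
      unfolding U_def sum_distrib_left n1 ..
    also have "\<dots> = 1 / h n e * ((U e (Suc m) - U e m) * y (nd n e (Suc m)) - (U e 1 - U e 0) * y (nd n e 0)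
        - (\<Sum>j\<in>{1..<Suc m}. ((U e (Suc j) - U e j) - (U e j - U e (j - 1))) * y (nd n e j)))"
      by (subst summation_by_parts) (rule refl)
    also have "\<dots> = VV e (n - 1) * y (nd n e n) - VV e 0 * y (nd n e 0) - (\<Sum>j\<in>{1..<n}. (VV e j - VV e (j - 1)) * y (nd n e j))"
    proof -
      have "1 / h n e * (\<Sum>j\<in>{1..<Suc m}. ((U e (Suc j) - U e j) - (U e j - U e (j - 1))) * y (nd n e j)) = (\<Sum>j\<in>{1..<n}. (VV e j - VV e (j - 1)) * y (nd n e j))"
        unfolding sum_distrib_left n1
        by (rule sum.cong) (auto simp: VV_def diff_divide_distrib[symmetric])
      then show ?thesis unfolding right_diff_distrib[of "1 / h n e"] n1 by (simp add: VV_def n1)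
    qed
    finally show "(\<Sum>j<n. 1 / h n e * ((x (nd n e (Suc j)) - x (nd n e j)) * (y (nd n e (Suc j)) - y (nd n e j)))) =
         VV e (n - 1) * y (nd n e n) - VV e 0 * y (nd n e 0) - (\<Sum>j\<in>{1..<n}. (VV e j - VV e (j - 1)) * y (nd n e j))" .
  qed
  moreover have "a\<^sup>2 * MQ n x y - \<rho> * dB n x y = (\<Sum>e\<in>E. \<Sum>j\<le>n. h n e * (gg a \<rho> (U e j) * y (nd n e j)))"
    unfolding MQ_def dB_def sum_distrib_left sum_subtractf[symmetric]
  proof (intro sum.cong refl)
    fix e j assume "e \<in> E" "j \<in> {..n}"
    then have "x (nd n e j) \<ge> 0" using U_nonneg by (simp add: U_def)
    then show "a\<^sup>2 * (h n e * (x (nd n e j) * y (nd n e j))) - \<rho> * (h n e * ((max 0 (x (nd n e j))) powr (p - 1) * y (nd n e j)))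
       = h n e * (gg a \<rho> (U e j) * y (nd n e j))"
      by (simp add: gg_def U_def algebra_simps)
  qed
  ultimately show ?thesis using crit[of y] unfolding dA_def a_def by linarith
qed

lemma interior_eq:
  assumes e: "e \<in> E" and j: "1 \<le> j" "j < n"
  shows "VV e j - VV e (j - 1) = h n e * gg a \<rho> (U e j)"
proof -
  define y :: "'v + 'e \<times> nat \<Rightarrow> real" where "y = (\<lambda>i. if i = Inr (e, j) then 1 else 0)"
  have y: "y (nd n e' j') = (if e' = e \<and> j' = j then 1 else 0)" if "j' \<le> n" for e' j'
    using j that by (auto simp: y_def nd_def)
  have "SQ x y = 0" by (simp add: SQ_def y_def)
  moreover have "(\<Sum>e\<in>E. VV e (n - 1) * y (nd n e n) - VV e 0 * y (nd n e 0) - (\<Sum>j\<in>{1..<n}. (VV e j - VV e (j - 1)) * y (nd n e j))) = - (VV e j - VV e (j - 1))"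
  proof -
    have "(\<Sum>e'\<in>E. VV e' (n - 1) * y (nd n e' n) - VV e' 0 * y (nd n e' 0) - (\<Sum>j'\<in>{1..<n}. (VV e' j' - VV e' (j' - 1)) * y (nd n e' j')))
      = (\<Sum>e'\<in>E. if e' = e then - (\<Sum>j'\<in>{1..<n}. if j' = j then VV e j - VV e (j - 1) else 0) else 0)"
    proof (intro sum.cong refl)
      fix e' assume "e' \<in> E"
      have "(\<Sum>j'\<in>{1..<n}. (VV e' j' - VV e' (j' - 1)) * y (nd n e' j')) = (if e' = e then (\<Sum>j'\<in>{1..<n}. if j' = j then VV e j - VV e (j - 1) else 0) else 0)"
      proof (cases "e' = e")
        case True
        show ?thesis unfolding if_P[OF True] by (rule sum.cong) (auto simp: y True)
      qed (simp add: y)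
      then show "VV e' (n - 1) * y (nd n e' n) - VV e' 0 * y (nd n e' 0) - (\<Sum>j'\<in>{1..<n}. (VV e' j' - VV e' (j' - 1)) * y (nd n e' j'))
        = (if e' = e then - (\<Sum>j'\<in>{1..<n}. if j' = j then VV e j - VV e (j - 1) else 0) else 0)"
        using j y[of n e'] y[of 0 e'] by auto
    qed
    also have "\<dots> = - (VV e j - VV e (j - 1))" using e finE j by simp
    finally show ?thesis .
  qed
  moreover have "(\<Sum>e\<in>E. \<Sum>j\<le>n. h n e * (gg a \<rho> (U e j) * y (nd n e j))) = h n e * gg a \<rho> (U e j)"
  proof -
    have "(\<Sum>e'\<in>E. \<Sum>j'\<le>n. h n e' * (gg a \<rho> (U e' j') * y (nd n e' j'))) = (\<Sum>e'\<in>E. if e' = e then (\<Sum>j'\<le>n. if j' = j then h n e * gg a \<rho> (U e j) else 0) else 0)"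
    proof (intro sum.cong refl)
      fix e' assume "e' \<in> E"
      show "(\<Sum>j'\<le>n. h n e' * (gg a \<rho> (U e' j') * y (nd n e' j'))) = (if e' = e then (\<Sum>j'\<le>n. if j' = j then h n e * gg a \<rho> (U e j) else 0) else 0)"
      proof (cases "e' = e")
        case True
        show ?thesis unfolding if_P[OF True] by (rule sum.cong) (auto simp: y True)
      qed (simp add: y)
    qed
    also have "\<dots> = h n e * gg a \<rho> (U e j)" using e finE j by simp
    finally show ?thesis .
  qed
  ultimately show ?thesis using weak_form[of y] by simp
qed

text \<open>Testing with the unit vector of a vertex leaves, besides the fluxes, the reaction terms
  at the two end nodes of each edge, each at most \<open>h n e * G0 c0\<close>; hence a defect of
  order \<open>1 / n\<close>.\<close>

lemma vertex_defect:
  assumes v: "v \<in> V"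
  shows "\<bar>(\<Sum>e\<in>{e\<in>E. s e = v}. VV e 0) - (\<Sum>e\<in>{e\<in>E. t e = v}. VV e (n - 1)) - a * N v * x (Inl v)\<bar> \<le> 2 * G0 c0 * LL / n"
proof -
  define y :: "'v + 'e \<times> nat \<Rightarrow> real" where "y = (\<lambda>i. if i = Inl v then 1 else 0)"
  have y0: "y (nd n e 0) = (if s e = v then 1 else 0)" and yn: "y (nd n e n) = (if t e = v then 1 else 0)" for e
    using n by (auto simp: y_def nd_def)
  have yj: "y (nd n e j) = 0" if "1 \<le> j" "j < n" for e j using that by (auto simp: y_def nd_def)
  have yb: "\<bar>y i\<bar> \<le> 1" for i by (simp add: y_def)
  have S: "SQ x y = N v * x (Inl v)"
  proof -
    have "SQ x y = (\<Sum>w\<in>V. if w = v then N v * x (Inl v) else 0)" unfolding SQ_def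
      by (intro sum.cong) (auto simp: y_def)
    then show ?thesis using v finV by simp
  qed
  have K: "(\<Sum>e\<in>E. VV e (n - 1) * y (nd n e n) - VV e 0 * y (nd n e 0) - (\<Sum>j\<in>{1..<n}. (VV e j - VV e (j - 1)) * y (nd n e j)))
    = (\<Sum>e\<in>{e\<in>E. t e = v}. VV e (n - 1)) - (\<Sum>e\<in>{e\<in>E. s e = v}. VV e 0)"
  proof -
    have z: "(\<Sum>j\<in>{1..<n}. (VV e j - VV e (j - 1)) * y (nd n e j)) = 0" for e
      by (intro sum.neutral) (auto simp: yj)
    have f1: "(\<Sum>e\<in>{e\<in>E. t e = v}. VV e (n - 1)) = (\<Sum>e\<in>E. if t e = v then VV e (n - 1) else 0)"
      by (rule sum.inter_filter[OF finE])
    have f2: "(\<Sum>e\<in>{e\<in>E. s e = v}. VV e 0) = (\<Sum>e\<in>E. if s e = v then VV e 0 else 0)"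
      by (rule sum.inter_filter[OF finE])
    show ?thesis unfolding z f1 f2 sum_subtractf[symmetric] by (intro sum.cong) (auto simp: y0 yn)
  qed
  have R: "\<bar>\<Sum>e\<in>E. \<Sum>j\<le>n. h n e * (gg a \<rho> (U e j) * y (nd n e j))\<bar> \<le> 2 * G0 c0 * LL / n"
  proof -
    have "\<bar>\<Sum>j\<le>n. h n e * (gg a \<rho> (U e j) * y (nd n e j))\<bar> \<le> h n e * (2 * G0 c0)" if e: "e \<in> E" for e
    proof -
      have g1: "\<bar>gg a \<rho> (U e j) * y (nd n e j)\<bar> \<le> G0 c0" if "j \<le> n" for j
        using mult_mono[OF g_bound[of "U e j"] yb[of "nd n e j"]] U_range[OF e that] const_nonneg(3)[OF c0] by (simp add: abs_mult)
      have "(\<Sum>j\<le>n. h n e * (gg a \<rho> (U e j) * y (nd n e j))) = (\<Sum>j\<in>{0, n}. h n e * (gg a \<rho> (U e j) * y (nd n e j)))"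
        by (rule sum.mono_neutral_right) (auto simp: yj)
      also have "\<dots> = h n e * (gg a \<rho> (U e 0) * y (nd n e 0) + gg a \<rho> (U e n) * y (nd n e n))" using n by (simp add: distrib_left)
      finally have "\<bar>\<Sum>j\<le>n. h n e * (gg a \<rho> (U e j) * y (nd n e j))\<bar> = h n e * \<bar>gg a \<rho> (U e 0) * y (nd n e 0) + gg a \<rho> (U e n) * y (nd n e n)\<bar>"
        using hp[OF e] by (simp add: abs_mult)
      also have "\<dots> \<le> h n e * (2 * G0 c0)" using g1[of 0] g1[of n] hp[OF e] by (intro mult_left_mono) auto
      finally show ?thesis .
    qed
    then have "\<bar>\<Sum>e\<in>E. \<Sum>j\<le>n. h n e * (gg a \<rho> (U e j) * y (nd n e j))\<bar> \<le> (\<Sum>e\<in>E. h n e * (2 * G0 c0))"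
      by (rule order_trans[OF sum_abs sum_mono])
    also have "\<dots> = 2 * G0 c0 * LL / n"
      unfolding h_def sum_distrib_right[symmetric] sum_divide_distrib[symmetric] LL_def by simp
    finally show ?thesis .
  qed
  show ?thesis using weak_form[of y] R unfolding K S by (simp add: mult.assoc)
qed

lemma VV_sum: "e \<in> E \<Longrightarrow> j < n \<Longrightarrow> VV e j = VV e 0 + (\<Sum>i<j. h n e * gg a \<rho> (U e (Suc i)))"
proof (induction j)
  case (Suc j)
  then show ?case using interior_eq[of e "Suc j"] by simp
qed simp

lemma hn_le: "e \<in> E \<Longrightarrow> j \<le> n \<Longrightarrow> real j * h n e \<le> el e"
  using mult_right_mono[of "real j" "real n" "h n e"] hp[of e] nh[of e] by simp

lemma VV_diff: assumes e: "e \<in> E" and j: "j < n" shows "\<bar>VV e j - VV e 0\<bar> \<le> LL * G0 c0"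
proof -
  have "\<bar>\<Sum>i<j. h n e * gg a \<rho> (U e (Suc i))\<bar> \<le> (\<Sum>i<j. h n e * G0 c0)"
  proof (intro order_trans[OF sum_abs] sum_mono)
    fix i assume "i \<in> {..<j}"
    then have "\<bar>gg a \<rho> (U e (Suc i))\<bar> \<le> G0 c0" using U_range[OF e, of "Suc i"] j by (intro g_bound) auto
    then show "\<bar>h n e * gg a \<rho> (U e (Suc i))\<bar> \<le> h n e * G0 c0" using hp[OF e] by (simp add: abs_mult)
  qed
  also have "\<dots> = (real j * h n e) * G0 c0" by simp
  also have "\<dots> \<le> LL * G0 c0"
    using hn_le[OF e, of j] LL_ge[OF e] j const_nonneg(3)[OF c0] by (intro mult_right_mono) auto
  finally show ?thesis using VV_sum[OF e j] by simp
qed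

lemma U_tele: "e \<in> E \<Longrightarrow> U e j = U e 0 + (\<Sum>i<j. h n e * VV e i)"
proof (induction j)
  case (Suc j)
  then show ?case using hp[of e] by (simp add: VV_def)
qed simp

text \<open>The mean slope over the edge is \<open>(U e n - U e 0) / el e\<close>, and every slope
  differs from the initial one by at most \<open>LL * G0 c0\<close>.\<close>

lemma VV_bound: assumes e: "e \<in> E" and j: "j < n" shows "\<bar>VV e j\<bar> \<le> V0 c0"
proof -
  have "U e n - U e 0 = (\<Sum>i<n. h n e * VV e i)" using U_tele[OF e, of n] by simp
  also have "\<dots> = el e * VV e 0 + (\<Sum>i<n. h n e * (VV e i - VV e 0))"
    by (simp add: right_diff_distrib sum_subtractf nh[symmetric])
  finally have "el e * VV e 0 = (U e n - U e 0) - (\<Sum>i<n. h n e * (VV e i - VV e 0))" by simp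
  moreover have "\<bar>\<Sum>i<n. h n e * (VV e i - VV e 0)\<bar> \<le> (\<Sum>i<n. h n e * (LL * G0 c0))"
  proof (intro order_trans[OF sum_abs] sum_mono)
    fix i assume "i \<in> {..<n}"
    then show "\<bar>h n e * (VV e i - VV e 0)\<bar> \<le> h n e * (LL * G0 c0)" using VV_diff[OF e, of i] hp[OF e] by (simp add: abs_mult)
  qed
  moreover have "(\<Sum>i<n. h n e * (LL * G0 c0)) = el e * (LL * G0 c0)" by (simp add: nh[symmetric])
  moreover have "\<bar>U e n - U e 0\<bar> \<le> B0 c0" using U_range[OF e, of 0] U_range[OF e, of n] by auto
  ultimately have "\<bar>el e * VV e 0\<bar> \<le> B0 c0 + el e * (LL * G0 c0)" by linarith
  then have "\<bar>VV e 0\<bar> \<le> B0 c0 * (1 / el e) + LL * G0 c0" using el_pos[OF e] by (simp add: abs_mult field_simps)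
  moreover have "B0 c0 * (1 / el e) \<le> B0 c0 * \<kappa>" using \<kappa>_ge[OF e] const_nonneg(1)[OF c0] by (intro mult_left_mono)
  ultimately show ?thesis using VV_diff[OF e j] unfolding V0_def by linarith
qed

text \<open>The piecewise linear interpolant, written as a sum of one clipped ramp per cell so that
  its continuity needs no gluing.\<close>

definition ip :: "'e \<Rightarrow> real \<Rightarrow> real" where
  "ip e y = U e 0 + (\<Sum>j<n. VV e j * max 0 (min (y - real j * h n e) (h n e)))"

lemma ip_cont: "continuous_on S (ip e)"
  unfolding ip_def[abs_def] by (intro continuous_intros)

lemma ip_cell:
  assumes e: "e \<in> E" and i: "i < n" and y: "y \<in> {real i * h n e..real (Suc i) * h n e}"
  shows "ip e y = U e i + VV e i * (y - real i * h n e)"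
proof -
  define g where "g = h n e"
  have g: "g > 0" using hp[OF e] by (simp add: g_def)
  define F where "F = (\<lambda>j. VV e j * max 0 (min (y - real j * g) g))"
  have late: "F j = 0" if "j \<ge> Suc i" for j
  proof -
    have "real (Suc i) * g \<le> real j * g" using that g by (intro mult_right_mono) auto
    then have "y \<le> real j * g" using y unfolding g_def by auto
    then have "max 0 (min (y - real j * g) g) = 0" by (simp add: max_absorb1 min.coboundedI1)
    then show ?thesis by (simp add: F_def)
  qed
  have early: "F j = g * VV e j" if "j < i" for j
  proof -
    have "real (Suc j) * g \<le> real i * g" using that g by (intro mult_right_mono) auto
    then have "g \<le> y - real j * g" using y by (simp add: g_def algebra_simps)
    then show ?thesis using g by (simp add: F_def)
  qed
  have mid: "F i = VV e i * (y - real i * g)" using y g by (simp add: F_def g_def algebra_simps)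
  have "(\<Sum>j<n. F j) = (\<Sum>j<Suc i. F j)"
    by (rule sum.mono_neutral_right) (use i late in auto)
  also have "\<dots> = (\<Sum>j<i. g * VV e j) + VV e i * (y - real i * g)" using early mid by simp
  finally show ?thesis using U_tele[OF e, of i] unfolding ip_def F_def g_def by simp
qed

lemma cell_exists:
  assumes e: "e \<in> E" and y: "y \<in> {0..el e}"
  obtains i where "i < n" "y \<in> {real i * h n e..real (Suc i) * h n e}"
proof (cases "y = el e")
  case True
  have "real (Suc (n - 1)) * h n e = el e" using n nh[of e] by simp
  moreover have "real (n - 1) * h n e \<le> real n * h n e" using hp[OF e] by (intro mult_right_mono) auto
  ultimately show thesis using that[of "n - 1"] n True nh[of e] by auto
next
  case False
  define i where "i = nat \<lfloor>y / h n e\<rfloor>"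
  have f0: "0 \<le> y / h n e" using y hp[OF e] by simp
  have "real i \<le> y / h n e" "y / h n e < real (Suc i)" using f0 unfolding i_def by linarith+
  then have iy: "real i * h n e \<le> y" "y < real (Suc i) * h n e" using hp[OF e] by (auto simp: field_simps)
  have "i < n"
  proof (rule ccontr)
    assume "\<not> i < n"
    then have "real n * h n e \<le> real i * h n e" using hp[OF e] by (intro mult_right_mono) auto
    then show False using iy y False nh[of e] by auto
  qed
  then show thesis using that[of i] iy by auto
qed

lemma ip_node: assumes e: "e \<in> E" and i: "i \<le> n" shows "ip e (real i * h n e) = U e i"
proof (cases "i < n")
  case True
  show ?thesis using ip_cell[OF e True, of "real i * h n e"] hp[OF e] by (simp add: algebra_simps)
next
  case False
  then have ii: "i = n" "n - 1 < n" "Suc (n - 1) = n" using i n by auto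
  have "ip e (real n * h n e) = U e (n - 1) + VV e (n - 1) * (real n * h n e - real (n - 1) * h n e)"
    by (rule ip_cell[OF e ii(2)]) (use ii(3) hp[OF e] in \<open>auto intro!: mult_right_mono\<close>)
  also have "real n * h n e - real (n - 1) * h n e = h n e" using n by (simp add: of_nat_diff algebra_simps)
  finally show ?thesis using hp[OF e] ii by (simp add: VV_def)
qed

lemma ip_range: assumes e: "e \<in> E" and y: "y \<in> {0..el e}" shows "0 \<le> ip e y \<and> ip e y \<le> B0 c0"
proof -
  obtain i where i: "i < n" "y \<in> {real i * h n e..real (Suc i) * h n e}" using cell_exists[OF e y] .
  define \<theta> where "\<theta> = (y - real i * h n e) / h n e"
  have \<theta>: "0 \<le> \<theta>" "\<theta> \<le> 1" using i hp[OF e] by (auto simp: \<theta>_def field_simps)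
  have "VV e i * (y - real i * h n e) = \<theta> * (U e (Suc i) - U e i)" by (simp add: VV_def \<theta>_def)
  then have "ip e y = (1 - \<theta>) * U e i + \<theta> * U e (Suc i)"
    using ip_cell[OF e i] by (simp add: algebra_simps)
  moreover have "0 \<le> (1 - \<theta>) * U e i + \<theta> * U e (Suc i)"
    using \<theta> U_range[OF e, of i] U_range[OF e, of "Suc i"] i by (intro add_nonneg_nonneg mult_nonneg_nonneg) auto
  moreover have "(1 - \<theta>) * U e i \<le> (1 - \<theta>) * B0 c0" "\<theta> * U e (Suc i) \<le> \<theta> * B0 c0"
    using \<theta> U_range[OF e, of i] U_range[OF e, of "Suc i"] i by (auto intro!: mult_left_mono)
  then have "(1 - \<theta>) * U e i + \<theta> * U e (Suc i) \<le> B0 c0" by (simp add: algebra_simps)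
  ultimately show ?thesis by simp
qed

lemma ip_osc:
  assumes e: "e \<in> E" and i: "i < n" and y: "y \<in> {real i * h n e..real (Suc i) * h n e}"
  shows "\<bar>ip e y - U e (Suc i)\<bar> \<le> V0 c0 * h n e"
proof -
  have "U e (Suc i) = U e i + VV e i * h n e" using hp[OF e] by (simp add: VV_def)
  then have "ip e y - U e (Suc i) = VV e i * (y - real (Suc i) * h n e)"
    using ip_cell[OF e i y] by (simp add: algebra_simps)
  then have "\<bar>ip e y - U e (Suc i)\<bar> = \<bar>VV e i\<bar> * \<bar>y - real (Suc i) * h n e\<bar>" by (simp add: abs_mult)
  also have "\<dots> \<le> V0 c0 * h n e"
    using VV_bound[OF e i] y const_nonneg(4)[OF c0] by (intro mult_mono) (auto simp: algebra_simps)
  finally show ?thesis .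
qed

lemma h_le: "e \<in> E \<Longrightarrow> h n e \<le> LL / n"
  unfolding h_def using LL_ge n by (intro divide_right_mono) auto

lemma composite_riemann:
  assumes e: "e \<in> E" and c: "continuous_on {0..el e} (\<lambda>y. f (ip e y))"
    and L: "\<And>a b. 0 \<le> a \<Longrightarrow> a \<le> B0 c0 \<Longrightarrow> 0 \<le> b \<Longrightarrow> b \<le> B0 c0 \<Longrightarrow> \<bar>f a - f b\<bar> \<le> K * \<bar>a - b\<bar>" and K: "K \<ge> 0"
    and i: "i \<le> n"
  shows "\<bar>(\<Sum>j<i. h n e * f (U e (Suc j))) - integral {0..real i * h n e} (\<lambda>y. f (ip e y))\<bar> \<le> K * (V0 c0 * LL * LL) / n"
proof -
  have "\<bar>(\<Sum>j<i. h n e * f (ip e (real (Suc j) * h n e))) - integral {0..real i * h n e} (\<lambda>y. f (ip e y))\<bar> \<le> (K * (V0 c0 * h n e)) * (real i * h n e)"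
  proof (rule riemann_sum_error[OF hp[OF e] _ _ i])
    show "continuous_on {0..real n * h n e} (\<lambda>y. f (ip e y))" using c by (simp add: nh)
    fix j y assume j: "j < n" and y: "y \<in> {real j * h n e..real (Suc j) * h n e}"
    have yin: "y \<in> {0..el e}" using y hn_le[OF e, of "Suc j"] j hp[OF e]
      by (auto intro: order_trans[rotated])
    have "\<bar>f (ip e y) - f (U e (Suc j))\<bar> \<le> K * \<bar>ip e y - U e (Suc j)\<bar>"
      using ip_range[OF e yin] U_range[OF e, of "Suc j"] j by (intro L) auto
    also have "\<dots> \<le> K * (V0 c0 * h n e)" using ip_osc[OF e j y] K by (intro mult_left_mono)
    finally show "\<bar>f (ip e y) - f (ip e (real (Suc j) * h n e))\<bar> \<le> K * (V0 c0 * h n e)"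
      using ip_node[OF e, of "Suc j"] j by simp
  qed
  also have "(\<Sum>j<i. h n e * f (ip e (real (Suc j) * h n e))) = (\<Sum>j<i. h n e * f (U e (Suc j)))"
    by (intro sum.cong refl) (use ip_node[OF e] i in \<open>auto simp del: of_nat_Suc\<close>)
  also have "(K * (V0 c0 * h n e)) * (real i * h n e) \<le> (K * (V0 c0 * (LL / n))) * LL"
    using K const_nonneg(4)[OF c0] h_le[OF e] hn_le[OF e i] LL_ge[OF e] hp[OF e] LL_pos
    by (intro mult_mono mult_left_mono mult_nonneg_nonneg) auto
  also have "\<dots> = K * (V0 c0 * LL * LL) / n" by simp
  finally show ?thesis .
qed

lemma gg_lipschitz:
  assumes "0 \<le> y" "y \<le> B0 c0" "0 \<le> z" "z \<le> B0 c0"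
  shows "\<bar>gg a \<rho> y - gg a \<rho> z\<bar> \<le> Lg c0 * \<bar>y - z\<bar>"
proof -
  have "\<bar>y powr (p - 1) - z powr (p - 1)\<bar> \<le> (p - 1) * B0 c0 powr (p - 1 - 1) * \<bar>y - z\<bar>"
    by (rule powr_lipschitz) (use assms p6 in auto)
  then have "\<rho> * \<bar>y powr (p - 1) - z powr (p - 1)\<bar> \<le> 1 * ((p - 1) * B0 c0 powr (p - 2) * \<bar>y - z\<bar>)"
    using \<rho> by (intro mult_mono) auto
  moreover have "a\<^sup>2 * \<bar>y - z\<bar> \<le> (A0 c0)\<^sup>2 * \<bar>y - z\<bar>"
    using a_bound a_pos by (intro mult_right_mono power_mono) auto
  moreover have "\<bar>gg a \<rho> y - gg a \<rho> z\<bar> \<le> a\<^sup>2 * \<bar>y - z\<bar> + \<rho> * \<bar>y powr (p - 1) - z powr (p - 1)\<bar>"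
  proof -
    have "gg a \<rho> y - gg a \<rho> z = a\<^sup>2 * (y - z) - \<rho> * (y powr (p - 1) - z powr (p - 1))"
      by (simp add: gg_def algebra_simps)
    also have "\<bar>\<dots>\<bar> \<le> \<bar>a\<^sup>2 * (y - z)\<bar> + \<bar>\<rho> * (y powr (p - 1) - z powr (p - 1))\<bar>" by (rule abs_triangle_ineq4)
    finally show ?thesis using \<rho> by (simp add: abs_mult)
  qed
  ultimately show ?thesis unfolding Lg_def distrib_right by simp
qed

lemma sq_lipschitz:
  assumes "0 \<le> y" "y \<le> B0 c0" "0 \<le> z" "z \<le> B0 c0"
  shows "\<bar>y\<^sup>2 - z\<^sup>2\<bar> \<le> (2 * B0 c0) * \<bar>y - z\<bar>"
proof -
  have "\<bar>y\<^sup>2 - z\<^sup>2\<bar> = \<bar>y + z\<bar> * \<bar>y - z\<bar>" by (simp add: power2_eq_square square_diff_square_factored abs_mult)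
  also have "\<dots> \<le> (2 * B0 c0) * \<bar>y - z\<bar>" using assms by (intro mult_right_mono) auto
  finally show ?thesis .
qed

lemma gg_ip_cont: "e \<in> E \<Longrightarrow> continuous_on {0..el e} (\<lambda>y. gg a \<rho> (ip e y))"
  by (rule gg_cont[OF ip_cont]) (use ip_range in auto)

definition err where "err = (Lg c0 * (V0 c0 * LL * LL) + LL * G0 c0) / n"

lemma err_nonneg: "0 \<le> err"
  unfolding err_def using const_nonneg[OF c0] LL_pos by (intro divide_nonneg_nonneg add_nonneg_nonneg mult_nonneg_nonneg) auto

text \<open>By the difference equation the increments of the slope form a Riemann sum of the
  reaction term; the error consists of the Riemann error up to the node and of the part of one cell
  beyond it.\<close>

lemma slope_error:
  assumes e: "e \<in> E" and i: "i < n" and y: "y \<in> {real i * h n e..real (Suc i) * h n e}"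
  shows "\<bar>VV e i - VV e 0 - Gi a \<rho> ip e y\<bar> \<le> err"
proof -
  have yel: "real i * h n e \<le> y" "y \<le> el e" "0 \<le> real i * h n e"
    using y hn_le[OF e, of "Suc i"] i hp[OF e] by auto
  have c: "continuous_on {0..y} (\<lambda>y. gg a \<rho> (ip e y))"
    by (rule continuous_on_subset[OF gg_ip_cont[OF e]]) (use yel in auto)
  have "Gi a \<rho> ip e y = integral {0..real i * h n e} (\<lambda>y. gg a \<rho> (ip e y)) + integral {real i * h n e..y} (\<lambda>y. gg a \<rho> (ip e y))"
    unfolding Gi_def
    by (rule Henstock_Kurzweil_Integration.integral_combine[OF yel(3,1) integrable_continuous_interval[OF c], symmetric])
  moreover have "norm (integral {real i * h n e..y} (\<lambda>y. gg a \<rho> (ip e y))) \<le> G0 c0 * (y - real i * h n e)"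
  proof (rule integral_bound[OF yel(1) continuous_on_subset[OF gg_ip_cont[OF e]]])
    fix z assume "z \<in> {real i * h n e..y}"
    then have "z \<in> {0..el e}" using yel by auto
    then show "norm (gg a \<rho> (ip e z)) \<le> G0 c0" using g_bound[of "ip e z"] ip_range[OF e] by auto
  qed (use yel in auto)
  moreover have "G0 c0 * (y - real i * h n e) \<le> G0 c0 * (LL / n)"
    using y h_le[OF e] const_nonneg(3)[OF c0] by (intro mult_left_mono) (auto simp: algebra_simps)
  moreover have "\<bar>(\<Sum>j<i. h n e * gg a \<rho> (U e (Suc j))) - integral {0..real i * h n e} (\<lambda>y. gg a \<rho> (ip e y))\<bar> \<le> Lg c0 * (V0 c0 * LL * LL) / n"
    by (rule composite_riemann[OF e gg_ip_cont[OF e] gg_lipschitz]) (use const_nonneg[OF c0] i in auto)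
  moreover have "VV e i - VV e 0 = (\<Sum>j<i. h n e * gg a \<rho> (U e (Suc j)))" using VV_sum[OF e i] by simp
  moreover have "err = Lg c0 * (V0 c0 * LL * LL) / n + G0 c0 * (LL / n)" by (simp add: err_def add_divide_distrib mult.commute)
  ultimately show ?thesis by simp
qed

text \<open>The difference of the two sides vanishes at 0 and has slope at most \<open>err\<close>
  on every cell by \<open>slope_error\<close>, so it grows at most linearly, cell after
  cell.\<close>

lemma ip_formula:
  assumes e: "e \<in> E" and y: "y \<in> {0..el e}"
  shows "\<bar>ip e y - (U e 0 + VV e 0 * y + integral {0..y} (Gi a \<rho> ip e))\<bar> \<le> err * LL"
proof -
  define D where "D = (\<lambda>y. ip e y - (U e 0 + VV e 0 * y + integral {0..y} (Gi a \<rho> ip e)))"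
  have Gc: "continuous_on {0..el e} (Gi a \<rho> ip e)" by (rule Gi_cont[OF ip_cont]) (use ip_range[OF e] in auto)
  have step: "\<bar>D z - D (real i * h n e)\<bar> \<le> err * (z - real i * h n e)"
    if i: "i < n" and z: "z \<in> {real i * h n e..real (Suc i) * h n e}" for i z
  proof -
    let ?S = "{real i * h n e..real (Suc i) * h n e}"
    have S: "?S \<subseteq> {0..el e}" using hn_le[OF e, of "Suc i"] i hp[OF e] by (auto intro: order_trans[rotated])
    have "norm (D z - D (real i * h n e)) \<le> err * norm (z - real i * h n e)"
    proof (rule field_differentiable_bound[where S = ?S])
      fix w assume w: "w \<in> ?S"
      have "((\<lambda>y. U e i + VV e i * (y - real i * h n e)) has_real_derivative VV e i) (at w within ?S)"
        by (auto intro!: derivative_eq_intros)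
      then have 1: "(ip e has_real_derivative VV e i) (at w within ?S)"
        by (rule has_field_derivative_transform_within[OF _ zero_less_one w]) (simp add: ip_cell[OF e i])
      have "((\<lambda>y. integral {0..y} (Gi a \<rho> ip e)) has_real_derivative Gi a \<rho> ip e w) (at w within {0..el e})"
        by (rule integral_has_real_derivative[OF Gc]) (use S w in auto)
      then have 2: "((\<lambda>y. integral {0..y} (Gi a \<rho> ip e)) has_real_derivative Gi a \<rho> ip e w) (at w within ?S)"
        by (rule DERIV_subset[OF _ S])
      show "(D has_field_derivative (VV e i - VV e 0 - Gi a \<rho> ip e w)) (at w within ?S)"
      proof -
        have "(D has_field_derivative (VV e i - (0 + VV e 0 * 1 + Gi a \<rho> ip e w))) (at w within ?S)"
          unfolding D_def by (intro DERIV_diff DERIV_add DERIV_const DERIV_cmult DERIV_ident 1 2)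
        then show ?thesis by (simp add: diff_diff_eq)
      qed
      show "norm (VV e i - VV e 0 - Gi a \<rho> ip e w) \<le> err" using slope_error[OF e i w] by simp
    qed (use z hp[OF e] in auto)
    then show ?thesis using z by simp
  qed
  have nodes: "\<bar>D (real i * h n e)\<bar> \<le> err * (real i * h n e)" if "i \<le> n" for i
    using that
  proof (induction i)
    case 0
    show ?case using ip_node[OF e, of 0] by (simp add: D_def)
  next
    case (Suc i)
    have "\<bar>D (real (Suc i) * h n e) - D (real i * h n e)\<bar> \<le> err * (real (Suc i) * h n e - real i * h n e)"
      by (rule step) (use Suc.prems hp[OF e] in auto)
    then show ?case using Suc by (simp add: algebra_simps)
  qed
  obtain i where i: "i < n" "y \<in> {real i * h n e..real (Suc i) * h n e}" using cell_exists[OF e y] .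
  have "\<bar>D y\<bar> \<le> err * y" using step[OF i] nodes[of i] i(1) by (simp add: algebra_simps)
  also have "\<dots> \<le> err * LL" using y LL_ge[OF e] err_nonneg by (intro mult_left_mono) auto
  finally show ?thesis by (simp add: D_def)
qed

lemma total_riemann:
  assumes c: "\<And>e. e \<in> E \<Longrightarrow> continuous_on {0..el e} (\<lambda>y. f (ip e y))"
    and L: "\<And>a b. 0 \<le> a \<Longrightarrow> a \<le> B0 c0 \<Longrightarrow> 0 \<le> b \<Longrightarrow> b \<le> B0 c0 \<Longrightarrow> \<bar>f a - f b\<bar> \<le> K * \<bar>a - b\<bar>" and K: "K \<ge> 0"
    and f: "\<And>z. 0 \<le> z \<Longrightarrow> z \<le> B0 c0 \<Longrightarrow> \<bar>f z\<bar> \<le> F"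
  shows "\<bar>(\<Sum>e\<in>E. \<Sum>j\<le>n. h n e * f (U e j)) - (\<Sum>e\<in>E. integral {0..el e} (\<lambda>y. f (ip e y)))\<bar>
    \<le> (card E * (K * (V0 c0 * LL * LL)) + LL * F) / n"
proof -
  have "\<bar>(\<Sum>j\<le>n. h n e * f (U e j)) - integral {0..el e} (\<lambda>y. f (ip e y))\<bar> \<le> K * (V0 c0 * LL * LL) / n + el e * F / n"
    if e: "e \<in> E" for e
  proof -
    have "(\<Sum>j\<le>n. h n e * f (U e j)) = h n e * f (U e 0) + (\<Sum>j<n. h n e * f (U e (Suc j)))"
      by (simp add: sum.atMost_shift)
    moreover have "\<bar>h n e * f (U e 0)\<bar> \<le> el e * F / n"
      using mult_left_mono[OF f[of "U e 0"], of "h n e"] U_range[OF e, of 0] hp[OF e] el_pos[OF e] by (simp add: abs_mult h_def abs_of_pos)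
    moreover have "\<bar>(\<Sum>j<n. h n e * f (U e (Suc j))) - integral {0..real n * h n e} (\<lambda>y. f (ip e y))\<bar> \<le> K * (V0 c0 * LL * LL) / n"
      by (rule composite_riemann[OF e c[OF e] L K]) auto
    ultimately show ?thesis by (simp add: nh)
  qed
  then have "\<bar>\<Sum>e\<in>E. ((\<Sum>j\<le>n. h n e * f (U e j)) - integral {0..el e} (\<lambda>y. f (ip e y)))\<bar> \<le> (\<Sum>e\<in>E. K * (V0 c0 * LL * LL) / n + el e * F / n)"
    by (rule order_trans[OF sum_abs sum_mono])
  also have "\<dots> = (card E * (K * (V0 c0 * LL * LL)) + LL * F) / n"
    by (simp add: sum.distrib LL_def sum_distrib_right sum_divide_distrib add_divide_distrib)
  finally show ?thesis by (simp add: sum_subtractf)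
qed

definition EM where "EM = (card E * (2 * B0 c0 * (V0 c0 * LL * LL)) + LL * (B0 c0)\<^sup>2) / n"
definition EP where "EP = (card E * (Lp c0 * (V0 c0 * LL * LL)) + LL * B0 c0 powr p) / n"

lemma Mass_error: "\<bar>MQ n x x - Mass ip\<bar> \<le> EM"
proof -
  have "MQ n x x = (\<Sum>e\<in>E. \<Sum>j\<le>n. h n e * (U e j)\<^sup>2)" by (simp add: MQ_def U_def power2_eq_square)
  moreover have "\<bar>(\<Sum>e\<in>E. \<Sum>j\<le>n. h n e * (\<lambda>z. z\<^sup>2) (U e j)) - (\<Sum>e\<in>E. integral {0..el e} (\<lambda>y. (\<lambda>z. z\<^sup>2) (ip e y)))\<bar> \<le> EM"
    unfolding EM_def
    by (rule total_riemann[where f = "\<lambda>z. z\<^sup>2"])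
       (use const_nonneg(1)[OF c0] sq_lipschitz in \<open>auto intro!: continuous_intros ip_cont power_mono\<close>)
  ultimately show ?thesis by (simp add: Mass_def)
qed

lemma Pow_error: "\<bar>p * BB n x - Pow ip\<bar> \<le> EP"
proof -
  have "p * BB n x = (\<Sum>e\<in>E. \<Sum>j\<le>n. h n e * (U e j powr p))"
    unfolding BB_def sum_distrib_left
  proof (intro sum.cong refl)
    fix e j assume "e \<in> E" "j \<in> {..n}"
    then have "U e j \<ge> 0" using U_nonneg by simp
    then show "p * (h n e * ((max 0 (x (nd n e j))) powr p / p)) = h n e * (U e j powr p)"
      using p6 by (simp add: U_def)
  qed
  moreover have "\<bar>(\<Sum>e\<in>E. \<Sum>j\<le>n. h n e * (\<lambda>z. z powr p) (U e j)) - (\<Sum>e\<in>E. integral {0..el e} (\<lambda>y. (\<lambda>z. z powr p) (ip e y)))\<bar> \<le> EP"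
    unfolding EP_def
  proof (rule total_riemann[where f = "\<lambda>z. z powr p"])
    show "continuous_on {0..el e} (\<lambda>y. ip e y powr p)" if "e \<in> E" for e
      by (rule continuous_on_powr_nonneg[OF ip_cont]) (use ip_range[OF that] p6 in auto)
    show "\<bar>a powr p - b powr p\<bar> \<le> Lp c0 * \<bar>a - b\<bar>" if "0 \<le> a" "a \<le> B0 c0" "0 \<le> b" "b \<le> B0 c0" for a b
      unfolding Lp_def by (rule powr_lipschitz) (use that p6 in auto)
    show "0 \<le> Lp c0" by (rule const_nonneg(6)[OF c0])
    show "\<bar>z powr p\<bar> \<le> B0 c0 powr p" if "0 \<le> z" "z \<le> B0 c0" for z using that p6 by (simp add: powr_mono2)
  qed
  ultimately show ?thesis by (simp add: Pow_def)
qed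

definition cc where "cc v = x (Inl v)"

lemma Sc_eq: "Sc cc = SQ x x" by (simp add: Sc_def SQ_def cc_def power2_eq_square)

lemma mass_id: "2 * a * (\<mu> - MQ n x x) = SQ x x + \<epsilon>"
proof -
  have "2 * (Q / (2 * P)) * P = Q" if "P > 0" for P Q :: real using that by simp
  from this[OF P_pos] show ?thesis unfolding a_def aa_def .
qed

text \<open>The tail term equals \<open>a * (SQ x x + \<epsilon>) / 4\<close>, and the virial
  identity removes \<open>KQ\<close>. What appears is the discrete counterpart of \<open>En\<close>,
  with \<open>a * \<epsilon> / 4\<close> as the only remainder.\<close>

lemma energy_id: "AA n \<epsilon> x - \<rho> * BB n x = (1/2 - 1/p) * (\<rho> * (p * BB n x)) - a * SQ x x / 4 - a\<^sup>2 * MQ n x x / 2 + a * \<epsilon> / 4"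
proof -
  have e1: "(SQ x x + \<epsilon>)\<^sup>2 / (8 * (\<mu> - MQ n x x)) = a * (SQ x x + \<epsilon>) / 4"
    using P_pos by (simp add: a_def aa_def power2_eq_square)
  have e2: "(1/2 - 1/p) * (\<rho> * (p * BB n x)) = \<rho> * (p * BB n x) / 2 - \<rho> * BB n x"
    using p6 by (simp add: algebra_simps)
  have e3: "a * (SQ x x + \<epsilon>) = a * SQ x x + a * \<epsilon>" by (simp add: distrib_left)
  show ?thesis unfolding AA_def e1 e2 using virial e3 by linarith
qed

lemma En_error: "\<bar>En a \<rho> ip cc - (AA n \<epsilon> x - \<rho> * BB n x)\<bar> \<le> EP + (A0 c0)\<^sup>2 * EM + A0 c0 * \<epsilon>"
proof -
  have d: "En a \<rho> ip cc - (AA n \<epsilon> x - \<rho> * BB n x) = (1/2 - 1/p) * \<rho> * (Pow ip - p * BB n x) + a\<^sup>2 / 2 * (MQ n x x - Mass ip) - a * \<epsilon> / 4"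
    unfolding energy_id En_def Sc_eq by (simp add: field_simps)
  have "\<bar>(1/2 - 1/p) * \<rho> * (Pow ip - p * BB n x)\<bar> \<le> EP"
  proof -
    have k1: "0 \<le> 1/2 - 1/p" "1/2 - 1/p \<le> 1" using p6 by (auto simp: field_simps)
    have k: "0 \<le> (1/2 - 1/p) * \<rho>" "(1/2 - 1/p) * \<rho> \<le> 1"
      using \<rho> by (auto intro: mult_le_one[OF k1(2)] mult_nonneg_nonneg[OF k1(1)])
    have "\<bar>(1/2 - 1/p) * \<rho> * (Pow ip - p * BB n x)\<bar> = (1/2 - 1/p) * \<rho> * \<bar>Pow ip - p * BB n x\<bar>"
      unfolding abs_mult[of "(1/2 - 1/p) * \<rho>"] using k by simp
    also have "\<dots> \<le> 1 * EP" using k Pow_error by (intro mult_mono) auto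
    finally show ?thesis by simp
  qed
  moreover have "\<bar>a\<^sup>2 / 2 * (MQ n x x - Mass ip)\<bar> \<le> (A0 c0)\<^sup>2 * EM"
  proof -
    have "a\<^sup>2 \<le> (A0 c0)\<^sup>2" using a_bound a_pos by (intro power_mono) auto
    then have "a\<^sup>2 / 2 \<le> (A0 c0)\<^sup>2" using zero_le_power2[of a] by linarith
    then have "a\<^sup>2 / 2 * \<bar>MQ n x x - Mass ip\<bar> \<le> (A0 c0)\<^sup>2 * EM" using Mass_error by (intro mult_mono) auto
    then show ?thesis by (simp add: abs_mult)
  qed
  moreover have "\<bar>a * \<epsilon> / 4\<bar> \<le> A0 c0 * \<epsilon>"
    using mult_right_mono[OF a_bound, of \<epsilon>] a_pos \<epsilon> by simp
  ultimately show ?thesis unfolding d by linarith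
qed

lemma last_slope: assumes e: "e \<in> E" shows "\<bar>VV e (n - 1) - (VV e 0 + Gi a \<rho> ip e (el e))\<bar> \<le> err"
proof -
  have "\<bar>VV e (n - 1) - VV e 0 - Gi a \<rho> ip e (el e)\<bar> \<le> err"
    by (rule slope_error[OF e]) (use n nh[of e] hp[OF e] in \<open>auto intro: mult_right_mono simp: nh[symmetric]\<close>)
  then show ?thesis by simp
qed

lemma approx_ip:
  assumes "err * LL \<le> \<eta>" "2 * G0 c0 * LL / n + card E * err \<le> \<eta>" "2 * A0 c0 * EM + \<epsilon> \<le> \<eta>"
  shows "approx \<eta> a \<rho> ip cc (\<lambda>e. VV e 0)"
  unfolding approx_def
proof (intro conjI ballI)
  fix e assume e: "e \<in> E"
  show "continuous_on {0..el e} (ip e)" by (rule ip_cont)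
  show "ip e 0 = cc (s e)" using ip_node[OF e, of 0] by (simp add: U_ends cc_def)
  show "ip e (el e) = cc (t e)" using ip_node[OF e, of n] by (simp add: U_ends cc_def nh)
  fix y assume y: "y \<in> {0..el e}"
  show "0 \<le> ip e y" using ip_range[OF e y] by simp
  show "\<bar>ip e y - (cc (s e) + VV e 0 * y + integral {0..y} (Gi a \<rho> ip e))\<bar> \<le> \<eta>"
    using ip_formula[OF e y] assms(1) by (simp add: U_ends cc_def)
next
  fix v assume v: "v \<in> V"
  have "\<bar>(\<Sum>e\<in>{e\<in>E. t e = v}. VV e (n - 1)) - (\<Sum>e\<in>{e\<in>E. t e = v}. VV e 0 + Gi a \<rho> ip e (el e))\<bar> \<le> (\<Sum>e\<in>{e\<in>E. t e = v}. err)"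
    unfolding sum_subtractf[symmetric] by (rule order_trans[OF sum_abs sum_mono]) (use last_slope in auto)
  also have "\<dots> \<le> card E * err" using err_nonneg card_mono[OF finE, of "{e\<in>E. t e = v}"] by (simp add: mult_right_mono)
  finally show "\<bar>(\<Sum>e\<in>{e\<in>E. s e = v}. VV e 0) - (\<Sum>e\<in>{e\<in>E. t e = v}. VV e 0 + Gi a \<rho> ip e (el e)) - a * N v * cc v\<bar> \<le> \<eta>"
    using vertex_defect[OF v] assms(2) unfolding cc_def by linarith
next
  have "\<bar>2 * a * (MQ n x x - Mass ip)\<bar> \<le> 2 * A0 c0 * EM"
    using mult_mono[OF a_bound Mass_error] a_pos const_nonneg(2)[OF c0] by (simp add: abs_mult)
  moreover have "2 * a * (\<mu> - Mass ip) - Sc cc = 2 * a * (MQ n x x - Mass ip) + \<epsilon>"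
    using mass_id unfolding Sc_eq by (simp add: algebra_simps)
  ultimately show "\<bar>2 * a * (\<mu> - Mass ip) - Sc cc\<bar> \<le> \<eta>" using assms(3) \<epsilon> by linarith
qed

end

text \<open>\<open>K\<close> is fixed before \<open>n\<close>, \<open>\<epsilon>\<close> and
  \<open>\<rho>\<close>, so along a refinement with \<open>\<epsilon>\<close> tending to 0 the
  defects vanish while the bounds on \<open>a\<close> and \<open>u\<close> stay put.\<close>

lemma (in core_graph) discrete_to_approx:
  assumes c0: "c0 \<ge> 0"
  shows "\<exists>K\<ge>0. \<forall>n \<epsilon> \<rho> x. n > 0 \<longrightarrow> 0 < \<epsilon> \<longrightarrow> \<epsilon> \<le> 1 \<longrightarrow> 1/2 \<le> \<rho> \<longrightarrow> \<rho> \<le> 1 \<longrightarrow> x \<in> DD n \<longrightarrow>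
    (\<forall>y. dA n \<epsilon> x y = \<rho> * dB n x y) \<longrightarrow> AA n \<epsilon> x \<le> c0 \<longrightarrow> BB n x \<le> c0 \<longrightarrow>
    (\<exists>a u c d. approx (K * (\<epsilon> + 1 / n)) a \<rho> u c d \<and> 0 \<le> a \<and> a \<le> A0 c0 \<and>
       (\<forall>e\<in>E. \<forall>y\<in>{0..el e}. u e y \<le> B0 c0) \<and>
       \<bar>En a \<rho> u c - (AA n \<epsilon> x - \<rho> * BB n x)\<bar> \<le> K * (\<epsilon> + 1 / n))"
proof -
  note cn = const_nonneg[OF c0]
  define k1 where "k1 = Lg c0 * (V0 c0 * LL * LL) + LL * G0 c0"
  define kM where "kM = card E * (2 * B0 c0 * (V0 c0 * LL * LL)) + LL * (B0 c0)\<^sup>2"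
  define kP where "kP = card E * (Lp c0 * (V0 c0 * LL * LL)) + LL * B0 c0 powr p"
  have k0: "k1 \<ge> 0" "kM \<ge> 0" "kP \<ge> 0"
    unfolding k1_def kM_def kP_def using cn LL_pos by (auto intro!: add_nonneg_nonneg mult_nonneg_nonneg)
  \<comment> \<open>The sum of the constants of all four error estimates, so that a single defect
    serves edges, vertices, mass and energy.\<close>
  define K where "K = k1 * LL + (2 * G0 c0 * LL + card E * k1) + (2 * A0 c0 * kM + 1) + (kP + (A0 c0)\<^sup>2 * kM + A0 c0)"
  have parts: "0 \<le> k1 * LL" "0 \<le> 2 * G0 c0 * LL + card E * k1" "0 \<le> 2 * A0 c0 * kM" "0 \<le> kP + (A0 c0)\<^sup>2 * kM"
    using cn k0 LL_pos by (auto intro!: add_nonneg_nonneg mult_nonneg_nonneg)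
  have K0: "K \<ge> 0" using parts cn unfolding K_def by linarith
  have main: "\<exists>a u c d. approx (K * (\<epsilon> + 1 / n)) a \<rho> u c d \<and> 0 \<le> a \<and> a \<le> A0 c0 \<and>
       (\<forall>e\<in>E. \<forall>y\<in>{0..el e}. u e y \<le> B0 c0) \<and>
       \<bar>En a \<rho> u c - (AA n \<epsilon> x - \<rho> * BB n x)\<bar> \<le> K * (\<epsilon> + 1 / n)"
    if n: "n > 0" and H: "0 < \<epsilon>" "\<epsilon> \<le> 1" "1/2 \<le> \<rho>" "\<rho> \<le> 1" "x \<in> DD n" "\<forall>y. dA n \<epsilon> x y = \<rho> * dB n x y" "AA n \<epsilon> x \<le> c0" "BB n x \<le> c0"
    for n :: nat and \<epsilon> \<rho> :: real and x
  proof -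
    interpret discrete_solution V E el s t N p \<mu> n \<epsilon> \<rho> c0 x by unfold_locales (use n H in auto)
    have Kn: "q / n + w * \<epsilon> \<le> K * (\<epsilon> + 1 / n)" if "q \<le> K" "w \<le> K" for q w
    proof -
      have "q / n \<le> K * (1 / n)" using that by (simp add: divide_right_mono)
      moreover have "w * \<epsilon> \<le> K * \<epsilon>" using that H by (intro mult_right_mono) auto
      ultimately show ?thesis by (simp add: distrib_left)
    qed
    have errk: "err = k1 / n" by (simp add: err_def k1_def)
    have "approx (K * (\<epsilon> + 1 / n)) a \<rho> ip cc (\<lambda>e. VV e 0)"
    proof (rule approx_ip)
      have "err * LL = (k1 * LL) / n + 0 * \<epsilon>" by (simp add: err_def k1_def)
      also have "\<dots> \<le> K * (\<epsilon> + 1 / n)" by (rule Kn; unfold K_def; use parts cn in linarith)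
      finally show "err * LL \<le> K * (\<epsilon> + 1 / n)" .
      have "2 * G0 c0 * LL / n + card E * err = (2 * G0 c0 * LL + card E * k1) / n + 0 * \<epsilon>"
        using errk by (simp add: add_divide_distrib)
      also have "\<dots> \<le> K * (\<epsilon> + 1 / n)" by (rule Kn; unfold K_def; use parts cn in linarith)
      finally show "2 * G0 c0 * LL / n + card E * err \<le> K * (\<epsilon> + 1 / n)" .
      have "2 * A0 c0 * EM + \<epsilon> = (2 * A0 c0 * kM) / n + 1 * \<epsilon>" by (simp add: EM_def kM_def)
      also have "\<dots> \<le> K * (\<epsilon> + 1 / n)" by (rule Kn; unfold K_def; use parts cn in linarith)
      finally show "2 * A0 c0 * EM + \<epsilon> \<le> K * (\<epsilon> + 1 / n)" .
    qed
    moreover have "\<bar>En a \<rho> ip cc - (AA n \<epsilon> x - \<rho> * BB n x)\<bar> \<le> K * (\<epsilon> + 1 / n)"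
    proof -
      have "EP + (A0 c0)\<^sup>2 * EM + A0 c0 * \<epsilon> = (kP + (A0 c0)\<^sup>2 * kM) / n + A0 c0 * \<epsilon>"
      proof -
        have "EP = kP / n" "EM = kM / n" by (simp_all add: EP_def EM_def kP_def kM_def)
        then show ?thesis by (simp add: add_divide_distrib)
      qed
      also have "\<dots> \<le> K * (\<epsilon> + 1 / n)" by (rule Kn; unfold K_def; use parts cn in linarith)
      finally show ?thesis using En_error by linarith
    qed
    moreover have "0 \<le> a" "a \<le> A0 c0" using a_pos a_bound by auto
    moreover have "\<forall>e\<in>E. \<forall>y\<in>{0..el e}. ip e y \<le> B0 c0" using ip_range by blast
    ultimately show ?thesis
      by (intro exI[of _ a] exI[of _ ip] exI[of _ cc] exI[of _ "\<lambda>e. VV e 0"] conjI)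
  qed
  show ?thesis
    by (rule exI[of _ K], rule conjI[OF K0]) (intro allI impI, rule main)
qed

section \<open>A priori bounds\<close>

text \<open>Used with \<open>q = 2 * (p - 4) / (p - 2)\<close>, which is below 2: the quadratic term
  in the lower bound for the energy then dominates the rest for large \<open>a\<close>.\<close>

lemma quadratic_dominates:
  fixes k1 k2 k3 \<sigma> q :: real
  assumes "\<sigma> > 0" "q < 2"
  shows "\<exists>X>0. \<forall>x\<ge>X. k1 * x + k2 * x powr q + k3 < \<sigma> * x\<^sup>2"
proof -
  have "((\<lambda>x::real. k1 * x powr (-1) + k2 * x powr (q - 2) + k3 * x powr (-2)) \<longlongrightarrow> k1 * 0 + k2 * 0 + k3 * 0) at_top"
    by (intro tendsto_intros tendsto_neg_powr filterlim_ident) (use assms in auto)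
  then have "eventually (\<lambda>x::real. k1 * x powr (-1) + k2 * x powr (q - 2) + k3 * x powr (-2) < \<sigma>) at_top"
    using assms by (intro order_tendstoD) auto
  then obtain X0 where X0: "\<And>x. x \<ge> X0 \<Longrightarrow> k1 * x powr (-1) + k2 * x powr (q - 2) + k3 * x powr (-2) < \<sigma>"
    by (auto simp: eventually_at_top_linorder)
  show ?thesis
  proof (intro exI[of _ "max 1 X0"] conjI allI impI)
    fix x assume x: "max 1 X0 \<le> x"
    have "(k1 * x powr (-1) + k2 * x powr (q - 2) + k3 * x powr (-2)) * x\<^sup>2 < \<sigma> * x\<^sup>2"
      using X0[of x] x by (intro mult_strict_right_mono) auto
    moreover have e1: "x powr (-1) * x\<^sup>2 = x" using x by (simp add: powr_minus power2_eq_square field_simps)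
    have e2: "x powr (q - 2) * x\<^sup>2 = x powr q" using x powr_add[of x "q - 2" 2] by (simp add: powr_numeral)
    have e3: "x powr (-2) * x\<^sup>2 = 1" using x powr_add[of x "-2" 2] by (simp add: powr_numeral)
    have "(k1 * x powr (-1) + k2 * x powr (q - 2) + k3 * x powr (-2)) * x\<^sup>2 = k1 * x + k2 * x powr q + k3"
      by (simp only: distrib_right mult.assoc e1 e2 e3 mult_1_right)
    ultimately show "k1 * x + k2 * x powr q + k3 < \<sigma> * x\<^sup>2" by simp
  qed auto
qed

section \<open>Identities and bounds for exact solutions on the core\<close>

locale core_solution = core_graph V E el s t N p \<mu>
  for V :: "'v set" and E :: "'e set" and el s t N p \<mu> +
  fixes a \<rho> :: real and u :: "'e \<Rightarrow> real \<Rightarrow> real" and c :: "'v \<Rightarrow> real" and d :: "'e \<Rightarrow> real"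
  assumes app: "approx 0 a \<rho> u c d" and a_pos: "a > 0" and \<rho>_ge: "1/2 \<le> \<rho>" and \<rho>_le: "\<rho> \<le> 1"
begin

definition du where "du e x = d e + Gi a \<rho> u e x"
definition hamiltonian where "hamiltonian e x = (du e x)\<^sup>2 / 2 - a\<^sup>2 * (u e x)\<^sup>2 / 2 + \<rho> * (u e x powr p) / p"

lemma u_cont: "e \<in> E \<Longrightarrow> continuous_on {0..el e} (u e)"
  and u_nonneg: "e \<in> E \<Longrightarrow> x \<in> {0..el e} \<Longrightarrow> 0 \<le> u e x"
  and u_s: "e \<in> E \<Longrightarrow> u e 0 = c (s e)" and u_t: "e \<in> E \<Longrightarrow> u e (el e) = c (t e)"
  and u_form: "e \<in> E \<Longrightarrow> x \<in> {0..el e} \<Longrightarrow> u e x = c (s e) + d e * x + integral {0..x} (Gi a \<rho> u e)"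
  and mass_eq: "2 * a * (\<mu> - Mass u) = Sc c"
  using app unfolding approx_def by auto

lemma du_0: "du e 0 = d e" by (simp add: du_def Gi_def)

lemma vertex_eq: "v \<in> V \<Longrightarrow> (\<Sum>e\<in>{e\<in>E. s e = v}. d e) - (\<Sum>e\<in>{e\<in>E. t e = v}. du e (el e)) = a * N v * c v"
  using app unfolding approx_def du_def by auto

lemma g_cont: "e \<in> E \<Longrightarrow> continuous_on {0..el e} (\<lambda>x. gg a \<rho> (u e x))"
  by (rule gg_cont[OF u_cont u_nonneg])

lemma u_deriv:
  assumes "e \<in> E" "x \<in> {0..el e}"
  shows "(u e has_real_derivative du e x) (at x within {0..el e})"
proof -
  have "((\<lambda>x. c (s e) + d e * x + integral {0..x} (Gi a \<rho> u e)) has_real_derivative (0 + d e * 1 + Gi a \<rho> u e x)) (at x within {0..el e})"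
    by (intro DERIV_add DERIV_const DERIV_cmult DERIV_ident integral_has_real_derivative Gi_cont u_cont u_nonneg assms)
  then have "((\<lambda>x. c (s e) + d e * x + integral {0..x} (Gi a \<rho> u e)) has_real_derivative du e x) (at x within {0..el e})"
    by (simp add: du_def)
  then show ?thesis
    by (rule has_field_derivative_transform_within[OF _ zero_less_one assms(2)]) (use u_form[OF assms(1)] in auto)
qed

lemma du_deriv:
  assumes "e \<in> E" "x \<in> {0..el e}"
  shows "(du e has_real_derivative gg a \<rho> (u e x)) (at x within {0..el e})"
proof -
  have "((\<lambda>x. d e + integral {0..x} (\<lambda>y. gg a \<rho> (u e y))) has_real_derivative (0 + gg a \<rho> (u e x))) (at x within {0..el e})"
    by (intro DERIV_add DERIV_const integral_has_real_derivative g_cont assms)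
  then show ?thesis by (simp add: du_def[abs_def] Gi_def)
qed

lemma du_cont: "e \<in> E \<Longrightarrow> continuous_on {0..el e} (du e)"
  using du_deriv by (intro DERIV_continuous_on) auto

lemma u_powr_deriv:
  assumes "e \<in> E" "x \<in> {0..el e}"
  shows "((\<lambda>x. u e x powr p) has_real_derivative p * u e x powr (p - 1) * du e x) (at x within {0..el e})"
proof -
  have "((\<lambda>x. (max 0 (u e x)) powr p) has_real_derivative p * (max 0 (u e x)) powr (p - 1) * du e x) (at x within {0..el e})"
    by (rule DERIV_chain2[OF pos_part_powr_deriv u_deriv[OF assms]]) (use p6 in auto)
  then have "((\<lambda>x. (max 0 (u e x)) powr p) has_real_derivative p * u e x powr (p - 1) * du e x) (at x within {0..el e})"
    using u_nonneg[OF assms] by simp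
  then show ?thesis
    by (rule has_field_derivative_transform_within[OF _ zero_less_one assms(2)]) (use u_nonneg[OF assms(1)] in auto)
qed

lemma hamiltonian_const:
  assumes "e \<in> E" "x \<in> {0..el e}"
  shows "hamiltonian e x = hamiltonian e 0"
proof -
  have "(hamiltonian e has_real_derivative 0) (at y within {0..el e})" if y: "y \<in> {0..el e}" for y
  proof -
    have "((\<lambda>x. (du e x)\<^sup>2 / 2 - a\<^sup>2 * (u e x)\<^sup>2 / 2 + \<rho> * (u e x powr p) / p) has_real_derivative
       (2 * du e y * gg a \<rho> (u e y)) / 2 - a\<^sup>2 * (2 * u e y * du e y) / 2 + \<rho> * (p * u e y powr (p - 1) * du e y) / p) (at y within {0..el e})"
      by (intro DERIV_add DERIV_diff DERIV_cdivide DERIV_cmult u_powr_deriv[OF assms(1) y])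
         (auto intro!: derivative_eq_intros u_deriv[OF assms(1) y] du_deriv[OF assms(1) y])
    moreover have "(2 * du e y * gg a \<rho> (u e y)) / 2 - a\<^sup>2 * (2 * u e y * du e y) / 2 + \<rho> * (p * u e y powr (p - 1) * du e y) / p = 0"
      using p6 by (simp add: gg_def field_simps)
    ultimately show ?thesis by (simp add: hamiltonian_def[abs_def])
  qed
  then have "\<exists>k. \<forall>y\<in>{0..el e}. hamiltonian e y = k"
    by (intro has_field_derivative_zero_constant) auto
  then show ?thesis using assms by force
qed

definition Ke where "Ke e = integral {0..el e} (\<lambda>x. (du e x)\<^sup>2)"
definition Me where "Me e = integral {0..el e} (\<lambda>x. (u e x)\<^sup>2)"
definition Pe where "Pe e = integral {0..el e} (\<lambda>x. u e x powr p)"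

lemma u_powr_cont: "e \<in> E \<Longrightarrow> q > 0 \<Longrightarrow> continuous_on {0..el e} (\<lambda>x. u e x powr q)"
  by (intro continuous_on_powr_nonneg u_cont u_nonneg)

lemma Ke_int: "e \<in> E \<Longrightarrow> ((\<lambda>x. (du e x)\<^sup>2) has_integral Ke e) {0..el e}"
  unfolding Ke_def by (intro integrable_integral integrable_continuous_interval continuous_intros du_cont)
lemma Me_int: "e \<in> E \<Longrightarrow> ((\<lambda>x. (u e x)\<^sup>2) has_integral Me e) {0..el e}"
  unfolding Me_def by (intro integrable_integral integrable_continuous_interval continuous_intros u_cont)
lemma Pe_int: "e \<in> E \<Longrightarrow> ((\<lambda>x. u e x powr p) has_integral Pe e) {0..el e}"
  unfolding Pe_def using p6 by (intro integrable_integral integrable_continuous_interval u_powr_cont) auto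

lemma Ke_nonneg: "e \<in> E \<Longrightarrow> 0 \<le> Ke e" by (rule has_integral_nonneg[OF Ke_int]) auto
lemma Me_nonneg: "e \<in> E \<Longrightarrow> 0 \<le> Me e" by (rule has_integral_nonneg[OF Me_int]) auto
lemma Pe_nonneg: "e \<in> E \<Longrightarrow> 0 \<le> Pe e" by (rule has_integral_nonneg[OF Pe_int]) auto

lemma edge_pohozaev:
  assumes e: "e \<in> E" shows "Ke e / 2 - a\<^sup>2 * Me e / 2 + \<rho> * Pe e / p = hamiltonian e 0 * el e"
proof -
  have "(hamiltonian e has_integral Ke e / 2 - a\<^sup>2 * Me e / 2 + \<rho> * Pe e / p) {0..el e}"
    unfolding hamiltonian_def[abs_def]
    by (intro has_integral_add has_integral_diff has_integral_divide has_integral_mult_right Ke_int Me_int Pe_int e)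
  moreover have "(hamiltonian e has_integral hamiltonian e 0 * el e) {0..el e}"
  proof -
    have "((\<lambda>x. hamiltonian e 0) has_integral hamiltonian e 0 * el e) {0..el e}"
      using has_integral_const_real[of "hamiltonian e 0" 0 "el e"] el_pos[OF e] by (simp add: mult.commute)
    then show ?thesis by (rule has_integral_eq[rotated]) (rule hamiltonian_const[OF e, symmetric])
  qed
  ultimately show ?thesis by (rule has_integral_unique)
qed

lemma u_gg: "e \<in> E \<Longrightarrow> x \<in> {0..el e} \<Longrightarrow> u e x * gg a \<rho> (u e x) = a\<^sup>2 * (u e x)\<^sup>2 - \<rho> * u e x powr p"
proof -
  assume "e \<in> E" "x \<in> {0..el e}"
  then have "0 \<le> u e x" by (rule u_nonneg)
  then have "u e x * u e x powr (p - 1) = u e x powr p"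
    using p6 by (cases "u e x = 0") (auto simp: powr_mult_base)
  then show ?thesis by (simp add: gg_def right_diff_distrib power2_eq_square)
qed

lemma edge_parts:
  assumes e: "e \<in> E" shows "Ke e + a\<^sup>2 * Me e - \<rho> * Pe e = c (t e) * du e (el e) - c (s e) * d e"
proof -
  have "((\<lambda>x. (du e x)\<^sup>2 + u e x * gg a \<rho> (u e x)) has_integral u e (el e) * du e (el e) - u e 0 * du e 0) {0..el e}"
  proof (rule fundamental_theorem_of_calculus)
    fix x assume x: "x \<in> {0..el e}"
    have "((\<lambda>x. u e x * du e x) has_real_derivative (du e x)\<^sup>2 + u e x * gg a \<rho> (u e x)) (at x within {0..el e})"
      by (auto intro!: derivative_eq_intros u_deriv[OF e x] du_deriv[OF e x] simp: power2_eq_square)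
    then show "((\<lambda>x. u e x * du e x) has_vector_derivative (du e x)\<^sup>2 + u e x * gg a \<rho> (u e x)) (at x within {0..el e})"
      by (simp add: has_real_derivative_iff_has_vector_derivative)
  qed (use el_pos[OF e] in simp)
  moreover have "((\<lambda>x. (du e x)\<^sup>2 + u e x * gg a \<rho> (u e x)) has_integral Ke e + (a\<^sup>2 * Me e - \<rho> * Pe e)) {0..el e}"
  proof (rule has_integral_eq[rotated])
    show "((\<lambda>x. (du e x)\<^sup>2 + (a\<^sup>2 * (u e x)\<^sup>2 - \<rho> * u e x powr p)) has_integral Ke e + (a\<^sup>2 * Me e - \<rho> * Pe e)) {0..el e}"
      by (intro has_integral_add has_integral_diff has_integral_mult_right Ke_int Me_int Pe_int e)
  qed (use u_gg[OF e] in simp)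
  ultimately have "Ke e + (a\<^sup>2 * Me e - \<rho> * Pe e) = u e (el e) * du e (el e) - u e 0 * du e 0"
    by (rule has_integral_unique[rotated])
  then show ?thesis using u_s[OF e] u_t[OF e] by (simp add: du_0)
qed

lemma Mass_eq: "Mass u = sum Me E" by (simp add: Mass_def Me_def)
lemma Pow_eq: "Pow u = sum Pe E" by (simp add: Pow_def Pe_def)

text \<open>Boundary terms of the edges, regrouped by vertex, are evaluated by the Robin
  condition.\<close>

lemma boundary_sum: "(\<Sum>e\<in>E. c (t e) * du e (el e) - c (s e) * d e) = - a * Sc c"
proof -
  have "a * Sc c = (\<Sum>v\<in>V. c v * (a * N v * c v))" unfolding Sc_def sum_distrib_left
    by (intro sum.cong) (auto simp: power2_eq_square algebra_simps)
  also have "\<dots> = (\<Sum>v\<in>V. c v * ((\<Sum>e\<in>{e\<in>E. s e = v}. d e) - (\<Sum>e\<in>{e\<in>E. t e = v}. du e (el e))))"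
    by (intro sum.cong) (auto simp: vertex_eq)
  also have "\<dots> = (\<Sum>v\<in>V. (\<Sum>e\<in>{e\<in>E. s e = v}. c (s e) * d e) - (\<Sum>e\<in>{e\<in>E. t e = v}. c (t e) * du e (el e)))"
    unfolding right_diff_distrib sum_distrib_left by (intro sum.cong arg_cong2[where f = "(-)"]) auto
  also have "\<dots> = (\<Sum>e\<in>E. c (s e) * d e) - (\<Sum>e\<in>E. c (t e) * du e (el e))"
    unfolding sum_subtractf sum_over_vertices ..
  finally show ?thesis by (simp add: sum_subtractf)
qed

lemma kinetic_identity: "sum Ke E = \<rho> * Pow u - a\<^sup>2 * Mass u - a * Sc c"
proof -
  have "(\<Sum>e\<in>E. Ke e + a\<^sup>2 * Me e - \<rho> * Pe e) = - a * Sc c"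
    using boundary_sum edge_parts by simp
  then show ?thesis by (simp add: Mass_eq Pow_eq sum.distrib sum_subtractf sum_distrib_left)
qed

text \<open>Sum of the integrated Hamiltonians, with the kinetic part taken from
  \<open>kinetic_identity\<close>. Once \<open>Sc\<close> is expressed through
  \<open>mass_eq\<close> the core mass cancels and the full mass \<open>\<mu>\<close>
  remains.\<close>

lemma pohozaev: "\<rho> * Pow u * (1/2 + 1/p) = (\<Sum>e\<in>E. hamiltonian e 0 * el e) + a\<^sup>2 * \<mu>"
proof -
  have "(\<Sum>e\<in>E. hamiltonian e 0 * el e) = sum Ke E / 2 - a\<^sup>2 * Mass u / 2 + \<rho> * Pow u / p"
    using edge_pohozaev[symmetric]
    by (simp add: Mass_eq Pow_eq sum.distrib sum_subtractf sum_distrib_left sum_divide_distrib)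
  moreover have "a * Sc c = 2 * a\<^sup>2 * \<mu> - 2 * a\<^sup>2 * Mass u"
    unfolding mass_eq[symmetric] by (simp add: algebra_simps power2_eq_square)
  moreover have "\<rho> * Pow u * (1/2 + 1/p) = \<rho> * Pow u / 2 + \<rho> * Pow u / p" by (simp add: distrib_left)
  ultimately show ?thesis using kinetic_identity by linarith
qed

lemma En_eq: "En a \<rho> u c = (1/2 - 1/p) * (\<rho> * Pow u) - a\<^sup>2 * \<mu> / 2"
proof -
  have "a * Sc c = 2 * a\<^sup>2 * \<mu> - 2 * a\<^sup>2 * Mass u"
    unfolding mass_eq[symmetric] by (simp add: algebra_simps power2_eq_square)
  then show ?thesis unfolding En_def by (simp add: field_simps)
qed

lemma Sc_nonneg: "0 \<le> Sc c" unfolding Sc_def by (intro sum_nonneg) (simp add: N_nonneg)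

lemma Mass_le: "Mass u \<le> \<mu>"
proof -
  have "0 \<le> 2 * a * (\<mu> - Mass u)" using mass_eq Sc_nonneg by simp
  then show ?thesis using a_pos by (simp add: zero_le_mult_iff)
qed

lemma Me_le: assumes "e \<in> E" shows "Me e \<le> \<mu>"
proof -
  have "Me e \<le> sum Me E" by (rule member_le_sum) (use assms finE Me_nonneg in auto)
  then show ?thesis using Mass_le by (simp add: Mass_eq)
qed

lemma \<rho>_pos: "\<rho> > 0" using \<rho>_ge by linarith

text \<open>
  If \<open>H < 0\<close> is the Hamiltonian of the edge, then \<open>u > 0\<close> and
  \<open>(u'/u)' = -2 H / u\<^sup>2 - (1 - 2/p) \<rho> u\<^bsup>p-2\<^esup>\<close>, while \<open>\<bar>u'/u\<bar> \<le> a\<close>; integrate over the edge and estimate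
  the integral of \<open>1/u\<^sup>2\<close> from below by the mass.
\<close>

lemma edge_hamiltonian_lower:
  assumes e: "e \<in> E"
  shows "- (hamiltonian e 0 * el e) \<le> Me e * ((2 * a + (p * a\<^sup>2) powr ((p - 4) / (p - 2)) * \<mu>) / (2 * el e))"
proof (cases "hamiltonian e 0 < 0")
  case False
  have "0 \<le> hamiltonian e 0 * el e" using False el_pos[OF e] by simp
  moreover have "0 \<le> Me e * ((2 * a + (p * a\<^sup>2) powr ((p - 4) / (p - 2)) * \<mu>) / (2 * el e))"
    using Me_nonneg[OF e] a_pos \<mu>_pos el_pos[OF e] by (intro mult_nonneg_nonneg divide_nonneg_nonneg add_nonneg_nonneg) auto
  ultimately show ?thesis by linarith
next
  case True
  \<comment> \<open>The first integral becomes
    \<open>(u')\<^sup>2 = a\<^sup>2 u\<^sup>2 - 2 \<rho> u^p / p - D\<close> with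
    \<open>D > 0\<close>. It makes \<open>u\<close> positive, bounds \<open>u^(p-2)\<close> by
    \<open>p a\<^sup>2\<close>, since \<open>\<rho>\<close> is at least 1/2, and bounds
    \<open>|u'|\<close> by \<open>a u\<close>.\<close>
  define D where "D = - 2 * hamiltonian e 0"
  define L where "L = el e"
  define K where "K = (p * a\<^sup>2) powr ((p - 4) / (p - 2))"
  have D: "D > 0" and L: "L > 0" using True el_pos[OF e] by (auto simp: D_def L_def)
  have Hx: "(du e x)\<^sup>2 = a\<^sup>2 * (u e x)\<^sup>2 - 2 * \<rho> * (u e x powr p) / p - D" if "x \<in> {0..L}" for x
    using hamiltonian_const[OF e that[unfolded L_def]] by (simp add: D_def hamiltonian_def)
  have pp: "0 \<le> 2 * \<rho> * (u e x powr p) / p" for x using \<rho>_pos p6 by simp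
  have upos: "u e x > 0" if x: "x \<in> {0..L}" for x
  proof -
    have "a\<^sup>2 * (u e x)\<^sup>2 > 0" using Hx[OF x] D pp[of x] zero_le_power2[of "du e x"] by linarith
    then have "u e x \<noteq> 0" by auto
    then show ?thesis using u_nonneg[OF e, of x] x by (auto simp: L_def)
  qed
  have split: "u e x powr p = u e x powr (p - 2) * (u e x)\<^sup>2" if "x \<in> {0..L}" for x
    using upos[OF that] powr_add[of "u e x" "p - 2" 2] by (simp add: powr_numeral)
  have up2: "u e x powr (p - 2) \<le> p * a\<^sup>2" if x: "x \<in> {0..L}" for x
  proof -
    have "2 * \<rho> * (u e x powr p) / p \<le> a\<^sup>2 * (u e x)\<^sup>2"
      using Hx[OF x] D zero_le_power2[of "du e x"] by linarith
    then have "(2 * \<rho> * u e x powr (p - 2) / p) * (u e x)\<^sup>2 \<le> a\<^sup>2 * (u e x)\<^sup>2"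
      unfolding split[OF x] by (simp add: mult.assoc)
    then have "2 * \<rho> * u e x powr (p - 2) / p \<le> a\<^sup>2"
      by (rule mult_right_le_imp_le) (use upos[OF x] in simp)
    then have "2 * \<rho> * u e x powr (p - 2) \<le> p * a\<^sup>2" using p6 by (simp add: field_simps)
    moreover have "1 * u e x powr (p - 2) \<le> 2 * \<rho> * u e x powr (p - 2)"
      using \<rho>_ge by (intro mult_right_mono) auto
    ultimately show ?thesis by linarith
  qed
  \<comment> \<open>Splitting off \<open>u\<^sup>2\<close> leaves \<open>u^(p-4)\<close>, bounded by
    \<open>K\<close>, so that the power term integrates against the mass; \<open>K\<close> is of an
    order below 2 in \<open>a\<close>.\<close>
  have upow: "u e x powr (p - 2) \<le> K * (u e x)\<^sup>2" if x: "x \<in> {0..L}" for x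
  proof -
    have "u e x powr (p - 4) = (u e x powr (p - 2)) powr ((p - 4) / (p - 2))"
      using p6 by (simp add: powr_powr)
    also have "\<dots> \<le> K" unfolding K_def by (rule powr_mono2) (use up2[OF x] p6 in auto)
    finally have "u e x powr (p - 4) * (u e x)\<^sup>2 \<le> K * (u e x)\<^sup>2" by (intro mult_right_mono) auto
    moreover have "u e x powr (p - 4) * (u e x)\<^sup>2 = u e x powr (p - 2)"
      using upos[OF x] powr_add[of "u e x" "p - 4" 2] by (simp add: powr_numeral)
    ultimately show ?thesis by simp
  qed
  have quot: "\<bar>du e x / u e x\<bar> \<le> a" if x: "x \<in> {0..L}" for x
  proof -
    have "(du e x)\<^sup>2 \<le> (a * u e x)\<^sup>2" using Hx[OF x] D pp[of x] by (simp add: power_mult_distrib)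
    then have "\<bar>du e x\<bar> \<le> a * u e x" using upos[OF x] a_pos by (metis abs_le_square_iff abs_of_pos mult_pos_pos)
    then show ?thesis using upos[OF x] by (simp add: field_simps abs_mult)
  qed
  have F: "((\<lambda>x. D / (u e x)\<^sup>2 - (1 - 2/p) * \<rho> * u e x powr (p - 2)) has_integral du e L / u e L - du e 0 / u e 0) {0..L}"
  proof (rule fundamental_theorem_of_calculus)
    fix x assume x: "x \<in> {0..L}"
    have u0: "u e x \<noteq> 0" using upos[OF x] by simp
    have x': "x \<in> {0..el e}" using x by (simp add: L_def)
    have "((\<lambda>x. du e x / u e x) has_real_derivative (gg a \<rho> (u e x) * u e x - du e x * du e x) / (u e x * u e x)) (at x within {0..L})"
      using u_deriv[OF e x'] du_deriv[OF e x'] u0 unfolding L_def[symmetric] by (intro DERIV_divide)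
    moreover have "(gg a \<rho> (u e x) * u e x - du e x * du e x) / (u e x * u e x) = D / (u e x)\<^sup>2 - (1 - 2/p) * \<rho> * u e x powr (p - 2)"
    proof -
      have "gg a \<rho> (u e x) * u e x - du e x * du e x = D - (1 - 2/p) * \<rho> * (u e x powr (p - 2) * (u e x)\<^sup>2)"
        using Hx[OF x] u_gg[OF e x'] unfolding split[OF x] by (simp add: power2_eq_square algebra_simps)
      then show ?thesis using u0 by (simp add: power2_eq_square diff_divide_distrib)
    qed
    ultimately show "((\<lambda>x. du e x / u e x) has_vector_derivative D / (u e x)\<^sup>2 - (1 - 2/p) * \<rho> * u e x powr (p - 2)) (at x within {0..L})"
      by (simp add: has_real_derivative_iff_has_vector_derivative)
  qed (use L in simp)
  have uc: "continuous_on {0..L} (u e)" using u_cont[OF e] by (simp add: L_def)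
  have M0: "Me e > 0"
  proof (rule ccontr)
    assume "\<not> Me e > 0"
    then have "integral {0..L} (\<lambda>x. (u e x)\<^sup>2) = 0" using Me_nonneg[OF e] by (simp add: Me_def L_def)
    then have "\<forall>x\<in>{0..L}. (u e x)\<^sup>2 = 0"
      using integral_eq_0_iff[of 0 L "\<lambda>x. (u e x)\<^sup>2"] L uc by (auto intro!: continuous_intros)
    then show False using upos[of 0] L by auto
  qed
  \<comment> \<open>The mean of \<open>u\<^sup>2\<close> over the edge. By convexity
    \<open>1 / y\<close> lies above its tangent at \<open>m\<close>, which is
    \<open>2 / m - y / m\<^sup>2\<close>; at \<open>y = u\<^sup>2\<close> this integrates to exactly
    \<open>L\<^sup>2 / Me e\<close>.\<close>
  define m where "m = Me e / L"
  have m: "m > 0" using M0 L by (simp add: m_def)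
  have MI: "((\<lambda>x. (u e x)\<^sup>2) has_integral Me e) {0..L}" using Me_int[OF e] by (simp add: L_def)
  have low: "((\<lambda>x. D * (2 / m - (u e x)\<^sup>2 / m\<^sup>2) - K * (u e x)\<^sup>2) has_integral D * (2 / m * L - Me e / m\<^sup>2) - K * Me e) {0..L}"
  proof -
    have "((\<lambda>x. 2 / m) has_integral 2 / m * L) {0..L}"
      using has_integral_const_real[of "2 / m" 0 L] L by (simp add: mult.commute)
    then show ?thesis by (intro has_integral_diff has_integral_mult_right has_integral_divide MI)
  qed
  have "D * (2 / m * L - Me e / m\<^sup>2) - K * Me e \<le> du e L / u e L - du e 0 / u e 0"
  proof (rule has_integral_le[OF low F])
    fix x assume x: "x \<in> {0..L}"
    define y where "y = (u e x)\<^sup>2"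
    have y: "y > 0" using upos[OF x] by (simp add: y_def)
    have "0 \<le> (y - m)\<^sup>2 / (y * m\<^sup>2)" using y m by simp
    also have "\<dots> = 1 / y - (2 / m - y / m\<^sup>2)" using y m by (simp add: field_simps power2_eq_square)
    finally have "2 / m - y / m\<^sup>2 \<le> 1 / y" by simp
    then have "D * (2 / m - y / m\<^sup>2) \<le> D * (1 / y)" using D by (intro mult_left_mono) auto
    moreover have "(1 - 2/p) * \<rho> * u e x powr (p - 2) \<le> 1 * u e x powr (p - 2)"
      using \<rho>_le \<rho>_pos p6 by (intro mult_right_mono) (auto intro: mult_le_one)
    moreover note upow[OF x]
    ultimately show "D * (2 / m - (u e x)\<^sup>2 / m\<^sup>2) - K * (u e x)\<^sup>2 \<le> D / (u e x)\<^sup>2 - (1 - 2/p) * \<rho> * u e x powr (p - 2)"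
      unfolding y_def by simp
  qed
  also have "\<dots> \<le> 2 * a"
  proof -
    have "0 \<in> {0..L}" "L \<in> {0..L}" using L by auto
    from quot[OF this(1)] quot[OF this(2)] show ?thesis by linarith
  qed
  finally have "D * (2 / m * L - Me e / m\<^sup>2) \<le> 2 * a + K * Me e" by linarith
  also have "2 / m * L - Me e / m\<^sup>2 = L\<^sup>2 / Me e" using M0 L by (simp add: m_def field_simps power2_eq_square)
  also have "2 * a + K * Me e \<le> 2 * a + K * \<mu>"
    using Me_le[OF e] by (intro add_left_mono mult_left_mono) (auto simp: K_def)
  finally have "D * L\<^sup>2 \<le> Me e * (2 * a + K * \<mu>)" using M0 by (simp add: field_simps)
  then have "D * L \<le> Me e * ((2 * a + K * \<mu>) / L)" using L by (simp add: field_simps power2_eq_square)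
  then have "D * L / 2 \<le> Me e * ((2 * a + K * \<mu>) / L) / 2" by (rule divide_right_mono) simp
  also have "D * L / 2 = - (hamiltonian e 0 * L)" by (simp add: D_def)
  also have "Me e * ((2 * a + K * \<mu>) / L) / 2 = Me e * ((2 * a + K * \<mu>) / (2 * L))" by simp
  finally show ?thesis unfolding K_def L_def .
qed

text \<open>Inserting \<open>pohozaev\<close> into \<open>En_eq\<close> gives
  \<open>a\<^sup>2 * \<mu>\<close> the coefficient
  \<open>(p - 2) / (p + 2) - 1 / 2 = (p - 6) / (2 * (p + 2))\<close>. The Hamiltonians cost only the
  lower-order terms of \<open>edge_hamiltonian_lower\<close>, summed with the edge masses as
  weights.\<close>

lemma En_lower:
  "\<mu> * ((p - 6) / (2 * (p + 2)) * a\<^sup>2 - \<kappa> / 2 * (2 * a + (p * a\<^sup>2) powr ((p - 4) / (p - 2)) * \<mu>)) \<le> En a \<rho> u c"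
proof -
  define R where "R = 2 * a + (p * a\<^sup>2) powr ((p - 4) / (p - 2)) * \<mu>"
  have R: "R \<ge> 0" using a_pos \<mu>_pos by (simp add: R_def)
  have \<kappa>0: "\<kappa> \<ge> 0" unfolding \<kappa>_def by (intro sum_nonneg) (simp add: less_imp_le[OF el_pos])
  have "- (hamiltonian e 0 * el e) \<le> Me e * (\<kappa> / 2 * R)" if e: "e \<in> E" for e
  proof -
    have "R / (2 * el e) = 1 / el e * (R / 2)" by simp
    also have "\<dots> \<le> \<kappa> * (R / 2)" using \<kappa>_ge[OF e] R by (intro mult_right_mono) auto
    finally have "Me e * (R / (2 * el e)) \<le> Me e * (\<kappa> / 2 * R)"
      using Me_nonneg[OF e] by (intro mult_left_mono) auto
    then show ?thesis using edge_hamiltonian_lower[OF e] unfolding R_def[symmetric] by linarith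
  qed
  then have "(\<Sum>e\<in>E. - (hamiltonian e 0 * el e)) \<le> (\<Sum>e\<in>E. Me e * (\<kappa> / 2 * R))" by (rule sum_mono)
  also have "\<dots> = Mass u * (\<kappa> / 2 * R)" by (simp add: Mass_eq sum_distrib_right)
  also have "\<dots> \<le> \<mu> * (\<kappa> / 2 * R)" using Mass_le \<kappa>0 R by (intro mult_right_mono) auto
  finally have S: "(\<Sum>e\<in>E. hamiltonian e 0 * el e) \<ge> - (\<mu> * (\<kappa> / 2 * R))" by (simp add: sum_negf)
  have "\<rho> * Pow u * ((p + 2) / (2 * p)) = (\<Sum>e\<in>E. hamiltonian e 0 * el e) + a\<^sup>2 * \<mu>"
    using pohozaev p6 by (simp add: field_simps)
  then have "\<rho> * Pow u = ((\<Sum>e\<in>E. hamiltonian e 0 * el e) + a\<^sup>2 * \<mu>) * (2 * p / (p + 2))"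
    using p6 by (simp add: field_simps)
  then have e1: "(1/2 - 1/p) * (\<rho> * Pow u) = ((1/2 - 1/p) * (2 * p / (p + 2))) * ((\<Sum>e\<in>E. hamiltonian e 0 * el e) + a\<^sup>2 * \<mu>)"
    by (simp only: mult.assoc mult.left_commute mult.commute)
  have e2: "(1/2 - 1/p) * (2 * p / (p + 2)) = (p - 2) / (p + 2)"
  proof -
    have "1/2 - 1/p = (p - 2) / (2 * p)" using p6 by (simp add: field_simps)
    then show ?thesis using p6 by simp
  qed
  note e1[unfolded e2]
  moreover have "(p - 2) / (p + 2) * (a\<^sup>2 * \<mu> - \<mu> * (\<kappa> / 2 * R)) \<le> (p - 2) / (p + 2) * ((\<Sum>e\<in>E. hamiltonian e 0 * el e) + a\<^sup>2 * \<mu>)"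
    using S p6 by (intro mult_left_mono) auto
  ultimately have "(p - 2) / (p + 2) * (a\<^sup>2 * \<mu>) - (p - 2) / (p + 2) * (\<mu> * (\<kappa> / 2 * R)) \<le> (1/2 - 1/p) * (\<rho> * Pow u)"
    by (simp add: right_diff_distrib)
  moreover have "(p - 2) / (p + 2) * (\<mu> * (\<kappa> / 2 * R)) \<le> 1 * (\<mu> * (\<kappa> / 2 * R))"
    using p6 \<mu>_pos \<kappa>0 R by (intro mult_right_mono) auto
  moreover have "\<mu> * ((p - 6) / (2 * (p + 2)) * a\<^sup>2) = (p - 2) / (p + 2) * (a\<^sup>2 * \<mu>) - a\<^sup>2 * \<mu> / 2"
    using p6 by (simp add: field_simps)
  ultimately show ?thesis unfolding En_eq R_def[symmetric] right_diff_distrib by linarith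
qed

text \<open>With \<open>a\<close> and the energy bounded, \<open>En_eq\<close> bounds
  \<open>\<rho> * Pow u\<close>, and the edge identities then bound the Hamiltonian from above. At a
  point the Hamiltonian controls \<open>\<rho> u^p / p\<close> up to
  \<open>a\<^sup>2 u\<^sup>2 / 2\<close>, which for \<open>u > 1\<close> bounds
  \<open>u^(p-2)\<close>.\<close>

lemma u_bound:
  assumes a: "a \<le> A" and En: "En a \<rho> u c \<le> C" and e: "e \<in> E" and x: "x \<in> {0..el e}"
  shows "u e x \<le> max 1 ((2 * p * ((C + A\<^sup>2 * \<mu> / 2) / (1/2 - 1/p) * \<kappa> + A\<^sup>2)) powr (1 / (p - 2)))"
proof -
  define P1 where "P1 = (C + A\<^sup>2 * \<mu> / 2) / (1/2 - 1/p)"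
  define Q where "Q = 2 * p * (P1 * \<kappa> + A\<^sup>2)"
  have \<kappa>0: "\<kappa> \<ge> 0" unfolding \<kappa>_def by (intro sum_nonneg) (simp add: less_imp_le[OF el_pos])
  have pp: "1/2 - 1/p > 0" using p6 by (simp add: field_simps)
  have a2: "a\<^sup>2 \<le> A\<^sup>2" using a a_pos by (intro power_mono) auto
  have "(1/2 - 1/p) * (\<rho> * Pow u) \<le> C + A\<^sup>2 * \<mu> / 2"
    using En mult_right_mono[OF a2, of "\<mu>"] \<mu>_pos unfolding En_eq by linarith
  then have P1: "\<rho> * Pow u \<le> P1" using pp by (simp add: P1_def pos_le_divide_eq mult.commute)
  have Pow0: "0 \<le> Pow u" unfolding Pow_eq by (intro sum_nonneg Pe_nonneg)
  have P10: "0 \<le> P1" using P1 Pow0 \<rho>_pos by (meson mult_nonneg_nonneg less_imp_le order_trans)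
  have KP: "sum Ke E \<le> \<rho> * Pow u"
  proof -
    have "0 \<le> a\<^sup>2 * Mass u" unfolding Mass_eq by (intro mult_nonneg_nonneg sum_nonneg Me_nonneg) auto
    moreover have "0 \<le> a * Sc c" using a_pos Sc_nonneg by simp
    ultimately show ?thesis unfolding kinetic_identity by linarith
  qed
  have "Ke e \<le> sum Ke E" by (rule member_le_sum) (use e finE Ke_nonneg in auto)
  moreover have "Pe e \<le> Pow u" unfolding Pow_eq by (rule member_le_sum) (use e finE Pe_nonneg in auto)
  then have "\<rho> * Pe e / p \<le> \<rho> * Pow u / p" using \<rho>_pos p6 by (intro divide_right_mono mult_left_mono) auto
  moreover have "\<rho> * Pow u / p \<le> \<rho> * Pow u / 2" using \<rho>_pos p6 Pow0 by (intro divide_left_mono) auto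
  moreover have "0 \<le> a\<^sup>2 * Me e / 2" using Me_nonneg[OF e] by simp
  ultimately have "hamiltonian e 0 * el e \<le> P1" using edge_pohozaev[OF e] KP P1 by linarith
  then have "hamiltonian e 0 \<le> P1 * (1 / el e)" using el_pos[OF e] by (simp add: field_simps)
  also have "\<dots> \<le> P1 * \<kappa>" using \<kappa>_ge[OF e] P10 by (intro mult_left_mono) auto
  finally have H: "hamiltonian e x \<le> P1 * \<kappa>" using hamiltonian_const[OF e x] by simp
  show ?thesis
  proof (cases "u e x \<le> 1")
    case True then show ?thesis by simp
  next
    case False
    then have u1: "u e x > 1" by simp
    have "\<rho> * (u e x powr p) / p \<le> P1 * \<kappa> + a\<^sup>2 * (u e x)\<^sup>2 / 2"
      using H zero_le_power2[of "du e x"] unfolding hamiltonian_def by linarith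
    also have "\<dots> \<le> P1 * \<kappa> * (u e x)\<^sup>2 + A\<^sup>2 * (u e x)\<^sup>2"
    proof (rule add_mono)
      show "P1 * \<kappa> \<le> P1 * \<kappa> * (u e x)\<^sup>2" using mult_left_mono[of 1 "(u e x)\<^sup>2" "P1 * \<kappa>"] u1 P10 \<kappa>0 by simp
      have "a\<^sup>2 * (u e x)\<^sup>2 \<le> A\<^sup>2 * (u e x)\<^sup>2" using a2 by (intro mult_right_mono) auto
      then show "a\<^sup>2 * (u e x)\<^sup>2 / 2 \<le> A\<^sup>2 * (u e x)\<^sup>2" by (smt (verit) zero_le_power2 mult_nonneg_nonneg field_sum_of_halves)
    qed
    finally have "\<rho> * (u e x powr p) \<le> p * (P1 * \<kappa> + A\<^sup>2) * (u e x)\<^sup>2"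
      using p6 by (simp add: field_simps)
    moreover have "1/2 * (u e x powr p) \<le> \<rho> * (u e x powr p)" using \<rho>_ge by (intro mult_right_mono) auto
    ultimately have "u e x powr p \<le> Q * (u e x)\<^sup>2" unfolding Q_def by linarith
    also have "u e x powr p = u e x powr (p - 2) * (u e x)\<^sup>2"
      using u1 powr_add[of "u e x" "p - 2" 2] by (simp add: powr_numeral)
    finally have "u e x powr (p - 2) \<le> Q" using u1 by simp
    then have "(u e x powr (p - 2)) powr (1 / (p - 2)) \<le> Q powr (1 / (p - 2))"
      using p6 by (intro powr_mono2) auto
    then show ?thesis using u1 p6 by (simp add: powr_powr Q_def P1_def)
  qed
qed

end

section \<open>Existence and positivity of solutions on the core\<close>

text \<open>The bounds depend on the energy bound \<open>C\<close> but not on \<open>\<rho>\<close>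
  in \<open>[1/2, 1]\<close>. This is what exact solutions offer beyond discrete critical points,
  whose bound on \<open>BB\<close> blows up as the interval of the monotonicity trick
  shrinks.\<close>

lemma (in core_graph) a_priori_bound:
  "\<exists>A B. \<forall>a \<rho> u c d. approx 0 a \<rho> u c d \<longrightarrow> a > 0 \<longrightarrow> 1/2 \<le> \<rho> \<longrightarrow> \<rho> \<le> 1 \<longrightarrow> En a \<rho> u c \<le> C \<longrightarrow>
    a \<le> A \<and> (\<forall>e\<in>E. \<forall>x\<in>{0..el e}. u e x \<le> B)"
proof -
  define kap where "kap = (\<Sum>e\<in>E. 1 / el e)"
  define \<theta> where "\<theta> = (p - 4) / (p - 2)"
  have \<theta>: "2 * \<theta> < 2" using p6 by (simp add: \<theta>_def field_simps)
  have \<sigma>: "(p - 6) / (2 * (p + 2)) > 0" using p6 by simp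
  obtain A where A: "A > 0" "\<And>x. x \<ge> A \<Longrightarrow> kap * x + (kap / 2 * p powr \<theta> * \<mu>) * x powr (2 * \<theta>) + C / \<mu> < (p - 6) / (2 * (p + 2)) * x\<^sup>2"
    using quadratic_dominates[OF \<sigma> \<theta>, of kap "kap / 2 * p powr \<theta> * \<mu>" "C / \<mu>"] by blast
  define B where "B = max 1 ((2 * p * ((C + A\<^sup>2 * \<mu> / 2) / (1/2 - 1/p) * kap + A\<^sup>2)) powr (1 / (p - 2)))"
  have "a \<le> A \<and> (\<forall>e\<in>E. \<forall>x\<in>{0..el e}. u e x \<le> B)"
    if H: "approx 0 a \<rho> u c d" "a > 0" "1/2 \<le> \<rho>" "\<rho> \<le> 1" "En a \<rho> u c \<le> C" for a \<rho> u c d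
  proof -
    interpret core_solution V E el s t N p \<mu> a \<rho> u c d by unfold_locales (use H in auto)
    have "a \<le> A"
    proof (rule ccontr)
      assume "\<not> a \<le> A"
      then have *: "kap * a + (kap / 2 * p powr \<theta> * \<mu>) * a powr (2 * \<theta>) + C / \<mu> < (p - 6) / (2 * (p + 2)) * a\<^sup>2"
        using A(2)[of a] by simp
      have "(p * a\<^sup>2) powr \<theta> = p powr \<theta> * a powr (2 * \<theta>)"
        using p6 H(2) powr_powr[of a 2 \<theta>] by (simp add: powr_mult powr_numeral)
      then have "kap / 2 * (2 * a + (p * a\<^sup>2) powr \<theta> * \<mu>) = kap * a + (kap / 2 * p powr \<theta> * \<mu>) * a powr (2 * \<theta>)"
        by (simp add: algebra_simps)
      then have "C / \<mu> < (p - 6) / (2 * (p + 2)) * a\<^sup>2 - kap / 2 * (2 * a + (p * a\<^sup>2) powr \<theta> * \<mu>)" using * by linarith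
      from mult_strict_left_mono[OF this \<mu>_pos] have "C < En a \<rho> u c"
        using En_lower[folded \<theta>_def, unfolded \<kappa>_def, folded kap_def] \<mu>_pos by simp
      then show False using H(5) by simp
    qed
    moreover have "u e x \<le> B" if "e \<in> E" "x \<in> {0..el e}" for e x
      using u_bound[OF \<open>a \<le> A\<close> H(5) that] unfolding \<kappa>_def B_def kap_def .
    ultimately show ?thesis by (intro conjI ballI)
  qed
  then show ?thesis by (intro exI[of _ A] exI[of _ B] allI impI)
qed

context core_graph
begin

text \<open>The order of the two limits matters. For fixed \<open>\<delta>\<close> the discrete
  bounds are uniform in the mesh and yield an exact solution for some \<open>\<rho>\<close> in
  \<open>[1 - \<delta>, 1]\<close>; only for exact solutions do the bounds become independent of
  \<open>\<delta>\<close>, which may then tend to 0. The bounds \<open>\<alpha>\<close> and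
  \<open>C\<close> on the energy are common to both stages.\<close>

lemma exists_core_solution:
  "\<exists>a u c d. a > 0 \<and> approx 0 a 1 u c d \<and> 0 < En a 1 u c"
proof -
  obtain \<alpha> C m \<epsilon>0 where \<alpha>: "\<alpha> > 0" and m: "m > (0::nat)" and \<epsilon>0: "\<epsilon>0 > 0"
    and disc: "\<And>\<delta> k \<epsilon>. 0 < \<delta> \<Longrightarrow> \<delta> \<le> 1/2 \<Longrightarrow> k > (0::nat) \<Longrightarrow> 0 < \<epsilon> \<Longrightarrow> \<epsilon> < \<epsilon>0 \<Longrightarrow>
    (\<exists>\<rho>\<in>{1-\<delta>..1}. \<exists>x\<in>DD (2*m*k). (\<forall>y. dA (2*m*k) \<epsilon> x y = \<rho> * dB (2*m*k) x y) \<and>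
       \<alpha> \<le> AA (2*m*k) \<epsilon> x - \<rho> * BB (2*m*k) x \<and> AA (2*m*k) \<epsilon> x - \<rho> * BB (2*m*k) x \<le> C \<and>
       BB (2*m*k) x \<le> (C - \<alpha>) / \<delta> + 2)"
    using discrete_critical by blast
  have fixed: "\<exists>a \<rho> u c d. a > 0 \<and> 1 - \<delta> \<le> \<rho> \<and> \<rho> \<le> 1 \<and> approx 0 a \<rho> u c d \<and> \<alpha> \<le> En a \<rho> u c \<and> En a \<rho> u c \<le> C"
    if \<delta>: "0 < \<delta>" "\<delta> \<le> 1/2" for \<delta>
  proof -
    \<comment> \<open>Bounds both \<open>AA\<close> and \<open>BB\<close>: as
      \<open>\<rho> <= 1\<close>, \<open>AA\<close> exceeds \<open>C\<close> by at most the bound on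
      \<open>BB\<close>. It depends on \<open>\<delta>\<close> but not on the mesh.\<close>
    define c0 where "c0 = max 0 (max C 0 + ((C - \<alpha>) / \<delta> + 2))"
    have c0: "c0 \<ge> 0" by (simp add: c0_def)
    obtain K where K: "K \<ge> 0" and appr: "\<And>n \<epsilon> \<rho> x. n > 0 \<Longrightarrow> 0 < \<epsilon> \<Longrightarrow> \<epsilon> \<le> 1 \<Longrightarrow> 1/2 \<le> \<rho> \<Longrightarrow> \<rho> \<le> 1 \<Longrightarrow> x \<in> DD n \<Longrightarrow>
      (\<And>y. dA n \<epsilon> x y = \<rho> * dB n x y) \<Longrightarrow> AA n \<epsilon> x \<le> c0 \<Longrightarrow> BB n x \<le> c0 \<Longrightarrow>
      (\<exists>a u c d. approx (K * (\<epsilon> + 1 / n)) a \<rho> u c d \<and> 0 \<le> a \<and> a \<le> A0 c0 \<and>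
         (\<forall>e\<in>E. \<forall>y\<in>{0..el e}. u e y \<le> B0 c0) \<and>
         \<bar>En a \<rho> u c - (AA n \<epsilon> x - \<rho> * BB n x)\<bar> \<le> K * (\<epsilon> + 1 / n))"
      using discrete_to_approx[OF c0] by blast
    \<comment> \<open>The regularisation is sent to 0 together with the mesh width, so that one
      sequence of defects covers both.\<close>
    define \<epsilon>s where "\<epsilon>s = (\<lambda>k::nat. min (\<epsilon>0 / 2) 1 / (real k + 1))"
    define \<eta>s where "\<eta>s = (\<lambda>k::nat. K * (\<epsilon>s k + 1 / real (2 * m * (k + 1))))"
    have \<epsilon>s: "0 < \<epsilon>s k" "\<epsilon>s k < \<epsilon>0" "\<epsilon>s k \<le> 1" for k
    proof -
      show "0 < \<epsilon>s k" using \<epsilon>0 by (simp add: \<epsilon>s_def)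
      have "\<epsilon>s k \<le> min (\<epsilon>0 / 2) 1 / 1" unfolding \<epsilon>s_def using \<epsilon>0 by (intro divide_left_mono) auto
      then show "\<epsilon>s k < \<epsilon>0" "\<epsilon>s k \<le> 1" using \<epsilon>0 by auto
    qed
    have "\<exists>a \<rho> u c d. 1 - \<delta> \<le> \<rho> \<and> \<rho> \<le> 1 \<and> approx (\<eta>s k) a \<rho> u c d \<and> 0 \<le> a \<and> a \<le> A0 c0 \<and>
       (\<forall>e\<in>E. \<forall>y\<in>{0..el e}. u e y \<le> B0 c0) \<and> \<alpha> - \<eta>s k \<le> En a \<rho> u c \<and> En a \<rho> u c \<le> C + \<eta>s k" for k
    proof -
      define n where "n = 2 * m * (k + 1)"
      obtain \<rho> x where r: "1 - \<delta> \<le> \<rho>" "\<rho> \<le> 1" "x \<in> DD n" "\<And>y. dA n (\<epsilon>s k) x y = \<rho> * dB n x y"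
        "\<alpha> \<le> AA n (\<epsilon>s k) x - \<rho> * BB n x" "AA n (\<epsilon>s k) x - \<rho> * BB n x \<le> C" "BB n x \<le> (C - \<alpha>) / \<delta> + 2"
        using disc[OF \<delta> _ \<epsilon>s(1,2), of "k + 1" k] unfolding n_def by auto
      have n: "n > 0" using m by (simp add: n_def)
      have r2: "1/2 \<le> \<rho>" using r(1) \<delta> by linarith
      have "\<rho> * BB n x \<le> 1 * ((C - \<alpha>) / \<delta> + 2)" using r r2 BB_nonneg[of n x] by (intro mult_mono) auto
      then have "AA n (\<epsilon>s k) x \<le> c0" "BB n x \<le> c0" using r(6,7) by (auto simp: c0_def)
      from appr[OF n \<epsilon>s(1,3) r2 r(2,3,4) this] obtain a u c d where
        "approx (K * (\<epsilon>s k + 1 / n)) a \<rho> u c d" "0 \<le> a" "a \<le> A0 c0"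
         "\<forall>e\<in>E. \<forall>y\<in>{0..el e}. u e y \<le> B0 c0" and
         E: "\<bar>En a \<rho> u c - (AA n (\<epsilon>s k) x - \<rho> * BB n x)\<bar> \<le> K * (\<epsilon>s k + 1 / n)" by blast
      moreover have "K * (\<epsilon>s k + 1 / n) = \<eta>s k" by (simp add: \<eta>s_def n_def)
      moreover have "\<alpha> - \<eta>s k \<le> En a \<rho> u c" "En a \<rho> u c \<le> C + \<eta>s k"
        using E r(5,6) unfolding \<open>K * (\<epsilon>s k + 1 / n) = \<eta>s k\<close> by linarith+
      ultimately show ?thesis using r(1,2) by (intro exI[of _ a] exI[of _ \<rho>] exI[of _ u] exI[of _ c] exI[of _ d]) auto
    qed
    then obtain a \<rho> u c d where H: "\<And>k. 1 - \<delta> \<le> \<rho> k" "\<And>k. \<rho> k \<le> 1" "\<And>k. approx (\<eta>s k) (a k) (\<rho> k) (u k) (c k) (d k)"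
       "\<And>k. 0 \<le> a k" "\<And>k. a k \<le> A0 c0" "\<And>k e y. e \<in> E \<Longrightarrow> y \<in> {0..el e} \<Longrightarrow> u k e y \<le> B0 c0"
       "\<And>k. \<alpha> - \<eta>s k \<le> En (a k) (\<rho> k) (u k) (c k)" "\<And>k. En (a k) (\<rho> k) (u k) (c k) \<le> C + \<eta>s k"
      by metis
    have \<eta>0: "\<eta>s \<longlonglongrightarrow> 0"
    proof -
      have "(\<lambda>k. 1 / (real k + 1)) \<longlonglongrightarrow> 0" using LIMSEQ_inverse_real_of_nat by (simp add: inverse_eq_divide add.commute)
      then have "(\<lambda>k. K * (min (\<epsilon>0 / 2) 1 * (1 / (real k + 1)) + 1 / (2 * real m) * (1 / (real k + 1)))) \<longlonglongrightarrow> K * (min (\<epsilon>0 / 2) 1 * 0 + 1 / (2 * real m) * 0)"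
        by (intro tendsto_intros)
      moreover have "\<eta>s = (\<lambda>k. K * (min (\<epsilon>0 / 2) 1 * (1 / (real k + 1)) + 1 / (2 * real m) * (1 / (real k + 1))))"
        by (rule ext) (simp add: \<eta>s_def \<epsilon>s_def add.commute distrib_left)
      ultimately show ?thesis by simp
    qed
    have "\<forall>\<^sub>F k in sequentially. \<eta>s k < 1" using order_tendstoD(2)[OF \<eta>0, of 1] by simp
    \<comment> \<open>Dropping the first \<open>k0\<close> indices secures the bound by 1 that
      \<open>limit_of_approx\<close> asks of every defect.\<close>
    then obtain k0 where k0: "\<And>k. k \<ge> k0 \<Longrightarrow> \<eta>s k < 1" by (auto simp: eventually_sequentially)
    have "\<exists>a' \<rho>' u' c' d' r. a' > 0 \<and> strict_mono r \<and> (\<lambda>k. \<rho> (r k + k0)) \<longlonglongrightarrow> \<rho>' \<and> approx 0 a' \<rho>' u' c' d' \<and>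
      \<alpha> \<le> En a' \<rho>' u' c' \<and> En a' \<rho>' u' c' \<le> C"
    proof (rule limit_of_approx[of "\<lambda>k. \<eta>s (k + k0)" "\<lambda>k. a (k + k0)" "\<lambda>k. \<rho> (k + k0)" "\<lambda>k. u (k + k0)" "\<lambda>k. c (k + k0)" "\<lambda>k. d (k + k0)" "A0 c0" "B0 c0"])
      show "(\<lambda>k. \<eta>s (k + k0)) \<longlonglongrightarrow> 0" using \<eta>0 by (rule LIMSEQ_ignore_initial_segment)
      show "\<eta>s (k + k0) \<le> 1" for k using k0[of "k + k0"] by simp
      show "1/2 \<le> \<rho> (k + k0)" for k using H(1)[of "k + k0"] \<delta> by linarith
    qed (use H \<alpha> in auto)
    then obtain a' \<rho>' u' c' d' r where L: "a' > 0" "(\<lambda>k. \<rho> (r k + k0)) \<longlonglongrightarrow> \<rho>'" "approx 0 a' \<rho>' u' c' d'"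
      "\<alpha> \<le> En a' \<rho>' u' c'" "En a' \<rho>' u' c' \<le> C" by blast
    have "1 - \<delta> \<le> \<rho>'" by (rule LIMSEQ_le_const[OF L(2)]) (use H in auto)
    moreover have "\<rho>' \<le> 1" by (rule LIMSEQ_le_const2[OF L(2)]) (use H in auto)
    ultimately show ?thesis using L by blast
  qed
  \<comment> \<open>The choice \<open>\<delta> = 1 / (k + 2)\<close> is at most 1/2 for every
    \<open>k\<close> and pushes \<open>\<rho>\<close> to 1.\<close>
  have "\<exists>a \<rho> u c d. a > 0 \<and> 1 - 1 / (real k + 2) \<le> \<rho> \<and> \<rho> \<le> 1 \<and> approx 0 a \<rho> u c d \<and> \<alpha> \<le> En a \<rho> u c \<and> En a \<rho> u c \<le> C" for k
    by (rule fixed) (auto simp: field_simps)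
  then obtain a \<rho> u c d where H: "\<And>k. a k > 0" "\<And>k. 1 - 1 / (real k + 2) \<le> \<rho> k" "\<And>k. \<rho> k \<le> 1"
    "\<And>k. approx 0 (a k) (\<rho> k) (u k) (c k) (d k)" "\<And>k. \<alpha> \<le> En (a k) (\<rho> k) (u k) (c k)" "\<And>k. En (a k) (\<rho> k) (u k) (c k) \<le> C"
    by metis
  have half: "1/2 \<le> \<rho> k" for k
  proof -
    have "1 / (real k + 2) \<le> 1/2" by (simp add: field_simps)
    then show ?thesis using H(2)[of k] by linarith
  qed
  obtain A B where AB: "\<And>a \<rho> u c d. approx 0 a \<rho> u c d \<Longrightarrow> a > 0 \<Longrightarrow> 1/2 \<le> \<rho> \<Longrightarrow> \<rho> \<le> 1 \<Longrightarrow> En a \<rho> u c \<le> C \<Longrightarrow>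
    a \<le> A \<and> (\<forall>e\<in>E. \<forall>x\<in>{0..el e}. u e x \<le> B)"
    using a_priori_bound[of C] by blast
  have b: "a k \<le> A \<and> (\<forall>e\<in>E. \<forall>x\<in>{0..el e}. u k e x \<le> B)" for k
    by (rule AB[OF H(4) H(1) half H(3) H(6)])
  have "\<exists>a' \<rho>' u' c' d' r. a' > 0 \<and> strict_mono r \<and> (\<lambda>k. \<rho> (r k)) \<longlonglongrightarrow> \<rho>' \<and> approx 0 a' \<rho>' u' c' d' \<and>
      \<alpha> \<le> En a' \<rho>' u' c' \<and> En a' \<rho>' u' c' \<le> C"
    by (rule limit_of_approx[of "\<lambda>_. 0" a \<rho> u c d A B]) (use H half b \<alpha> in \<open>auto simp: less_imp_le\<close>)
  then obtain a' \<rho>' u' c' d' r where L: "a' > 0" "strict_mono (r :: nat \<Rightarrow> nat)" "(\<lambda>k. \<rho> (r k)) \<longlonglongrightarrow> \<rho>'" "approx 0 a' \<rho>' u' c' d'"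
    "\<alpha> \<le> En a' \<rho>' u' c'" by blast
  have "\<rho> \<longlonglongrightarrow> 1"
  proof (rule tendsto_sandwich[OF _ _ _ tendsto_const])
    have "(\<lambda>k. 1 / real (Suc (k + 1))) \<longlonglongrightarrow> 0"
      using LIMSEQ_ignore_initial_segment[OF LIMSEQ_inverse_real_of_nat, of 1] by (simp add: inverse_eq_divide)
    then have "(\<lambda>k. 1 - 1 / real (Suc (k + 1))) \<longlonglongrightarrow> 1 - 0" by (intro tendsto_intros)
    then show "(\<lambda>k. 1 - 1 / (real k + 2)) \<longlonglongrightarrow> 1" by (simp add: add.commute)
  qed (use H in auto)
  from LIMSEQ_subseq_LIMSEQ[OF this L(2)] have "\<rho>' = 1" using LIMSEQ_unique[OF L(3)] by (simp add: o_def)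
  then show ?thesis using L \<alpha> by (intro exI[of _ a'] exI[of _ u'] exI[of _ c'] exI[of _ d']) auto
qed

end

section \<open>Positivity on the core\<close>

context core_solution
begin

text \<open>A zero is a minimum of the nonnegative function \<open>u\<close>, so a derivative on a
  side that belongs to the edge has a sign.\<close>

lemma zero_slope_sign:
  assumes e: "e \<in> E" and x: "x \<in> {0..el e}" and z: "u e x = 0"
  shows "x < el e \<Longrightarrow> 0 \<le> du e x" "0 < x \<Longrightarrow> du e x \<le> 0"
proof -
  show "0 \<le> du e x" if "x < el e"
  proof (rule ccontr)
    assume "\<not> 0 \<le> du e x"
    then obtain \<epsilon> where \<epsilon>: "\<epsilon> > 0" "\<And>h. h > 0 \<Longrightarrow> x + h \<in> {0..el e} \<Longrightarrow> h < \<epsilon> \<Longrightarrow> u e x > u e (x + h)"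
      using has_real_derivative_neg_dec_right[OF u_deriv[OF e x]] by auto
    define h where "h = min (\<epsilon> / 2) (el e - x)"
    have "h > 0" "x + h \<in> {0..el e}" "h < \<epsilon>" using \<epsilon>(1) that x by (auto simp: h_def min_def)
    then show False using \<epsilon>(2)[of h] u_nonneg[OF e, of "x + h"] z by auto
  qed
  show "du e x \<le> 0" if "0 < x"
  proof (rule ccontr)
    assume "\<not> du e x \<le> 0"
    then obtain \<epsilon> where \<epsilon>: "\<epsilon> > 0" "\<And>h. h > 0 \<Longrightarrow> x - h \<in> {0..el e} \<Longrightarrow> h < \<epsilon> \<Longrightarrow> u e (x - h) < u e x"
      using has_real_derivative_pos_inc_left[OF u_deriv[OF e x]] by auto
    define h where "h = min (\<epsilon> / 2) x"
    have "h > 0" "x - h \<in> {0..el e}" "h < \<epsilon>" using \<epsilon>(1) that x by (auto simp: h_def min_def)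
    then show False using \<epsilon>(2)[of h] u_nonneg[OF e, of "x - h"] z by auto
  qed
qed

text \<open>A double zero makes the Hamiltonian vanish, whence \<open>|u'| <= a * u\<close>. Then
  \<open>u * exp (- a * x)\<close> to the right of \<open>x0\<close> and
  \<open>u * exp (a * x)\<close> to its left are monotone in the direction that forces
  \<open>u <= 0\<close>.\<close>

lemma unique_continuation:
  assumes e: "e \<in> E" and x0: "x0 \<in> {0..el e}" and z: "u e x0 = 0" "du e x0 = 0" and x: "x \<in> {0..el e}"
  shows "u e x = 0"
proof -
  have H0: "hamiltonian e 0 = 0" using hamiltonian_const[OF e x0] z p6 by (simp add: hamiltonian_def)
  have slope: "\<bar>du e y\<bar> \<le> a * u e y" if y: "y \<in> {0..el e}" for y
  proof -
    have "0 \<le> \<rho> * (u e y powr p) / p" using \<rho>_pos p6 by simp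
    then have "(du e y)\<^sup>2 \<le> (a * u e y)\<^sup>2" using hamiltonian_const[OF e y] H0 by (simp add: hamiltonian_def power_mult_distrib)
    then show ?thesis using u_nonneg[OF e y] a_pos by (metis abs_le_square_iff abs_of_nonneg mult_nonneg_nonneg less_imp_le)
  qed
  have mono: "\<And>k. ((\<lambda>y. u e y * exp (k * y)) has_real_derivative (du e y + k * u e y) * exp (k * y)) (at y within {0..el e})"
    if "y \<in> {0..el e}" for y
    by (auto intro!: derivative_eq_intros u_deriv[OF e that] simp: algebra_simps)
  have cont: "continuous_on {0..el e} (\<lambda>y. u e y * exp (k * y))" for k
    by (intro continuous_intros u_cont e)
  have dint: "((\<lambda>y. u e y * exp (k * y)) has_real_derivative (du e y + k * u e y) * exp (k * y)) (at y)" if "0 < y" "y < el e" for y k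
    using mono[of y k] that at_within_interior[of y "{0..el e}"] by simp
  have "u e x \<le> 0"
  proof (cases "x0 \<le> x")
    case True
    have "u e x * exp (- a * x) \<le> u e x0 * exp (- a * x0)"
    proof (rule DERIV_nonpos_imp_decreasing_open[OF True])
      fix y assume y: "x0 < y" "y < x"
      have "du e y + - a * u e y \<le> 0" using slope[of y] y x0 x by auto
      then have "(du e y + - a * u e y) * exp (- a * y) \<le> 0" by (rule mult_nonpos_nonneg) simp
      then show "\<exists>D. ((\<lambda>y. u e y * exp (- a * y)) has_real_derivative D) (at y) \<and> D \<le> 0"
        using dint[of y "- a"] y x0 x by (intro exI[of _ "(du e y + - a * u e y) * exp (- a * y)"] conjI) auto
    qed (rule continuous_on_subset[OF cont], use x0 x in auto)
    then show ?thesis using z by (simp add: mult_le_0_iff)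
  next
    case False
    then have le: "x \<le> x0" by simp
    have "u e x * exp (a * x) \<le> u e x0 * exp (a * x0)"
    proof (rule DERIV_nonneg_imp_increasing_open[OF le])
      fix y assume y: "x < y" "y < x0"
      have "0 \<le> du e y + a * u e y" using slope[of y] y x0 x by auto
      then have "0 \<le> (du e y + a * u e y) * exp (a * y)" by simp
      then show "\<exists>D. ((\<lambda>y. u e y * exp (a * y)) has_real_derivative D) (at y) \<and> 0 \<le> D"
        using dint[of y a] y x0 x by (intro exI[of _ "(du e y + a * u e y) * exp (a * y)"] conjI) auto
    qed (rule continuous_on_subset[OF cont], use x0 x in auto)
    then show ?thesis using z by (simp add: mult_le_0_iff)
  qed
  then show ?thesis using u_nonneg[OF e x] by simp
qed

text \<open>At a zero vertex all outer derivatives are nonnegative, while their sum is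
  \<open>a * N v * c v = 0\<close>. So each of them vanishes, and every incident edge starts from a
  double zero.\<close>

lemma zero_vertex_edges:
  assumes v: "v \<in> V" and cv: "c v = 0" and e: "e \<in> E" "s e = v \<or> t e = v" and x: "x \<in> {0..el e}"
  shows "u e x = 0"
proof -
  have S: "0 \<le> d e" if "e \<in> E" "s e = v" for e
    using zero_slope_sign(1)[OF that(1), of 0] el_pos[OF that(1)] u_s[OF that(1)] that cv by (simp add: du_0)
  have T: "0 \<le> - du e (el e)" if "e \<in> E" "t e = v" for e
    using zero_slope_sign(2)[OF that(1), of "el e"] el_pos[OF that(1)] u_t[OF that(1)] that cv by simp
  have sum0: "(\<Sum>e\<in>{e\<in>E. s e = v}. d e) + (\<Sum>e\<in>{e\<in>E. t e = v}. - du e (el e)) = 0"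
    using vertex_eq[OF v] cv by (simp add: sum_negf)
  have n1: "0 \<le> (\<Sum>e\<in>{e\<in>E. s e = v}. d e)" using S by (intro sum_nonneg) auto
  have n2: "0 \<le> (\<Sum>e\<in>{e\<in>E. t e = v}. - du e (el e))" using T by (intro sum_nonneg) auto
  have z1: "(\<Sum>e\<in>{e\<in>E. s e = v}. d e) = 0" and z2: "(\<Sum>e\<in>{e\<in>E. t e = v}. - du e (el e)) = 0"
    using sum0 n1 n2 by linarith+
  from e(2) show ?thesis
  proof
    assume "s e = v"
    then have "d e = 0" using z1 S sum_nonneg_eq_0_iff[of "{e\<in>E. s e = v}" d] finE e by auto
    then show ?thesis using unique_continuation[OF e(1), of 0 x] u_s[OF e(1)] cv \<open>s e = v\<close> el_pos[OF e(1)] x by (simp add: du_0)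
  next
    assume "t e = v"
    then have "- du e (el e) = 0" using z2 T sum_nonneg_eq_0_iff[of "{e\<in>E. t e = v}" "\<lambda>e. - du e (el e)"] finE e by auto
    then show ?thesis using unique_continuation[OF e(1), of "el e" x] u_t[OF e(1)] cv \<open>t e = v\<close> el_pos[OF e(1)] x by simp
  qed
qed

text \<open>A zero spreads along bounded edges to every vertex by connectedness; \<open>u\<close>
  then vanishes identically and \<open>En_eq\<close> makes the energy nonpositive.\<close>

lemma no_zero_vertex:
  assumes En: "En a \<rho> u c > 0" and v: "v \<in> V" shows "c v \<noteq> 0"
proof
  assume cv: "c v = 0"
  have all0: "c w = 0" if "w \<in> V" for w
    using connected[OF v that]
  proof (induction rule: rtrancl_induct)
    case (step b w')
    then obtain e where e: "e \<in> E" "{b, w'} = {s e, t e}" by auto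
    have bV: "b \<in> V" using e s_in[OF e(1)] t_in[OF e(1)] by (auto simp: doubleton_eq_iff)
    have "u e x = 0" if "x \<in> {0..el e}" for x
      by (rule zero_vertex_edges[OF bV step.IH e(1) _ that]) (use e(2) in \<open>auto simp: doubleton_eq_iff\<close>)
    then have "u e 0 = 0" "u e (el e) = 0" using el_pos[OF e(1)] by auto
    then show ?case using e(2) u_s[OF e(1)] u_t[OF e(1)] by (auto simp: doubleton_eq_iff)
  qed (rule cv)
  have "u e x = 0" if "e \<in> E" "x \<in> {0..el e}" for e x
    by (rule zero_vertex_edges[OF s_in[OF that(1)] all0[OF s_in[OF that(1)]] that(1) _ that(2)]) simp
  then have "Pow u = 0" unfolding Pow_def
    by (intro sum.neutral) (use p6 in \<open>auto intro!: integral_unique has_integral_is_0\<close>)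
  moreover have "0 \<le> a\<^sup>2 * \<mu> / 2" using \<mu>_pos by simp
  ultimately show False using En unfolding En_eq by simp
qed

text \<open>An interior zero is a double zero and would propagate to the start of the edge, where
  \<open>u\<close> equals a nonzero vertex value.\<close>

lemma u_pos:
  assumes En: "En a \<rho> u c > 0" and e: "e \<in> E" and x: "x \<in> {0..el e}" shows "0 < u e x"
proof (rule ccontr)
  assume "\<not> 0 < u e x"
  then have z: "u e x = 0" using u_nonneg[OF e x] by simp
  have "x \<noteq> 0" using z u_s[OF e] no_zero_vertex[OF En s_in[OF e]] by auto
  moreover have "x \<noteq> el e" using z u_t[OF e] no_zero_vertex[OF En t_in[OF e]] by auto
  ultimately have "0 < x" "x < el e" using x by auto
  then have "du e x = 0" using zero_slope_sign[OF e x z] by simp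
  then have "u e 0 = 0" using unique_continuation[OF e x z, of 0] el_pos[OF e] by simp
  then show False using u_s[OF e] no_zero_vertex[OF En s_in[OF e]] by simp
qed

end

section \<open>Weak derivatives on intervals\<close>

text \<open>A quadratic spline rising from 0 to 1 on \<open>[0, 1]\<close>; its derivative is the
  tent of height 2 at 1/2. It has exactly the C1 regularity that \<open>test_functions\<close> asks
  for.\<close>

definition smooth_step :: "real \<Rightarrow> real" where
  "smooth_step x = 2 * (max 0 x)\<^sup>2 - 4 * (max 0 (x - 1/2))\<^sup>2 + 2 * (max 0 (x - 1))\<^sup>2"
definition smooth_step_deriv :: "real \<Rightarrow> real" where
  "smooth_step_deriv x = 4 * max 0 x - 8 * max 0 (x - 1/2) + 4 * max 0 (x - 1)"

lemma pos_part_square_deriv: "((\<lambda>x::real. (max 0 x)\<^sup>2) has_real_derivative 2 * max 0 x) (at x)"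
proof -
  consider "x > 0" | "x < 0" | "x = 0" by linarith
  then show ?thesis
  proof cases
    case 1
    have "((\<lambda>x::real. x\<^sup>2) has_real_derivative 2 * x) (at x)" by (auto intro!: derivative_eq_intros)
    then have "((\<lambda>x::real. (max 0 x)\<^sup>2) has_real_derivative 2 * x) (at x)"
      by (rule has_field_derivative_transform_within_open[where S = "{0<..}"]) (use 1 in auto)
    then show ?thesis using 1 by simp
  next
    case 2
    have "((\<lambda>x. 0::real) has_real_derivative 0) (at x)" by simp
    then have "((\<lambda>x::real. (max 0 x)\<^sup>2) has_real_derivative 0) (at x)"
      by (rule has_field_derivative_transform_within_open[where S = "{..<0}"]) (use 2 in auto)
    then show ?thesis using 2 by simp
  next
    case 3
    have "((\<lambda>h::real. \<bar>h\<bar>) \<longlongrightarrow> 0) (at 0)" by (intro tendsto_rabs_zero tendsto_ident_at)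
    moreover have "norm ((max 0 (0 + h))\<^sup>2 / h) \<le> \<bar>h\<bar>" for h :: real
      by (auto simp: max_def power2_eq_square)
    ultimately have "((\<lambda>h. (max 0 (0 + h))\<^sup>2 / h) \<longlongrightarrow> 0) (at (0::real))"
      by (intro Lim_null_comparison[OF _ \<open>((\<lambda>h::real. \<bar>h\<bar>) \<longlongrightarrow> 0) (at 0)\<close>]) auto
    then show ?thesis using 3 by (simp add: DERIV_def)
  qed
qed

lemma smooth_step_has_deriv: "(smooth_step has_real_derivative smooth_step_deriv x) (at x)"
proof -
  have "((\<lambda>x. (max 0 (x - c))\<^sup>2) has_real_derivative 2 * max 0 (x - c) * 1) (at x)" for c :: real
    by (rule DERIV_chain2[OF pos_part_square_deriv]) (auto intro!: derivative_eq_intros)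
  note * = this[of "1/2"] this[of 1]
  show ?thesis
    using DERIV_add[OF DERIV_diff[OF DERIV_cmult[OF pos_part_square_deriv, of 2] DERIV_cmult[OF *(1), of 4]] DERIV_cmult[OF *(2), of 2]]
    unfolding smooth_step_def[abs_def] smooth_step_deriv_def by simp
qed

lemma smooth_step_deriv_cont: "continuous_on S smooth_step_deriv"
  unfolding smooth_step_deriv_def[abs_def] by (intro continuous_intros)

lemma smooth_step_0: "x \<le> 0 \<Longrightarrow> smooth_step x = 0"
  by (simp add: smooth_step_def)

lemma smooth_step_1: "x \<ge> 1 \<Longrightarrow> smooth_step x = 1"
  by (simp add: smooth_step_def power2_eq_square algebra_simps)

lemma smooth_step_deriv_nonneg: "0 \<le> smooth_step_deriv x"
  by (auto simp: smooth_step_deriv_def max_def)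

lemma smooth_step_deriv_0: "x \<le> 0 \<or> 1 \<le> x \<Longrightarrow> smooth_step_deriv x = 0"
  by (auto simp: smooth_step_deriv_def max_def)

lemma smooth_step_mono: "x \<le> y \<Longrightarrow> smooth_step x \<le> smooth_step y"
  by (rule DERIV_nonneg_imp_nondecreasing) (use smooth_step_has_deriv smooth_step_deriv_nonneg in blast)+

lemma smooth_step_range: "0 \<le> smooth_step x" "smooth_step x \<le> 1"
  using smooth_step_mono[of "min 0 x" x] smooth_step_mono[of x "max 1 x"] smooth_step_0[of "min 0 x"] smooth_step_1[of "max 1 x"]
  by auto

text \<open>The rescaled derivative of the step is a unit bump living on \<open>[c, c + d]\<close>,
  so integration against it averages \<open>f\<close> over that interval.\<close>

lemma bump_integral_error:
  fixes f :: "real \<Rightarrow> real"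
  assumes f: "continuous_on {x..y} f" and d: "d > 0" and c: "x \<le> c" "c + d \<le> y"
    and osc: "\<And>z. z \<in> {c..c + d} \<Longrightarrow> \<bar>f z - k\<bar> \<le> \<epsilon>"
  shows "\<bar>integral {x..y} (\<lambda>z. f z * (smooth_step_deriv ((z - c) / d) / d)) - k\<bar> \<le> \<epsilon>"
proof -
  define b where "b = (\<lambda>z. smooth_step_deriv ((z - c) / d) / d)"
  have bc: "continuous_on {x..y} b" unfolding b_def
    by (intro continuous_intros continuous_on_compose2[OF smooth_step_deriv_cont]) (use d in auto)
  have b0: "0 \<le> b z" for z using d smooth_step_deriv_nonneg by (simp add: b_def)
  have xy: "x \<le> y" using c d by linarith
  have B: "(b has_integral 1) {x..y}"
  proof -
    have "(b has_integral smooth_step ((y - c) / d) - smooth_step ((x - c) / d)) {x..y}"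
    proof (rule fundamental_theorem_of_calculus[OF xy])
      fix z assume "z \<in> {x..y}"
      have "((\<lambda>z. smooth_step ((z - c) / d)) has_real_derivative smooth_step_deriv ((z - c) / d) * (1 / d)) (at z within {x..y})"
        by (rule DERIV_chain2[OF smooth_step_has_deriv]) (use d in \<open>auto intro!: derivative_eq_intros\<close>)
      then show "((\<lambda>z. smooth_step ((z - c) / d)) has_vector_derivative b z) (at z within {x..y})"
        by (simp add: b_def has_real_derivative_iff_has_vector_derivative)
    qed
    moreover have "smooth_step ((y - c) / d) = 1" using c d by (intro smooth_step_1) (simp add: field_simps)
    moreover have "smooth_step ((x - c) / d) = 0" using c d by (intro smooth_step_0) (simp add: divide_nonpos_pos)
    ultimately show ?thesis by simp
  qed
  have I: "((\<lambda>z. f z * b z - k * b z) has_integral integral {x..y} (\<lambda>z. f z * b z) - k * 1) {x..y}"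
    by (intro has_integral_diff has_integral_mult_right B integrable_integral integrable_continuous_interval continuous_intros f bc)
  have pt: "\<bar>f z * b z - k * b z\<bar> \<le> \<epsilon> * b z" for z
  proof (cases "z \<in> {c..c + d}")
    case True
    have "\<bar>f z * b z - k * b z\<bar> = \<bar>f z - k\<bar> * b z" using b0[of z] by (simp add: abs_mult left_diff_distrib[symmetric])
    also have "\<dots> \<le> \<epsilon> * b z" by (rule mult_right_mono[OF osc[OF True] b0])
    finally show ?thesis .
  next
    case False
    then have "b z = 0" unfolding b_def using d by (subst smooth_step_deriv_0) (auto simp: field_simps)
    then show ?thesis by simp
  qed
  have E: "((\<lambda>z. \<epsilon> * b z) has_integral \<epsilon> * 1) {x..y}" by (intro has_integral_mult_right B)
  have E': "((\<lambda>z. - (\<epsilon> * b z)) has_integral - (\<epsilon> * 1)) {x..y}" using E by (rule has_integral_neg)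
  have pt2: "f z * b z - k * b z \<le> \<epsilon> * b z" "- (\<epsilon> * b z) \<le> f z * b z - k * b z" for z
    using pt[of z] by linarith+
  have "integral {x..y} (\<lambda>z. f z * b z) - k * 1 \<le> \<epsilon> * 1"
    by (rule has_integral_le[OF I E]) (rule pt2)
  moreover have "- (\<epsilon> * 1) \<le> integral {x..y} (\<lambda>z. f z * b z) - k * 1"
    by (rule has_integral_le[OF E' I]) (rule pt2)
  ultimately show ?thesis by (simp add: b_def abs_le_iff)
qed

section \<open>Square-integrable functions and integration by parts on intervals\<close>

lemma L2_on_integrable_mult:
  assumes "f \<in> L2_on I" "g \<in> L2_on I"
  shows "integrable (lebesgue_on I) (\<lambda>x. f x * g x)"
proof (rule Bochner_Integration.integrable_bound)
  show "integrable (lebesgue_on I) (\<lambda>x. (f x)\<^sup>2 + (g x)\<^sup>2)" using assms by (auto simp: L2_on_def)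
  show "(\<lambda>x. f x * g x) \<in> borel_measurable (lebesgue_on I)" using assms by (auto simp: L2_on_def)
  have "\<bar>a * b\<bar> \<le> a\<^sup>2 + b\<^sup>2" for a b :: real
  proof -
    have "0 \<le> (\<bar>a\<bar> - \<bar>b\<bar>)\<^sup>2" by simp
    then have "2 * (\<bar>a\<bar> * \<bar>b\<bar>) \<le> a\<^sup>2 + b\<^sup>2" by (simp add: power2_diff)
    moreover have "0 \<le> \<bar>a\<bar> * \<bar>b\<bar>" by simp
    ultimately show ?thesis unfolding abs_mult by linarith
  qed
  then show "AE x in lebesgue_on I. norm (f x * g x) \<le> norm ((f x)\<^sup>2 + (g x)\<^sup>2)" by (auto simp: abs_of_nonneg)
qed

lemma L2_on_add: "f \<in> L2_on I \<Longrightarrow> g \<in> L2_on I \<Longrightarrow> (\<lambda>x. f x + g x) \<in> L2_on I"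
  using L2_on_integrable_mult[of f I g] unfolding L2_on_def
  by (auto simp: power2_sum mult.assoc intro!: Bochner_Integration.integrable_add Bochner_Integration.integrable_mult_right)

lemma L2_on_cmult: "f \<in> L2_on I \<Longrightarrow> (\<lambda>x. c * f x) \<in> L2_on I"
  by (auto simp: L2_on_def power_mult_distrib)

lemma L2_on_continuous: "continuous_on {a..b} f \<Longrightarrow> f \<in> L2_on {a..b}"
  by (auto simp: L2_on_def intro!: continuous_imp_measurable_on_sets_lebesgue continuous_imp_integrable_real continuous_intros)

lemma L2_on_subset:
  assumes f: "f \<in> L2_on I" and S: "S \<subseteq> I" "S \<in> sets lebesgue" "I \<in> sets lebesgue"
  shows "f \<in> L2_on S"
proof -
  have "f \<in> borel_measurable (lebesgue_on S)"
    using f S unfolding L2_on_def by (auto intro: measurable_restrict_mono)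
  moreover have "integrable (lebesgue_on S) (\<lambda>x. (f x)\<^sup>2)"
  proof -
    have "set_integrable lebesgue I (\<lambda>x. (f x)\<^sup>2)"
      using f S by (simp add: L2_on_def set_integrable_def integrable_restrict_space)
    then have "set_integrable lebesgue S (\<lambda>x. (f x)\<^sup>2)" by (rule set_integrable_subset) (use S in auto)
    then show ?thesis using S by (simp add: set_integrable_def integrable_restrict_space)
  qed
  ultimately show ?thesis by (simp add: L2_on_def)
qed

lemma L2_on_integrable_interval:
  assumes f: "f \<in> L2_on I" and S: "{a..b} \<subseteq> I" "I \<in> sets lebesgue"
  shows "integrable (lebesgue_on {a..b}) f"
  using L2_on_integrable_mult[OF L2_on_subset[OF f S(1) _ S(2)] L2_on_continuous[of a b "\<lambda>_. 1"]] by simp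

text \<open>
  Test functions are compactly supported in the interior of \<open>I\<close>; multiply \<open>w\<close> by a smooth cut-off of \<open>{x..y}\<close>
  whose derivative concentrates at the end points.
\<close>

lemma weak_deriv_by_parts:
  fixes v g w w' :: "real \<Rightarrow> real"
  assumes xy: "x < y" "{x..y} \<subseteq> I" and I: "I \<in> sets lebesgue"
    and v: "continuous_on {x..y} v" and g: "g \<in> L2_on I" and weak: "has_weak_deriv I v g"
    and w: "\<And>z. z \<in> {x..y} \<Longrightarrow> (w has_real_derivative w' z) (at z within {x..y})"
    and w': "continuous_on {x..y} w'"
  shows "(LINT z|lebesgue_on {x..y}. g z * w z) = v y * w y - v x * w x - (LINT z|lebesgue_on {x..y}. v z * w' z)"
proof -
  have wc: "continuous_on {x..y} w" using w by (intro DERIV_continuous_on) auto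
  define \<delta> where "\<delta> = (\<lambda>n::nat. (y - x) / (real n + 4))"
  have \<delta>0: "\<delta> n > 0" for n using xy by (simp add: \<delta>_def)
  have \<delta>4: "4 * \<delta> n \<le> y - x" for n
  proof -
    have "(y - x) * (4 / (real n + 4)) \<le> (y - x) * 1" using xy by (intro mult_left_mono) auto
    then show ?thesis by (simp add: \<delta>_def mult.commute)
  qed
  have \<delta>lim: "\<delta> \<longlonglongrightarrow> 0"
  proof -
    have "(\<lambda>n. (y - x) * (1 / real (Suc (n + 3)))) \<longlonglongrightarrow> (y - x) * 0"
      using LIMSEQ_ignore_initial_segment[OF LIMSEQ_inverse_real_of_nat, of 3]
      by (intro tendsto_mult tendsto_const) (simp add: inverse_eq_divide)
    then show ?thesis by (simp add: \<delta>_def[abs_def] add.commute)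
  qed
  \<comment> \<open>The cut-off rises on \<open>[x + \<delta>, x + 2 \<delta>]\<close> and falls on
    \<open>[y - 2 \<delta>, y - \<delta>]\<close>. The bound \<open>4 \<delta> <= y - x\<close>
    keeps the ramps in this order, and the margin \<open>\<delta>\<close> keeps the support away
    from \<open>x\<close> and \<open>y\<close>.\<close>
  define c1 where "c1 = (\<lambda>n. x + \<delta> n)"
  define c2 where "c2 = (\<lambda>n. y - 2 * \<delta> n)"
  define cf where "cf = (\<lambda>n z. smooth_step ((z - c1 n) / \<delta> n) - smooth_step ((z - c2 n) / \<delta> n))"
  define cd where "cd = (\<lambda>n z. smooth_step_deriv ((z - c1 n) / \<delta> n) / \<delta> n - smooth_step_deriv ((z - c2 n) / \<delta> n) / \<delta> n)"
  have cderiv: "(cf n has_real_derivative cd n z) (at z within S)" for n z S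
  proof -
    have "((\<lambda>z. smooth_step ((z - c) / \<delta> n)) has_real_derivative smooth_step_deriv ((z - c) / \<delta> n) * (1 / \<delta> n)) (at z within S)" for c
      by (rule DERIV_chain2[OF smooth_step_has_deriv]) (use \<delta>0[of n] in \<open>auto intro!: derivative_eq_intros\<close>)
    from DERIV_diff[OF this[of "c1 n"] this[of "c2 n"]] show ?thesis by (simp add: cf_def cd_def)
  qed
  have sdc: "continuous_on S (\<lambda>z. smooth_step_deriv ((z - c) / \<delta> n) / \<delta> n)" for S c n
    by (intro continuous_intros continuous_on_compose2[OF smooth_step_deriv_cont[of UNIV]]) (use \<delta>0[of n] in auto)
  have cdc: "continuous_on S (cd n)" for n S
    unfolding cd_def by (intro continuous_on_diff sdc)
  have cutc: "continuous_on S (cf n)" for n S using cderiv by (intro DERIV_continuous_on)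
  have cut1: "\<bar>cf n z\<bar> \<le> 1" for n z
    using smooth_step_range[of "(z - c1 n) / \<delta> n"] smooth_step_range[of "(z - c2 n) / \<delta> n"] by (auto simp: cf_def)
  have out: "cf n z = 0 \<and> cd n z = 0" if "z \<le> x + \<delta> n \<or> y - \<delta> n \<le> z" for n z
    using that
  proof
    assume "z \<le> x + \<delta> n"
    then have "(z - c1 n) / \<delta> n \<le> 0" "(z - c2 n) / \<delta> n \<le> 0"
      using \<delta>0[of n] \<delta>4[of n] by (auto simp: c1_def c2_def divide_nonpos_pos)
    then show ?thesis by (simp add: cf_def cd_def smooth_step_0 smooth_step_deriv_0)
  next
    assume "y - \<delta> n \<le> z"
    then have "(z - c1 n) / \<delta> n \<ge> 1" "(z - c2 n) / \<delta> n \<ge> 1"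
      using \<delta>0[of n] \<delta>4[of n] by (auto simp: c1_def c2_def field_simps)
    then show ?thesis by (simp add: cf_def cd_def smooth_step_1 smooth_step_deriv_0)
  qed
  have inside: "\<forall>\<^sub>F n in sequentially. cf n z = 1" if z: "x < z" "z < y" for z
  proof -
    define m where "m = min ((z - x) / 2) ((y - z) / 2)"
    have "\<forall>\<^sub>F n in sequentially. \<delta> n < m" using order_tendstoD(2)[OF \<delta>lim, of m] z by (simp add: m_def)
    then show ?thesis
    proof eventually_elim
      case (elim n)
      then have "2 * \<delta> n \<le> z - x" "2 * \<delta> n \<le> y - z" by (auto simp: m_def)
      then have "(z - c1 n) / \<delta> n \<ge> 1" "(z - c2 n) / \<delta> n \<le> 0"
        using \<delta>0[of n] by (auto simp: c1_def c2_def field_simps divide_nonpos_pos)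
      then show ?case by (simp add: cf_def smooth_step_1 smooth_step_0)
    qed
  qed
  have eq: "(LINT z|lebesgue_on {x..y}. v z * (w' z * cf n z + w z * cd n z)) = - (LINT z|lebesgue_on {x..y}. g z * (w z * cf n z))" for n
  proof -
    define \<phi> where "\<phi> = (\<lambda>z. (if z \<in> {x..y} then w z * cf n z else 0))"
    define D where "D = (\<lambda>z. (if z \<in> {x..y} then w' z * cf n z + w z * cd n z else 0))"
    \<comment> \<open>On \<open>T\<close> the cut-off product is zero, and outside \<open>T\<close>
      its factor \<open>w\<close> is differentiable. Since \<open>T\<close> and the interior of
      \<open>{x..y}\<close> are open and cover the line, \<open>\<phi>\<close> is C1 everywhere
      although \<open>w\<close> is controlled on \<open>{x..y}\<close> only.\<close>
    define T where "T = {..<x + \<delta> n} \<union> {y - \<delta> n<..}"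
    have T0: "\<phi> z = 0" "D z = 0" if "z \<in> T" for z using out[of z n] that by (auto simp: T_def \<phi>_def D_def)
    have cover: "{x<..<y} \<union> T = UNIV" using \<delta>0[of n] by (auto simp: T_def)
    have openT: "open T" by (simp add: T_def open_Un)
    have der: "(\<phi> has_real_derivative D z) (at z)" for z
    proof (cases "z \<in> T")
      case True
      have "((\<lambda>_. 0) has_real_derivative 0) (at z)" by simp
      then have "(\<phi> has_real_derivative 0) (at z)"
        by (rule has_field_derivative_transform_within_open[OF _ openT True]) (simp add: T0)
      then show ?thesis using T0 True by simp
    next
      case False
      then have z: "z \<in> {x<..<y}" using cover by blast
      then have "(w has_real_derivative w' z) (at z)"
        using w[of z] at_within_interior[of z "{x..y}"] by simp
      then have "((\<lambda>z. w z * cf n z) has_real_derivative w' z * cf n z + w z * cd n z) (at z)"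
        by (auto intro!: derivative_eq_intros cderiv)
      then have "(\<phi> has_real_derivative w' z * cf n z + w z * cd n z) (at z)"
        by (rule has_field_derivative_transform_within_open[where S = "{x<..<y}"]) (use z in \<open>auto simp: \<phi>_def\<close>)
      then show ?thesis using z by (simp add: D_def)
    qed
    have Dc: "continuous_on UNIV D"
    proof -
      have "continuous_on {x<..<y} (\<lambda>z. w' z * cf n z + w z * cd n z)"
        by (intro continuous_intros continuous_on_subset[OF w'] continuous_on_subset[OF wc] cutc cdc) auto
      then have 1: "continuous_on {x<..<y} D" by (rule continuous_on_eq) (auto simp: D_def)
      have 2: "continuous_on T D" by (rule continuous_on_eq[OF continuous_on_const[of T 0]]) (simp add: T0)
      show ?thesis using continuous_on_open_Un[OF open_greaterThanLessThan openT 1 2] by (simp add: cover)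
    qed
    have sub: "{z. \<phi> z \<noteq> 0} \<subseteq> {x + \<delta> n..y - \<delta> n}" using T0(1) by (force simp: T_def)
    then have cl: "closure {z. \<phi> z \<noteq> 0} \<subseteq> {x + \<delta> n..y - \<delta> n}" by (rule closure_minimal) simp
    have "\<phi> \<in> test_functions I"
      unfolding test_functions_def
    proof (intro CollectI conjI)
      show "\<phi> C1_differentiable_on UNIV" unfolding C1_differentiable_on_def
        by (rule exI[of _ D]) (use der Dc in \<open>auto simp: has_real_derivative_iff_has_vector_derivative\<close>)
      show "compact (closure {z. \<phi> z \<noteq> 0})"
        using bounded_subset[OF bounded_closed_interval cl] by (simp add: compact_eq_bounded_closed)
      have "{x<..<y} \<subseteq> interior I" by (rule interior_maximal) (use xy in auto)
      moreover have "{x + \<delta> n..y - \<delta> n} \<subseteq> {x<..<y}" using \<delta>0[of n] by auto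
      ultimately show "closure {z. \<phi> z \<noteq> 0} \<subseteq> interior I" using cl by (meson order_trans)
    qed
    then have W: "(LINT z|lebesgue_on I. v z * deriv \<phi> z) = - (LINT z|lebesgue_on I. g z * \<phi> z)"
      using weak by (simp add: has_weak_deriv_def)
    have dphi: "deriv \<phi> = D" using der by (intro ext DERIV_imp_deriv)
    have s: "{x..y} \<in> sets lebesgue" by simp
    have "(LINT z|lebesgue_on I. v z * deriv \<phi> z) = (LINT z|lebesgue_on I. (if z \<in> {x..y} then v z * (w' z * cf n z + w z * cd n z) else 0))"
      unfolding dphi by (rule Bochner_Integration.integral_cong) (auto simp: D_def)
    also have "\<dots> = (LINT z|lebesgue_on {x..y}. v z * (w' z * cf n z + w z * cd n z))"
      by (rule Lebesgue_Measure.integral_restrict[OF xy(2) s I])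
    finally have L: "(LINT z|lebesgue_on I. v z * deriv \<phi> z) = \<dots>" .
    have "(LINT z|lebesgue_on I. g z * \<phi> z) = (LINT z|lebesgue_on I. (if z \<in> {x..y} then g z * (w z * cf n z) else 0))"
      by (rule Bochner_Integration.integral_cong) (auto simp: \<phi>_def)
    also have "\<dots> = (LINT z|lebesgue_on {x..y}. g z * (w z * cf n z))"
      by (rule Lebesgue_Measure.integral_restrict[OF xy(2) s I])
    finally show ?thesis using W L by simp
  qed
  have AEin: "AE z in lebesgue_on {x..y}. (\<lambda>n. cf n z) \<longlonglongrightarrow> 1"
  proof -
    have "AE z in lebesgue. z \<notin> {x, y}" by (rule AE_not_in) (simp add: null_sets_completionI)
    then have "AE z in lebesgue. z \<in> {x..y} \<longrightarrow> (\<lambda>n. cf n z) \<longlonglongrightarrow> 1"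
    proof eventually_elim
      case (elim z)
      show ?case
      proof
        assume "z \<in> {x..y}"
        then have "x < z" "z < y" using elim by auto
        then show "(\<lambda>n. cf n z) \<longlonglongrightarrow> 1" by (intro tendsto_eventually inside)
      qed
    qed
    then show ?thesis by (simp add: AE_restrict_space_iff)
  qed
  have gw: "integrable (lebesgue_on {x..y}) (\<lambda>z. g z * w z)"
    by (rule L2_on_integrable_mult[OF L2_on_subset[OF g xy(2) _ I] L2_on_continuous[OF wc]]) simp
  have vw: "integrable (lebesgue_on {x..y}) (\<lambda>z. v z * w' z)"
    by (intro continuous_imp_integrable_real continuous_intros v w')
  have dct: "(\<lambda>n. LINT z|lebesgue_on {x..y}. f z * cf n z) \<longlonglongrightarrow> (LINT z|lebesgue_on {x..y}. f z)"
    if f: "integrable (lebesgue_on {x..y}) f" for f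
  proof (rule integral_dominated_convergence[where w = "\<lambda>z. \<bar>f z\<bar>"])
    have cutm: "cf n \<in> borel_measurable (lebesgue_on {x..y})" for n
      by (rule continuous_imp_measurable_on_sets_lebesgue[OF cutc]) simp
    show "(\<lambda>z. f z * cf n z) \<in> borel_measurable (lebesgue_on {x..y})" for n
      using f cutm by (intro borel_measurable_times) auto
    show "AE z in lebesgue_on {x..y}. (\<lambda>n. f z * cf n z) \<longlonglongrightarrow> f z"
      using AEin by eventually_elim (auto intro!: tendsto_eq_intros)
    show "AE z in lebesgue_on {x..y}. norm (f z * cf n z) \<le> \<bar>f z\<bar>" for n
      using cut1 by (auto simp: abs_mult intro!: mult_left_le)
  qed (use f in auto)
  \<comment> \<open>\<open>cd n\<close> is the difference of two unit bumps concentrating at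
    \<open>x\<close> and at \<open>y\<close>; these produce the boundary terms.\<close>
  have bumps: "(\<lambda>n. LINT z|lebesgue_on {x..y}. v z * (w z * cd n z)) \<longlonglongrightarrow> v x * w x - v y * w y"
  proof -
    define f where "f = (\<lambda>z. v z * w z)"
    have fc: "continuous_on {x..y} f" unfolding f_def by (intro continuous_intros v wc)
    define B where "B = (\<lambda>c n. integral {x..y} (\<lambda>z. f z * (smooth_step_deriv ((z - c) / \<delta> n) / \<delta> n)))"
    have split: "(LINT z|lebesgue_on {x..y}. v z * (w z * cd n z)) = B (c1 n) n - B (c2 n) n" for n
    proof -
      have eqf: "(\<lambda>z. v z * (w z * cd n z)) = (\<lambda>z. f z * (smooth_step_deriv ((z - c1 n) / \<delta> n) / \<delta> n) - f z * (smooth_step_deriv ((z - c2 n) / \<delta> n) / \<delta> n))"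
        by (auto simp: f_def cd_def algebra_simps)
      have "(LINT z|lebesgue_on {x..y}. v z * (w z * cd n z)) = integral {x..y} (\<lambda>z. v z * (w z * cd n z))"
        by (intro lebesgue_integral_eq_integral continuous_imp_integrable_real continuous_intros v wc cdc) simp
      also have "\<dots> = B (c1 n) n - B (c2 n) n" unfolding B_def eqf
        by (intro Henstock_Kurzweil_Integration.integral_diff integrable_continuous_interval continuous_on_mult fc sdc)
      finally show ?thesis .
    qed
    have B1: "(\<lambda>n. B (c n) n) \<longlonglongrightarrow> f q" if q: "q \<in> {x..y}" and near: "\<And>n. x \<le> c n" "\<And>n. c n + \<delta> n \<le> y"
       "\<And>n z. z \<in> {c n..c n + \<delta> n} \<Longrightarrow> \<bar>z - q\<bar> \<le> 2 * \<delta> n" for c q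
    proof (rule LIMSEQ_I)
      fix r :: real assume r: "0 < r"
      obtain d where d: "d > 0" "\<And>z. z \<in> {x..y} \<Longrightarrow> \<bar>z - q\<bar> < d \<Longrightarrow> \<bar>f z - f q\<bar> < r / 2"
      proof -
        have "r / 2 > 0" using r by simp
        from fc[unfolded continuous_on_iff, rule_format, OF q this] obtain d where
          "d > 0" "\<forall>z\<in>{x..y}. dist z q < d \<longrightarrow> dist (f z) (f q) < r / 2" by blast
        then show thesis by (intro that[of d]) (auto simp: dist_real_def)
      qed
      have "\<forall>\<^sub>F n in sequentially. \<delta> n < d / 2" using order_tendstoD(2)[OF \<delta>lim, of "d / 2"] d by simp
      then obtain n0 where n0: "\<And>n. n \<ge> n0 \<Longrightarrow> \<delta> n < d / 2" by (auto simp: eventually_sequentially)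
      have "norm (B (c n) n - f q) < r" if n: "n \<ge> n0" for n
      proof -
        have "\<bar>B (c n) n - f q\<bar> \<le> r / 2" unfolding B_def
        proof (rule bump_integral_error[OF fc \<delta>0 near(1,2)])
          fix z assume z: "z \<in> {c n..c n + \<delta> n}"
          have "z \<in> {x..y}" using z near(1,2)[of n] by auto
          moreover have "\<bar>z - q\<bar> < d" using near(3)[OF z] n0[OF n] by linarith
          ultimately show "\<bar>f z - f q\<bar> \<le> r / 2" using d(2) by (simp add: less_imp_le)
        qed
        then show ?thesis using r by simp
      qed
      then show "\<exists>no. \<forall>n\<ge>no. norm (B (c n) n - f q) < r" by blast
    qed
    have "(\<lambda>n. B (c1 n) n) \<longlonglongrightarrow> f x"
    proof (rule B1)
      show "x \<le> c1 n" "c1 n + \<delta> n \<le> y" for n using \<delta>0[of n] \<delta>4[of n] by (auto simp: c1_def)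
      show "\<bar>z - x\<bar> \<le> 2 * \<delta> n" if "z \<in> {c1 n..c1 n + \<delta> n}" for n z using that \<delta>0[of n] by (auto simp: c1_def)
    qed (use xy in auto)
    moreover have "(\<lambda>n. B (c2 n) n) \<longlonglongrightarrow> f y"
    proof (rule B1)
      show "x \<le> c2 n" "c2 n + \<delta> n \<le> y" for n using \<delta>0[of n] \<delta>4[of n] by (auto simp: c2_def)
      show "\<bar>z - y\<bar> \<le> 2 * \<delta> n" if "z \<in> {c2 n..c2 n + \<delta> n}" for n z using that \<delta>0[of n] by (auto simp: c2_def)
    qed (use xy in auto)
    ultimately show ?thesis unfolding split by (auto simp: f_def intro: tendsto_diff)
  qed
  have lhs: "(LINT z|lebesgue_on {x..y}. v z * (w' z * cf n z + w z * cd n z)) =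
     (LINT z|lebesgue_on {x..y}. v z * w' z * cf n z) + (LINT z|lebesgue_on {x..y}. v z * (w z * cd n z))" for n
  proof -
    have "(LINT z|lebesgue_on {x..y}. v z * w' z * cf n z + v z * (w z * cd n z)) =
     (LINT z|lebesgue_on {x..y}. v z * w' z * cf n z) + (LINT z|lebesgue_on {x..y}. v z * (w z * cd n z))"
      by (intro Bochner_Integration.integral_add continuous_imp_integrable_real continuous_intros v w' wc cutc cdc)
    then show ?thesis by (simp add: distrib_left mult.assoc)
  qed
  have "(\<lambda>n. LINT z|lebesgue_on {x..y}. v z * (w' z * cf n z + w z * cd n z)) \<longlonglongrightarrow>
     (LINT z|lebesgue_on {x..y}. v z * w' z) + (v x * w x - v y * w y)"
    unfolding lhs by (intro tendsto_add dct vw bumps)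
  moreover have "(\<lambda>n. - (LINT z|lebesgue_on {x..y}. g z * w z * cf n z)) \<longlonglongrightarrow> - (LINT z|lebesgue_on {x..y}. g z * w z)"
    by (intro tendsto_minus dct gw)
  ultimately have "(LINT z|lebesgue_on {x..y}. v z * w' z) + (v x * w x - v y * w y) = - (LINT z|lebesgue_on {x..y}. g z * w z)"
    unfolding eq by (intro LIMSEQ_unique) (auto simp: mult.assoc)
  then show ?thesis by simp
qed

text \<open>Rays form an intersection-stable generator of the Borel sets, so the vanishing extends
  to all Borel sets by a Dynkin argument; its complement step uses the integral over the whole line,
  a limit over rays. The Borel representative \<open>f'\<close> moves the question from the
  completed measure to the Borel one.\<close>

lemma integral_zero_imp_AE_zero:
  fixes f :: "real \<Rightarrow> real"
  assumes f: "integrable lebesgue f" and z: "\<And>a. (LINT x|lebesgue. indicator {a<..} x * f x) = 0"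
  shows "AE x in lebesgue. f x = 0"
proof -
  obtain f' where f': "f' \<in> borel_measurable lborel" "AE x in lborel. f x = f' x"
    using f completion_ex_borel_measurable_real[of f lborel] by auto
  have AE': "AE x in lebesgue. f x = f' x" using f'(2) by (rule AE_completion)
  have m': "f' \<in> borel_measurable lebesgue" using f'(1) by (rule measurable_completion)
  have "integrable lebesgue f'" by (rule Bochner_Integration.integrable_cong_AE_imp[OF f m']) (use AE' in auto)
  then have int': "integrable lborel f'" using integrable_completion[OF f'(1)] by simp
  define P where "P = (\<lambda>A. (LINT x:A|lborel. f' x) = 0)"
  have si: "set_integrable lborel A f'" if "A \<in> sets borel" for A
    unfolding set_integrable_def by (rule integrable_mult_indicator) (use that int' in auto)
  have ray: "P {a<..}" for a
  proof -
    have "(LINT x|lborel. indicator {a<..} x * f' x) = (LINT x|lebesgue. indicator {a<..} x * f' x)"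
      by (rule integral_completion[symmetric]) (use f'(1) in simp)
    also have "\<dots> = (LINT x|lebesgue. indicator {a<..} x * f x)"
      by (rule integral_cong_AE) (use AE' m' f in \<open>auto intro!: borel_measurable_times borel_measurable_indicator\<close>)
    finally show ?thesis using z by (simp add: P_def set_lebesgue_integral_def)
  qed
  have total: "P UNIV"
  proof -
    have "(\<lambda>n. LINT x|lborel. indicator {- real n<..} x * f' x) \<longlonglongrightarrow> (LINT x|lborel. f' x)"
    proof (rule integral_dominated_convergence[where w = "\<lambda>x. \<bar>f' x\<bar>"])
      show "AE x in lborel. (\<lambda>n. indicator {- real n<..} x * f' x) \<longlonglongrightarrow> f' x"
      proof (rule AE_I2)
        fix x :: real
        obtain k :: nat where k: "real k > - x" using reals_Archimedean2 by blast
        have "\<forall>\<^sub>F n in sequentially. indicator {- real n<..} x * f' x = f' x"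
          using eventually_ge_at_top[of k] by eventually_elim (use k in \<open>auto simp: indicator_def\<close>)
        then show "(\<lambda>n. indicator {- real n<..} x * f' x) \<longlonglongrightarrow> f' x" by (rule tendsto_eventually)
      qed
    qed (use f'(1) int' in \<open>auto simp: indicator_def\<close>)
    moreover have "(LINT x|lborel. indicator {- real n<..} x * f' x) = 0" for n
      using ray[of "- real n"] by (simp add: P_def set_lebesgue_integral_def)
    ultimately have "(LINT x|lborel. f' x) = 0" using LIMSEQ_unique[OF _ tendsto_const[of 0]] by simp
    then show ?thesis by (simp add: P_def set_lebesgue_integral_def)
  qed
  have all: "P A" if A: "A \<in> sets borel" for A
  proof -
    have sb: "sets borel = sigma_sets UNIV (range (\<lambda>a::real. {a<..}))"
      by (subst borel_Ioi) (rule sets_measure_of, simp)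
    have A1: "A \<in> sigma_sets UNIV (range (\<lambda>a::real. {a<..}))" using A by (simp add: sb)
    have IS: "Int_stable (range (\<lambda>a::real. {a<..}))"
    proof -
      have "{a<..} \<inter> {b<..} = {max a b<..}" for a b :: real by auto
      then show ?thesis unfolding Int_stable_def by auto
    qed
    have PW: "range (\<lambda>a::real. {a<..}) \<subseteq> Pow UNIV" by simp
    show ?thesis
    proof (rule sigma_sets_induct_disjoint[where P = P, OF IS PW A1])
      fix B assume "B \<in> range (\<lambda>a::real. {a<..})"
      then show "P B" using ray by auto
    next
      show "P {}" by (simp add: P_def set_lebesgue_integral_def)
    next
      fix B assume B: "B \<in> sigma_sets UNIV (range (\<lambda>a::real. {a<..}))" "P B"
      then have Bs: "B \<in> sets borel" by (simp add: sb)
      have "(LINT x:B \<union> (UNIV - B)|lborel. f' x) = (LINT x:B|lborel. f' x) + (LINT x:(UNIV - B)|lborel. f' x)"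
        by (rule set_integral_Un) (use Bs in \<open>auto intro!: si\<close>)
      then show "P (UNIV - B)" using B total by (simp add: P_def)
    next
      fix B :: "nat \<Rightarrow> real set"
      assume B: "disjoint_family B" "range B \<subseteq> sigma_sets UNIV (range (\<lambda>a::real. {a<..}))" "\<And>i. P (B i)"
      have Bs: "B i \<in> sets borel" for i using B(2) by (auto simp: sb)
      have "(LINT x:(\<Union>i. B i)|lborel. f' x) = (\<Sum>i. (LINT x:B i|lborel. f' x))"
        by (rule lebesgue_integral_countable_add) (use Bs B(1) in \<open>auto intro!: si simp: disjoint_family_on_def\<close>)
      then show "P (\<Union>i. B i)" using B(3) by (simp add: P_def)
    qed
  qed
  have "AE x in lborel. f' x = 0"
    by (rule density_unique_real[OF int']) (use all in \<open>auto simp: P_def set_lebesgue_integral_def\<close>)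
  then have "AE x in lebesgue. f' x = 0" by (rule AE_completion)
  with AE' show ?thesis by eventually_elim simp
qed

text \<open>Integration by parts against the constant 1 gives both candidates the integral
  \<open>v R - v b\<close> over \<open>{b..R}\<close>; hence their difference, cut off to
  \<open>{0..R}\<close>, integrates to 0 over every ray.\<close>

lemma weak_deriv_unique_interval:
  assumes xy: "0 < R" "{0..R} \<subseteq> I" and I: "I \<in> sets lebesgue" and v: "continuous_on {0..R} v"
    and g: "g1 \<in> L2_on I" "g2 \<in> L2_on I" and weak: "has_weak_deriv I v g1" "has_weak_deriv I v g2"
  shows "AE x in lebesgue. x \<in> {0..R} \<longrightarrow> g1 x = g2 x"
proof -
  define f where "f = (\<lambda>x. if x \<in> {0..R} then g1 x - g2 x else 0)"
  have i12: "integrable (lebesgue_on {a..b}) g1" "integrable (lebesgue_on {a..b}) g2" if "{a..b} \<subseteq> {0..R}" for a b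
    using that xy by (auto intro!: L2_on_integrable_interval[OF _ _ I] g)
  have fi: "integrable lebesgue f" unfolding f_def
    by (subst Lebesgue_Measure.integrable_restrict_UNIV) (auto intro!: Bochner_Integration.integrable_diff i12)
  have "(LINT x|lebesgue. indicator {a<..} x * f x) = 0" for a
  proof (cases "a < R")
    case False
    then have "(\<lambda>x. indicator {a<..} x * f x) = (\<lambda>_. 0)" by (auto simp: f_def indicator_def)
    then show ?thesis by simp
  next
    case True
    define b where "b = max a 0"
    have b: "0 \<le> b" "b < R" using True xy by (auto simp: b_def)
    have AEab: "AE x in lebesgue. x \<notin> {b}" by (rule AE_not_in) (simp add: null_sets_completionI)
    have fm: "f \<in> borel_measurable lebesgue" using fi by auto
    have "(LINT x|lebesgue. indicator {a<..} x * f x) = (LINT x|lebesgue. indicator {b..R} x * f x)"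
    proof (rule integral_cong_AE)
      show "AE x in lebesgue. indicator {a<..} x * f x = indicator {b..R} x * f x"
        using AEab by eventually_elim (auto simp: f_def indicator_def b_def max_def split: if_splits)
    qed (use fm in \<open>auto intro!: borel_measurable_times borel_measurable_indicator\<close>)
    also have "\<dots> = (LINT x|lebesgue. (if x \<in> {b..R} then g1 x - g2 x else 0))"
      by (rule Bochner_Integration.integral_cong) (use b in \<open>auto simp: f_def indicator_def\<close>)
    also have "\<dots> = (LINT x|lebesgue_on {b..R}. g1 x - g2 x)" by (rule Lebesgue_Measure.integral_restrict_UNIV) simp
    also have "\<dots> = (LINT x|lebesgue_on {b..R}. g1 x) - (LINT x|lebesgue_on {b..R}. g2 x)"
      using b by (intro Bochner_Integration.integral_diff i12) auto
    also have "(LINT x|lebesgue_on {b..R}. g1 x) = (LINT x|lebesgue_on {b..R}. g2 x)"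
    proof -
      have sub: "{b..R} \<subseteq> I" using b xy by auto
      have vc: "continuous_on {b..R} v" by (rule continuous_on_subset[OF v]) (use b in auto)
      have "(LINT z|lebesgue_on {b..R}. g z * 1) = v R * 1 - v b * 1 - (LINT z|lebesgue_on {b..R}. v z * 0)"
        if "g \<in> L2_on I" "has_weak_deriv I v g" for g
        by (rule weak_deriv_by_parts[OF b(2) sub I vc that]) auto
      from this[OF g(1) weak(1)] this[OF g(2) weak(2)] show ?thesis by simp
    qed
    finally show ?thesis by simp
  qed
  from integral_zero_imp_AE_zero[OF fi this] show ?thesis by eventually_elim (auto simp: f_def)
qed

section \<open>Functions on whole edges: closed intervals and half-lines\<close>

definition edge_set :: "real set \<Rightarrow> bool" where
  "edge_set I \<longleftrightarrow> (\<exists>l>0. I = {0..l}) \<or> I = {0..}"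

lemma edge_set_lebesgue: "edge_set I \<Longrightarrow> I \<in> sets lebesgue"
  unfolding edge_set_def by auto

lemma edge_set_exhaust:
  assumes "edge_set I"
  obtains R :: "nat \<Rightarrow> real" where "\<And>n. 0 < R n" "\<And>n. {0..R n} \<subseteq> I" "\<And>x. x \<in> I \<Longrightarrow> \<exists>n. x \<in> {0..R n}"
  using assms unfolding edge_set_def
proof (elim disjE exE conjE)
  fix l :: real assume "l > 0" "I = {0..l}"
  then show thesis using that[of "\<lambda>_. l"] by auto
next
  assume I: "I = {0..}"
  show thesis
  proof (rule that[of "\<lambda>n. real (Suc n)"])
    fix x assume "x \<in> I"
    obtain n :: nat where "x < real n" using reals_Archimedean2 by blast
    then show "\<exists>n. x \<in> {0..real (Suc n)}" using \<open>x \<in> I\<close> I by (intro exI[of _ n]) auto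
  qed (use I in auto)
qed

lemma weak_deriv_unique:
  assumes I: "edge_set I" and v: "continuous_on I v"
    and g: "g1 \<in> L2_on I" "g2 \<in> L2_on I" and weak: "has_weak_deriv I v g1" "has_weak_deriv I v g2"
  shows "AE x in lebesgue_on I. g1 x = g2 x"
proof -
  obtain R :: "nat \<Rightarrow> real" where R: "\<And>n. 0 < R n" "\<And>n. {0..R n} \<subseteq> I" "\<And>x. x \<in> I \<Longrightarrow> \<exists>n. x \<in> {0..R n}"
    using edge_set_exhaust[OF I] by metis
  have "AE x in lebesgue. x \<in> {0..R n} \<longrightarrow> g1 x = g2 x" for n
    by (rule weak_deriv_unique_interval[OF R(1,2) edge_set_lebesgue[OF I] continuous_on_subset[OF v R(2)] g weak])
  then have "AE x in lebesgue. \<forall>n. x \<in> {0..R n} \<longrightarrow> g1 x = g2 x" unfolding AE_all_countable by blast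
  then have "AE x in lebesgue. x \<in> I \<longrightarrow> g1 x = g2 x" by eventually_elim (use R(3) in blast)
  then show ?thesis using edge_set_lebesgue[OF I] by (simp add: AE_restrict_space_iff)
qed

text \<open>Both shapes of edge reduce to a compact interval at whose ends the test function
  vanishes: the whole edge if it is bounded, and otherwise an interval reaching beyond the
  support.\<close>

lemma test_functionE:
  assumes \<phi>: "\<phi> \<in> test_functions I" and I: "edge_set I"
  obtains D R where "\<And>x. (\<phi> has_real_derivative D x) (at x)" "continuous_on UNIV D" "deriv \<phi> = D"
    "0 < R" "{0..R} \<subseteq> I" "\<phi> 0 = 0" "\<phi> R = 0" "\<And>x. x \<in> I \<Longrightarrow> x \<notin> {0..R} \<Longrightarrow> \<phi> x = 0 \<and> D x = 0"
proof -
  define K where "K = closure {x. \<phi> x \<noteq> 0}"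
  have C1: "\<phi> C1_differentiable_on UNIV" and cK: "compact K" and KI: "K \<subseteq> interior I"
    using \<phi> by (auto simp: test_functions_def K_def)
  obtain D where D0: "\<And>x. (\<phi> has_vector_derivative D x) (at x)" and Dc: "continuous_on UNIV D"
    using C1 unfolding C1_differentiable_on_def by auto
  have D: "(\<phi> has_real_derivative D x) (at x)" for x
    using D0[of x] by (simp add: has_real_derivative_iff_has_vector_derivative)
  have dD: "deriv \<phi> = D" using D by (intro ext DERIV_imp_deriv)
  have out: "\<phi> x = 0 \<and> D x = 0" if "x \<notin> K" for x
  proof
    have z: "\<phi> y = 0" if "y \<in> - K" for y using that closure_subset[of "{x. \<phi> x \<noteq> 0}"] by (auto simp: K_def)
    show "\<phi> x = 0" using z that by simp
    have op: "open (- K)" by (simp add: K_def open_Compl)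
    have "((\<lambda>_. 0) has_real_derivative 0) (at x)" by simp
    then have "(\<phi> has_real_derivative 0) (at x)"
      by (rule has_field_derivative_transform_within_open[OF _ op]) (use z that in auto)
    then show "D x = 0" using D[of x] DERIV_unique by blast
  qed
  have "\<exists>R>0. {0..R} \<subseteq> I \<and> 0 \<notin> K \<and> R \<notin> K \<and> (\<forall>x\<in>I. x \<notin> {0..R} \<longrightarrow> x \<notin> K)"
    using I unfolding edge_set_def
  proof (elim disjE exE conjE)
    fix l :: real assume l: "l > 0" "I = {0..l}"
    then have "K \<subseteq> {0<..<l}" using KI by simp
    then show ?thesis using l by (intro exI[of _ l]) auto
  next
    assume Ih: "I = {0..}"
    then have K0: "K \<subseteq> {0<..}" using KI by simp
    obtain b where b: "\<And>x. x \<in> K \<Longrightarrow> \<bar>x\<bar> \<le> b" using compact_imp_bounded[OF cK] by (auto simp: bounded_iff)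
    define R where "R = \<bar>b\<bar> + 1"
    have "x < R" if "x \<in> K" for x using b[OF that] unfolding R_def by linarith
    moreover have "R > 0" by (simp add: R_def add_nonneg_pos)
    ultimately show ?thesis using K0 Ih by (intro exI[of _ R]) force
  qed
  then obtain R where "R > 0" "{0..R} \<subseteq> I" "0 \<notin> K" "R \<notin> K" "\<forall>x\<in>I. x \<notin> {0..R} \<longrightarrow> x \<notin> K" by blast
  then show thesis using that[OF D Dc dD] out by blast
qed

lemma L2_on_compact_support:
  assumes I: "edge_set I" and c: "continuous_on UNIV f" and R: "0 < R" "{0..R} \<subseteq> I" and out: "\<And>x. x \<in> I \<Longrightarrow> x \<notin> {0..R} \<Longrightarrow> f x = 0"
  shows "f \<in> L2_on I"
proof -
  have m: "f \<in> borel_measurable (lebesgue_on I)"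
    by (rule continuous_imp_measurable_on_sets_lebesgue[OF continuous_on_subset[OF c] edge_set_lebesgue[OF I]]) simp
  have "integrable lebesgue (\<lambda>x. if x \<in> {0..R} then (f x)\<^sup>2 else 0)"
    by (subst Lebesgue_Measure.integrable_restrict_UNIV)
       (auto intro!: continuous_imp_integrable_real continuous_intros continuous_on_subset[OF c])
  moreover have "(\<lambda>x. if x \<in> {0..R} then (f x)\<^sup>2 else 0) = (\<lambda>x. if x \<in> I then (f x)\<^sup>2 else 0)"
    using out R by fastforce
  ultimately have "integrable (lebesgue_on I) (\<lambda>x. (f x)\<^sup>2)"
    using edge_set_lebesgue[OF I] by (simp add: Lebesgue_Measure.integrable_restrict_UNIV)
  then show ?thesis using m by (simp add: L2_on_def)
qed

lemma test_function_L2: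
  assumes "\<phi> \<in> test_functions I" and I: "edge_set I"
  shows "\<phi> \<in> L2_on I" "deriv \<phi> \<in> L2_on I"
proof -
  obtain D R where D: "\<And>x. (\<phi> has_real_derivative D x) (at x)" "continuous_on UNIV D" "deriv \<phi> = D"
    "0 < R" "{0..R} \<subseteq> I" "\<And>x. x \<in> I \<Longrightarrow> x \<notin> {0..R} \<Longrightarrow> \<phi> x = 0 \<and> D x = 0"
    using test_functionE[OF assms] by metis
  have "continuous_on UNIV \<phi>" using D(1) by (intro DERIV_continuous_on) auto
  then show "\<phi> \<in> L2_on I" by (rule L2_on_compact_support[OF I _ D(4,5)]) (use D(6) in blast)
  show "deriv \<phi> \<in> L2_on I" unfolding D(3) by (rule L2_on_compact_support[OF I D(2) D(4,5)]) (use D(6) in blast)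
qed

lemma has_weak_deriv_add:
  assumes I: "edge_set I" and L2: "v \<in> L2_on I" "g \<in> L2_on I" "w \<in> L2_on I" "k \<in> L2_on I"
    and weak: "has_weak_deriv I v g" "has_weak_deriv I w k"
  shows "has_weak_deriv I (\<lambda>x. v x + w x) (\<lambda>x. g x + k x)"
  unfolding has_weak_deriv_def
proof
  fix \<phi> assume \<phi>: "\<phi> \<in> test_functions I"
  note t = test_function_L2[OF \<phi> I]
  have "(LINT x|lebesgue_on I. (v x + w x) * deriv \<phi> x) = (LINT x|lebesgue_on I. v x * deriv \<phi> x) + (LINT x|lebesgue_on I. w x * deriv \<phi> x)"
    unfolding distrib_right by (intro Bochner_Integration.integral_add L2_on_integrable_mult L2 t)
  moreover have "(LINT x|lebesgue_on I. (g x + k x) * \<phi> x) = (LINT x|lebesgue_on I. g x * \<phi> x) + (LINT x|lebesgue_on I. k x * \<phi> x)"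
    unfolding distrib_right by (intro Bochner_Integration.integral_add L2_on_integrable_mult L2 t)
  ultimately show "(LINT x|lebesgue_on I. (v x + w x) * deriv \<phi> x) = - (LINT x|lebesgue_on I. (g x + k x) * \<phi> x)"
    using weak \<phi> by (simp add: has_weak_deriv_def)
qed

lemma classical_weak_deriv:
  assumes I: "edge_set I" and v: "\<And>x. x \<in> I \<Longrightarrow> (v has_real_derivative v' x) (at x within I)" and v': "continuous_on I v'"
  shows "has_weak_deriv I v v'"
  unfolding has_weak_deriv_def
proof
  fix \<phi> assume \<phi>: "\<phi> \<in> test_functions I"
  obtain D R where D: "\<And>x. (\<phi> has_real_derivative D x) (at x)" "continuous_on UNIV D" "deriv \<phi> = D"
    "0 < R" "{0..R} \<subseteq> I" "\<phi> 0 = 0" "\<phi> R = 0" "\<And>x. x \<in> I \<Longrightarrow> x \<notin> {0..R} \<Longrightarrow> \<phi> x = 0 \<and> D x = 0"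
    using test_functionE[OF \<phi> I] by metis
  have s: "{0..R} \<in> sets lebesgue" by simp
  have vc: "continuous_on {0..R} v" 
    by (rule DERIV_continuous_on[where D = v'], rule DERIV_subset[OF v D(5)]) (use D(5) in auto)
  have vc': "continuous_on {0..R} v'" by (rule continuous_on_subset[OF v' D(5)])
  have \<phi>c: "continuous_on {0..R} \<phi>" 
    by (rule DERIV_continuous_on[where D = D], rule has_field_derivative_at_within[OF D(1)])
  have Dc: "continuous_on {0..R} D" by (rule continuous_on_subset[OF D(2)]) simp
  have red: "(LINT x|lebesgue_on I. a x * b x) = integral {0..R} (\<lambda>x. a x * b x)"
    if "continuous_on {0..R} a" "continuous_on {0..R} b" "\<And>x. x \<in> I \<Longrightarrow> x \<notin> {0..R} \<Longrightarrow> b x = 0" for a b :: "real \<Rightarrow> real"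
  proof -
    have "(LINT x|lebesgue_on I. a x * b x) = (LINT x|lebesgue_on I. (if x \<in> {0..R} then a x * b x else 0))"
      by (rule Bochner_Integration.integral_cong) (use that(3) in \<open>auto simp: space_restrict_space\<close>)
    also have "\<dots> = (LINT x|lebesgue_on {0..R}. a x * b x)"
      by (rule Lebesgue_Measure.integral_restrict[OF D(5) s edge_set_lebesgue[OF I]])
    also have "\<dots> = integral {0..R} (\<lambda>x. a x * b x)"
      by (intro lebesgue_integral_eq_integral continuous_imp_integrable_real continuous_on_mult that) simp
    finally show ?thesis .
  qed
  have "((\<lambda>x. v' x * \<phi> x + v x * D x) has_integral v R * \<phi> R - v 0 * \<phi> 0) {0..R}"
  proof (rule fundamental_theorem_of_calculus)
    fix x assume x: "x \<in> {0..R}"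
    then have "(v has_real_derivative v' x) (at x within {0..R})" using D(5) by (intro DERIV_subset[OF v D(5)]) auto
    then have "((\<lambda>x. v x * \<phi> x) has_real_derivative v' x * \<phi> x + v x * D x) (at x within {0..R})"
      by (auto intro!: derivative_eq_intros has_field_derivative_at_within[OF D(1)])
    then show "((\<lambda>x. v x * \<phi> x) has_vector_derivative v' x * \<phi> x + v x * D x) (at x within {0..R})"
      by (simp add: has_real_derivative_iff_has_vector_derivative)
  qed (use D(4) in simp)
  then have "integral {0..R} (\<lambda>x. v' x * \<phi> x + v x * D x) = 0" using D(6,7) by (simp add: integral_unique)
  moreover have "integral {0..R} (\<lambda>x. v' x * \<phi> x + v x * D x) = integral {0..R} (\<lambda>x. v' x * \<phi> x) + integral {0..R} (\<lambda>x. v x * D x)"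
    by (intro Henstock_Kurzweil_Integration.integral_add integrable_continuous_interval continuous_on_mult vc vc' \<phi>c Dc)
  moreover have "(LINT x|lebesgue_on I. v x * deriv \<phi> x) = integral {0..R} (\<lambda>x. v x * D x)"
    unfolding D(3) by (rule red[OF vc Dc]) (use D(8) in blast)
  moreover have "(LINT x|lebesgue_on I. v' x * \<phi> x) = integral {0..R} (\<lambda>x. v' x * \<phi> x)"
    by (rule red[OF vc' \<phi>c]) (use D(8) in blast)
  ultimately show "(LINT x|lebesgue_on I. v x * deriv \<phi> x) = - (LINT x|lebesgue_on I. v' x * \<phi> x)" by simp
qed

lemma weak_deriv_spec:
  assumes "v \<in> H1_on I" shows "v \<in> L2_on I" "weak_deriv I v \<in> L2_on I" "has_weak_deriv I v (weak_deriv I v)"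
proof -
  have "\<exists>g. g \<in> L2_on I \<and> has_weak_deriv I v g" using assms by (auto simp: H1_on_def)
  from someI_ex[OF this] show "weak_deriv I v \<in> L2_on I" "has_weak_deriv I v (weak_deriv I v)"
    unfolding weak_deriv_def by auto
  show "v \<in> L2_on I" using assms by (simp add: H1_on_def)
qed

lemma weak_deriv_AE:
  assumes I: "edge_set I" and v: "continuous_on I v" "v \<in> L2_on I" and g: "g \<in> L2_on I" "has_weak_deriv I v g"
  shows "AE x in lebesgue_on I. weak_deriv I v x = g x"
proof -
  have "v \<in> H1_on I" using v g by (auto simp: H1_on_def)
  from weak_deriv_unique[OF I v(1) weak_deriv_spec(2)[OF this] g(1) weak_deriv_spec(3)[OF this] g(2)] show ?thesis .
qed

lemma L2_on_measurable: "f \<in> L2_on I \<Longrightarrow> f \<in> borel_measurable (lebesgue_on I)"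
  by (simp add: L2_on_def)

text \<open>\<open>weak_deriv\<close> selects an unspecified representative, so it is additive only
  almost everywhere; the square is expanded after replacing the derivative of the sum by
  \<open>u' x + weak_deriv I v x\<close>.\<close>

lemma weak_deriv_square_add:
  assumes I: "edge_set I" and u: "continuous_on I u" "u \<in> L2_on I" "u' \<in> L2_on I" "has_weak_deriv I u u'"
    and v: "continuous_on I v" "v \<in> H1_on I"
  shows "(LINT x|lebesgue_on I. \<bar>weak_deriv I (\<lambda>x. u x + v x) x\<bar>\<^sup>2) = (LINT x|lebesgue_on I. \<bar>weak_deriv I u x\<bar>\<^sup>2)
    + 2 * (LINT x|lebesgue_on I. weak_deriv I v x * u' x) + (LINT x|lebesgue_on I. \<bar>weak_deriv I v x\<bar>\<^sup>2)"
proof -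
  note vs = weak_deriv_spec[OF v(2)]
  have s: "has_weak_deriv I (\<lambda>x. u x + v x) (\<lambda>x. u' x + weak_deriv I v x)"
    by (rule has_weak_deriv_add[OF I u(2,3) vs(1,2) u(4) vs(3)])
  have sL: "(\<lambda>x. u' x + weak_deriv I v x) \<in> L2_on I" by (rule L2_on_add[OF u(3) vs(2)])
  have s2: "(\<lambda>x. u x + v x) \<in> L2_on I" by (rule L2_on_add[OF u(2) vs(1)])
  have sc: "continuous_on I (\<lambda>x. u x + v x)" by (intro continuous_intros u v)
  have s1: "(\<lambda>x. u x + v x) \<in> H1_on I" using s2 sL s by (auto simp: H1_on_def)
  have u1: "u \<in> H1_on I" using u by (auto simp: H1_on_def)
  have A: "AE x in lebesgue_on I. weak_deriv I (\<lambda>x. u x + v x) x = u' x + weak_deriv I v x"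
    by (rule weak_deriv_AE[OF I sc s2 sL s])
  have B: "AE x in lebesgue_on I. weak_deriv I u x = u' x" by (rule weak_deriv_AE[OF I u])
  note m = L2_on_measurable[OF weak_deriv_spec(2)[OF s1]] L2_on_measurable[OF weak_deriv_spec(2)[OF u1]]
     L2_on_measurable[OF vs(2)] L2_on_measurable[OF u(3)]
  have "(LINT x|lebesgue_on I. \<bar>weak_deriv I (\<lambda>x. u x + v x) x\<bar>\<^sup>2) = (LINT x|lebesgue_on I. (u' x)\<^sup>2 + 2 * (weak_deriv I v x * u' x) + (weak_deriv I v x)\<^sup>2)"
    by (rule integral_cong_AE) (use A m in \<open>auto simp: power2_sum algebra_simps elim!: eventually_mono\<close>)
  also have "\<dots> = (LINT x|lebesgue_on I. (u' x)\<^sup>2) + 2 * (LINT x|lebesgue_on I. weak_deriv I v x * u' x) + (LINT x|lebesgue_on I. (weak_deriv I v x)\<^sup>2)"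
    using L2_on_integrable_mult[OF vs(2) u(3)] u(3) vs(2) by (simp add: L2_on_def)
  also have "(LINT x|lebesgue_on I. (u' x)\<^sup>2) = (LINT x|lebesgue_on I. \<bar>weak_deriv I u x\<bar>\<^sup>2)"
    by (rule integral_cong_AE) (use B m in \<open>auto elim!: eventually_mono\<close>)
  finally show ?thesis by simp
qed

lemma L2_square_add:
  assumes "u \<in> L2_on I" "v \<in> L2_on I"
  shows "(LINT x|lebesgue_on I. \<bar>u x + v x\<bar>\<^sup>2) = (LINT x|lebesgue_on I. \<bar>u x\<bar>\<^sup>2)
    + 2 * (LINT x|lebesgue_on I. u x * v x) + (LINT x|lebesgue_on I. \<bar>v x\<bar>\<^sup>2)"
proof -
  have "(LINT x|lebesgue_on I. \<bar>u x + v x\<bar>\<^sup>2) = (LINT x|lebesgue_on I. (u x)\<^sup>2 + 2 * (u x * v x) + (v x)\<^sup>2)"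
    by (rule Bochner_Integration.integral_cong) (auto simp: power2_sum algebra_simps)
  also have "\<dots> = (LINT x|lebesgue_on I. (u x)\<^sup>2) + 2 * (LINT x|lebesgue_on I. u x * v x) + (LINT x|lebesgue_on I. (v x)\<^sup>2)"
    using L2_on_integrable_mult[OF assms] assms by (simp add: L2_on_def)
  finally show ?thesis by simp
qed

lemma parts_bounded_edge:
  assumes l: "l > 0" and v: "continuous_on {0..l} v" "v \<in> H1_on {0..l}"
    and w: "\<And>z. z \<in> {0..l} \<Longrightarrow> (w has_real_derivative w' z) (at z within {0..l})" and w': "continuous_on {0..l} w'"
  shows "(LINT z|lebesgue_on {0..l}. weak_deriv {0..l} v z * w z) = v l * w l - v 0 * w 0 - (LINT z|lebesgue_on {0..l}. v z * w' z)"
  by (rule weak_deriv_by_parts[OF l _ _ v(1) weak_deriv_spec(2,3)[OF v(2)] w w']) auto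

text \<open>One-dimensional Sobolev inequality:
  \<open>(v x)\<^sup>2 <= 2 * (v y)\<^sup>2 + 2 * (v x - v y)\<^sup>2\<close>, the increment is
  controlled by the weak derivative, and averaging over \<open>y\<close> brings in the mass.\<close>

lemma sup_bound_interval:
  assumes l: "l > 0" and v: "continuous_on {0..l} v" "v \<in> H1_on {0..l}" and x: "x \<in> {0..l}"
  shows "(v x)\<^sup>2 \<le> (2 / l) * (LINT z|lebesgue_on {0..l}. \<bar>v z\<bar>\<^sup>2) + 2 * l * (LINT z|lebesgue_on {0..l}. \<bar>weak_deriv {0..l} v z\<bar>\<^sup>2)"
proof -
  let ?g = "weak_deriv {0..l} v"
  note vs = weak_deriv_spec[OF v(2)]
  define Kv where "Kv = (LINT z|lebesgue_on {0..l}. (?g z)\<^sup>2)"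
  have g2: "integrable (lebesgue_on {0..l}) (\<lambda>z. (?g z)\<^sup>2)" using vs(2) by (simp add: L2_on_def)
  have Kv: "Kv \<ge> 0" unfolding Kv_def by simp
  have diff: "(v b - v a)\<^sup>2 \<le> l * Kv" if ab: "0 \<le> a" "a < b" "b \<le> l" for a b
  proof -
    have sub: "{a..b} \<subseteq> {0..l}" using ab by auto
    have "(LINT z|lebesgue_on {a..b}. ?g z * 1) = v b * 1 - v a * 1 - (LINT z|lebesgue_on {a..b}. v z * 0)"
      by (rule weak_deriv_by_parts[OF ab(2) sub _ continuous_on_subset[OF v(1) sub] vs(2,3)]) auto
    then have eq: "v b - v a = (LINT z|lebesgue_on {a..b}. ?g z)" by simp
    \<comment> \<open>The mean of the weak derivative over \<open>{a..b}\<close>; nonnegativity of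
      the integral of \<open>(?g z - q)\<^sup>2\<close> is the Cauchy-Schwarz inequality in the form
      required.\<close>
    define q where "q = (v b - v a) / (b - a)"
    have gi: "integrable (lebesgue_on {a..b}) ?g" by (rule L2_on_integrable_interval[OF vs(2) sub]) simp
    have gi2: "integrable (lebesgue_on {a..b}) (\<lambda>z. (?g z)\<^sup>2)"
      using L2_on_subset[OF vs(2) sub] by (simp add: L2_on_def)
    have c: "(LINT z|lebesgue_on {a..b}. k) = k * (b - a)" for k :: real
    proof -
      have "(LINT z|lebesgue_on {a..b}. k) = integral {a..b} (\<lambda>_. k)"
        by (intro lebesgue_integral_eq_integral continuous_imp_integrable_real continuous_intros) simp
      then show ?thesis using ab by simp
    qed
    have ci: "integrable (lebesgue_on {a..b}) (\<lambda>z. k)" for k :: real by (intro continuous_imp_integrable_real continuous_intros)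
    have "0 \<le> (LINT z|lebesgue_on {a..b}. (?g z - q)\<^sup>2)" by simp
    also have "(LINT z|lebesgue_on {a..b}. (?g z - q)\<^sup>2) = (LINT z|lebesgue_on {a..b}. (?g z)\<^sup>2 - 2 * q * ?g z + q\<^sup>2)"
      by (rule Bochner_Integration.integral_cong) (auto simp: power2_diff algebra_simps)
    also have "\<dots> = (LINT z|lebesgue_on {a..b}. (?g z)\<^sup>2) - 2 * q * (v b - v a) + q\<^sup>2 * (b - a)"
    proof -
      have "(LINT z|lebesgue_on {a..b}. (?g z)\<^sup>2 - 2 * q * ?g z + q\<^sup>2) = (LINT z|lebesgue_on {a..b}. (?g z)\<^sup>2 - 2 * q * ?g z) + (LINT z|lebesgue_on {a..b}. q\<^sup>2)"
        by (intro Bochner_Integration.integral_add Bochner_Integration.integrable_diff gi2 ci integrable_mult_right gi)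
      also have "(LINT z|lebesgue_on {a..b}. (?g z)\<^sup>2 - 2 * q * ?g z) = (LINT z|lebesgue_on {a..b}. (?g z)\<^sup>2) - (LINT z|lebesgue_on {a..b}. 2 * q * ?g z)"
        by (intro Bochner_Integration.integral_diff gi2 integrable_mult_right gi)
      also have "(LINT z|lebesgue_on {a..b}. 2 * q * ?g z) = 2 * q * (LINT z|lebesgue_on {a..b}. ?g z)"
        by simp
      finally show ?thesis by (simp only: eq c)
    qed
    also have "2 * q * (v b - v a) = 2 * (v b - v a)\<^sup>2 / (b - a)" by (simp add: q_def power2_eq_square)
    also have "q\<^sup>2 * (b - a) = (v b - v a)\<^sup>2 / (b - a)" using ab by (simp add: q_def power2_eq_square)
    finally have "(v b - v a)\<^sup>2 / (b - a) \<le> (LINT z|lebesgue_on {a..b}. (?g z)\<^sup>2)" by simp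
    also have "\<dots> \<le> Kv"
    proof -
      have "(LINT z|lebesgue_on {a..b}. (?g z)\<^sup>2) = (LINT z|lebesgue_on {0..l}. (if z \<in> {a..b} then (?g z)\<^sup>2 else 0))"
        by (rule Lebesgue_Measure.integral_restrict[OF sub, symmetric]) auto
      also have "\<dots> \<le> Kv" unfolding Kv_def
        by (rule integral_mono_AE') (use g2 in auto)
      finally show ?thesis .
    qed
    finally have "(v b - v a)\<^sup>2 \<le> Kv * (b - a)" using ab by (simp add: field_simps)
    also have "\<dots> \<le> Kv * l" using ab Kv by (intro mult_left_mono) auto
    finally show ?thesis by (simp add: mult.commute)
  qed
  have pt: "(v x)\<^sup>2 \<le> 2 * (v y)\<^sup>2 + 2 * (l * Kv)" if y: "y \<in> {0..l}" for y
  proof -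
    have "(v x - v y)\<^sup>2 \<le> l * Kv"
    proof (cases x y rule: linorder_cases)
      case less then show ?thesis using diff[of x y] x y by (simp add: power2_commute)
    next
      case greater then show ?thesis using diff[of y x] x y by simp
    next
      case equal then show ?thesis using l Kv by simp
    qed
    moreover have "(v x)\<^sup>2 \<le> 2 * (v y)\<^sup>2 + 2 * (v x - v y)\<^sup>2"
    proof -
      have "0 \<le> (v x - 2 * v y)\<^sup>2" by simp
      then show ?thesis by (simp add: power2_eq_square algebra_simps)
    qed
    ultimately show ?thesis by linarith
  qed
  define Mv where "Mv = (LINT z|lebesgue_on {0..l}. (v z)\<^sup>2)"
  have "((\<lambda>y. (v x)\<^sup>2) has_integral (v x)\<^sup>2 * l) {0..l}"
    using has_integral_const_real[of "(v x)\<^sup>2" 0 l] l by (simp add: mult.commute)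
  moreover have "((\<lambda>y. 2 * (v y)\<^sup>2 + 2 * (l * Kv)) has_integral 2 * Mv + 2 * (l * Kv) * l) {0..l}"
  proof (intro has_integral_add has_integral_mult_right)
    have "Mv = integral {0..l} (\<lambda>z. (v z)\<^sup>2)" unfolding Mv_def
      by (intro lebesgue_integral_eq_integral continuous_imp_integrable_real continuous_intros v) simp
    then show "((\<lambda>y. (v y)\<^sup>2) has_integral Mv) {0..l}"
      by (simp add: integrable_integral integrable_continuous_interval continuous_on_power v)
    show "((\<lambda>y. 2 * (l * Kv)) has_integral 2 * (l * Kv) * l) {0..l}"
      using has_integral_const_real[of "2 * (l * Kv)" 0 l] l by (simp add: mult.commute)
  qed
  ultimately have "(v x)\<^sup>2 * l \<le> 2 * Mv + 2 * (l * Kv) * l" by (rule has_integral_le) (rule pt)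
  then have "(v x)\<^sup>2 \<le> (2 / l) * Mv + 2 * l * Kv" using l by (simp add: field_simps)
  then show ?thesis by (simp add: Mv_def Kv_def)
qed

lemma exp_half_line:
  fixes a :: real assumes a: "a > 0"
  shows "(\<lambda>x. exp (- a * x)) \<in> L2_on {0..}" "(LINT x|lebesgue_on {0..}. (exp (- a * x))\<^sup>2) = 1 / (2 * a)"
proof -
  have e2: "(exp (- a * x))\<^sup>2 = exp (- (2 * a) * x)" for x by (simp add: power2_eq_square exp_add[symmetric])
  have h: "((\<lambda>x. exp (- (2 * a) * x)) has_integral exp (- (2 * a) * 0) / (2 * a)) {0..}"
    by (rule has_integral_exp_minus_to_infinity) (use a in simp)
  have "(\<lambda>x. exp (- (2 * a) * x)) absolutely_integrable_on {0..}"
    by (rule nonnegative_absolutely_integrable_1) (use h in auto)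
  then have i: "integrable (lebesgue_on {0..}) (\<lambda>x. exp (- (2 * a) * x))"
    by (rule absolutely_integrable_imp_integrable) simp
  have m: "(\<lambda>x. exp (- a * x)) \<in> borel_measurable (lebesgue_on {0..})"
    by (rule continuous_imp_measurable_on_sets_lebesgue) (auto intro!: continuous_intros)
  show "(\<lambda>x. exp (- a * x)) \<in> L2_on {0..}" unfolding L2_on_def mem_Collect_eq e2 using i m by blast
  show "(LINT x|lebesgue_on {0..}. (exp (- a * x))\<^sup>2) = 1 / (2 * a)"
    unfolding e2 using lebesgue_integral_eq_integral[OF i] integral_unique[OF h] by simp
qed

text \<open>Integration by parts on \<open>{0..R n}\<close> and passage to the limit. The boundary
  term at \<open>R n\<close> needs no decay of \<open>v\<close>: from
  \<open>|g| <= 1 + g\<^sup>2\<close> the function \<open>v\<close> grows at most linearly, which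
  the exponential beats.\<close>

lemma parts_half_line:
  fixes a :: real
  assumes a: "a > 0" and v: "continuous_on {0..} v" "v \<in> H1_on {0..}"
  shows "(LINT z|lebesgue_on {0..}. weak_deriv {0..} v z * exp (- a * z)) = - v 0 + a * (LINT z|lebesgue_on {0..}. v z * exp (- a * z))"
proof -
  let ?g = "weak_deriv {0..} v"
  note vs = weak_deriv_spec[OF v(2)]
  note e = exp_half_line[OF a]
  define Kv where "Kv = (LINT z|lebesgue_on {0..}. (?g z)\<^sup>2)"
  have g2: "integrable (lebesgue_on {0..}) (\<lambda>z. (?g z)\<^sup>2)" using vs(2) by (simp add: L2_on_def)
  define R where "R = (\<lambda>n. real (Suc n))"
  have sub: "{0..R n} \<subseteq> {0..}" and R0: "0 < R n" for n by (auto simp: R_def)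
  have eq: "(LINT z|lebesgue_on {0..R n}. ?g z * exp (- a * z)) = v (R n) * exp (- a * R n) - v 0 + a * (LINT z|lebesgue_on {0..R n}. v z * exp (- a * z))" for n
  proof -
    have "(LINT z|lebesgue_on {0..R n}. ?g z * exp (- a * z)) = v (R n) * exp (- a * R n) - v 0 * exp (- a * 0) - (LINT z|lebesgue_on {0..R n}. v z * (- a * exp (- a * z)))"
      by (rule weak_deriv_by_parts[OF R0 sub _ continuous_on_subset[OF v(1) sub] vs(2,3)]) (auto intro!: derivative_eq_intros continuous_intros)
    moreover have "(LINT z|lebesgue_on {0..R n}. v z * (- a * exp (- a * z))) = (LINT z|lebesgue_on {0..R n}. (- a) * (v z * exp (- a * z)))"
      by (rule Bochner_Integration.integral_cong) auto
    ultimately show ?thesis by simp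
  qed
  have lim: "(\<lambda>n. LINT z|lebesgue_on {0..R n}. f z) \<longlonglongrightarrow> (LINT z|lebesgue_on {0..}. f z)"
    if f: "integrable (lebesgue_on {0..}) f" for f :: "real \<Rightarrow> real"
  proof -
    have "(LINT z|lebesgue_on {0..R n}. f z) = (LINT z|lebesgue_on {0..}. (if z \<in> {0..R n} then f z else 0))" for n
      by (rule Lebesgue_Measure.integral_restrict[OF sub, symmetric]) auto
    moreover have "(\<lambda>n. LINT z|lebesgue_on {0..}. (if z \<in> {0..R n} then f z else 0)) \<longlonglongrightarrow> (LINT z|lebesgue_on {0..}. f z)"
    proof (rule integral_dominated_convergence[where w = "\<lambda>z. \<bar>f z\<bar>"])
      show "AE z in lebesgue_on {0..}. (\<lambda>n. if z \<in> {0..R n} then f z else 0) \<longlonglongrightarrow> f z"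
      proof (rule AE_I2)
        fix z :: real assume "z \<in> space (lebesgue_on {0..})"
        then have z: "z \<ge> 0" by (simp add: space_restrict_space)
        obtain k :: nat where k: "real k > z" using reals_Archimedean2 by blast
        have "\<forall>\<^sub>F n in sequentially. (if z \<in> {0..R n} then f z else 0) = f z"
          using eventually_ge_at_top[of k] by eventually_elim (use k z in \<open>auto simp: R_def\<close>)
        then show "(\<lambda>n. if z \<in> {0..R n} then f z else 0) \<longlonglongrightarrow> f z" by (rule tendsto_eventually)
      qed
      show "(\<lambda>z. if z \<in> {0..R n} then f z else 0) \<in> borel_measurable (lebesgue_on {0..})" for n
      proof -
        have "{0..R n} \<in> sets (lebesgue_on {0..})" using sub[of n] by (simp add: sets_restrict_space_iff)
        then have "(\<lambda>z. indicator {0..R n} z * f z) \<in> borel_measurable (lebesgue_on {0..})"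
          using f by (intro borel_measurable_times borel_measurable_indicator) auto
        moreover have "(\<lambda>z. indicator {0..R n} z * f z) = (\<lambda>z. if z \<in> {0..R n} then f z else 0)" by auto
        ultimately show ?thesis by (simp only:)
      qed
    qed (use f in auto)
    ultimately show ?thesis by simp
  qed
  have bnd: "\<bar>v (R n) * exp (- a * R n)\<bar> \<le> (\<bar>v 0\<bar> + R n + Kv) * exp (- a * R n)" for n
  proof -
    have "(LINT z|lebesgue_on {0..R n}. ?g z * 1) = v (R n) * 1 - v 0 * 1 - (LINT z|lebesgue_on {0..R n}. v z * 0)"
      by (rule weak_deriv_by_parts[OF R0 sub _ continuous_on_subset[OF v(1) sub] vs(2,3)]) auto
    then have eq: "v (R n) = v 0 + (LINT z|lebesgue_on {0..R n}. ?g z)" by simp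
    have gi: "integrable (lebesgue_on {0..R n}) ?g" by (rule L2_on_integrable_interval[OF vs(2) sub]) simp
    have gi2: "integrable (lebesgue_on {0..R n}) (\<lambda>z. (?g z)\<^sup>2)"
      using L2_on_subset[OF vs(2) sub] by (simp add: L2_on_def)
    have ci: "integrable (lebesgue_on {0..R n}) (\<lambda>z. 1::real)" by (intro continuous_imp_integrable_real continuous_intros)
    have "\<bar>LINT z|lebesgue_on {0..R n}. ?g z\<bar> \<le> (LINT z|lebesgue_on {0..R n}. \<bar>?g z\<bar>)" using integral_abs_bound by blast
    also have "\<dots> \<le> (LINT z|lebesgue_on {0..R n}. 1 + (?g z)\<^sup>2)"
    proof (rule integral_mono)
      fix z
      have "0 \<le> (\<bar>?g z\<bar> - 1)\<^sup>2" by simp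
      then have "2 * \<bar>?g z\<bar> \<le> 1 + (?g z)\<^sup>2" by (simp add: power2_diff)
      then show "\<bar>?g z\<bar> \<le> 1 + (?g z)\<^sup>2" by (smt (verit) abs_ge_zero)
    qed (use gi gi2 ci in auto)
    also have "\<dots> = (LINT z|lebesgue_on {0..R n}. 1) + (LINT z|lebesgue_on {0..R n}. (?g z)\<^sup>2)"
      by (rule Bochner_Integration.integral_add[OF ci gi2])
    also have "(LINT z|lebesgue_on {0..R n}. 1) = R n"
    proof -
      have "(LINT z|lebesgue_on {0..R n}. 1) = integral {0..R n} (\<lambda>_. 1::real)" by (rule lebesgue_integral_eq_integral[OF ci]) simp
      then show ?thesis using R0[of n] by simp
    qed
    also have "(LINT z|lebesgue_on {0..R n}. (?g z)\<^sup>2) \<le> Kv"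
    proof -
      have "(LINT z|lebesgue_on {0..R n}. (?g z)\<^sup>2) = (LINT z|lebesgue_on {0..}. (if z \<in> {0..R n} then (?g z)\<^sup>2 else 0))"
        by (rule Lebesgue_Measure.integral_restrict[OF sub, symmetric]) auto
      also have "\<dots> \<le> Kv" unfolding Kv_def by (rule integral_mono_AE') (use g2 in auto)
      finally show ?thesis .
    qed
    finally have "\<bar>v (R n)\<bar> \<le> \<bar>v 0\<bar> + R n + Kv" using eq by linarith
    then show ?thesis by (simp add: abs_mult)
  qed
  have "(\<lambda>n. v (R n) * exp (- a * R n)) \<longlonglongrightarrow> 0"
  proof (rule Lim_null_comparison)
    show "\<forall>\<^sub>F n in sequentially. norm (v (R n) * exp (- a * R n)) \<le> (\<bar>v 0\<bar> + R n + Kv) * exp (- a * R n)"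
      using bnd by simp
    show "(\<lambda>n. (\<bar>v 0\<bar> + R n + Kv) * exp (- a * R n)) \<longlonglongrightarrow> 0"
      unfolding R_def using a by real_asymp
  qed
  then have "(\<lambda>n. v (R n) * exp (- a * R n) - v 0 + a * (LINT z|lebesgue_on {0..R n}. v z * exp (- a * z))) \<longlonglongrightarrow>
     0 - v 0 + a * (LINT z|lebesgue_on {0..}. v z * exp (- a * z))"
    by (intro tendsto_intros lim L2_on_integrable_mult vs e)
  moreover have "(\<lambda>n. LINT z|lebesgue_on {0..R n}. ?g z * exp (- a * z)) \<longlonglongrightarrow> (LINT z|lebesgue_on {0..}. ?g z * exp (- a * z))"
    by (intro lim L2_on_integrable_mult vs e)
  ultimately show ?thesis unfolding eq by (auto dest: LIMSEQ_unique)
qed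

section \<open>The solution on the metric graph\<close>

text \<open>The mean value theorem followed by the Lipschitz bound for the power
  \<open>p - 1\<close> on \<open>[0, B]\<close> yields a quadratic remainder from first derivatives
  alone.\<close>

lemma powr_taylor:
  fixes x h p B :: real
  assumes p: "p > 2" and x: "0 \<le> x" "x \<le> B" "0 \<le> x + h" "x + h \<le> B"
  shows "\<bar>(x + h) powr p - x powr p - p * x powr (p - 1) * h\<bar> \<le> p * ((p - 1) * B powr (p - 2)) * h\<^sup>2"
proof -
  have D: "((\<lambda>y. (max 0 y) powr p) has_real_derivative p * (max 0 y) powr (p - 1)) (at y)" for y
    by (rule pos_part_powr_deriv) (use p in simp)
  have "\<exists>z\<ge>0. z \<le> B \<and> \<bar>z - x\<bar> \<le> \<bar>h\<bar> \<and> (x + h) powr p - x powr p = h * (p * z powr (p - 1))"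
  proof (cases h "0::real" rule: linorder_cases)
    case greater
    then obtain z where "x < z" "z < x + h" "(max 0 (x + h)) powr p - (max 0 x) powr p = (x + h - x) * (p * (max 0 z) powr (p - 1))"
      using MVT2[of x "x + h", OF _ D] by auto
    then show ?thesis using x by (intro exI[of _ z]) auto
  next
    case less
    then obtain z where "x + h < z" "z < x" "(max 0 x) powr p - (max 0 (x + h)) powr p = (x - (x + h)) * (p * (max 0 z) powr (p - 1))"
      using MVT2[of "x + h" x, OF _ D] by auto
    then show ?thesis using x by (intro exI[of _ z]) auto
  next
    case equal
    then show ?thesis using x by (intro exI[of _ x]) auto
  qed
  then obtain z where z: "0 \<le> z" "z \<le> B" "\<bar>z - x\<bar> \<le> \<bar>h\<bar>" "(x + h) powr p - x powr p = h * (p * z powr (p - 1))" by blast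
  have "\<bar>z powr (p - 1) - x powr (p - 1)\<bar> \<le> (p - 1) * B powr (p - 2) * \<bar>z - x\<bar>"
    using powr_lipschitz[of "p - 1" z B x] p x z by simp
  also have "\<dots> \<le> (p - 1) * B powr (p - 2) * \<bar>h\<bar>" using p z by (intro mult_left_mono) auto
  finally have l: "\<bar>z powr (p - 1) - x powr (p - 1)\<bar> \<le> (p - 1) * B powr (p - 2) * \<bar>h\<bar>" .
  have "(x + h) powr p - x powr p - p * x powr (p - 1) * h = p * h * (z powr (p - 1) - x powr (p - 1))"
    using z(4) by (simp add: algebra_simps)
  then have "\<bar>(x + h) powr p - x powr p - p * x powr (p - 1) * h\<bar> = p * \<bar>h\<bar> * \<bar>z powr (p - 1) - x powr (p - 1)\<bar>"
    using p by (simp add: abs_mult)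
  also have "\<dots> \<le> p * \<bar>h\<bar> * ((p - 1) * B powr (p - 2) * \<bar>h\<bar>)" using p l by (intro mult_left_mono) auto
  also have "\<dots> = p * ((p - 1) * B powr (p - 2)) * h\<^sup>2" by (simp add: power2_eq_square abs_mult_self_eq)
  finally show ?thesis .
qed

lemma bounded_edge_interval:
  assumes "finite_metric_graph G" "e \<in> bounded_edges G"
  shows "0 < real_of_ereal (len G e)" "edge_interval G e = {0..real_of_ereal (len G e)}"
proof -
  have "0 < len G e" "len G e < \<infinity>" using assms by (auto simp: finite_metric_graph_def bounded_edges_def)
  then obtain l where l: "len G e = ereal l" "l > 0" by (cases "len G e") auto
  show "0 < real_of_ereal (len G e)" "edge_interval G e = {0..real_of_ereal (len G e)}"
    using l by (auto simp: edge_interval_def)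
qed

lemma half_line_interval: "e \<in> half_lines G \<Longrightarrow> edge_interval G e = {0..}"
  by (auto simp: edge_interval_def half_lines_def)

lemma edges_split: "edges G = bounded_edges G \<union> half_lines G" "bounded_edges G \<inter> half_lines G = {}"
  by (auto simp: bounded_edges_def half_lines_def)

text \<open>Connectedness runs through bounded edges only, so a vertex reached by a nontrivial chain
  from a core vertex is itself an end of a bounded edge.\<close>

lemma core_verts_eq_verts:
  assumes fin: "finite_metric_graph G" and con: "connected_metric_graph G" and B: "bounded_edges G \<noteq> {}"
  shows "core_verts G = verts G"
proof
  show sub: "core_verts G \<subseteq> verts G"
    using fin by (auto simp: core_verts_def finite_metric_graph_def bounded_edges_def)
  show "verts G \<subseteq> core_verts G"
  proof
    fix v assume v: "v \<in> verts G"
    obtain e where e: "e \<in> bounded_edges G" using B by blast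
    then have ce: "src G e \<in> core_verts G" by (simp add: core_verts_def)
    then have "src G e \<in> verts G" using sub by blast
    with v con have "(src G e, v) \<in> {(a, b). \<exists>e\<in>bounded_edges G. {a, b} = {src G e, tgt G e}}\<^sup>*"
      by (simp add: connected_metric_graph_def)
    then show "v \<in> core_verts G"
    proof (cases rule: rtranclE)
      case base then show ?thesis using ce by simp
    next
      case (step y)
      then obtain e' where "e' \<in> bounded_edges G" "{y, v} = {src G e', tgt G e'}" by auto
      then show ?thesis by (auto simp: core_verts_def doubleton_eq_iff)
    qed
  qed
qed

lemma core_graph_of_metric_graph:
  assumes fin: "finite_metric_graph G" and con: "connected_metric_graph G"
    and nc: "noncompact_metric_graph G" and core: "compact_core G \<noteq> {}" and p: "p > 6" and \<mu>: "\<mu> > 0"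
  shows "core_graph (verts G) (bounded_edges G) (\<lambda>e. real_of_ereal (len G e)) (src G) (tgt G)
    (\<lambda>v. real (card {e \<in> half_lines G. src G e = v})) p \<mu>"
proof
  have finE: "finite (edges G)" using fin by (simp add: finite_metric_graph_def)
  show "finite (verts G)" using fin by (simp add: finite_metric_graph_def)
  show "finite (bounded_edges G)" using finE edges_split(1)[of G] by simp
  \<comment> \<open>A core point on a half-line sits at a core vertex, hence at an end of a bounded
    edge; so a nonempty core always provides a bounded edge.\<close>
  show B: "bounded_edges G \<noteq> {}" using core by (auto simp: compact_core_def core_verts_def)
  note cv = core_verts_eq_verts[OF fin con B]
  show "verts G \<subseteq> src G ` bounded_edges G \<union> tgt G ` bounded_edges G" using cv by (simp add: core_verts_def)
  show "src G e \<in> verts G" "tgt G e \<in> verts G" if "e \<in> bounded_edges G" for e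
    unfolding cv[symmetric] using that by (auto simp: core_verts_def)
  show "0 < real_of_ereal (len G e)" if "e \<in> bounded_edges G" for e by (rule bounded_edge_interval(1)[OF fin that])
  show "(v, w) \<in> {(a, b). \<exists>e\<in>bounded_edges G. {a, b} = {src G e, tgt G e}}\<^sup>*" if "v \<in> verts G" "w \<in> verts G" for v w
    using con that by (simp add: connected_metric_graph_def)
  obtain h where h: "h \<in> half_lines G" using nc by (auto simp: noncompact_metric_graph_def)
  have "src G h \<in> verts G" using h fin by (auto simp: finite_metric_graph_def half_lines_def)
  moreover have "finite (half_lines G)" using finE edges_split(1)[of G] by simp
  then have "card {e \<in> half_lines G. src G e = src G h} > 0" using h by (subst card_gt_0_iff) auto
  ultimately show "\<exists>v\<in>verts G. 0 < real (card {e \<in> half_lines G. src G e = v})" by auto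
qed (use p \<mu> in auto)

section \<open>Gluing exponential tails to a solution on the core\<close>

locale graph_solution =
  core_solution "verts G" "bounded_edges G" "\<lambda>e. real_of_ereal (len G e)" "src G" "tgt G" N p \<mu> a 1 u c d
  for G :: "('v, 'e) mgraph" and N p \<mu> a u c d +
  assumes finite_graph: "finite_metric_graph G"
    and N_eq: "N v = real (card {e \<in> half_lines G. src G e = v})"
    and En_pos: "0 < En a 1 u c"
begin

abbreviation "ell e \<equiv> real_of_ereal (len G e)"
abbreviation "J e \<equiv> edge_interval G e"
abbreviation "W v e \<equiv> weak_deriv (edge_interval G e) (v e)"

definition U :: "'e \<Rightarrow> real \<Rightarrow> real" where
  "U e x = (if e \<in> bounded_edges G then u e x else c (src G e) * exp (- a * x))"
definition dU :: "'e \<Rightarrow> real \<Rightarrow> real" where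
  "dU e x = (if e \<in> bounded_edges G then du e x else - a * c (src G e) * exp (- a * x))"
definition ddU :: "'e \<Rightarrow> real \<Rightarrow> real" where
  "ddU e x = a\<^sup>2 * U e x - (if e \<in> bounded_edges G then u e x powr (p - 1) else 0)"

lemma edge_cases:
  assumes "e \<in> edges G"
  obtains (bounded) "e \<in> bounded_edges G" "J e = {0..ell e}" "ell e > 0"
    | (half_line) "e \<in> half_lines G" "e \<notin> bounded_edges G" "J e = {0..}"
  using assms edges_split[of G] bounded_edge_interval[OF finite_graph] half_line_interval[of e G] by blast

lemma fin_half: "finite (half_lines G)" and fin_edges: "finite (edges G)"
  using finite_graph by (auto simp: finite_metric_graph_def half_lines_def)

lemma sum_edges: "sum f (edges G) = sum f (bounded_edges G) + sum f (half_lines G)" for f :: "'e \<Rightarrow> real"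
  using edges_split[of G] finE fin_half by (simp add: sum.union_disjoint)

lemma sum_half_lines: "(\<Sum>e\<in>half_lines G. f (src G e)) = (\<Sum>v\<in>verts G. N v * f v)" for f :: "'v \<Rightarrow> real"
proof -
  have "src G ` half_lines G \<subseteq> verts G"
    using finite_graph by (auto simp: finite_metric_graph_def half_lines_def)
  then have "(\<Sum>e\<in>half_lines G. f (src G e)) = (\<Sum>v\<in>verts G. \<Sum>e\<in>{e \<in> half_lines G. src G e = v}. f (src G e))"
    by (rule sum.group[OF fin_half finV, symmetric])
  then show ?thesis by (simp add: N_eq)
qed

lemma edge_set_I: "e \<in> edges G \<Longrightarrow> edge_set (J e)"
  by (erule edge_cases) (auto simp: edge_set_def)

lemma U_deriv:
  assumes "e \<in> edges G" "x \<in> J e" shows "(U e has_real_derivative dU e x) (at x within J e)"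
  using assms(1)
proof (cases rule: edge_cases)
  case bounded
  then show ?thesis using u_deriv[of e x] assms by (simp add: U_def[abs_def] dU_def)
next
  case half_line
  then show ?thesis unfolding U_def[abs_def] dU_def by (auto intro!: derivative_eq_intros)
qed

lemma dU_deriv:
  assumes "e \<in> edges G" "x \<in> J e" shows "(dU e has_real_derivative ddU e x) (at x within J e)"
  using assms(1)
proof (cases rule: edge_cases)
  case bounded
  then show ?thesis using du_deriv[of e x] assms by (simp add: dU_def[abs_def] ddU_def U_def gg_def)
next
  case half_line
  then show ?thesis unfolding U_def[abs_def] dU_def ddU_def by (auto intro!: derivative_eq_intros simp: power2_eq_square)
qed

lemma U_cont: "e \<in> edges G \<Longrightarrow> continuous_on (J e) (U e)"
  by (rule DERIV_continuous_on[OF U_deriv])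
lemma dU_cont: "e \<in> edges G \<Longrightarrow> continuous_on (J e) (dU e)"
  by (rule DERIV_continuous_on[OF dU_deriv])

lemma U_L2:
  assumes e: "e \<in> edges G" shows "U e \<in> L2_on (J e)"
  using e
proof (cases rule: edge_cases)
  case bounded
  then show ?thesis using L2_on_continuous[of 0 "ell e" "U e"] U_cont[OF e] by simp
next
  case half_line
  then show ?thesis
    using L2_on_cmult[OF exp_half_line(1)[OF a_pos], of "c (src G e)"] by (simp add: U_def[abs_def])
qed

lemma dU_L2:
  assumes e: "e \<in> edges G" shows "dU e \<in> L2_on (J e)"
  using e
proof (cases rule: edge_cases)
  case bounded
  then show ?thesis using L2_on_continuous[of 0 "ell e" "dU e"] dU_cont[OF e] by simp
next
  case half_line
  then show ?thesis
    using L2_on_cmult[OF exp_half_line(1)[OF a_pos], of "- a * c (src G e)"] by (simp add: dU_def[abs_def])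
qed

lemma U_weak: "e \<in> edges G \<Longrightarrow> has_weak_deriv (J e) (U e) (dU e)"
  by (rule classical_weak_deriv[OF edge_set_I U_deriv dU_cont])

lemma U_H1: "U \<in> H1 G"
proof -
  have "U e 0 = c (src G e)" if "e \<in> edges G" for e using u_s[of e] by (simp add: U_def)
  moreover have "U e (ell e) = c (tgt G e)" if "e \<in> bounded_edges G" for e using u_t[OF that] that by (simp add: U_def)
  ultimately have "graph_continuous G U" unfolding graph_continuous_def using U_cont by blast
  then show ?thesis unfolding H1_def H1_on_def using U_L2 dU_L2 U_weak by blast
qed

lemma H1D:
  assumes "v \<in> H1 G" "e \<in> edges G"
  shows "continuous_on (J e) (v e)" "v e \<in> H1_on (J e)" "v e \<in> L2_on (J e)" "W v e \<in> L2_on (J e)"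
  using assms weak_deriv_spec[of "v e" "J e"] by (auto simp: H1_def graph_continuous_def)

lemma c_pos: "v \<in> verts G \<Longrightarrow> 0 < c v"
proof -
  assume "v \<in> verts G"
  then obtain e where e: "e \<in> bounded_edges G" "v = src G e \<or> v = tgt G e" using V_ends by blast
  show ?thesis using e(2) u_pos[OF En_pos e(1), of 0] u_pos[OF En_pos e(1), of "ell e"] u_s[OF e(1)] u_t[OF e(1)] el_pos[OF e(1)]
    by auto
qed

lemma src_verts: "e \<in> edges G \<Longrightarrow> src G e \<in> verts G"
  using finite_graph by (auto simp: finite_metric_graph_def)

lemma U_pos:
  assumes e: "e \<in> edges G" and x: "x \<in> J e" shows "0 < U e x"
  using e
proof (cases rule: edge_cases)
  case bounded
  then show ?thesis using u_pos[OF En_pos bounded(1)] x by (simp add: U_def)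
next
  case half_line
  then show ?thesis using c_pos[OF src_verts[OF e]] by (simp add: U_def)
qed

lemma half_not_bounded: "e \<in> half_lines G \<Longrightarrow> e \<notin> bounded_edges G"
  by (simp add: bounded_edges_def half_lines_def)

lemma half_line_square:
  assumes "e \<in> half_lines G"
  shows "(LINT x|lebesgue_on (J e). (k * exp (- a * x))\<^sup>2) = k\<^sup>2 * (1 / (2 * a))"
  by (simp only: half_line_interval[OF assms] power_mult_distrib integral_mult_right_zero exp_half_line(2)[OF a_pos])

text \<open>The tails carry the mass \<open>Sc c / (2 * a)\<close>, which \<open>mass_eq\<close>
  identifies with \<open>\<mu> - Mass u\<close>.\<close>

lemma mass_U: "mass G U = \<mu>"
proof -
  have "(LINT x|lebesgue_on (J e). \<bar>U e x\<bar>\<^sup>2) = Me e" if e: "e \<in> bounded_edges G" for e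
  proof -
    have "e \<in> edges G" using e by (simp add: bounded_edges_def half_lines_def)
    from U_L2[OF this] have "integrable (lebesgue_on {0..ell e}) (\<lambda>x. (U e x)\<^sup>2)"
      by (simp add: L2_on_def bounded_edge_interval[OF finite_graph e])
    from lebesgue_integral_eq_integral[OF this] e show ?thesis
      by (simp add: bounded_edge_interval[OF finite_graph e] Me_def U_def)
  qed
  moreover have "(LINT x|lebesgue_on (J e). \<bar>U e x\<bar>\<^sup>2) = (c (src G e))\<^sup>2 * (1 / (2 * a))" if e: "e \<in> half_lines G" for e
    using half_line_square[OF e, of "c (src G e)"] half_not_bounded[OF e] by (simp add: U_def)
  ultimately have "mass G U = sum Me (bounded_edges G) + (\<Sum>e\<in>half_lines G. (c (src G e))\<^sup>2) * (1 / (2 * a))"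
    unfolding mass_def sum_edges by (simp add: sum_distrib_right sum_divide_distrib)
  also have "\<dots> = Mass u + Sc c / (2 * a)" unfolding sum_half_lines[of "\<lambda>v. (c v)\<^sup>2"] by (simp add: Mass_eq Sc_def)
  also have "\<dots> = \<mu>" using mass_eq a_pos by (simp add: field_simps)
  finally show ?thesis .
qed

lemma kinetic_U: "kinetic G U = sum Ke (bounded_edges G) + a * Sc c / 2"
proof -
  have sq: "(LINT x|lebesgue_on (J e). \<bar>W U e x\<bar>\<^sup>2) = (LINT x|lebesgue_on (J e). (dU e x)\<^sup>2)" if e: "e \<in> edges G" for e
    by (rule integral_cong_AE)
      (use weak_deriv_AE[OF edge_set_I[OF e] U_cont[OF e] U_L2[OF e] dU_L2[OF e] U_weak[OF e]]
         L2_on_measurable[OF dU_L2[OF e]] L2_on_measurable[OF H1D(4)[OF U_H1 e]] in \<open>auto elim!: eventually_mono\<close>)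
  have "(LINT x|lebesgue_on (J e). \<bar>W U e x\<bar>\<^sup>2) = Ke e" if e: "e \<in> bounded_edges G" for e
  proof -
    have ed: "e \<in> edges G" using e by (simp add: bounded_edges_def half_lines_def)
    from dU_L2[OF this] have "integrable (lebesgue_on {0..ell e}) (\<lambda>x. (dU e x)\<^sup>2)"
      by (simp add: L2_on_def bounded_edge_interval[OF finite_graph e])
    from lebesgue_integral_eq_integral[OF this] e show ?thesis
      unfolding sq[OF ed] by (simp add: bounded_edge_interval[OF finite_graph e] Ke_def dU_def)
  qed
  moreover have "(LINT x|lebesgue_on (J e). \<bar>W U e x\<bar>\<^sup>2) = (c (src G e))\<^sup>2 * (a / 2)" if e: "e \<in> half_lines G" for e
  proof -
    have ed: "e \<in> edges G" using e by (simp add: bounded_edges_def half_lines_def)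
    show ?thesis unfolding sq[OF ed]
      using half_line_square[OF e, of "- a * c (src G e)"] half_not_bounded[OF e] a_pos by (simp add: dU_def power2_eq_square)
  qed
  ultimately have "kinetic G U = sum Ke (bounded_edges G) + (\<Sum>e\<in>half_lines G. (c (src G e))\<^sup>2) * (a / 2)"
    unfolding kinetic_def sum_edges by (simp add: sum_distrib_right)
  also have "\<dots> = sum Ke (bounded_edges G) + a * Sc c / 2" unfolding sum_half_lines[of "\<lambda>v. (c v)\<^sup>2"] by (simp add: Sc_def)
  finally show ?thesis .
qed

text \<open>By \<open>kinetic_identity\<close> the energy of \<open>U\<close> is exactly
  \<open>En a 1 u c\<close>, whose positivity comes from the lower bound on the mountain-pass
  level.\<close>

lemma energy_U: "0 < energy G p U"
proof -
  have "(LINT x|lebesgue_on (J e). \<bar>U e x\<bar> powr p) = Pe e" if e: "e \<in> bounded_edges G" for e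
  proof -
    have "(LINT x|lebesgue_on (J e). \<bar>U e x\<bar> powr p) = (LINT x|lebesgue_on {0..ell e}. u e x powr p)"
      unfolding bounded_edge_interval(2)[OF finite_graph e]
      by (rule Bochner_Integration.integral_cong) (use u_nonneg[OF e] e in \<open>auto simp: U_def\<close>)
    also have "\<dots> = Pe e" unfolding Pe_def
      by (rule lebesgue_integral_eq_integral) (use u_powr_cont[OF e, of p] p6 in \<open>auto intro!: continuous_imp_integrable_real\<close>)
    finally show ?thesis .
  qed
  then have "energy G p U = 1 / 2 * kinetic G U - 1 / p * Pow u" by (simp add: energy_def Pow_eq)
  also have "\<dots> = En a 1 u c"
    unfolding kinetic_U kinetic_identity En_def by (simp add: algebra_simps)
  finally show ?thesis using En_pos by simp
qed

lemma edge_deriv_U: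
  assumes e: "e \<in> edges G" and x: "x \<in> J e" shows "edge_deriv G U e x = dU e x"
proof -
  obtain R :: "nat \<Rightarrow> real" where R: "\<And>n. 0 < R n" "\<And>n. {0..R n} \<subseteq> J e" "\<And>x. x \<in> J e \<Longrightarrow> \<exists>n. x \<in> {0..R n}"
    using edge_set_exhaust[OF edge_set_I[OF e]] by metis
  obtain n where n: "x \<in> {0..R n}" using R(3)[OF x] by blast
  have "x islimpt {0..R n}" using n R(1)[of n] by (subst islimpt_Icc) auto
  then have "x islimpt J e" by (rule islimpt_subset[OF _ R(2)])
  then have "at x within J e \<noteq> bot" by (simp add: trivial_limit_within)
  then show ?thesis unfolding edge_deriv_def
    by (rule vector_derivative_within)
       (use U_deriv[OF e x] in \<open>simp add: has_real_derivative_iff_has_vector_derivative\<close>)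
qed

lemma U_solves:
  assumes e: "e \<in> edges G" shows "solves_on_edge G p (a\<^sup>2) U e"
  unfolding solves_on_edge_def
proof (intro conjI ballI)
  show "U e differentiable_on J e"
    unfolding differentiable_on_def using U_deriv[OF e] by (auto simp: real_differentiable_def)
  show "continuous_on (J e) (edge_deriv G U e)"
    using dU_cont[OF e] edge_deriv_U[OF e] by (simp cong: continuous_on_cong)
  fix x assume x: "x \<in> interior (J e)"
  then have xI: "x \<in> J e" using interior_subset by blast
  have "(dU e has_real_derivative ddU e x) (at x)"
    using dU_deriv[OF e xI] at_within_interior[OF x] by simp
  then have D: "(edge_deriv G U e has_real_derivative ddU e x) (at x)"
    by (rule has_field_derivative_transform_within_open[OF _ open_interior x])
       (use edge_deriv_U[OF e] interior_subset in fastforce)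
  then show "edge_deriv G U e differentiable (at x)" by (auto simp: real_differentiable_def)
  show "- deriv (edge_deriv G U e) x + a\<^sup>2 * U e x = core_indicator G e x * \<bar>U e x\<bar> powr (p - 2) * U e x"
    unfolding DERIV_imp_deriv[OF D] using e
  proof (cases rule: edge_cases)
    case bounded
    have "core_indicator G e x = 1" using bounded xI by (simp add: core_indicator_def compact_core_def)
    moreover have "U e x powr (p - 1) = U e x powr (p - 2) * U e x"
      using powr_add[of "U e x" "p - 2" 1] U_pos[OF e xI] by simp
    ultimately show "- ddU e x + a\<^sup>2 * U e x = core_indicator G e x * \<bar>U e x\<bar> powr (p - 2) * U e x"
      using U_pos[OF e xI] bounded by (simp add: ddU_def U_def)
  next
    case half_line
    \<comment> \<open>Interior points exclude the origin of the half-line, the one point of it that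
      may belong to the core.\<close>
    have "x \<noteq> 0" using x half_line by auto
    then have "core_indicator G e x = 0" using half_line by (simp add: core_indicator_def compact_core_def)
    then show "- ddU e x + a\<^sup>2 * U e x = core_indicator G e x * \<bar>U e x\<bar> powr (p - 2) * U e x"
      using half_line by (simp add: ddU_def)
  qed
qed

text \<open>The half-lines at \<open>v\<close> contribute \<open>- (a * N v * c v)\<close>, so the
  Robin condition on the core is the Kirchhoff condition on the graph.\<close>

lemma vertex_sum:
  assumes v: "v \<in> verts G"
  shows "(\<Sum>e\<in>{e \<in> edges G. src G e = v}. dU e 0) - (\<Sum>e\<in>{e \<in> bounded_edges G. tgt G e = v}. dU e (ell e)) = 0"
proof -
  have "{e \<in> edges G. src G e = v} = {e \<in> bounded_edges G. src G e = v} \<union> {e \<in> half_lines G. src G e = v}"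
    using edges_split(1)[of G] by auto
  then have "(\<Sum>e\<in>{e \<in> edges G. src G e = v}. dU e 0) =
      (\<Sum>e\<in>{e \<in> bounded_edges G. src G e = v}. dU e 0) + (\<Sum>e\<in>{e \<in> half_lines G. src G e = v}. dU e 0)"
    using finE fin_half edges_split(2)[of G] by (auto intro!: sum.union_disjoint)
  also have "(\<Sum>e\<in>{e \<in> bounded_edges G. src G e = v}. dU e 0) = (\<Sum>e\<in>{e \<in> bounded_edges G. src G e = v}. d e)"
    by (rule sum.cong) (auto simp: dU_def du_0)
  also have "(\<Sum>e\<in>{e \<in> half_lines G. src G e = v}. dU e 0) = (\<Sum>e\<in>{e \<in> half_lines G. src G e = v}. - a * c v)"
    by (rule sum.cong) (use edges_split(2)[of G] in \<open>auto simp: dU_def\<close>)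
  also have "(\<Sum>e\<in>{e \<in> half_lines G. src G e = v}. - a * c v) = - (a * N v * c v)" by (simp add: N_eq)
  finally show ?thesis
    using vertex_eq[OF v] by (simp add: dU_def)
qed

lemma kirchhoff_U:
  assumes v: "v \<in> core_verts G" shows "kirchhoff_sum G U v = 0"
proof -
  have vV: "v \<in> verts G" using v s_in t_in by (auto simp: core_verts_def)
  have 0: "0 \<in> J e" if "e \<in> edges G" for e using that by (cases rule: edge_cases) auto
  have l: "ell e \<in> J e" if "e \<in> bounded_edges G" for e
    using bounded_edge_interval[OF finite_graph that] by auto
  have be: "e \<in> edges G" if "e \<in> bounded_edges G" for e using that by (simp add: bounded_edges_def)
  have "kirchhoff_sum G U v = (\<Sum>e\<in>{e \<in> edges G. src G e = v}. dU e 0) + (\<Sum>e\<in>{e \<in> bounded_edges G. tgt G e = v}. - dU e (ell e))"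
    unfolding kirchhoff_sum_def
    by (intro arg_cong2[of _ _ _ _ "(+)"] sum.cong) (auto simp: edge_deriv_U 0 l be)
  then show ?thesis using vertex_sum[OF vV] by (simp add: sum_negf)
qed

section \<open>Frechet derivatives of mass and energy at the solution\<close>

definition inner_U :: "('e \<Rightarrow> real \<Rightarrow> real) \<Rightarrow> real" where
  "inner_U v = (\<Sum>e\<in>edges G. LINT x|lebesgue_on (J e). U e x * v e x)"

lemma U_mult_integrable: "v \<in> H1 G \<Longrightarrow> e \<in> edges G \<Longrightarrow> integrable (lebesgue_on (J e)) (\<lambda>x. U e x * v e x)"
  by (rule L2_on_integrable_mult[OF U_L2 H1D(3)])

lemma inner_U_add: "v \<in> H1 G \<Longrightarrow> w \<in> H1 G \<Longrightarrow> inner_U (\<lambda>e x. v e x + w e x) = inner_U v + inner_U w"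
  unfolding inner_U_def sum.distrib[symmetric]
  by (rule sum.cong) (simp_all add: distrib_left U_mult_integrable)

lemma inner_U_cmult: "inner_U (\<lambda>e x. k * v e x) = k * inner_U v"
  unfolding inner_U_def sum_distrib_left
  by (rule sum.cong) (simp_all add: mult.left_commute[of _ k])

lemma inner_U_U: "inner_U U = \<mu>"
  using mass_U by (simp add: inner_U_def mass_def power2_eq_square)

lemma mass_nonneg: "0 \<le> mass G v" and kinetic_nonneg: "0 \<le> kinetic G v"
  by (auto simp: mass_def kinetic_def intro!: sum_nonneg)

lemma H1_norm_square: "(H1_norm G v)\<^sup>2 = kinetic G v + mass G v" and H1_norm_nonneg: "0 \<le> H1_norm G v"
  using mass_nonneg[of v] kinetic_nonneg[of v] by (auto simp: H1_norm_def)

text \<open>The factor \<open>k\<close> lets one expansion serve both the derivative of the mass, at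
  \<open>k = 1\<close>, and the Cauchy-Schwarz argument of \<open>inner_U_bound\<close>.\<close>

lemma mass_add:
  assumes "v \<in> H1 G"
  shows "mass G (\<lambda>e x. k * U e x + v e x) = k\<^sup>2 * \<mu> + 2 * k * inner_U v + mass G v"
proof -
  have "(LINT x|lebesgue_on (J e). \<bar>k * U e x + v e x\<bar>\<^sup>2) = k\<^sup>2 * (LINT x|lebesgue_on (J e). \<bar>U e x\<bar>\<^sup>2)
      + 2 * k * (LINT x|lebesgue_on (J e). U e x * v e x) + (LINT x|lebesgue_on (J e). \<bar>v e x\<bar>\<^sup>2)" if "e \<in> edges G" for e
    using L2_square_add[OF L2_on_cmult[OF U_L2[OF that], of k] H1D(3)[OF assms that]]
    by (simp add: power_mult_distrib mult.assoc)
  then show ?thesis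
    by (simp add: mass_def inner_U_def sum.distrib sum_distrib_left mass_U[unfolded mass_def, symmetric])
qed

text \<open>Cauchy-Schwarz: the mass of \<open>k * U + v\<close> is nonnegative at the minimising
  value of \<open>k\<close>.\<close>

lemma inner_U_bound:
  assumes "v \<in> H1 G" shows "\<bar>inner_U v\<bar> \<le> sqrt \<mu> * H1_norm G v"
proof -
  define k where "k = - inner_U v / \<mu>"
  have k: "k * \<mu> = - inner_U v" using \<mu>_pos by (simp add: k_def)
  have "0 \<le> k\<^sup>2 * \<mu> + 2 * k * inner_U v + mass G v" unfolding mass_add[OF assms, symmetric] by (rule mass_nonneg)
  also have "k\<^sup>2 * \<mu> = - (k * inner_U v)" using k by (simp add: power2_eq_square mult.assoc)
  finally have "- (k * inner_U v) \<le> mass G v" by simp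
  then have "- (k * inner_U v) * \<mu> \<le> mass G v * \<mu>" using \<mu>_pos by (intro mult_right_mono) auto
  also have "- (k * inner_U v) * \<mu> = - ((k * \<mu>) * inner_U v)" by simp
  also have "\<dots> = (inner_U v)\<^sup>2" unfolding k by (simp add: power2_eq_square)
  also have "mass G v * \<mu> \<le> (H1_norm G v)\<^sup>2 * \<mu>"
    using \<mu>_pos kinetic_nonneg[of v] by (intro mult_right_mono) (auto simp: H1_norm_square)
  also have "\<dots> = (sqrt \<mu> * H1_norm G v)\<^sup>2" using \<mu>_pos by (simp add: power_mult_distrib)
  finally have "\<bar>inner_U v\<bar>\<^sup>2 \<le> (sqrt \<mu> * H1_norm G v)\<^sup>2" by simp
  then show ?thesis by (rule power2_le_imp_le) (use \<mu>_pos H1_norm_nonneg[of v] in auto)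
qed

text \<open>Both derivatives at \<open>U\<close> are multiples of \<open>inner_U\<close>, so
  linearity and boundedness are settled once, and a quadratic remainder near 0 is all that is left
  to check.\<close>

lemma frechet_inner_U:
  assumes R: "\<And>v. v \<in> H1 G \<Longrightarrow> H1_norm G v < r \<Longrightarrow>
      \<bar>F (\<lambda>e x. U e x + v e x) - F U - k * inner_U v\<bar> \<le> C * (H1_norm G v)\<^sup>2" and r: "r > 0" and C: "C > 0"
  shows "H1_frechet_deriv G F U (\<lambda>v. k * inner_U v)"
  unfolding H1_frechet_deriv_def
proof (intro conjI ballI allI impI)
  show "k * inner_U (\<lambda>e x. v e x + w e x) = k * inner_U v + k * inner_U w" if "v \<in> H1 G" "w \<in> H1 G" for v w
    using inner_U_add[OF that] by (simp add: distrib_left)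
  show "k * inner_U (\<lambda>e x. b * v e x) = b * (k * inner_U v)" for b v by (simp add: inner_U_cmult)
  show "\<exists>K. \<forall>v\<in>H1 G. \<bar>k * inner_U v\<bar> \<le> K * H1_norm G v"
  proof (intro exI ballI)
    fix v assume "v \<in> H1 G"
    from mult_left_mono[OF inner_U_bound[OF this], of "\<bar>k\<bar>"]
    show "\<bar>k * inner_U v\<bar> \<le> \<bar>k\<bar> * sqrt \<mu> * H1_norm G v" by (simp add: abs_mult mult.assoc)
  qed
  fix \<epsilon> :: real assume \<epsilon>: "\<epsilon> > 0"
  show "\<exists>\<delta>>0. \<forall>v\<in>H1 G. H1_norm G v < \<delta> \<longrightarrow> \<bar>F (\<lambda>e x. U e x + v e x) - F U - k * inner_U v\<bar> \<le> \<epsilon> * H1_norm G v"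
  proof (intro exI[of _ "min r (\<epsilon> / C)"] conjI ballI impI)
    fix v assume v: "v \<in> H1 G" and n: "H1_norm G v < min r (\<epsilon> / C)"
    have "C * (H1_norm G v)\<^sup>2 = (C * H1_norm G v) * H1_norm G v" by (simp add: power2_eq_square)
    also have "\<dots> \<le> \<epsilon> * H1_norm G v"
      using n C H1_norm_nonneg[of v] by (intro mult_right_mono) (auto simp: field_simps)
    finally show "\<bar>F (\<lambda>e x. U e x + v e x) - F U - k * inner_U v\<bar> \<le> \<epsilon> * H1_norm G v"
      using R[OF v] n by simp
  qed (use r \<epsilon> C in auto)
qed

lemma frechet_mass: "H1_frechet_deriv G (mass G) U (\<lambda>v. 2 * inner_U v)"
proof (rule frechet_inner_U[where r = 1 and C = 1])
  fix v assume v: "v \<in> H1 G"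
  show "\<bar>mass G (\<lambda>e x. U e x + v e x) - mass G U - 2 * inner_U v\<bar> \<le> 1 * (H1_norm G v)\<^sup>2"
    using mass_add[OF v, of 1] mass_U mass_nonneg[of v] kinetic_nonneg[of v] by (simp add: H1_norm_square)
qed auto

definition reaction :: "('e \<Rightarrow> real \<Rightarrow> real) \<Rightarrow> real" where
  "reaction v = (\<Sum>e\<in>bounded_edges G. LINT x|lebesgue_on (J e). U e x powr (p - 1) * v e x)"

lemma U_powr_cont: "e \<in> bounded_edges G \<Longrightarrow> q > 0 \<Longrightarrow> continuous_on (J e) (\<lambda>x. U e x powr q)"
  using u_powr_cont[of e q] by (simp add: U_def bounded_edge_interval[OF finite_graph])

lemma bounded_in_edges: "e \<in> bounded_edges G \<Longrightarrow> e \<in> edges G"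
  by (simp add: bounded_edges_def)

lemma half_in_edges: "e \<in> half_lines G \<Longrightarrow> e \<in> edges G"
  by (simp add: half_lines_def)

lemma bounded_integrable:
  fixes f :: "real \<Rightarrow> real"
  assumes "e \<in> bounded_edges G" "continuous_on (J e) f"
  shows "integrable (lebesgue_on (J e)) f"
  using assms continuous_imp_integrable_real by (simp add: bounded_edge_interval[OF finite_graph])

lemma sum_by_vertex:
  fixes b :: "'v \<Rightarrow> real" and g :: "'e \<Rightarrow> real"
  assumes "finite A" "f ` A \<subseteq> verts G"
  shows "(\<Sum>e\<in>A. b (f e) * g e) = (\<Sum>w\<in>verts G. b w * (\<Sum>e\<in>{e \<in> A. f e = w}. g e))"
proof -
  have "(\<Sum>e\<in>A. b (f e) * g e) = (\<Sum>w\<in>verts G. \<Sum>e\<in>{e \<in> A. f e = w}. b (f e) * g e)"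
    by (rule sum.group[OF assms(1) finV assms(2), symmetric])
  also have "\<dots> = (\<Sum>w\<in>verts G. b w * (\<Sum>e\<in>{e \<in> A. f e = w}. g e))"
    unfolding sum_distrib_left by (intro sum.cong) auto
  finally show ?thesis .
qed

text \<open>The boundary terms cancel by the vertex conditions.\<close>

lemma weak_equation:
  assumes v: "v \<in> H1 G"
  shows "(\<Sum>e\<in>edges G. LINT x|lebesgue_on (J e). W v e x * dU e x) = reaction v - a\<^sup>2 * inner_U v"
proof -
  obtain b where b: "\<And>e. e \<in> edges G \<Longrightarrow> v e 0 = b (src G e)" "\<And>e. e \<in> bounded_edges G \<Longrightarrow> v e (ell e) = b (tgt G e)"
    using v by (auto simp: H1_def graph_continuous_def)
  have B: "(LINT x|lebesgue_on (J e). W v e x * dU e x) = b (tgt G e) * dU e (ell e) - b (src G e) * dU e 0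
      - a\<^sup>2 * (LINT x|lebesgue_on (J e). U e x * v e x) + (LINT x|lebesgue_on (J e). U e x powr (p - 1) * v e x)"
    if e: "e \<in> bounded_edges G" for e
  proof -
    note ed = bounded_in_edges[OF e] and iv = bounded_edge_interval[OF finite_graph e]
    have "continuous_on (J e) (\<lambda>x. a\<^sup>2 * U e x - U e x powr (p - 1))"
      by (intro continuous_intros U_cont ed U_powr_cont e) (use p6 in auto)
    then have ddc: "continuous_on (J e) (ddU e)" using e by (simp add: ddU_def[abs_def] U_def)
    have "(LINT x|lebesgue_on (J e). W v e x * dU e x) = v e (ell e) * dU e (ell e) - v e 0 * dU e 0 - (LINT x|lebesgue_on (J e). v e x * ddU e x)"
      using parts_bounded_edge[OF iv(1), of "v e" "dU e" "ddU e"] H1D(1,2)[OF v ed] dU_deriv[OF ed] ddc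
      unfolding iv(2) by blast
    also have "(LINT x|lebesgue_on (J e). v e x * ddU e x) = (LINT x|lebesgue_on (J e). a\<^sup>2 * (U e x * v e x) - U e x powr (p - 1) * v e x)"
      by (rule Bochner_Integration.integral_cong) (use e in \<open>auto simp: ddU_def U_def algebra_simps\<close>)
    also have "\<dots> = (LINT x|lebesgue_on (J e). a\<^sup>2 * (U e x * v e x)) - (LINT x|lebesgue_on (J e). U e x powr (p - 1) * v e x)"
      by (intro Bochner_Integration.integral_diff integrable_mult_right U_mult_integrable v ed bounded_integrable[OF e]
          continuous_on_mult U_powr_cont[OF e] H1D(1)[OF v ed]) (use p6 in auto)
    also have "(LINT x|lebesgue_on (J e). a\<^sup>2 * (U e x * v e x)) = a\<^sup>2 * (LINT x|lebesgue_on (J e). U e x * v e x)" by simp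
    finally show ?thesis by (simp add: b ed e)
  qed
  have H: "(LINT x|lebesgue_on (J e). W v e x * dU e x) = - b (src G e) * dU e 0 - a\<^sup>2 * (LINT x|lebesgue_on (J e). U e x * v e x)"
    if e: "e \<in> half_lines G" for e
  proof -
    note ed = half_in_edges[OF e] and iv = half_line_interval[OF e] and nb = half_not_bounded[OF e]
    define k where "k = c (src G e)"
    have "(LINT x|lebesgue_on (J e). W v e x * dU e x) = (LINT x|lebesgue_on (J e). (- a * k) * (W v e x * exp (- a * x)))"
      by (rule Bochner_Integration.integral_cong) (use nb in \<open>auto simp: dU_def k_def\<close>)
    also have "\<dots> = (- a * k) * (LINT x|lebesgue_on (J e). W v e x * exp (- a * x))" by (rule integral_mult_right_zero)
    also have "\<dots> = (- a * k) * (- v e 0 + a * (LINT x|lebesgue_on (J e). v e x * exp (- a * x)))"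
      using parts_half_line[OF a_pos, of "v e"] H1D(1,2)[OF v ed] unfolding iv by simp
    also have "\<dots> = a * k * v e 0 - a\<^sup>2 * (k * (LINT x|lebesgue_on (J e). v e x * exp (- a * x)))"
      by (simp add: power2_eq_square algebra_simps)
    also have "k * (LINT x|lebesgue_on (J e). v e x * exp (- a * x)) = (LINT x|lebesgue_on (J e). k * (v e x * exp (- a * x)))"
      by (rule integral_mult_right_zero[symmetric])
    also have "\<dots> = (LINT x|lebesgue_on (J e). U e x * v e x)"
      by (rule Bochner_Integration.integral_cong) (use nb in \<open>auto simp: U_def k_def\<close>)
    finally show ?thesis using nb by (simp add: b ed dU_def k_def)
  qed
  have "(\<Sum>e\<in>edges G. LINT x|lebesgue_on (J e). W v e x * dU e x) =
      (\<Sum>e\<in>bounded_edges G. b (tgt G e) * dU e (ell e)) - (\<Sum>e\<in>edges G. b (src G e) * dU e 0) - a\<^sup>2 * inner_U v + reaction v"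
    unfolding sum_edges inner_U_def reaction_def
    by (simp add: B H sum.distrib sum_subtractf sum_negf sum_distrib_left distrib_left)
  also have "(\<Sum>e\<in>edges G. b (src G e) * dU e 0) = (\<Sum>w\<in>verts G. b w * (\<Sum>e\<in>{e \<in> edges G. src G e = w}. dU e 0))"
    by (rule sum_by_vertex[OF fin_edges]) (use src_verts in auto)
  also have "\<dots> = (\<Sum>w\<in>verts G. b w * (\<Sum>e\<in>{e \<in> bounded_edges G. tgt G e = w}. dU e (ell e)))"
    by (rule sum.cong) (use vertex_sum in auto)
  also have "\<dots> = (\<Sum>e\<in>bounded_edges G. b (tgt G e) * dU e (ell e))"
    by (rule sum_by_vertex[OF finE, symmetric]) (use t_in in auto)
  finally show ?thesis by simp
qed

lemma kinetic_add:
  assumes v: "v \<in> H1 G"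
  shows "kinetic G (\<lambda>e x. U e x + v e x) = kinetic G U + 2 * (reaction v - a\<^sup>2 * inner_U v) + kinetic G v"
  unfolding weak_equation[OF v, symmetric] kinetic_def sum_distrib_left sum.distrib[symmetric]
  by (rule sum.cong) (use weak_deriv_square_add[OF edge_set_I U_cont U_L2 dU_L2 U_weak H1D(1,2)[OF v]] in auto)

text \<open>The positive lower bound \<open>m\<close> is what keeps \<open>U + v\<close> nonnegative
  on the core for small \<open>v\<close>, so that the power can be expanded on a half-line where it
  is smooth enough.\<close>

lemma u_range:
  obtains m M where "m > 0" "\<And>e x. e \<in> bounded_edges G \<Longrightarrow> x \<in> J e \<Longrightarrow> m \<le> U e x \<and> U e x \<le> M"
proof -
  have "\<exists>m M. m > 0 \<and> M \<ge> 0 \<and> (\<forall>x\<in>J e. m \<le> U e x \<and> U e x \<le> M)" if e: "e \<in> bounded_edges G" for e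
  proof -
    note ed = bounded_in_edges[OF e] and iv = bounded_edge_interval[OF finite_graph e]
    have K: "compact (J e)" "J e \<noteq> {}" using iv by auto
    obtain y where "y \<in> J e" "\<forall>x\<in>J e. U e y \<le> U e x" using continuous_attains_inf[OF K U_cont[OF ed]] by blast
    moreover obtain z where "z \<in> J e" "\<forall>x\<in>J e. U e x \<le> U e z" using continuous_attains_sup[OF K U_cont[OF ed]] by blast
    ultimately show ?thesis using U_pos[OF ed] by (intro exI[of _ "U e y"] exI[of _ "U e z"]) (auto simp: less_imp_le)
  qed
  then obtain m M where mM: "\<And>e. e \<in> bounded_edges G \<Longrightarrow> m e > 0 \<and> M e \<ge> 0 \<and> (\<forall>x\<in>J e. m e \<le> U e x \<and> U e x \<le> M e)" by metis
  show thesis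
  proof (rule that[of "Min (m ` bounded_edges G)" "sum M (bounded_edges G)"])
    show "0 < Min (m ` bounded_edges G)" using finE E_ne mM by (subst Min_gr_iff) auto
    fix e x assume e: "e \<in> bounded_edges G" and x: "x \<in> J e"
    have "Min (m ` bounded_edges G) \<le> m e" using e finE by (intro Min_le) auto
    moreover have "M e \<le> sum M (bounded_edges G)" using e finE mM by (intro member_le_sum) auto
    ultimately show "Min (m ` bounded_edges G) \<le> U e x \<and> U e x \<le> sum M (bounded_edges G)"
      using mM[OF e] x by force
  qed
qed

lemma edge_terms_le:
  assumes "v \<in> H1 G" "e \<in> bounded_edges G"
  shows "(LINT x|lebesgue_on (J e). \<bar>v e x\<bar>\<^sup>2) \<le> mass G v" "(LINT x|lebesgue_on (J e). \<bar>W v e x\<bar>\<^sup>2) \<le> kinetic G v"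
  unfolding mass_def kinetic_def using bounded_in_edges[OF assms(2)] fin_edges
  by (auto intro!: member_le_sum)

lemma sup_bound:
  obtains K where "K > 0" "\<And>v e x. v \<in> H1 G \<Longrightarrow> e \<in> bounded_edges G \<Longrightarrow> x \<in> J e \<Longrightarrow> (v e x)\<^sup>2 \<le> K * (H1_norm G v)\<^sup>2"
proof (rule that[of "1 + (\<Sum>e\<in>bounded_edges G. 2 / ell e + 2 * ell e)"])
  have nn: "0 \<le> 2 / ell e + 2 * ell e" if "e \<in> bounded_edges G" for e using el_pos[OF that] by simp
  show "0 < 1 + (\<Sum>e\<in>bounded_edges G. 2 / ell e + 2 * ell e)"
    using sum_nonneg[of "bounded_edges G" "\<lambda>e. 2 / ell e + 2 * ell e"] nn by force
  fix v e x assume v: "v \<in> H1 G" and e: "e \<in> bounded_edges G" and x: "x \<in> J e"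
  note ed = bounded_in_edges[OF e] and iv = bounded_edge_interval[OF finite_graph e]
  have "(v e x)\<^sup>2 \<le> (2 / ell e) * (LINT z|lebesgue_on (J e). \<bar>v e z\<bar>\<^sup>2) + 2 * ell e * (LINT z|lebesgue_on (J e). \<bar>W v e z\<bar>\<^sup>2)"
    using sup_bound_interval[OF iv(1), of "v e" x] H1D(1,2)[OF v ed] x unfolding iv(2) by blast
  also have "\<dots> \<le> (2 / ell e) * (H1_norm G v)\<^sup>2 + 2 * ell e * (H1_norm G v)\<^sup>2"
    unfolding H1_norm_square
    using edge_terms_le[OF v e] mass_nonneg[of v] kinetic_nonneg[of v] iv(1) by (intro add_mono mult_left_mono) auto
  also have "\<dots> = (2 / ell e + 2 * ell e) * (H1_norm G v)\<^sup>2" by (simp add: distrib_right)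
  also have "\<dots> \<le> (1 + (\<Sum>e\<in>bounded_edges G. 2 / ell e + 2 * ell e)) * (H1_norm G v)\<^sup>2"
    using member_le_sum[of e "bounded_edges G" "\<lambda>e. 2 / ell e + 2 * ell e"] e nn finE by (intro mult_right_mono) auto
  finally show "(v e x)\<^sup>2 \<le> (1 + (\<Sum>e\<in>bounded_edges G. 2 / ell e + 2 * ell e)) * (H1_norm G v)\<^sup>2" .
qed

text \<open>The term \<open>reaction v\<close> from \<open>kinetic_add\<close> cancels against the
  first-order part of the power term and leaves \<open>- a\<^sup>2 * inner_U v\<close>. The radius
  \<open>m / sqrt K\<close> ensures \<open>|v| <= m\<close> on the bounded edges, so
  \<open>U\<close> and \<open>U + v\<close> stay in \<open>[0, M + m]\<close>, where
  \<open>C\<close> is the constant of \<open>powr_taylor\<close>.\<close>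

lemma frechet_energy: "H1_frechet_deriv G (energy G p) U (\<lambda>v. - a\<^sup>2 * inner_U v)"
proof -
  obtain m M where m: "m > 0" and M: "\<And>e x. e \<in> bounded_edges G \<Longrightarrow> x \<in> J e \<Longrightarrow> m \<le> U e x \<and> U e x \<le> M"
    using u_range by blast
  obtain K where K: "K > 0" and Kb: "\<And>v e x. v \<in> H1 G \<Longrightarrow> e \<in> bounded_edges G \<Longrightarrow> x \<in> J e \<Longrightarrow> (v e x)\<^sup>2 \<le> K * (H1_norm G v)\<^sup>2"
    using sup_bound by blast
  define C where "C = p * ((p - 1) * (M + m) powr (p - 2))"
  have C0: "C \<ge> 0" using p6 by (simp add: C_def)
  show ?thesis
  proof (rule frechet_inner_U[where r = "m / sqrt K" and C = "1 / 2 + C / p"])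
    fix v assume v: "v \<in> H1 G" and n: "H1_norm G v < m / sqrt K"
    have vm: "\<bar>v e x\<bar> \<le> m" if e: "e \<in> bounded_edges G" and x: "x \<in> J e" for e x
    proof -
      have "(H1_norm G v * sqrt K)\<^sup>2 \<le> m\<^sup>2"
        using n K H1_norm_nonneg[of v] by (intro power_mono) (auto simp: field_simps)
      then have "\<bar>v e x\<bar>\<^sup>2 \<le> m\<^sup>2" using Kb[OF v e x] K by (simp add: power_mult_distrib mult.commute)
      then show ?thesis by (rule power2_le_imp_le) (use m in simp)
    qed
    define D where "D = (\<lambda>e. (LINT x|lebesgue_on (J e). \<bar>U e x + v e x\<bar> powr p) - (LINT x|lebesgue_on (J e). \<bar>U e x\<bar> powr p)
        - p * (LINT x|lebesgue_on (J e). U e x powr (p - 1) * v e x))"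
    have De: "\<bar>D e\<bar> \<le> C * (LINT x|lebesgue_on (J e). \<bar>v e x\<bar>\<^sup>2)" if e: "e \<in> bounded_edges G" for e
    proof -
      note ed = bounded_in_edges[OF e]
      have i1: "integrable (lebesgue_on (J e)) (\<lambda>x. \<bar>U e x + v e x\<bar> powr p)"
        by (intro bounded_integrable[OF e] continuous_on_powr_nonneg continuous_intros U_cont ed H1D(1)[OF v]) (use p6 in auto)
      have i2: "integrable (lebesgue_on (J e)) (\<lambda>x. \<bar>U e x\<bar> powr p)"
        by (intro bounded_integrable[OF e] continuous_on_powr_nonneg continuous_intros U_cont ed) (use p6 in auto)
      have i3: "integrable (lebesgue_on (J e)) (\<lambda>x. U e x powr (p - 1) * v e x)"
        by (intro bounded_integrable[OF e] continuous_on_mult U_powr_cont[OF e] H1D(1)[OF v ed]) (use p6 in auto)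
      have i4: "integrable (lebesgue_on (J e)) (\<lambda>x. \<bar>v e x\<bar>\<^sup>2)"
        by (intro bounded_integrable[OF e] continuous_intros H1D(1)[OF v ed])
      have i13: "integrable (lebesgue_on (J e)) (\<lambda>x. \<bar>U e x + v e x\<bar> powr p - \<bar>U e x\<bar> powr p - p * (U e x powr (p - 1) * v e x))"
        by (intro Bochner_Integration.integrable_diff i1 i2 integrable_mult_right i3)
      have "D e = (LINT x|lebesgue_on (J e). \<bar>U e x + v e x\<bar> powr p - \<bar>U e x\<bar> powr p - p * (U e x powr (p - 1) * v e x))"
        unfolding D_def by (simp add: i1 i2 i3)
      then have "\<bar>D e\<bar> \<le> (LINT x|lebesgue_on (J e). \<bar>\<bar>U e x + v e x\<bar> powr p - \<bar>U e x\<bar> powr p - p * (U e x powr (p - 1) * v e x)\<bar>)"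
        by (simp only: integral_abs_bound)
      also have "\<dots> \<le> (LINT x|lebesgue_on (J e). C * \<bar>v e x\<bar>\<^sup>2)"
      proof (rule integral_mono)
        fix x assume "x \<in> space (lebesgue_on (J e))"
        then have x: "x \<in> J e" by (simp add: space_restrict_space)
        have r: "0 \<le> U e x" "U e x \<le> M + m" "0 \<le> U e x + v e x" "U e x + v e x \<le> M + m"
          using M[OF e x] vm[OF e x] m by linarith+
        show "\<bar>\<bar>U e x + v e x\<bar> powr p - \<bar>U e x\<bar> powr p - p * (U e x powr (p - 1) * v e x)\<bar> \<le> C * \<bar>v e x\<bar>\<^sup>2"
          using powr_taylor[of p "U e x" "M + m" "v e x"] p6 r by (simp add: C_def mult.assoc)
      qed (use i13 i4 in auto)
      also have "\<dots> = C * (LINT x|lebesgue_on (J e). \<bar>v e x\<bar>\<^sup>2)" by simp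
      finally show ?thesis .
    qed
    have "\<bar>sum D (bounded_edges G)\<bar> \<le> (\<Sum>e\<in>bounded_edges G. C * (LINT x|lebesgue_on (J e). \<bar>v e x\<bar>\<^sup>2))"
      by (rule order_trans[OF sum_abs sum_mono[OF De]])
    also have "\<dots> = C * (\<Sum>e\<in>bounded_edges G. LINT x|lebesgue_on (J e). \<bar>v e x\<bar>\<^sup>2)" by (simp add: sum_distrib_left)
    also have "\<dots> \<le> C * mass G v"
      unfolding mass_def sum_edges using C0 by (intro mult_left_mono) (auto intro!: sum_nonneg)
    finally have sD: "\<bar>sum D (bounded_edges G)\<bar> \<le> C * mass G v" .
    have sDe: "sum D (bounded_edges G) = (\<Sum>e\<in>bounded_edges G. LINT x|lebesgue_on (J e). \<bar>U e x + v e x\<bar> powr p)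
        - (\<Sum>e\<in>bounded_edges G. LINT x|lebesgue_on (J e). \<bar>U e x\<bar> powr p) - p * reaction v"
      by (simp add: D_def reaction_def sum_subtractf sum_distrib_left)
    have eq: "energy G p (\<lambda>e x. U e x + v e x) - energy G p U - (- a\<^sup>2 * inner_U v)
        = kinetic G v / 2 - sum D (bounded_edges G) / p"
      unfolding energy_def kinetic_add[OF v] sDe using p6 by (simp add: field_simps)
    have "\<bar>kinetic G v / 2 - sum D (bounded_edges G) / p\<bar> \<le> kinetic G v / 2 + \<bar>sum D (bounded_edges G)\<bar> / p"
      using kinetic_nonneg[of v] p6 abs_triangle_ineq4[of "kinetic G v / 2" "sum D (bounded_edges G) / p"] by simp
    also have "\<dots> \<le> kinetic G v / 2 + C * mass G v / p"
      using sD p6 by (intro add_left_mono divide_right_mono) auto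
    also have "\<dots> \<le> 1 / 2 * (H1_norm G v)\<^sup>2 + C / p * (H1_norm G v)\<^sup>2"
    proof (rule add_mono)
      show "kinetic G v / 2 \<le> 1 / 2 * (H1_norm G v)\<^sup>2" using mass_nonneg[of v] by (simp add: H1_norm_square)
      have "C / p * mass G v \<le> C / p * (H1_norm G v)\<^sup>2"
        using kinetic_nonneg[of v] C0 p6 by (intro mult_left_mono) (auto simp: H1_norm_square)
      then show "C * mass G v / p \<le> C / p * (H1_norm G v)\<^sup>2" by simp
    qed
    finally show "\<bar>energy G p (\<lambda>e x. U e x + v e x) - energy G p U - - a\<^sup>2 * inner_U v\<bar> \<le> (1 / 2 + C / p) * (H1_norm G v)\<^sup>2"
      unfolding eq by (simp only: distrib_right)
  next
    show "0 < m / sqrt K" using m K by simp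
    have "0 \<le> C / p" using C0 p6 by simp
    then show "0 < 1 / 2 + C / p" by linarith
  qed
qed

text \<open>The differentials of energy and mass are multiples of the same form, hence the inclusion
  of kernels; \<open>U\<close> itself, having mass \<open>\<mu> > 0\<close>, shows that the
  differential of the mass is nonzero.\<close>

lemma critical_U: "constrained_critical_point G (energy G p) \<mu> U"
proof -
  have "\<exists>v\<in>H1 G. 2 * inner_U v \<noteq> 0" using inner_U_U \<mu>_pos by (intro bexI[OF _ U_H1]) simp
  moreover have "\<forall>v\<in>H1 G. 2 * inner_U v = 0 \<longrightarrow> - a\<^sup>2 * inner_U v = 0" by simp
  moreover have "U \<in> H1_mass G \<mu>" using U_H1 mass_U by (simp add: H1_mass_def)
  ultimately show ?thesis
    unfolding constrained_critical_point_def using frechet_energy frechet_mass by blast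
qed

end

theorem theorem1p1:
  fixes G :: "('v, 'e) mgraph" and p :: real
  assumes "finite_metric_graph G"
    and "connected_metric_graph G"
    and "noncompact_metric_graph G"
    and "compact_core G \<noteq> {}"
    and "p > 6"
  shows "\<forall>\<mu>>0. \<exists>u\<in>H1 G. \<exists>lam>0.
           (\<forall>e\<in>edges G. \<forall>x\<in>edge_interval G e. u e x > 0) \<and>
           mass G u = \<mu> \<and>
           (\<forall>e\<in>edges G. solves_on_edge G p lam u e) \<and>
           (\<forall>v\<in>core_verts G. kirchhoff_sum G u v = 0) \<and>
           constrained_critical_point G (energy G p) \<mu> u \<and>
           energy G p u > 0"
proof (intro allI impI)
  fix \<mu> :: real assume \<mu>: "\<mu> > 0"
  define N where "N = (\<lambda>v. real (card {e \<in> half_lines G. src G e = v}))"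
  interpret cg: core_graph "verts G" "bounded_edges G" "\<lambda>e. real_of_ereal (len G e)" "src G" "tgt G" N p \<mu>
    unfolding N_def by (rule core_graph_of_metric_graph[OF assms \<mu>])
  obtain a u c d where sol: "a > 0" "cg.approx 0 a 1 u c d" "0 < cg.En a 1 u c"
    using cg.exists_core_solution by blast
  interpret graph_solution G N p \<mu> a u c d
    by unfold_locales (use sol assms(1) in \<open>auto simp: N_def\<close>)
  show "\<exists>u\<in>H1 G. \<exists>lam>0.
           (\<forall>e\<in>edges G. \<forall>x\<in>edge_interval G e. u e x > 0) \<and>
           mass G u = \<mu> \<and>
           (\<forall>e\<in>edges G. solves_on_edge G p lam u e) \<and>
           (\<forall>v\<in>core_verts G. kirchhoff_sum G u v = 0) \<and>
           constrained_critical_point G (energy G p) \<mu> u \<and>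
           energy G p u > 0"
    using U_H1 sol(1) U_pos mass_U U_solves kirchhoff_U critical_U energy_U
    by (intro bexI[of _ U] exI[of _ "a\<^sup>2"] conjI ballI) auto
qed

end
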